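(* Let $r$ be a positive integer. (Simplicial case) Let $X[-]$ be a simplicial set. Then $|\operatorname{sd}_rX[-]|$ is given, via the canonical bijection, by the filtered colimit $$\operatorname{colim}_{F\in\mathcal{F}_r}\widetilde{X}[\pi_0([0,r]\setminus F)],$$ and hence admits an action by $G_r=\operatorname{Homeo}([0,r],\partial[0,r])$. In particular, the bijection $s:[0,r]\to[0,1]$, $x\mapsto x/r$, induces isomorphisms $D_r:|\operatorname{sd}_rX[-]|\to|X[-]|$ (a homeomorphism) and $d_r:G_r\to G=\operatorname{Homeo}([0,1],\partial[0,1])$ (of groups) such that the diagram $$\begin{array}{ccc}G_r\times|\operatorname{sd}_rX[-]|&\to&|\operatorname{sd}_rX[-]|\\ {\scriptstyle d_r\times D_r}\downarrow&&\downarrow{\scriptstyle D_r}\\ G\times|X[-]|&\to&|X[-]|\end{array}$$ whose horizontal maps are the actions, commutes. (Cyclic case) Let $X[-]$ be a cyclic set. Then $|\operatorname{sd}_rX[-]|$ is given, via the canonical bijection, by the filtered colimit $$\operatorname{colim}_{F\in\mathcal{F}'_r}\widetilde{X}[\pi_0(\mathbb{R}/r\mathbb{Z}\setminus F)],$$ and hence admits an action by $G_r=\operatorname{Homeo}^+\mathbb{R}/r\mathbb{Z}$. In particular, the bijection $s:\mathbb{R}/r\mathbb{Z}\to\mathbb{R}/\mathbb{Z}$, $x\mapsto x/r$, induces isomorphisms $D_r:|\operatorname{sd}_rX[-]|\to|X[-]|$ (a homeomorphism) and $d_r:G_r\to G=\operatorname{Homeo}^+\mathbb{R}/\mathbb{Z}$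 (of groups) such that the same diagram commutes.
   Context: **Simplicial sets.** $\Delta$ is the category of $[n]=\{0<\dots<n\}$, $n\ge0$, and order-preserving maps; a simplicial set is a functor $X[-]:\Delta^{\mathrm{op}}\to\mathrm{Sets}$. $|X[-]|=\coprod_nX[n]\times\Delta[n]/\sim$, where $\Delta[n]=\{(z_0,\dots,z_n)\in[0,1]^{n+1}\mid\sum z_i=1\}$, $X[n]$ is discrete, and $\sim$ is generated by $(x,\theta_*z)\sim(\theta^*x,z)$. $\Delta_{\mathrm{big}}$ is the category of all finite nonempty linearly ordered sets and order-preserving maps, and $\widetilde X[-]:\Delta_{\mathrm{big}}^{\mathrm{op}}\to\mathrm{Sets}$ is the extension of $X[-]$ along the equivalence $\Delta\subset\Delta_{\mathrm{big}}$ (unique up to unique isomorphism restricting to the identity). **$\mathbb{Z}_+$-categories and cyclic sets.** Let $\mathbb{Z}_+$ be the additive monoid of non-negative integers. A $\mathbb{Z}_+$-category is a category with a non-identity endomorphism $1_c:c\to c$ on each object $c$ such that $f\circ1_{c_1}=1_{c_2}\circ f$ for all $f:c_1\to c_2$; a $\mathbb{Z}_+$-functor is a functor preserving these endomorphisms. For a positive integer $L$, $\mathbb{R}/L\mathbb{Z}$ is a $\mathbb{Z}_+$-category: objects are points; morphisms $x\to y$ are homotopy classes of paths from $x$ to $y$ of the form $[0,1]\to\mathbb{R}\to\mathbb{R}/L\mathbb{Z}$, the first map continuous non-decreasing and the second the projection; $1_x$ is the class of degree 1 loops at $x$. For a finite subset $F$, $\pi_0(\mathbb{R}/L\mathbb{Z}\setminus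 F)$ is the $\mathbb{Z}_+$-category with objects the connected components and $\operatorname{Hom}(c,d)=\operatorname{Hom}_{\mathbb{R}/L\mathbb{Z}}(x_c,x_d)$ for chosen $x_c\in c$, $x_d\in d$. For a finite nonempty linearly ordered set $\mathcal{A}=\{a_0<\dots<a_n\}$, $\mathcal{A}_{\mathrm{cyc}}$ is the $\mathbb{Z}_+$-category with the objects of $\mathcal{A}$ and morphisms generated by those of $\mathcal{A}$ and one new generator $a_n\to a_0$, with $1_{a_i}:a_i\to a_n\to a_0\to a_i$; it is functorial for order-preserving maps, and $[n]_{\mathrm{cyc}}$ is identified with the full subcategory of $\mathbb{R}/\mathbb{Z}$ on $0,\frac1{n+1},\dots,\frac n{n+1}$. $\Delta C$ (resp. $\Delta_{\mathrm{big}}C$) is the category of the $[n]_{\mathrm{cyc}}$ (resp. small $\mathbb{Z}_+$-categories isomorphic to some $[n]_{\mathrm{cyc}}$) and $\mathbb{Z}_+$-functors. A cyclic set is a functor $X[-]:(\Delta C)^{\mathrm{op}}\to\mathrm{Sets}$, with essentially unique extension $\widetilde X[-]$ to $(\Delta_{\mathrm{big}}C)^{\mathrm{op}}$; its realization is that of its underlying simplicial set, obtained via $\Delta\to\Delta C$, $[n]\mapsto[n]_{\mathrm{cyc}}$, $f\mapsto f_{\mathrm{cyc}}$. **Subdivision.** $\operatorname{sd}_r:\Delta\to\Delta$ is the functor $\operatorname{sd}_r[n]=[r(n+1)-1]$, $\operatorname{sd}_r[f](a(m+1)+b)=a(n+1)+f(b)$ for $f:[m]\to[n]$, $0\le a<r$,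 $0\le b\le m$. For a simplicial set, $\operatorname{sd}_rX[-]=X[-]\circ\operatorname{sd}_r$. For a cyclic set, $\operatorname{sd}_rX[-]$ carries additional structure, but its realization is by definition that of its underlying simplicial set, which is $X|_{\Delta^{\mathrm{op}}}[-]\circ\operatorname{sd}_r$. **Index categories.** $\mathcal{F}_r$ and $\mathcal{F}'_r$ are the sets of finite subsets of $[0,r]$ and of $\mathbb{R}/r\mathbb{Z}$, viewed as categories by inclusions. $\pi_0([0,r]\setminus F)$ is linearly ordered by $[x]\le[y]$ if $x\le y$. For $F\subset G$ there are evident maps from $\pi_0$ of the complement of $G$ to that of $F$. $\mathrm{in}_F$ denotes the canonical map from the $F$-term to the colimit. If $F\in\mathcal{F}_r$ contains $0$ or $r$ and $\overline F$ is its image in $\mathbb{R}/r\mathbb{Z}$, then $\pi_0([0,r]\setminus F)_{\mathrm{cyc}}=\pi_0(\mathbb{R}/r\mathbb{Z}\setminus\overline F)$. **Canonical bijections.** Given $(\xi,z)\in X[r(n+1)-1]\times\Delta[n]$ representing a point of $|\operatorname{sd}_rX[-]|$, let $x_0=0$, $x_i=z_0+\dots+z_{i-1}$ (so $x_{n+1}=1$), $F=\{k+x_i\mid0\le k<r,0\le i\le n+1\}$, and let $f:\pi_0([0,r]\setminus F)\to[r(n+1)-1]$ send the component $(k+x_i,k+x_{i+1})$ (when nonempty) to $k(n+1)+i$. The point is sent to $\mathrm{in}_F(\widetilde X[f](\xi))$ in the simplicial case and to $\mathrm{in}_{\overline F}(\widetilde X[f_{\mathrm{cyc}}](\xi))$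 in the cyclic case. For $r=1$ this gives the canonical bijections from $|X[-]|$ to $\operatorname{colim}_{F\in\mathcal{F}_1}\widetilde X[\pi_0([0,1]\setminus F)]$, resp. $\operatorname{colim}_{F\in\mathcal{F}'_1}\widetilde X[\pi_0(\mathbb{R}/\mathbb{Z}\setminus F)]$. **Actions and induced maps.** $\operatorname{Homeo}([0,L],\partial[0,L])$ is the group of order-preserving homeomorphisms of $[0,L]$; $\operatorname{Homeo}^+$ denotes orientation-preserving homeomorphisms. Any such homeomorphism $\alpha$, and also the rescaling $s$, induces isomorphisms $\alpha_F$ (resp. $s_F$) from $\pi_0$ of the complement of $F$ to $\pi_0$ of the complement of $\alpha(F)$ (resp. $s(F)$). The action of $\alpha$ is the map $\rho_\alpha$ with $\rho_\alpha\circ\mathrm{in}_F=\mathrm{in}_{\alpha(F)}\circ\widetilde X[\alpha_F^{-1}]$. The maps induced by $s$ are $D_r$, with $D_r\circ\mathrm{in}_F=\mathrm{in}_{s(F)}\circ\widetilde X[s_F^{-1}]$, and $d_r(\alpha)=s\circ\alpha\circ s^{-1}$.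
   Formalization: In the cyclic case the colimit runs over the nonempty finite subsets F of R/rZ, because no functorial transition maps to the term of the empty subset exist (compatibility through {a} and {b} forces a contradiction). *)

theory Defs
  imports "HOL-Homology.Homology" "HOL-Algebra.Group_Action"
begin

section \<open>Categories and presheaves\<close>

text \<open>
  Maps between sets are represented by extensional functions, so that morphisms are determined by
  their values on the carriers. The composite of \<open>f : a \<rightarrow> b\<close> and \<open>g : b \<rightarrow> c\<close> is \<open>cmp C a b c g f\<close>.
\<close>

record ('o, 'm) category =
  obs :: "'o set"
  mor :: "'o \<Rightarrow> 'o \<Rightarrow> 'm set"
  idm :: "'o \<Rightarrow> 'm"
  cmp :: "'o \<Rightarrow> 'o \<Rightarrow> 'o \<Rightarrow> 'm \<Rightarrow> 'm \<Rightarrow> 'm"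

record ('o, 'm, 'a) psh =
  pob :: "'o \<Rightarrow> 'a set"
  pact :: "'o \<Rightarrow> 'o \<Rightarrow> 'm \<Rightarrow> 'a \<Rightarrow> 'a"

text \<open>Functors from the opposite of \<open>C\<close> to sets; \<open>f : a \<rightarrow> b\<close> acts by \<open>pact X a b f : X b \<rightarrow> X a\<close>.\<close>

definition presheaf :: "('o, 'm) category \<Rightarrow> ('o, 'm, 'a) psh \<Rightarrow> bool" where
  "presheaf C X \<longleftrightarrow>
    (\<forall>a\<in>obs C. \<forall>b\<in>obs C. \<forall>f\<in>mor C a b. pact X a b f \<in> pob X b \<rightarrow> pob X a) \<and>
    (\<forall>a\<in>obs C. \<forall>x\<in>pob X a. pact X a a (idm C a) x = x) \<and>
    (\<forall>a\<in>obs C. \<forall>b\<in>obs C. \<forall>c\<in>obs C. \<forall>f\<in>mor C a b. \<forall>g\<in>mor C b c. \<forall>x\<in>pob X c.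
      pact X a c (cmp C a b c g f) x = pact X a b f (pact X b c g x))"

text \<open>\<open>Xt\<close> restricts to \<open>X\<close> along the functor given on objects by \<open>J\<close> and on morphisms by \<open>Jm\<close>.\<close>

definition restricts_to ::
  "('o, 'm) category \<Rightarrow> ('o \<Rightarrow> 'p) \<Rightarrow> ('o \<Rightarrow> 'o \<Rightarrow> 'm \<Rightarrow> 'n) \<Rightarrow> ('p, 'n, 'a) psh \<Rightarrow> ('o, 'm, 'a) psh \<Rightarrow> bool"
where
  "restricts_to C J Jm Xt X \<longleftrightarrow>
    (\<forall>a\<in>obs C. pob Xt (J a) = pob X a) \<and>
    (\<forall>a\<in>obs C. \<forall>b\<in>obs C. \<forall>f\<in>mor C a b. \<forall>x\<in>pob X b.
      pact Xt (J a) (J b) (Jm a b f) x = pact X a b f x)"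

text \<open>The map \<open>i ` A \<rightarrow> j ` B\<close> corresponding to \<open>f : A \<rightarrow> B\<close> under injections \<open>i\<close> and \<open>j\<close>.\<close>

definition conj_map :: "'a set \<Rightarrow> ('a \<Rightarrow> 'c) \<Rightarrow> ('b \<Rightarrow> 'd) \<Rightarrow> ('a \<Rightarrow> 'b) \<Rightarrow> 'c \<Rightarrow> 'd" where
  "conj_map A i j f = (\<lambda>u\<in>i ` A. j (f (inv_into A i u)))"


section \<open>Simplicial sets\<close>

definition Delta :: "(nat, nat \<Rightarrow> nat) category" where
  "Delta = \<lparr>obs = UNIV,
     mor = (\<lambda>m n. {f \<in> {..m} \<rightarrow>\<^sub>E {..n}. mono_on {..m} f}),
     idm = (\<lambda>n. \<lambda>i\<in>{..n}. i),
     cmp = (\<lambda>l m n g f. compose {..l} g f)\<rparr>"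

text \<open>A linearly ordered set is given by its (reflexive) order relation, with carrier the field.\<close>

definition Delta_big :: "('e rel, 'e \<Rightarrow> 'e) category" where
  "Delta_big = \<lparr>obs = {R. finite R \<and> R \<noteq> {} \<and> Linear_order R},
     mor = (\<lambda>R S. {f \<in> Field R \<rightarrow>\<^sub>E Field S. \<forall>(x, y)\<in>R. (f x, f y) \<in> S}),
     idm = (\<lambda>R. \<lambda>x\<in>Field R. x),
     cmp = (\<lambda>Q R S g f. compose (Field Q) g f)\<rparr>"

definition ord :: "nat \<Rightarrow> nat rel" where
  "ord n = {(i, j). i \<le> j \<and> j \<le> n}"

text \<open>
  A type of elements large enough to contain both the standard ordinals and the sets of connected
  components of subsets of the real line; the two kinds are tagged by \<open>Inl\<close> and \<open>Inr\<close>. The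
  inclusion of \<open>Delta\<close> into \<open>Delta_big\<close> over this type is given by \<open>std_ord\<close> and \<open>std_ord_map\<close>.
\<close>

type_synonym elem = "nat + real set"

definition std_ord :: "nat \<Rightarrow> elem rel" where
  "std_ord n = map_prod Inl Inl ` ord n"

definition std_ord_map :: "nat \<Rightarrow> nat \<Rightarrow> (nat \<Rightarrow> nat) \<Rightarrow> elem \<Rightarrow> elem" where
  "std_ord_map m n f = conj_map {..m} Inl Inl f"

definition extends_simplicial ::
  "(elem rel, elem \<Rightarrow> elem, 'a) psh \<Rightarrow> (nat, nat \<Rightarrow> nat, 'a) psh \<Rightarrow> bool" where
  "extends_simplicial Xt X \<longleftrightarrow>
     presheaf Delta_big Xt \<and> restricts_to Delta std_ord std_ord_map Xt X"

subsection \<open>Geometric realization\<close>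

definition simplex_push :: "nat \<Rightarrow> (nat \<Rightarrow> nat) \<Rightarrow> (nat \<Rightarrow> real) \<Rightarrow> nat \<Rightarrow> real" where
  "simplex_push m \<theta> z = (\<lambda>j. \<Sum>i | i \<le> m \<and> \<theta> i = j. z i)"

definition pre_realization :: "(nat, nat \<Rightarrow> nat, 'a) psh \<Rightarrow> (nat \<times> 'a \<times> (nat \<Rightarrow> real)) topology" where
  "pre_realization X =
     sum_topology (\<lambda>n. prod_topology (discrete_topology (pob X n))
       (subtopology (powertop_real UNIV) (standard_simplex n))) UNIV"

definition realization_gen ::
  "(nat, nat \<Rightarrow> nat, 'a) psh \<Rightarrow> nat \<times> 'a \<times> (nat \<Rightarrow> real) \<Rightarrow> nat \<times> 'a \<times> (nat \<Rightarrow> real) \<Rightarrow> bool" where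
  "realization_gen X p q \<longleftrightarrow>
     (\<exists>m n. \<exists>\<theta>\<in>mor Delta m n. \<exists>x\<in>pob X n. \<exists>z\<in>standard_simplex m.
        p = (n, x, simplex_push m \<theta> z) \<and> q = (m, pact X m n \<theta> x, z))"

definition realization_point ::
  "(nat, nat \<Rightarrow> nat, 'a) psh \<Rightarrow> nat \<times> 'a \<times> (nat \<Rightarrow> real) \<Rightarrow> (nat \<times> 'a \<times> (nat \<Rightarrow> real)) set" where
  "realization_point X p = {q \<in> topspace (pre_realization X). equivclp (realization_gen X) p q}"

definition quotient_topology :: "'a topology \<Rightarrow> ('a \<Rightarrow> 'b) \<Rightarrow> 'b topology" where
  "quotient_topology T f =
     topology (\<lambda>U. U \<subseteq> f ` topspace T \<and> openin T {x \<in> topspace T. f x \<in> U})"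

definition realization_top ::
  "(nat, nat \<Rightarrow> nat, 'a) psh \<Rightarrow> (nat \<times> 'a \<times> (nat \<Rightarrow> real)) set topology" where
  "realization_top X = quotient_topology (pre_realization X) (realization_point X)"

abbreviation realization ::
  "(nat, nat \<Rightarrow> nat, 'a) psh \<Rightarrow> (nat \<times> 'a \<times> (nat \<Rightarrow> real)) set set" where
  "realization X \<equiv> topspace (realization_top X)"

lemma istopology_quotient:
  "istopology (\<lambda>U. U \<subseteq> f ` topspace T \<and> openin T {x \<in> topspace T. f x \<in> U})"
proof -
  have 1: "{x \<in> topspace T. f x \<in> S \<inter> S'} = {x \<in> topspace T. f x \<in> S} \<inter> {x \<in> topspace T. f x \<in> S'}"
    for S S' by auto
  have 2: "{x \<in> topspace T. f x \<in> \<Union> \<K>} = (\<Union>K\<in>\<K>. {x \<in> topspace T. f x \<in> K})" for \<K>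
    by auto
  show ?thesis
    unfolding istopology_def 1 2 by blast
qed

lemma openin_quotient_topology:
  "openin (quotient_topology T f) U \<longleftrightarrow>
     U \<subseteq> f ` topspace T \<and> openin T {x \<in> topspace T. f x \<in> U}"
  by (simp add: quotient_topology_def istopology_quotient)

lemma topspace_quotient_topology [simp]: "topspace (quotient_topology T f) = f ` topspace T"
proof
  show "topspace (quotient_topology T f) \<subseteq> f ` topspace T"
    by (metis openin_quotient_topology openin_topspace)
  have "{x \<in> topspace T. f x \<in> f ` topspace T} = topspace T"
    by auto
  then have "openin (quotient_topology T f) (f ` topspace T)"
    by (simp add: openin_quotient_topology)
  then show "f ` topspace T \<subseteq> topspace (quotient_topology T f)"
    by (rule openin_subset)
qed

subsection \<open>Subdivision\<close>

definition sd_map :: "nat \<Rightarrow> nat \<Rightarrow> nat \<Rightarrow> (nat \<Rightarrow> nat) \<Rightarrow> nat \<Rightarrow> nat" where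
  "sd_map r m n f = (\<lambda>i\<in>{..r * (m + 1) - 1}. (i div (m + 1)) * (n + 1) + f (i mod (m + 1)))"

definition sd :: "nat \<Rightarrow> (nat, nat \<Rightarrow> nat, 'a) psh \<Rightarrow> (nat, nat \<Rightarrow> nat, 'a) psh" where
  "sd r X = \<lparr>pob = (\<lambda>n. pob X (r * (n + 1) - 1)),
     pact = (\<lambda>m n f. pact X (r * (m + 1) - 1) (r * (n + 1) - 1) (sd_map r m n f))\<rparr>"


section \<open>Colimits of sets indexed by families of sets\<close>

text \<open>
  The index category is a family \<open>I\<close> of sets ordered by inclusion; the diagram consists of sets
  \<open>D F\<close> and maps \<open>T F G : D F \<rightarrow> D G\<close> for \<open>F \<subseteq> G\<close>.
\<close>

definition filtered_diagram ::
  "'i set set \<Rightarrow> ('i set \<Rightarrow> 'a set) \<Rightarrow> ('i set \<Rightarrow> 'i set \<Rightarrow> 'a \<Rightarrow> 'a) \<Rightarrow> bool" where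
  "filtered_diagram I D T \<longleftrightarrow>
     I \<noteq> {} \<and> (\<forall>F\<in>I. \<forall>G\<in>I. \<exists>H\<in>I. F \<subseteq> H \<and> G \<subseteq> H) \<and>
     (\<forall>F\<in>I. \<forall>G\<in>I. F \<subseteq> G \<longrightarrow> T F G \<in> D F \<rightarrow> D G) \<and>
     (\<forall>F\<in>I. \<forall>x\<in>D F. T F F x = x) \<and>
     (\<forall>F\<in>I. \<forall>G\<in>I. \<forall>H\<in>I. F \<subseteq> G \<longrightarrow> G \<subseteq> H \<longrightarrow> (\<forall>x\<in>D F. T G H (T F G x) = T F H x))"

definition colim_gen ::
  "'i set set \<Rightarrow> ('i set \<Rightarrow> 'a set) \<Rightarrow> ('i set \<Rightarrow> 'i set \<Rightarrow> 'a \<Rightarrow> 'a) \<Rightarrow> 'i set \<times> 'a \<Rightarrow> 'i set \<times> 'a \<Rightarrow> bool"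
where
  "colim_gen I D T p q \<longleftrightarrow>
     (\<exists>F\<in>I. \<exists>G\<in>I. F \<subseteq> G \<and> (\<exists>x\<in>D F. p = (F, x) \<and> q = (G, T F G x)))"

definition colim_in ::
  "'i set set \<Rightarrow> ('i set \<Rightarrow> 'a set) \<Rightarrow> ('i set \<Rightarrow> 'i set \<Rightarrow> 'a \<Rightarrow> 'a) \<Rightarrow> 'i set \<Rightarrow> 'a \<Rightarrow> ('i set \<times> 'a) set"
where
  "colim_in I D T F x = {q \<in> Sigma I D. equivclp (colim_gen I D T) (F, x) q}"

definition colim ::
  "'i set set \<Rightarrow> ('i set \<Rightarrow> 'a set) \<Rightarrow> ('i set \<Rightarrow> 'i set \<Rightarrow> 'a \<Rightarrow> 'a) \<Rightarrow> ('i set \<times> 'a) set set" where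
  "colim I D T = (\<lambda>(F, x). colim_in I D T F x) ` Sigma I D"


section \<open>Complements of finite subsets of an interval\<close>

definition fin_interval :: "real \<Rightarrow> real set set" where
  "fin_interval L = {F. finite F \<and> F \<subseteq> {0..L}}"

abbreviation icomps :: "real \<Rightarrow> real set \<Rightarrow> real set set" where
  "icomps L F \<equiv> components ({0..L} - F)"

definition pi0 :: "real \<Rightarrow> real set \<Rightarrow> real set rel" where
  "pi0 L F = {(A, B). A \<in> icomps L F \<and> B \<in> icomps L F \<and> (\<exists>x\<in>A. \<exists>y\<in>B. x \<le> y)}"

definition pi0_elem :: "real \<Rightarrow> real set \<Rightarrow> elem rel" where
  "pi0_elem L F = map_prod Inr Inr ` pi0 L F"

definition pi0_refine :: "real \<Rightarrow> real set \<Rightarrow> real set \<Rightarrow> real set \<Rightarrow> real set" where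
  "pi0_refine L F G = (\<lambda>C\<in>icomps L G. THE D. D \<in> icomps L F \<and> C \<subseteq> D)"

text \<open>The inverse of the bijection on components induced by a homeomorphism \<open>h : [0,L] \<rightarrow> [0,L']\<close>.\<close>

definition pi0_inv :: "real \<Rightarrow> real \<Rightarrow> (real \<Rightarrow> real) \<Rightarrow> real set \<Rightarrow> real set \<Rightarrow> real set" where
  "pi0_inv L L' h F = (\<lambda>C\<in>icomps L' (h ` F). inv_into (icomps L F) ((`) h) C)"

context
  fixes Xt :: "(elem rel, elem \<Rightarrow> elem, 'a) psh"
begin

definition interval_val :: "real \<Rightarrow> real set \<Rightarrow> 'a set" where
  "interval_val L F = pob Xt (pi0_elem L F)"

definition interval_trans :: "real \<Rightarrow> real set \<Rightarrow> real set \<Rightarrow> 'a \<Rightarrow> 'a" where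
  "interval_trans L F G = pact Xt (pi0_elem L G) (pi0_elem L F)
     (conj_map (icomps L G) Inr Inr (pi0_refine L F G))"

definition interval_colim :: "real \<Rightarrow> (real set \<times> 'a) set set" where
  "interval_colim L = colim (fin_interval L) (interval_val L) (interval_trans L)"

definition interval_in :: "real \<Rightarrow> real set \<Rightarrow> 'a \<Rightarrow> (real set \<times> 'a) set" where
  "interval_in L = colim_in (fin_interval L) (interval_val L) (interval_trans L)"

text \<open>The \<open>F\<close>-component of the map of colimits induced by a homeomorphism \<open>h : [0,L] \<rightarrow> [0,L']\<close>.\<close>

definition interval_push ::
  "real \<Rightarrow> real \<Rightarrow> (real \<Rightarrow> real) \<Rightarrow> real set \<Rightarrow> 'a \<Rightarrow> (real set \<times> 'a) set" where
  "interval_push L L' h F x = interval_in L' (h ` F)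
     (pact Xt (pi0_elem L' (h ` F)) (pi0_elem L F)
       (conj_map (icomps L' (h ` F)) Inr Inr (pi0_inv L L' h F)) x)"

end

definition cut :: "(nat \<Rightarrow> real) \<Rightarrow> nat \<Rightarrow> real" where
  "cut z i = (\<Sum>j<i. z j)"

definition cut_set :: "nat \<Rightarrow> nat \<Rightarrow> (nat \<Rightarrow> real) \<Rightarrow> real set" where
  "cut_set r n z = {real k + cut z i | k i. k < r \<and> i \<le> n + 1}"

definition cut_index :: "nat \<Rightarrow> nat \<Rightarrow> (nat \<Rightarrow> real) \<Rightarrow> real set \<Rightarrow> nat" where
  "cut_index r n z = (\<lambda>C\<in>icomps r (cut_set r n z). THE j. \<exists>k<r. \<exists>i\<le>n.
     C = {real k + cut z i <..< real k + cut z (i + 1)} \<and> j = k * (n + 1) + i)"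

definition interval_canon ::
  "(elem rel, elem \<Rightarrow> elem, 'a) psh \<Rightarrow> nat \<Rightarrow> nat \<Rightarrow> 'a \<Rightarrow> (nat \<Rightarrow> real) \<Rightarrow> (real set \<times> 'a) set" where
  "interval_canon Xt r n \<xi> z = interval_in Xt r (cut_set r n z)
     (pact Xt (pi0_elem r (cut_set r n z)) (std_ord (r * (n + 1) - 1))
       (conj_map (icomps r (cut_set r n z)) Inr Inl (cut_index r n z)) \<xi>)"

definition homeo_interval :: "real \<Rightarrow> (real \<Rightarrow> real) monoid" where
  "homeo_interval L = \<lparr>carrier = {\<alpha> \<in> extensional {0..L}.
       homeomorphic_map (top_of_set {0..L}) (top_of_set {0..L}) \<alpha> \<and> mono_on {0..L} \<alpha>},
     mult = (\<lambda>\<alpha> \<beta>. compose {0..L} \<alpha> \<beta>), one = (\<lambda>x\<in>{0..L}. x)\<rparr>"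

definition scale_interval :: "nat \<Rightarrow> real \<Rightarrow> real" where
  "scale_interval r = (\<lambda>x\<in>{0..real r}. x / real r)"

definition conjugate :: "'a set \<Rightarrow> 'b set \<Rightarrow> ('a \<Rightarrow> 'b) \<Rightarrow> ('a \<Rightarrow> 'a) \<Rightarrow> 'b \<Rightarrow> 'b" where
  "conjugate S T s \<alpha> = (\<lambda>y\<in>T. s (\<alpha> (inv_into S s y)))"


section \<open>Categories over the monoid of natural numbers and cyclic sets\<close>

record ('o, 'm) zcat =
  zob :: "'o set"
  zar :: "'m set"
  zdom :: "'m \<Rightarrow> 'o"
  zcod :: "'m \<Rightarrow> 'o"
  zid :: "'o \<Rightarrow> 'm"
  zcomp :: "'m \<Rightarrow> 'm \<Rightarrow> 'm"
  zone :: "'o \<Rightarrow> 'm"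

definition zplus_category :: "('o, 'm) zcat \<Rightarrow> bool" where
  "zplus_category C \<longleftrightarrow>
     (\<forall>f\<in>zar C. zdom C f \<in> zob C \<and> zcod C f \<in> zob C) \<and>
     (\<forall>c\<in>zob C. zid C c \<in> zar C \<and> zdom C (zid C c) = c \<and> zcod C (zid C c) = c) \<and>
     (\<forall>f\<in>zar C. \<forall>g\<in>zar C. zcod C f = zdom C g \<longrightarrow>
        zcomp C g f \<in> zar C \<and> zdom C (zcomp C g f) = zdom C f \<and> zcod C (zcomp C g f) = zcod C g) \<and>
     (\<forall>f\<in>zar C. zcomp C f (zid C (zdom C f)) = f \<and> zcomp C (zid C (zcod C f)) f = f) \<and>
     (\<forall>f\<in>zar C. \<forall>g\<in>zar C. \<forall>h\<in>zar C. zcod C f = zdom C g \<longrightarrow> zcod C g = zdom C h \<longrightarrow>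
        zcomp C h (zcomp C g f) = zcomp C (zcomp C h g) f) \<and>
     (\<forall>c\<in>zob C. zone C c \<in> zar C \<and> zdom C (zone C c) = c \<and> zcod C (zone C c) = c \<and>
        zone C c \<noteq> zid C c) \<and>
     (\<forall>f\<in>zar C. zcomp C f (zone C (zdom C f)) = zcomp C (zone C (zcod C f)) f)"

type_synonym ('o, 'm, 'p, 'n) zfun = "('o \<Rightarrow> 'p) \<times> ('m \<Rightarrow> 'n)"

definition zfunctors :: "('o, 'm) zcat \<Rightarrow> ('p, 'n) zcat \<Rightarrow> ('o, 'm, 'p, 'n) zfun set" where
  "zfunctors C D = {(\<phi>, \<psi>). \<phi> \<in> zob C \<rightarrow>\<^sub>E zob D \<and> \<psi> \<in> zar C \<rightarrow>\<^sub>E zar D \<and>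
     (\<forall>f\<in>zar C. zdom D (\<psi> f) = \<phi> (zdom C f) \<and> zcod D (\<psi> f) = \<phi> (zcod C f)) \<and>
     (\<forall>c\<in>zob C. \<psi> (zid C c) = zid D (\<phi> c)) \<and>
     (\<forall>f\<in>zar C. \<forall>g\<in>zar C. zcod C f = zdom C g \<longrightarrow> \<psi> (zcomp C g f) = zcomp D (\<psi> g) (\<psi> f)) \<and>
     (\<forall>c\<in>zob C. \<psi> (zone C c) = zone D (\<phi> c))}"

definition zfun_id :: "('o, 'm) zcat \<Rightarrow> ('o, 'm, 'o, 'm) zfun" where
  "zfun_id C = (\<lambda>c\<in>zob C. c, \<lambda>f\<in>zar C. f)"

definition zfun_comp ::
  "('o, 'm) zcat \<Rightarrow> ('p, 'n, 'q, 'l) zfun \<Rightarrow> ('o, 'm, 'p, 'n) zfun \<Rightarrow> ('o, 'm, 'q, 'l) zfun" where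
  "zfun_comp C G F = (compose (zob C) (fst G) (fst F), compose (zar C) (snd G) (snd F))"

definition zfun_inv ::
  "('o, 'm) zcat \<Rightarrow> ('p, 'n) zcat \<Rightarrow> ('o, 'm, 'p, 'n) zfun \<Rightarrow> ('p, 'n, 'o, 'm) zfun" where
  "zfun_inv C D F = (\<lambda>d\<in>zob D. inv_into (zob C) (fst F) d, \<lambda>g\<in>zar D. inv_into (zar C) (snd F) g)"

definition zisomorphic :: "('o, 'm) zcat \<Rightarrow> ('p, 'n) zcat \<Rightarrow> bool" where
  "zisomorphic C D \<longleftrightarrow> (\<exists>F\<in>zfunctors C D. \<exists>G\<in>zfunctors D C.
     zfun_comp C G F = zfun_id C \<and> zfun_comp D F G = zfun_id D)"

text \<open>
  The copy of \<open>C\<close> obtained by renaming objects and morphisms along injections, and the renaming of a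
  functor from \<open>C\<close> to \<open>D\<close>.
\<close>

definition zrelabel :: "('o \<Rightarrow> 'p) \<Rightarrow> ('m \<Rightarrow> 'n) \<Rightarrow> ('o, 'm) zcat \<Rightarrow> ('p, 'n) zcat" where
  "zrelabel i j C = \<lparr>zob = i ` zob C, zar = j ` zar C,
     zdom = (\<lambda>f. i (zdom C (inv_into (zar C) j f))),
     zcod = (\<lambda>f. i (zcod C (inv_into (zar C) j f))),
     zid = (\<lambda>c. j (zid C (inv_into (zob C) i c))),
     zcomp = (\<lambda>g f. j (zcomp C (inv_into (zar C) j g) (inv_into (zar C) j f))),
     zone = (\<lambda>c. j (zone C (inv_into (zob C) i c)))\<rparr>"

definition zrelabel_fun ::
  "('o, 'm) zcat \<Rightarrow> ('o \<Rightarrow> 'p) \<Rightarrow> ('m \<Rightarrow> 'n) \<Rightarrow> ('q \<Rightarrow> 's) \<Rightarrow> ('l \<Rightarrow> 't) \<Rightarrow>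
     ('o, 'm, 'q, 'l) zfun \<Rightarrow> ('p, 'n, 's, 't) zfun" where
  "zrelabel_fun C i j i' j' F = (conj_map (zob C) i i' (fst F), conj_map (zar C) j j' (snd F))"

text \<open>
  The category obtained from a finite linearly ordered set \<open>a\<^sub>0 < \<dots> < a\<^sub>n\<close> by freely adjoining a
  morphism \<open>a\<^sub>n \<rightarrow> a\<^sub>0\<close>. A morphism \<open>a \<rightarrow> b\<close> is a word in morphisms of the poset and copies of the
  new generator; it is determined by \<open>a\<close>, \<open>b\<close> and the number \<open>k\<close> of occurrences of the generator,
  and \<open>k = 0\<close> is possible only for \<open>a \<le> b\<close>. Thus \<open>(a, a, 1)\<close> is \<open>a \<rightarrow> a\<^sub>n \<rightarrow> a\<^sub>0 \<rightarrow> a\<close>.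
\<close>

definition cyc :: "'e rel \<Rightarrow> ('e, 'e \<times> 'e \<times> nat) zcat" where
  "cyc R = \<lparr>zob = Field R,
     zar = {(a, b, k). a \<in> Field R \<and> b \<in> Field R \<and> (k = 0 \<longrightarrow> (a, b) \<in> R)},
     zdom = (\<lambda>(a, b, k). a),
     zcod = (\<lambda>(a, b, k). b),
     zid = (\<lambda>a. (a, a, 0)),
     zcomp = (\<lambda>(b, c, l) (a, b', k). (a, c, k + l)),
     zone = (\<lambda>a. (a, a, 1))\<rparr>"

definition cyc_map :: "'e rel \<Rightarrow> ('e \<Rightarrow> 'f) \<Rightarrow> ('e, 'e \<times> 'e \<times> nat, 'f, 'f \<times> 'f \<times> nat) zfun" where
  "cyc_map R f = (\<lambda>a\<in>Field R. f a, \<lambda>(a, b, k)\<in>zar (cyc R). (f a, f b, k))"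

type_synonym czfun = "(nat, nat \<times> nat \<times> nat, nat, nat \<times> nat \<times> nat) zfun"

definition DeltaC :: "(nat, czfun) category" where
  "DeltaC = \<lparr>obs = UNIV,
     mor = (\<lambda>m n. zfunctors (cyc (ord m)) (cyc (ord n))),
     idm = (\<lambda>n. zfun_id (cyc (ord n))),
     cmp = (\<lambda>l m n G F. zfun_comp (cyc (ord l)) G F)\<rparr>"

definition DeltaC_big :: "(('o, 'm) zcat, ('o, 'm, 'o, 'm) zfun) category" where
  "DeltaC_big = \<lparr>obs = {C. zplus_category C \<and> (\<exists>n. zisomorphic (cyc (ord n)) C)},
     mor = zfunctors,
     idm = zfun_id,
     cmp = (\<lambda>B C D G F. zfun_comp B G F)\<rparr>"

definition simplicial_of :: "(nat, czfun, 'a) psh \<Rightarrow> (nat, nat \<Rightarrow> nat, 'a) psh" where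
  "simplicial_of X = \<lparr>pob = pob X, pact = (\<lambda>m n f. pact X m n (cyc_map (ord m) f))\<rparr>"

text \<open>
  As in the simplicial case: types of objects and morphisms large enough to contain the categories
  \<open>cyc (ord n)\<close> (tagged by \<open>Inl\<close>) and the categories of components of subsets of a circle (tagged by
  \<open>Inr\<close>). Points of a circle are cosets, of type \<^typ>\<open>real set\<close>, components are sets of points, and
  homotopy classes are sets of paths.
\<close>

type_synonym hclass = "(real \<Rightarrow> real set) set"
type_synonym cobj = "nat + real set set"
type_synonym carr = "(nat \<times> nat \<times> nat) + (real set set \<times> real set set \<times> hclass)"
type_synonym 'a cyc_big = "((cobj, carr) zcat, (cobj, carr, cobj, carr) zfun, 'a) psh"

definition std_cyc :: "nat \<Rightarrow> (cobj, carr) zcat" where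
  "std_cyc n = zrelabel Inl Inl (cyc (ord n))"

definition std_cyc_map :: "nat \<Rightarrow> nat \<Rightarrow> czfun \<Rightarrow> (cobj, carr, cobj, carr) zfun" where
  "std_cyc_map m n F = zrelabel_fun (cyc (ord m)) Inl Inl Inl Inl F"

definition extends_cyclic :: "'a cyc_big \<Rightarrow> (nat, czfun, 'a) psh \<Rightarrow> bool" where
  "extends_cyclic Xt X \<longleftrightarrow>
     presheaf DeltaC_big Xt \<and> restricts_to DeltaC std_cyc std_cyc_map Xt X"


section \<open>Circles\<close>

definition circ_pt :: "real \<Rightarrow> real \<Rightarrow> real set" where
  "circ_pt L x = {x + L * of_int k | k. True}"

definition circ_top :: "real \<Rightarrow> real set topology" where
  "circ_top L = quotient_topology euclideanreal (circ_pt L)"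

abbreviation circ :: "real \<Rightarrow> real set set" where
  "circ L \<equiv> topspace (circ_top L)"

text \<open>Only the restriction of a path to the unit interval is relevant; the homotopy classes below
  are closed under changing paths elsewhere.\<close>

definition mono_lift :: "real \<Rightarrow> (real \<Rightarrow> real set) \<Rightarrow> (real \<Rightarrow> real) \<Rightarrow> bool" where
  "mono_lift L p l \<longleftrightarrow>
     continuous_on {0..1} l \<and> mono_on {0..1} l \<and> (\<forall>t\<in>{0..1}. p t = circ_pt L (l t))"

definition mono_path :: "real \<Rightarrow> (real \<Rightarrow> real set) \<Rightarrow> bool" where
  "mono_path L p \<longleftrightarrow> (\<exists>l. mono_lift L p l)"

definition path_homotopic :: "real \<Rightarrow> (real \<Rightarrow> real set) \<Rightarrow> (real \<Rightarrow> real set) \<Rightarrow> bool" where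
  "path_homotopic L p q \<longleftrightarrow>
     homotopic_with (\<lambda>g. g 0 = p 0 \<and> g 1 = p 1) (top_of_set {0..1}) (circ_top L) p q"

text \<open>The monotone paths in the homotopy class of an arbitrary path.\<close>

definition path_class :: "real \<Rightarrow> (real \<Rightarrow> real set) \<Rightarrow> hclass" where
  "path_class L p = {q. mono_path L q \<and> path_homotopic L p q}"

text \<open>Concatenation; \<open>joinpaths\<close> requires a type of class \<open>topological_space\<close>.\<close>

definition path_join :: "(real \<Rightarrow> 'a) \<Rightarrow> (real \<Rightarrow> 'a) \<Rightarrow> real \<Rightarrow> 'a" where
  "path_join p q = (\<lambda>t. if t \<le> 1 / 2 then p (2 * t) else q (2 * t - 1))"

definition circ_cat :: "real \<Rightarrow> (real set, hclass) zcat" where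
  "circ_cat L = \<lparr>zob = circ L,
     zar = {path_class L p | p. mono_path L p},
     zdom = (\<lambda>f. (SOME p. p \<in> f) 0),
     zcod = (\<lambda>f. (SOME p. p \<in> f) 1),
     zid = (\<lambda>x. path_class L (\<lambda>t. x)),
     zcomp = (\<lambda>g f. \<Union>p\<in>f. \<Union>q\<in>g. path_class L (path_join p q)),
     zone = (\<lambda>x. {p. p 0 = x \<and> (\<exists>l. mono_lift L p l \<and> l 1 = l 0 + L)})\<rparr>"

definition ccomps :: "real \<Rightarrow> real set set \<Rightarrow> real set set set" where
  "ccomps L F = connected_components_of (subtopology (circ_top L) (circ L - F))"

definition chosen :: "'a set \<Rightarrow> 'a" where
  "chosen c = (SOME x. x \<in> c)"

definition cpi0 :: "real \<Rightarrow> real set set \<Rightarrow> (real set set, real set set \<times> real set set \<times> hclass) zcat" where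
  "cpi0 L F = \<lparr>zob = ccomps L F,
     zar = {(c, d, f). c \<in> ccomps L F \<and> d \<in> ccomps L F \<and> f \<in> zar (circ_cat L) \<and>
        zdom (circ_cat L) f = chosen c \<and> zcod (circ_cat L) f = chosen d},
     zdom = (\<lambda>(c, d, f). c),
     zcod = (\<lambda>(c, d, f). d),
     zid = (\<lambda>c. (c, c, zid (circ_cat L) (chosen c))),
     zcomp = (\<lambda>(d, e, g) (c, d', f). (c, e, zcomp (circ_cat L) g f)),
     zone = (\<lambda>c. (c, c, zone (circ_cat L) (chosen c)))\<rparr>"

definition paths_in :: "real \<Rightarrow> real set set \<Rightarrow> real set \<Rightarrow> real set \<Rightarrow> (real \<Rightarrow> real set) set" where
  "paths_in L c x y = {p. pathin (subtopology (circ_top L) c) p \<and> p 0 = x \<and> p 1 = y}"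

text \<open>
  The functor induced by a map \<open>h\<close> of circles that carries each component \<open>c\<close> of the complement of
  \<open>F\<close> into a component \<open>c'\<close> of the complement of \<open>F'\<close>. The chosen points need not correspond, so the
  image \<open>h \<circ> p\<close> of a path from \<open>x\<^sub>c\<close> to \<open>x\<^sub>d\<close> is first extended by a path in \<open>c'\<close> from \<open>x\<^sub>c\<^sub>'\<close> to \<open>h x\<^sub>c\<close>
  and one in \<open>d'\<close> from \<open>h x\<^sub>d\<close> to \<open>x\<^sub>d\<^sub>'\<close>. For nonempty finite \<open>F'\<close> the components are arcs, so these
  are unique up to homotopy.
\<close>

definition ccomp_map :: "real \<Rightarrow> real set set \<Rightarrow> (real set \<Rightarrow> real set) \<Rightarrow> real set set \<Rightarrow> real set set" where
  "ccomp_map L' F' h c = (THE c'. c' \<in> ccomps L' F' \<and> h ` c \<subseteq> c')"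

definition cpi0_map ::
  "real \<Rightarrow> real set set \<Rightarrow> real \<Rightarrow> real set set \<Rightarrow> (real set \<Rightarrow> real set) \<Rightarrow>
     (real set set, real set set \<times> real set set \<times> hclass,
      real set set, real set set \<times> real set set \<times> hclass) zfun" where
  "cpi0_map L F L' F' h =
     (\<lambda>c\<in>ccomps L F. ccomp_map L' F' h c,
      \<lambda>(c, d, f)\<in>zar (cpi0 L F).
        let c' = ccomp_map L' F' h c; d' = ccomp_map L' F' h d in
        (c', d', \<Union>p\<in>f. \<Union>u\<in>paths_in L' c' (chosen c') (h (chosen c)).
           \<Union>v\<in>paths_in L' d' (h (chosen d)) (chosen d').
             path_class L' (path_join u (path_join (h \<circ> p) v))))"

text \<open>
  Only nonempty subsets are used as indices. The empty set admits no transition maps: the complement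
  of a singleton and the whole circle both have one object and endomorphism monoid generated by
  \<open>1\<close>, so the only functor preserving \<open>1\<close> between them is the isomorphism. For \<open>a \<noteq> b\<close> a functor
  from the complement of \<open>{a, b}\<close> to the whole circle would have to factor through the complements of
  \<open>{a}\<close> and of \<open>{b}\<close>, hence to send the arrow across \<open>a\<close> both to \<open>1\<close> and to the identity.
\<close>

definition fin_circle :: "real \<Rightarrow> real set set set" where
  "fin_circle L = {F. finite F \<and> F \<noteq> {} \<and> F \<subseteq> circ L}"

definition cpi0_big :: "real \<Rightarrow> real set set \<Rightarrow> (cobj, carr) zcat" where
  "cpi0_big L F = zrelabel Inr Inr (cpi0 L F)"

context
  fixes Xt :: "'a cyc_big"
begin

definition circle_val :: "real \<Rightarrow> real set set \<Rightarrow> 'a set" where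
  "circle_val L F = pob Xt (cpi0_big L F)"

definition circle_trans :: "real \<Rightarrow> real set set \<Rightarrow> real set set \<Rightarrow> 'a \<Rightarrow> 'a" where
  "circle_trans L F G = pact Xt (cpi0_big L G) (cpi0_big L F)
     (zrelabel_fun (cpi0 L G) Inr Inr Inr Inr (cpi0_map L G L F (\<lambda>x. x)))"

definition circle_colim :: "real \<Rightarrow> (real set set \<times> 'a) set set" where
  "circle_colim L = colim (fin_circle L) (circle_val L) (circle_trans L)"

definition circle_in :: "real \<Rightarrow> real set set \<Rightarrow> 'a \<Rightarrow> (real set set \<times> 'a) set" where
  "circle_in L = colim_in (fin_circle L) (circle_val L) (circle_trans L)"

definition circle_push ::
  "real \<Rightarrow> real \<Rightarrow> (real set \<Rightarrow> real set) \<Rightarrow> real set set \<Rightarrow> 'a \<Rightarrow> (real set set \<times> 'a) set" where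
  "circle_push L L' h F x = circle_in L' (h ` F)
     (pact Xt (cpi0_big L' (h ` F)) (cpi0_big L F)
       (zrelabel_fun (cpi0 L' (h ` F)) Inr Inr Inr Inr
         (zfun_inv (cpi0 L F) (cpi0 L' (h ` F)) (cpi0_map L F L' (h ` F) h))) x)"

end

text \<open>
  For \<open>F\<close> containing \<open>0\<close> and \<open>L\<close>, the identification of \<open>cyc (pi0 L F)\<close> with the category of
  components of the complement of the image of \<open>F\<close> in the circle: the morphism \<open>(A, B, k)\<close>
  corresponds to the paths that lift to a path from \<open>A\<close> to the translate of \<open>B\<close> by \<open>k L\<close>.
\<close>

definition glue ::
  "real \<Rightarrow> real set \<Rightarrow> (real set, real set \<times> real set \<times> nat,
     real set set, real set set \<times> real set set \<times> hclass) zfun" where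
  "glue L F =
     (\<lambda>A\<in>icomps L F. circ_pt L ` A,
      \<lambda>(A, B, k)\<in>zar (cyc (pi0 L F)).
        (circ_pt L ` A, circ_pt L ` B,
         {p. p 0 = chosen (circ_pt L ` A) \<and> p 1 = chosen (circ_pt L ` B) \<and>
             (\<exists>l. mono_lift L p l \<and> l 0 \<in> A \<and> l 1 - L * real k \<in> B)}))"

definition circle_canon ::
  "'a cyc_big \<Rightarrow> nat \<Rightarrow> nat \<Rightarrow> 'a \<Rightarrow> (nat \<Rightarrow> real) \<Rightarrow> (real set set \<times> 'a) set" where
  "circle_canon Xt r n \<xi> z =
     (let F = cut_set r n z; F' = circ_pt r ` F;
          f_cyc = zfun_comp (cpi0 r F') (cyc_map (pi0 r F) (cut_index r n z))
                    (zfun_inv (cyc (pi0 r F)) (cpi0 r F') (glue r F))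
      in circle_in Xt r F'
           (pact Xt (cpi0_big r F') (std_cyc (r * (n + 1) - 1))
             (zrelabel_fun (cpi0 r F') Inr Inr Inl Inl f_cyc) \<xi>))"

definition homeo_circle :: "real \<Rightarrow> (real set \<Rightarrow> real set) monoid" where
  "homeo_circle L = \<lparr>carrier = {\<alpha> \<in> extensional (circ L).
       homeomorphic_map (circ_top L) (circ_top L) \<alpha> \<and>
       (\<exists>l. continuous_on UNIV l \<and> strict_mono l \<and> (\<forall>x. \<alpha> (circ_pt L x) = circ_pt L (l x)))},
     mult = (\<lambda>\<alpha> \<beta>. compose (circ L) \<alpha> \<beta>), one = (\<lambda>x\<in>circ L. x)\<rparr>"

definition scale_circle :: "nat \<Rightarrow> real set \<Rightarrow> real set" where
  "scale_circle r = (\<lambda>P\<in>circ r. (\<lambda>x. x / real r) ` P)"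

end

theory Submission
  imports Defs "HOL-Analysis.Analysis"
begin

text \<open>
  Why the theorem holds. A point \<open>z\<close> of a simplex cuts \<open>[0,1]\<close> into consecutive intervals of lengths
  \<open>z\<^sub>0, \<dots>, z\<^sub>n\<close>, and its \<open>r\<close> translates cut \<open>[0,r]\<close> into \<open>r (n + 1)\<close> intervals, that is, into
  \<open>sd\<^sub>r [n]\<close>. A representative \<open>(\<xi>, z)\<close> of a point of the subdivided realization is thus a finite set
  \<open>F\<close> of cut points together with a simplex whose vertices label the components of the complement of
  \<open>F\<close>. Passing to a face or a degeneracy of \<open>\<xi>\<close> removes or adds cut points, which is the relation that
  defines the colimit over finite sets. The comparison is a bijection (\<open>realization_as_colimit\<close>)
  because the cut sets of inner points are cofinal among all finite sets (\<open>cut_set_cofinal\<close>), all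
  intervals of an inner point are nonempty, so that labels and components correspond bijectively, and
  an inclusion of cut sets always comes from a simplicial operator (\<open>cut_set_detect\<close>).

  The colimit depends only on the interval and its finite subsets, so homeomorphisms between
  intervals of different lengths act on it functorially. This functoriality alone gives the group
  actions and the commuting square: the isomorphism \<open>D\<^sub>r\<close> is the action of the rescaling \<open>x \<mapsto> x / r\<close>, and
  \<open>d\<^sub>r\<close> is conjugation by it (locale \<open>homeo_colimits\<close>, \<open>actions_and_rescaling\<close>). On representatives
  \<open>D\<^sub>r\<close> sends \<open>(\<xi>, z)\<close> to \<open>(\<xi>, w)\<close>, where \<open>w\<close> consists of \<open>r\<close> copies of \<open>z / r\<close> (\<open>spread\<close>). That it is
  continuous is then clear; that it is closed follows from compactness, since every point of a simplex
  is a degenerate image of some \<open>w\<close> of bounded dimension (\<open>homeomorphic_map_spread\<close>).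

  In the cyclic case the same two arguments apply to the circle, once the categories of components
  have been made computable. Monotone paths on the circle are homotopic precisely if they have lifts
  with the same end points, because the circle wraps around the punctured plane, which is covered by the
  exponential map. Morphisms between components are therefore pairs of gaps between the lifts of the
  cut points, up to simultaneous translation by the length (\<open>hcls_eq_iff\<close>, \<open>arr_eq_iff\<close>). In this
  description a map of circles acts through any of its lifts to the line (\<open>cpi0_map_acts\<close>), the
  choice of base points disappears, and an equation between functors is an equation between lifts
  (\<open>acts_eq\<close>). Cutting at a point of \<open>F\<close> identifies the category with the cyclic category of the
  linearly ordered set of components in one period (\<open>cpi0_ziso\<close>, \<open>glue_ziso\<close>), which relates the
  canonical bijection of the circle to the labels of the interval (\<open>cut_functor_natural\<close>).
\<close>

section \<open>Filtered colimits of sets\<close>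

lemma filtered_diagramD:
  assumes "filtered_diagram I D T"
  shows "\<And>F G. F \<in> I \<Longrightarrow> G \<in> I \<Longrightarrow> \<exists>H\<in>I. F \<subseteq> H \<and> G \<subseteq> H"
    and "\<And>F G x. F \<in> I \<Longrightarrow> G \<in> I \<Longrightarrow> F \<subseteq> G \<Longrightarrow> x \<in> D F \<Longrightarrow> T F G x \<in> D G"
    and "\<And>F x. F \<in> I \<Longrightarrow> x \<in> D F \<Longrightarrow> T F F x = x"
    and "\<And>F G H x. F \<in> I \<Longrightarrow> G \<in> I \<Longrightarrow> H \<in> I \<Longrightarrow> F \<subseteq> G \<Longrightarrow> G \<subseteq> H \<Longrightarrow> x \<in> D F \<Longrightarrow>
      T G H (T F G x) = T F H x"
  using assms by (simp_all add: filtered_diagram_def Pi_iff)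

text \<open>
  Filteredness is what makes equality in the colimit testable: the relation "equal in some common
  later stage" contains the generators and is transitive because any two later stages lie below a
  third one.
\<close>

lemma colim_in_eq_iff:
  assumes fd: "filtered_diagram I D T" and F: "F \<in> I" "x \<in> D F" and G: "G \<in> I" "y \<in> D G"
  shows "colim_in I D T F x = colim_in I D T G y \<longleftrightarrow>
    (\<exists>H\<in>I. F \<subseteq> H \<and> G \<subseteq> H \<and> T F H x = T G H y)"
proof -
  note dir = filtered_diagramD(1)[OF fd] and mem = filtered_diagramD(2)[OF fd]
    and tid = filtered_diagramD(3)[OF fd] and tcomp = filtered_diagramD(4)[OF fd]
  let ?E = "\<lambda>p q. p \<in> Sigma I D \<and> q \<in> Sigma I D \<and>
    (\<exists>H\<in>I. fst p \<subseteq> H \<and> fst q \<subseteq> H \<and> T (fst p) H (snd p) = T (fst q) H (snd q))"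
  have E_gen: "?E p q" if gen: "colim_gen I D T p q" for p q
  proof -
    obtain F G x where p: "F \<in> I" "G \<in> I" "F \<subseteq> G" "x \<in> D F" "p = (F, x)" "q = (G, T F G x)"
      using gen unfolding colim_gen_def by blast
    have m: "T F G x \<in> D G"
      by (rule mem[OF p(1-4)])
    have t: "T F G x = T G G (T F G x)"
      by (rule tid[OF p(2) m, symmetric])
    show ?thesis
      unfolding p(5,6) fst_conv snd_conv mem_Sigma_iff
      by (intro conjI bexI[of _ G]) (fact p(1-4) m t subset_refl)+
  qed
  have E_trans: "?E p s" if pq: "?E p q" and qs: "?E q s" for p q s
  proof -
    obtain H where H: "H \<in> I" "fst p \<subseteq> H" "fst q \<subseteq> H" "T (fst p) H (snd p) = T (fst q) H (snd q)"
      using pq by blast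
    obtain K where K: "K \<in> I" "fst q \<subseteq> K" "fst s \<subseteq> K" "T (fst q) K (snd q) = T (fst s) K (snd s)"
      using qs by blast
    obtain M where M: "M \<in> I" "H \<subseteq> M" "K \<subseteq> M"
      using dir H(1) K(1) by blast
    have mm: "fst p \<in> I" "snd p \<in> D (fst p)" "fst q \<in> I" "snd q \<in> D (fst q)"
      "fst s \<in> I" "snd s \<in> D (fst s)"
      using pq qs by auto
    have "T (fst p) M (snd p) = T (fst q) M (snd q)"
      using tcomp[OF mm(1) H(1) M(1) H(2) M(2) mm(2)] tcomp[OF mm(3) H(1) M(1) H(3) M(2) mm(4)] H(4)
      by simp
    moreover have "T (fst q) M (snd q) = T (fst s) M (snd s)"
      using tcomp[OF mm(3) K(1) M(1) K(2) M(3) mm(4)] tcomp[OF mm(5) K(1) M(1) K(3) M(3) mm(6)] K(4)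
      by simp
    ultimately show ?thesis
      using pq qs M H(2) K(3) by (metis subset_trans)
  qed
  have E_sym: "?E q p" if "?E p q" for p q
    using that by metis
  have eq: "?E p q" if "equivclp (colim_gen I D T) p q" "p \<in> Sigma I D" for p q
    using that
  proof (induction rule: equivclp_induct)
    case base
    then show ?case by auto
  next
    case (step y z)
    then have "?E y z"
      using E_gen[of y z] E_gen[of z y] E_sym[of z y] by argo
    from E_trans[OF step.IH[OF step.prems] this] show ?case .
  qed
  have conv: "equivclp (colim_gen I D T) (F, x) (G, y)"
    if "H \<in> I" "F \<subseteq> H" "G \<subseteq> H" "T F H x = T G H y" for H
  proof -
    have "colim_gen I D T (F, x) (H, T F H x)" "colim_gen I D T (G, y) (H, T G H y)"
      using F G that unfolding colim_gen_def by blast+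
    then show ?thesis
      using that(4) by (metis converse_r_into_equivclp equivclp_trans r_into_equivclp)
  qed
  have "colim_in I D T F x = colim_in I D T G y \<longleftrightarrow> equivclp (colim_gen I D T) (F, x) (G, y)"
  proof
    assume eq: "colim_in I D T F x = colim_in I D T G y"
    have "(G, y) \<in> colim_in I D T F x"
      unfolding eq using G by (simp add: colim_in_def)
    then show "equivclp (colim_gen I D T) (F, x) (G, y)"
      by (simp add: colim_in_def)
  next
    assume "equivclp (colim_gen I D T) (F, x) (G, y)"
    then have "equivclp (colim_gen I D T) (F, x) q \<longleftrightarrow> equivclp (colim_gen I D T) (G, y) q" for q
      by (meson equivclp_sym equivclp_trans)
    then show "colim_in I D T F x = colim_in I D T G y"
      by (simp add: colim_in_def)
  qed
  then show ?thesis
    using eq[of "(F, x)" "(G, y)"] conv F by auto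
qed

lemma colim_in_trans:
  assumes fd: "filtered_diagram I D T" and "F \<in> I" "G \<in> I" "F \<subseteq> G" "x \<in> D F"
  shows "colim_in I D T G (T F G x) = colim_in I D T F x"
proof -
  have m: "T F G x \<in> D G"
    by (rule filtered_diagramD(2)[OF assms])
  have "T G G (T F G x) = T F G x"
    by (rule filtered_diagramD(3)[OF fd assms(3) m])
  then show ?thesis
    unfolding colim_in_eq_iff[OF fd assms(3) m assms(2,5)] using assms(3,4) by blast
qed

lemma colim_in_mem: "F \<in> I \<Longrightarrow> x \<in> D F \<Longrightarrow> colim_in I D T F x \<in> colim I D T"
  by (auto simp: colim_def image_iff intro!: bexI[of _ "(F, x)"])

lemma colimE:
  assumes "c \<in> colim I D T"
  obtains F x where "F \<in> I" "x \<in> D F" "c = colim_in I D T F x"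
  using assms by (auto simp: colim_def)

lemma colim_map_well_defined:
  assumes fd: "filtered_diagram I D T" and fd': "filtered_diagram I' D' T'"
    and a: "\<And>F. F \<in> I \<Longrightarrow> a F \<in> I'" "\<And>F G. F \<in> I \<Longrightarrow> G \<in> I \<Longrightarrow> F \<subseteq> G \<Longrightarrow> a F \<subseteq> a G"
    and s: "\<And>F x. F \<in> I \<Longrightarrow> x \<in> D F \<Longrightarrow> s F x \<in> D' (a F)"
    and nat: "\<And>F G x. F \<in> I \<Longrightarrow> G \<in> I \<Longrightarrow> F \<subseteq> G \<Longrightarrow> x \<in> D F \<Longrightarrow>
      T' (a F) (a G) (s F x) = s G (T F G x)"
    and F: "F \<in> I" "x \<in> D F" and G: "G \<in> I" "y \<in> D G"
    and eq: "colim_in I D T F x = colim_in I D T G y"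
  shows "colim_in I' D' T' (a F) (s F x) = colim_in I' D' T' (a G) (s G y)"
proof -
  obtain H where H: "H \<in> I" "F \<subseteq> H" "G \<subseteq> H" "T F H x = T G H y"
    using eq colim_in_eq_iff[of I D T, OF fd F G] by blast
  have "T' (a F) (a H) (s F x) = T' (a G) (a H) (s G y)"
    using nat[of F H x] nat[of G H y] F G H by simp
  then show ?thesis
    unfolding colim_in_eq_iff[OF fd' a(1)[OF F(1)] s[OF F] a(1)[OF G(1)] s[OF G]]
    using a(1)[OF H(1)] a(2)[OF F(1) H(1,2)] a(2)[OF G(1) H(1,3)] by blast
qed


section \<open>Realizations as filtered colimits\<close>

lemma simplex_push_simplex:
  assumes "\<theta> \<in> mor Delta m n" "z \<in> standard_simplex m"
  shows "simplex_push m \<theta> z \<in> standard_simplex n"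
proof -
  have mem: "\<theta> ` {..m} \<subseteq> {..n}"
    using assms(1) by (auto simp: Delta_def)
  have z: "\<And>i. 0 \<le> z i" "sum z {..m} = 1"
    using assms(2) by (auto simp: standard_simplex_def)
  have set_eq: "{i. i \<le> m \<and> \<theta> i = j} = {i \<in> {..m}. \<theta> i = j}" for j
    by auto
  have "(\<Sum>j\<le>n. simplex_push m \<theta> z j) = sum z {..m}"
    unfolding simplex_push_def set_eq by (rule sum.group) (use mem in auto)
  moreover have "simplex_push m \<theta> z j \<le> sum z {..m}" for j
    unfolding simplex_push_def by (rule sum_mono2) (use z in auto)
  moreover have "simplex_push m \<theta> z j = 0" if "j > n" for j
    unfolding simplex_push_def by (rule sum.neutral) (use mem that in force)
  ultimately show ?thesis
    using z by (auto simp: standard_simplex_def simplex_push_def sum_nonneg)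
qed

lemma topspace_pre_realization:
  "topspace (pre_realization X) = {(n, x, z). x \<in> pob X n \<and> z \<in> standard_simplex n}"
  by (auto simp: pre_realization_def)

lemma realization_eq:
  "realization X =
     {realization_point X (n, x, z) | n x z. x \<in> pob X n \<and> z \<in> standard_simplex n}"
  by (auto simp: realization_top_def topspace_pre_realization)

lemma realizationE:
  assumes "P \<in> realization X"
  obtains n x z where "x \<in> pob X n" "z \<in> standard_simplex n" "P = realization_point X (n, x, z)"
  using assms unfolding realization_eq by blast

lemma realization_pointI:
  "x \<in> pob X n \<Longrightarrow> z \<in> standard_simplex n \<Longrightarrow> realization_point X (n, x, z) \<in> realization X"
  by (auto simp: realization_eq)

lemma realization_point_eq_iff:
  assumes "y \<in> pob X m" "w \<in> standard_simplex m"
  shows "realization_point X p = realization_point X (m, y, w) \<longleftrightarrow>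
    equivclp (realization_gen X) p (m, y, w)"
proof
  assume eq: "realization_point X p = realization_point X (m, y, w)"
  have "(m, y, w) \<in> realization_point X p"
    unfolding eq using assms by (simp add: realization_point_def topspace_pre_realization)
  then show "equivclp (realization_gen X) p (m, y, w)"
    by (simp add: realization_point_def)
next
  assume "equivclp (realization_gen X) p (m, y, w)"
  then have "equivclp (realization_gen X) p q \<longleftrightarrow> equivclp (realization_gen X) (m, y, w) q" for q
    by (meson equivclp_sym equivclp_trans)
  then show "realization_point X p = realization_point X (m, y, w)"
    by (simp add: realization_point_def)
qed

lemma presheaf_pact_mem:
  "presheaf C X \<Longrightarrow> a \<in> obs C \<Longrightarrow> b \<in> obs C \<Longrightarrow> f \<in> mor C a b \<Longrightarrow> x \<in> pob X b \<Longrightarrow>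
    pact X a b f x \<in> pob X a"
  unfolding presheaf_def by blast

lemma presheaf_pact_id: "presheaf C X \<Longrightarrow> a \<in> obs C \<Longrightarrow> x \<in> pob X a \<Longrightarrow> pact X a a (idm C a) x = x"
  unfolding presheaf_def by blast

lemma presheaf_pact_comp:
  "presheaf C X \<Longrightarrow> a \<in> obs C \<Longrightarrow> b \<in> obs C \<Longrightarrow> c \<in> obs C \<Longrightarrow> f \<in> mor C a b \<Longrightarrow> g \<in> mor C b c \<Longrightarrow>
    x \<in> pob X c \<Longrightarrow> pact X a b f (pact X b c g x) = pact X a c (cmp C a b c g f) x"
  unfolding presheaf_def by metis

lemma obs_Delta [simp]: "n \<in> obs Delta"
  by (simp add: Delta_def)

lemma realization_point_push:
  assumes "presheaf Delta X" "\<theta> \<in> mor Delta m n" "x \<in> pob X n" "z \<in> standard_simplex m"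
  shows "realization_point X (n, x, simplex_push m \<theta> z) =
    realization_point X (m, pact X m n \<theta> x, z)"
proof -
  have "realization_gen X (n, x, simplex_push m \<theta> z) (m, pact X m n \<theta> x, z)"
    using assms unfolding realization_gen_def by blast
  then show ?thesis
    using assms by (subst realization_point_eq_iff) (auto intro: presheaf_pact_mem)
qed

definition inner_point :: "nat \<Rightarrow> (nat \<Rightarrow> real) \<Rightarrow> bool" where
  "inner_point n z \<longleftrightarrow> z \<in> standard_simplex n \<and> (\<forall>i\<le>n. 0 < z i)"

text \<open>
  The common core of the simplicial and the cyclic case. A point \<open>z\<close> of a simplex determines an
  index \<open>\<Phi> z\<close>, a set of cut points, and \<open>\<psi> z\<close> sends simplices of \<open>Y\<close> to the value of the diagram
  there. The indices coming from inner points are cofinal, and for them \<open>\<psi> z\<close> is bijective.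
  If \<open>w\<close> is an inner point with more cut points than \<open>z\<close> then \<open>z\<close> is the image of \<open>w\<close> under a face or
  degeneracy operator \<open>\<theta>\<close>, so \<open>(\<xi>, z)\<close> is equivalent to \<open>(\<theta>\<^sup>* \<xi>, w)\<close>. Hence two points with equal image
  in the colimit can be rewritten over one common \<open>w\<close>, where injectivity of \<open>\<psi> w\<close> applies.
\<close>

lemma realization_as_colimit:
  fixes Y :: "(nat, nat \<Rightarrow> nat, 'a) psh"
  assumes Y: "presheaf Delta Y" and fd: "filtered_diagram I D T"
    and \<Phi>_in: "\<And>n z. z \<in> standard_simplex n \<Longrightarrow> \<Phi> n z \<in> I"
    and \<psi>_in: "\<And>n z x. z \<in> standard_simplex n \<Longrightarrow> x \<in> pob Y n \<Longrightarrow> \<psi> n z x \<in> D (\<Phi> n z)"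
    and push_sub: "\<And>m n \<theta> z. \<theta> \<in> mor Delta m n \<Longrightarrow> z \<in> standard_simplex m \<Longrightarrow>
      \<Phi> n (simplex_push m \<theta> z) \<subseteq> \<Phi> m z"
    and push_nat: "\<And>m n \<theta> z x. \<theta> \<in> mor Delta m n \<Longrightarrow> z \<in> standard_simplex m \<Longrightarrow> x \<in> pob Y n \<Longrightarrow>
      T (\<Phi> n (simplex_push m \<theta> z)) (\<Phi> m z) (\<psi> n (simplex_push m \<theta> z) x) = \<psi> m z (pact Y m n \<theta> x)"
    and bij: "\<And>n z. inner_point n z \<Longrightarrow> bij_betw (\<psi> n z) (pob Y n) (D (\<Phi> n z))"
    and cofinal: "\<And>F. F \<in> I \<Longrightarrow> \<exists>n z. inner_point n z \<and> F \<subseteq> \<Phi> n z"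
    and detect: "\<And>n z m w. z \<in> standard_simplex n \<Longrightarrow> inner_point m w \<Longrightarrow> \<Phi> n z \<subseteq> \<Phi> m w \<Longrightarrow>
      \<exists>\<theta>\<in>mor Delta m n. z = simplex_push m \<theta> w"
  shows "\<exists>\<kappa>. bij_betw \<kappa> (realization Y) (colim I D T) \<and>
    (\<forall>n. \<forall>\<xi>\<in>pob Y n. \<forall>z\<in>standard_simplex n.
       \<kappa> (realization_point Y (n, \<xi>, z)) = colim_in I D T (\<Phi> n z) (\<psi> n z \<xi>))"
proof -
  define c where "c = (\<lambda>(n, \<xi>, z). colim_in I D T (\<Phi> n z) (\<psi> n z \<xi>))"
  have c_push: "c (n, x, simplex_push m \<theta> z) = c (m, pact Y m n \<theta> x, z)"
    if "\<theta> \<in> mor Delta m n" "x \<in> pob Y n" "z \<in> standard_simplex m" for m n \<theta> x z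
    using colim_in_trans[OF fd \<Phi>_in \<Phi>_in push_sub[OF that(1,3)] \<psi>_in, of x]
      simplex_push_simplex[OF that(1,3)] push_nat[OF that(1,3,2)] that
    by (simp add: c_def)
  have c_gen: "c p = c q" if "realization_gen Y p q" for p q
    using that c_push unfolding realization_gen_def by auto
  have c_equiv: "c p = c q" if "equivclp (realization_gen Y) p q" for p q
    using that
  proof (induction rule: equivclp_induct)
    case (step y z)
    then show ?case
      using c_gen[of y z] c_gen[of z y] by auto
  qed simp
  have c_inj: "realization_point Y (n, \<xi>, z) = realization_point Y (m, \<zeta>, w)"
    if eq: "c (n, \<xi>, z) = c (m, \<zeta>, w)"
      and mem: "\<xi> \<in> pob Y n" "z \<in> standard_simplex n" "\<zeta> \<in> pob Y m" "w \<in> standard_simplex m"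
    for n \<xi> z m \<zeta> w
  proof -
    obtain H where H: "H \<in> I" "\<Phi> n z \<subseteq> H" "\<Phi> m w \<subseteq> H"
      "T (\<Phi> n z) H (\<psi> n z \<xi>) = T (\<Phi> m w) H (\<psi> m w \<zeta>)"
      using eq mem \<Phi>_in \<psi>_in unfolding c_def prod.case
      by (subst (asm) colim_in_eq_iff[OF fd]) auto
    obtain k v where v: "inner_point k v" "H \<subseteq> \<Phi> k v"
      using cofinal[OF H(1)] by blast
    then have v': "v \<in> standard_simplex k"
      by (simp add: inner_point_def)
    obtain \<theta> where \<theta>: "\<theta> \<in> mor Delta k n" "z = simplex_push k \<theta> v"
      using detect[OF mem(2) v(1)] H v by blast
    obtain \<eta> where \<eta>: "\<eta> \<in> mor Delta k m" "w = simplex_push k \<eta> v"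
      using detect[OF mem(4) v(1)] H v by blast
    have t: "T H (\<Phi> k v) (T (\<Phi> n z) H x) = T (\<Phi> n z) (\<Phi> k v) x" if "z \<in> standard_simplex n"
      "\<Phi> n z \<subseteq> H" "x \<in> D (\<Phi> n z)" for n z x
      using filtered_diagramD(4)[OF fd \<Phi>_in[OF that(1)] H(1) \<Phi>_in[OF v'] that(2) v(2) that(3)] .
    have "\<psi> k v (pact Y k n \<theta> \<xi>) = \<psi> k v (pact Y k m \<eta> \<zeta>)"
      using t[OF mem(2) H(2) \<psi>_in[OF mem(2,1)]] t[OF mem(4) H(3) \<psi>_in[OF mem(4,3)]]
        push_nat[OF \<theta>(1) v' mem(1)] push_nat[OF \<eta>(1) v' mem(3)] H(4) \<theta>(2) \<eta>(2) by simp
    moreover have "pact Y k n \<theta> \<xi> \<in> pob Y k" "pact Y k m \<eta> \<zeta> \<in> pob Y k"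
      using presheaf_pact_mem[OF Y] \<theta> \<eta> mem by auto
    ultimately have "pact Y k n \<theta> \<xi> = pact Y k m \<eta> \<zeta>"
      using bij[OF v(1)] by (auto simp: bij_betw_def inj_on_def)
    then show ?thesis
      using realization_point_push[OF Y \<theta>(1) mem(1) v'] realization_point_push[OF Y \<eta>(1) mem(3) v']
        \<theta>(2) \<eta>(2) by simp
  qed
  define \<kappa> where "\<kappa> P = c (SOME p. p \<in> P)" for P
  have \<kappa>: "\<kappa> (realization_point Y (n, \<xi>, z)) = c (n, \<xi>, z)"
    if "\<xi> \<in> pob Y n" "z \<in> standard_simplex n" for n \<xi> z
  proof -
    have "(n, \<xi>, z) \<in> realization_point Y (n, \<xi>, z)"
      using that by (auto simp: realization_point_def topspace_pre_realization)
    then have "(SOME p. p \<in> realization_point Y (n, \<xi>, z)) \<in> realization_point Y (n, \<xi>, z)"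
      by (rule someI)
    then have "equivclp (realization_gen Y) (n, \<xi>, z) (SOME p. p \<in> realization_point Y (n, \<xi>, z))"
      unfolding realization_point_def by blast
    then show ?thesis
      unfolding \<kappa>_def by (rule c_equiv[symmetric])
  qed
  have "bij_betw \<kappa> (realization Y) (colim I D T)"
  proof (rule bij_betw_imageI)
    show "inj_on \<kappa> (realization Y)"
    proof (rule inj_onI)
      fix P Q assume "P \<in> realization Y" and "Q \<in> realization Y" and eq: "\<kappa> P = \<kappa> Q"
      from this(1) obtain n \<xi> z where P: "\<xi> \<in> pob Y n" "z \<in> standard_simplex n"
        "P = realization_point Y (n, \<xi>, z)"
        by (rule realizationE)
      from \<open>Q \<in> realization Y\<close> obtain m \<zeta> w where Q: "\<zeta> \<in> pob Y m" "w \<in> standard_simplex m"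
        "Q = realization_point Y (m, \<zeta>, w)"
        by (rule realizationE)
      show "P = Q"
        using eq unfolding P(3) Q(3) \<kappa>[OF P(1,2)] \<kappa>[OF Q(1,2)] by (rule c_inj) (fact P Q)+
    qed
    have "\<kappa> P \<in> colim I D T" if "P \<in> realization Y" for P
    proof -
      from that obtain n \<xi> z where P: "\<xi> \<in> pob Y n" "z \<in> standard_simplex n"
        "P = realization_point Y (n, \<xi>, z)"
        by (rule realizationE)
      then show ?thesis
        using \<kappa>[OF P(1,2)] colim_in_mem[of "\<Phi> n z" I "\<psi> n z \<xi>" D T] \<Phi>_in[OF P(2)] \<psi>_in[OF P(2,1)]
        by (simp add: c_def)
    qed
    then have "\<kappa> ` realization Y \<subseteq> colim I D T"
      by blast
    moreover have "p \<in> \<kappa> ` realization Y" if p: "p \<in> colim I D T" for p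
    proof -
      obtain F x where F: "F \<in> I" "x \<in> D F" "p = colim_in I D T F x"
        using p by (rule colimE)
      obtain k v where v: "inner_point k v" "F \<subseteq> \<Phi> k v"
        using cofinal[OF F(1)] by blast
      then have v': "v \<in> standard_simplex k"
        by (simp add: inner_point_def)
      have "T F (\<Phi> k v) x \<in> D (\<Phi> k v)"
        using filtered_diagramD(2)[OF fd F(1) \<Phi>_in[OF v'] v(2) F(2)] .
      then obtain \<xi> where \<xi>: "\<xi> \<in> pob Y k" "\<psi> k v \<xi> = T F (\<Phi> k v) x"
        using bij[OF v(1)] by (metis bij_betw_iff_bijections)
      then have "\<kappa> (realization_point Y (k, \<xi>, v)) = p"
        using \<kappa>[OF \<xi>(1) v'] F v colim_in_trans[OF fd F(1) \<Phi>_in[OF v'] v(2), of x]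
        by (simp add: c_def)
      then show ?thesis
        using realization_pointI[OF \<xi>(1) v'] by (metis imageI)
    qed
    ultimately show "\<kappa> ` realization Y = colim I D T"
      by blast
  qed
  then show ?thesis
    using \<kappa> by (auto simp: c_def)
qed

section \<open>Cut points and subdivision\<close>

lemma cut_0 [simp]: "cut z 0 = 0"
  by (simp add: cut_def)

lemma cut_Suc: "cut z (Suc i) = cut z i + z i"
  by (simp add: cut_def)

lemma cut_mono:
  assumes "z \<in> standard_simplex n" "i \<le> j"
  shows "cut z i \<le> cut z j"
  unfolding cut_def by (rule sum_mono2) (use assms in \<open>auto simp: standard_simplex_def\<close>)

lemma cut_last: "z \<in> standard_simplex n \<Longrightarrow> cut z (Suc n) = 1"
  by (simp add: cut_def standard_simplex_def lessThan_Suc_atMost)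

lemma cut_bounds:
  assumes "z \<in> standard_simplex n" "i \<le> Suc n"
  shows "0 \<le> cut z i" "cut z i \<le> 1"
  using cut_mono[OF assms(1), of 0 i] cut_mono[OF assms] cut_last[OF assms(1)] by auto

lemma inner_pointD: "inner_point n z \<Longrightarrow> z \<in> standard_simplex n"
  by (simp add: inner_point_def)

lemma cut_strict_mono:
  assumes "inner_point n z" "i < j" "j \<le> Suc n"
  shows "cut z i < cut z j"
proof -
  have "cut z i < cut z (Suc i)"
    using assms by (simp add: cut_Suc inner_point_def)
  also have "\<dots> \<le> cut z j"
    using assms by (intro cut_mono[OF inner_pointD]) auto
  finally show ?thesis .
qed

lemma cut_less_iff:
  assumes "inner_point n z" "i \<le> Suc n" "j \<le> Suc n"
  shows "cut z i < cut z j \<longleftrightarrow> i < j"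
  using cut_strict_mono[OF assms(1)] assms by (metis less_asym' linorder_neqE_nat order.irrefl)

lemma cut_setE:
  assumes "x \<in> cut_set r n z"
  obtains k i where "k < r" "i \<le> Suc n" "x = real k + cut z i"
  using assms by (auto simp: cut_set_def)

lemma cut_setI: "k < r \<Longrightarrow> i \<le> Suc n \<Longrightarrow> real k + cut z i \<in> cut_set r n z"
  by (auto simp: cut_set_def)

lemma cut_set_subset:
  assumes "z \<in> standard_simplex n"
  shows "cut_set r n z \<subseteq> {0..real r}"
proof
  fix x assume "x \<in> cut_set r n z"
  then obtain k i where "k < r" "i \<le> Suc n" "x = real k + cut z i"
    by (rule cut_setE)
  then show "x \<in> {0..real r}"
    using cut_bounds[OF assms, of i] by auto
qed

lemma finite_cut_set: "finite (cut_set r n z)"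
proof -
  have "cut_set r n z = (\<lambda>(k, i). real k + cut z i) ` ({..<r} \<times> {..n + 1})"
    by (auto simp: cut_set_def image_iff)
  then show ?thesis
    by simp
qed

lemma cut_set_fin_interval: "z \<in> standard_simplex n \<Longrightarrow> cut_set r n z \<in> fin_interval r"
  using cut_set_subset finite_cut_set by (auto simp: fin_interval_def)

lemma cut_set_ends:
  assumes "z \<in> standard_simplex n" "r > 0"
  shows "0 \<in> cut_set r n z" "real r \<in> cut_set r n z"
proof -
  show "0 \<in> cut_set r n z"
    using cut_setI[of 0 r 0 n z] assms by simp
  show "real r \<in> cut_set r n z"
    using cut_setI[of "r - 1" r "Suc n" n z] assms cut_last[OF assms(1)] by simp
qed

definition in_cell :: "(nat \<Rightarrow> real) \<Rightarrow> nat \<Rightarrow> nat \<Rightarrow> real \<Rightarrow> bool" where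
  "in_cell z k i x \<longleftrightarrow> real k + cut z i < x \<and> x < real k + cut z (Suc i)"

lemma in_cell_floor:
  assumes "z \<in> standard_simplex n" "i \<le> n" "in_cell z k i x"
  shows "real k < x" "x < real k + 1"
  using assms(3) cut_bounds[OF assms(1), of i] cut_bounds[OF assms(1), of "Suc i"] assms(2)
  by (auto simp: in_cell_def)

lemma in_cell_mono:
  assumes z: "z \<in> standard_simplex n" and "i \<le> n" "j \<le> n" "in_cell z k i x" "in_cell z l j y" "x \<le> y"
  shows "k < l \<or> k = l \<and> i \<le> j"
proof -
  have "real k < real l + 1"
    using in_cell_floor[OF z \<open>i \<le> n\<close> assms(4)] in_cell_floor[OF z \<open>j \<le> n\<close> assms(5)] assms(6) by simp
  then have "k \<le> l"
    by linarith
  moreover have "i \<le> j" if "k = l"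
  proof (rule ccontr)
    assume "\<not> i \<le> j"
    then have "cut z (Suc j) \<le> cut z i"
      by (intro cut_mono[OF z]) auto
    then show False
      using assms that by (auto simp: in_cell_def)
  qed
  ultimately show ?thesis
    by auto
qed

lemma in_cell_unique:
  assumes "z \<in> standard_simplex n" "i \<le> n" "j \<le> n" "in_cell z k i x" "in_cell z l j x"
  shows "k = l \<and> i = j"
  using in_cell_mono[OF assms(1-5)] in_cell_mono[OF assms(1,3,2,5,4)] by auto

lemma in_cell_not_cut:
  assumes z: "z \<in> standard_simplex n" and i: "i \<le> n" and c: "in_cell z k i x"
  shows "x \<notin> cut_set r n z"
proof
  assume "x \<in> cut_set r n z"
  then obtain l j where l: "l < r" "j \<le> Suc n" "x = real l + cut z j"
    by (rule cut_setE)
  have "real k < real l + 1" "real l < real k + 1"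
    using in_cell_floor[OF z i c] cut_bounds[OF z l(2)] l(3) by auto
  then have "k = l"
    by linarith
  then have "cut z i < cut z j" "cut z j < cut z (Suc i)"
    using c l by (auto simp: in_cell_def)
  then show False
    using cut_mono[OF z, of j i] cut_mono[OF z, of "Suc i" j] by (cases "j \<le> i") auto
qed

lemma in_cell_exists:
  assumes z: "z \<in> standard_simplex n" and r: "r > 0" and x: "x \<in> {0..real r} - cut_set r n z"
  obtains k i where "k < r" "i \<le> n" "in_cell z k i x"
proof -
  define k where "k = nat \<lfloor>x\<rfloor>"
  have xr: "0 < x" "x < real r"
  proof -
    have "x \<noteq> 0" "x \<noteq> real r"
      using x cut_set_ends[OF z r] by auto
    then show "0 < x" "x < real r"
      using x by auto
  qed
  have k: "real k \<le> x" "x < real k + 1"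
    using xr of_nat_floor[of x] by (simp_all add: k_def)
  have kr: "k < r"
    using k xr by linarith
  have ne: "x \<noteq> real k + cut z i" if "i \<le> Suc n" for i
    using cut_setI[OF kr that, of z] x by auto
  define A where "A = {i. i \<le> n \<and> real k + cut z i < x}"
  have A: "finite A" "0 \<in> A"
    using k ne[of 0] by (auto simp: A_def)
  define i where "i = Max A"
  have i: "i \<in> A"
    unfolding i_def using A by (intro Max_in) auto
  have "x < real k + cut z (Suc i)"
  proof (rule ccontr)
    assume *: "\<not> x < real k + cut z (Suc i)"
    show False
    proof (cases "i = n")
      case True
      then show False
        using * cut_last[OF z] k by simp
    next
      case False
      then have "Suc i \<in> A"
        using * ne[of "Suc i"] i by (auto simp: A_def)
      then show False
        using Max_ge[OF A(1), of "Suc i"] by (simp add: i_def)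
    qed
  qed
  then show ?thesis
    using that[OF kr, of i] i by (auto simp: A_def in_cell_def)
qed

lemma mor_DeltaD:
  assumes "\<theta> \<in> mor Delta m n"
  shows "\<And>j. j \<le> m \<Longrightarrow> \<theta> j \<le> n" "\<And>i j. i \<le> j \<Longrightarrow> j \<le> m \<Longrightarrow> \<theta> i \<le> \<theta> j" "\<theta> \<in> extensional {..m}"
  using assms by (auto simp: Delta_def mono_on_def PiE_def)

lemma cut_push: "cut (simplex_push m \<theta> z) i = (\<Sum>j | j \<le> m \<and> \<theta> j < i. z j)"
proof -
  have eq: "simplex_push m \<theta> z l = sum z {j \<in> {j. j \<le> m \<and> \<theta> j < i}. \<theta> j = l}" if "l \<in> {..<i}" for l
    using that unfolding simplex_push_def by (intro sum.cong) auto
  show ?thesis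
    unfolding cut_def by (subst sum.cong[OF refl eq], assumption, rule sum.group) auto
qed

lemma cut_push_eq_cut:
  assumes "\<theta> \<in> mor Delta m n"
  shows "\<exists>t\<le>Suc m. cut (simplex_push m \<theta> z) i = cut z t"
proof -
  have "\<exists>t\<le>Suc m. {j. j \<le> m \<and> \<theta> j < i} = {..<t}"
  proof (cases "\<exists>j\<le>m. i \<le> \<theta> j")
    case True
    define t where "t = (LEAST j. j \<le> m \<and> i \<le> \<theta> j)"
    have t: "t \<le> m" "i \<le> \<theta> t"
      using LeastI_ex[OF True] unfolding t_def by auto
    have "\<theta> j < i" if "j < t" for j
      using not_less_Least[of j "\<lambda>j. j \<le> m \<and> i \<le> \<theta> j"] that t unfolding t_def by force
    moreover have "j < t" if "\<theta> j < i" "j \<le> m" for j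
      using mor_DeltaD(2)[OF assms, of t j] that t by force
    ultimately show ?thesis
      using t by (intro exI[of _ t]) auto
  next
    case False
    then have "\<theta> j < i" if "j \<le> m" for j
      using that by (meson not_le)
    then have "{j. j \<le> m \<and> \<theta> j < i} = {..<Suc m}"
      by (auto simp: less_Suc_eq_le)
    then show ?thesis
      by blast
  qed
  then show ?thesis
    unfolding cut_push by (auto simp: cut_def)
qed

lemma cut_set_push_subset:
  assumes "\<theta> \<in> mor Delta m n"
  shows "cut_set r n (simplex_push m \<theta> z) \<subseteq> cut_set r m z"
proof
  fix x assume "x \<in> cut_set r n (simplex_push m \<theta> z)"
  then obtain k i where "k < r" "i \<le> Suc n" "x = real k + cut (simplex_push m \<theta> z) i"
    by (rule cut_setE)
  then show "x \<in> cut_set r m z"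
    using cut_push_eq_cut[OF assms, of z i] by (auto intro: cut_setI)
qed

lemma in_cell_push:
  assumes \<theta>: "\<theta> \<in> mor Delta m n" and z: "z \<in> standard_simplex m" and j: "j \<le> m" "in_cell z k j x"
  shows "in_cell (simplex_push m \<theta> z) k (\<theta> j) x"
proof -
  have nn: "\<And>i. 0 \<le> z i"
    using z by (auto simp: standard_simplex_def)
  have sub: "{l. l \<le> m \<and> \<theta> l < \<theta> j} \<subseteq> {..<j}"
    using mor_DeltaD(2)[OF \<theta>, of j] by (auto simp: not_less[symmetric])
  have "cut (simplex_push m \<theta> z) (\<theta> j) \<le> cut z j"
    unfolding cut_push unfolding cut_def using sub by (intro sum_mono2) (auto simp: nn)
  moreover have "cut z (Suc j) \<le> cut (simplex_push m \<theta> z) (Suc (\<theta> j))"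
    unfolding cut_push unfolding cut_def
    by (intro sum_mono2) (use mor_DeltaD(2)[OF \<theta>] j nn in \<open>auto simp: less_Suc_eq_le\<close>)
  ultimately show ?thesis
    using j by (auto simp: in_cell_def)
qed

text \<open>
  The \<open>j\<close>-th cell of the finer cut set lies in the cell of the coarser one whose number is the
  largest \<open>i\<close> with \<open>cut z i \<le> cut w j\<close>; pushing the lengths of the small cells along this assignment
  adds them up to the lengths of the large ones.
\<close>

lemma cut_set_detect:
  assumes z: "z \<in> standard_simplex n" and w: "inner_point m w" and r: "r > 0"
    and sub: "cut_set r n z \<subseteq> cut_set r m w"
  shows "\<exists>\<theta>\<in>mor Delta m n. z = simplex_push m \<theta> w"
proof -
  define A where "A j = {i. i \<le> n \<and> cut z i \<le> cut w j}" for j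
  define \<theta> where "\<theta> = (\<lambda>j\<in>{..m}. Max (A j))"
  note w' = inner_pointD[OF w]
  have A: "finite (A j)" "0 \<in> A j" if "j \<le> m" for j
    using cut_bounds[OF w', of j] that by (auto simp: A_def)
  have \<theta>_le: "\<theta> j \<in> A j" if "j \<le> m" for j
    using Max_in[OF A(1)[OF that]] A(2)[OF that] that by (auto simp: \<theta>_def)
  have \<theta>_iff: "\<theta> j < i \<longleftrightarrow> cut w j < cut z i" if "j \<le> m" "i \<le> n" for i j
  proof
    assume "\<theta> j < i"
    then have "i \<notin> A j"
      using Max_ge[OF A(1)[OF that(1)], of i] that by (auto simp: \<theta>_def)
    then show "cut w j < cut z i"
      using that by (auto simp: A_def)
  next
    assume *: "cut w j < cut z i"
    show "\<theta> j < i"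
      using * \<theta>_le[OF that(1)] cut_mono[OF z, of i "\<theta> j"] by (force simp: A_def)
  qed
  have \<theta>_mor: "\<theta> \<in> mor Delta m n"
    unfolding Delta_def
  proof (simp, intro conjI)
    show "\<theta> \<in> {..m} \<rightarrow>\<^sub>E {..n}"
      using \<theta>_le by (auto simp: A_def \<theta>_def)
    show "mono_on {..m} \<theta>"
    proof (rule mono_onI)
      fix i j assume ij: "i \<in> {..m}" "j \<in> {..m}" "i \<le> j"
      then have "\<theta> i \<in> A j"
        using \<theta>_le[of i] cut_mono[OF w', of i j] by (auto simp: A_def)
      then show "\<theta> i \<le> \<theta> j"
        using Max_ge[OF A(1)[of j]] ij by (auto simp: \<theta>_def)
    qed
  qed
  have cut_w: "\<exists>t\<le>Suc m. cut z i = cut w t" if i: "i \<le> Suc n" for i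
  proof -
    have "cut z i \<in> cut_set r m w"
      using cut_setI[OF r i, of z] sub by auto
    then obtain k t where t: "t \<le> Suc m" "cut z i = real k + cut w t"
      by (rule cut_setE)
    have b: "0 \<le> cut w t" "real k + cut w t \<le> 1"
      using t cut_bounds[OF w' t(1)] cut_bounds[OF z i] by auto
    then consider "k = 0" | "k = 1" "cut w t = 0"
      by (cases k) auto
    then show ?thesis
    proof cases
      case 1
      then show ?thesis
        using t by auto
    next
      case 2
      then show ?thesis
        using t cut_last[OF w'] by auto
    qed
  qed
  let ?p = "simplex_push m \<theta> w"
  have p: "?p \<in> standard_simplex n"
    by (rule simplex_push_simplex[OF \<theta>_mor w'])
  have cut_eq: "cut ?p i = cut z i" if i: "i \<le> Suc n" for i
  proof (cases "i = Suc n")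
    case True
    then show ?thesis
      using cut_last p z by simp
  next
    case False
    then have i': "i \<le> n"
      using i by simp
    obtain t where t: "t \<le> Suc m" "cut z i = cut w t"
      using cut_w[OF i] by blast
    have "{j. j \<le> m \<and> \<theta> j < i} = {..<t}"
      using \<theta>_iff[OF _ i'] cut_less_iff[OF w _ t(1)] t by auto
    then show ?thesis
      unfolding cut_push t(2) by (simp add: cut_def)
  qed
  have "z i = ?p i" for i
  proof (cases "i \<le> n")
    case True
    then show ?thesis
      using cut_eq[of i] cut_eq[of "Suc i"] by (simp add: cut_Suc)
  next
    case False
    then show ?thesis
      using p z by (auto simp: standard_simplex_def)
  qed
  then show ?thesis
    using \<theta>_mor by (intro bexI[of _ \<theta>] ext)
qed

text \<open>
  To enlarge a finite set to a cut set, take all fractional parts of its elements, with both values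
  \<open>0\<close> and \<open>1\<close> for integers. The bound on the dimension makes finitely many simplices sufficient when
  all sets of a given size are treated at once.
\<close>

lemma cut_set_cofinal:
  assumes F: "F \<in> fin_interval r" and r: "r > 0"
  obtains m z where "inner_point m z" "F \<subseteq> cut_set r m z" "m \<le> r * card F"
proof -
  define Q where "Q = (\<lambda>(x, k). x - real k) ` (F \<times> {..<r})"
  define P where "P = {0, 1} \<union> (Q \<inter> {0..1})"
  have finF: "finite F" and F01: "F \<subseteq> {0..real r}"
    using F by (auto simp: fin_interval_def)
  have finQ: "finite Q"
    unfolding Q_def using finF by auto
  then have finP: "finite P"
    by (simp add: P_def)
  have "card Q \<le> card F * r"
    unfolding Q_def using card_image_le[of "F \<times> {..<r}"] finF by (simp add: card_cartesian_product)
  moreover have "card P \<le> 2 + card Q"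
    unfolding P_def using card_Un_le[of "{0, 1}" "Q \<inter> {0..1}"] card_mono[OF finQ, of "Q \<inter> {0..1}"]
    by simp
  moreover have "2 \<le> card P"
    using card_mono[OF finP, of "{0, 1}"] by (simp add: P_def)
  ultimately have card_P: "2 \<le> card P" "card P \<le> 2 + r * card F"
    by (simp_all add: mult.commute)
  define m where "m = card P - 2"
  have m: "card P = Suc (Suc m)" "m \<le> r * card F"
    using card_P by (simp_all add: m_def)
  define h where "h = (!) (sorted_list_of_set P)"
  have h: "bij_betw h {..<card P} P" "strict_mono_on {..<card P} h"
    unfolding h_def using finP
    by (auto intro!: bij_betw_nth strict_mono_onI sorted_wrt_nth_less[OF strict_sorted_list_of_set])
  have h_less: "h i < h j" if "i < j" "j \<le> Suc m" for i j
    using h(2) that m by (simp add: strict_mono_on_def)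
  have h_mem: "h i \<in> P" if "i \<le> Suc m" for i
    using h(1) that m by (auto simp: bij_betw_def)
  have P01: "P \<subseteq> {0..1}"
    by (auto simp: P_def)
  have h_surj: "\<exists>i\<le>Suc m. h i = x" if "x \<in> P" for x
  proof -
    have "x \<in> h ` {..<card P}"
      using h(1) that by (simp add: bij_betw_def)
    then show ?thesis
      using m by (auto simp: less_Suc_eq_le)
  qed
  have h0: "h 0 = 0"
  proof -
    obtain i where i: "i \<le> Suc m" "h i = 0"
      using h_surj[of 0] by (auto simp: P_def)
    then show ?thesis
      using h_less[of 0 i] h_mem[of 0] P01 by (cases "i = 0") force+
  qed
  have h1: "h (Suc m) = 1"
  proof -
    obtain i where i: "i \<le> Suc m" "h i = 1"
      using h_surj[of 1] by (auto simp: P_def)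
    then show ?thesis
      using h_less[of i "Suc m"] h_mem[of "Suc m"] P01 by (cases "i = Suc m") force+
  qed
  define z where "z i = (if i \<le> m then h (Suc i) - h i else 0)" for i
  have cut_z: "cut z i = h i" if "i \<le> Suc m" for i
    using that by (induction i) (auto simp: cut_Suc h0 z_def)
  have pos: "0 < z i" if "i \<le> m" for i
    using h_less[of i "Suc i"] that by (simp add: z_def)
  have "z \<in> standard_simplex m"
  proof -
    have "(\<Sum>i\<le>m. z i) = 1"
      using cut_z[of "Suc m"] h1 by (simp add: cut_def lessThan_Suc_atMost)
    moreover have "z i \<le> 1" for i
    proof -
      have "0 \<le> h j \<and> h j \<le> 1" if "j \<le> Suc m" for j
        using h_mem[OF that] P01 by auto
      from this[of i] this[of "Suc i"] show ?thesis
        unfolding z_def by (cases "i \<le> m") auto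
    qed
    ultimately show ?thesis
      using pos less_imp_le[OF pos] by (auto simp: standard_simplex_def z_def)
  qed
  then have inner: "inner_point m z"
    using pos by (simp add: inner_point_def)
  have "F \<subseteq> cut_set r m z"
  proof
    fix x assume x: "x \<in> F"
    then have x0r: "0 \<le> x" "x \<le> real r"
      using F01 by auto
    \<comment> \<open>The minimum matters only for \<open>x = r\<close>, which is the last cut point of the last copy.\<close>
    define k where "k = min (nat \<lfloor>x\<rfloor>) (r - 1)"
    have k: "k < r" "real k \<le> x" "x \<le> real k + 1"
      using r x0r by (auto simp: k_def min_def) linarith+
    then have "x - real k \<in> Q"
      using x by (auto simp: Q_def intro!: image_eqI[of _ _ "(x, k)"])
    then have "x - real k \<in> P"
      using k by (auto simp: P_def)
    then obtain i where "i \<le> Suc m" "h i = x - real k"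
      using h_surj by blast
    then show "x \<in> cut_set r m z"
      using cut_setI[OF k(1), of i m z] cut_z[of i] by simp
  qed
  then show ?thesis
    using that inner m by blast
qed

subsection \<open>The subdivision functor\<close>

lemma sd_index_less: "r > 0 \<Longrightarrow> i \<le> r * (n + 1) - 1 \<longleftrightarrow> i < r * Suc n"
  by (cases "r * Suc n") auto

lemma sd_index:
  fixes r :: nat
  assumes "k < r" "i \<le> n"
  shows "k * (n + 1) + i \<le> r * (n + 1) - 1"
proof -
  have "k * Suc n + i < k * Suc n + Suc n"
    using assms by simp
  also have "\<dots> = Suc k * Suc n"
    by simp
  also have "\<dots> \<le> r * Suc n"
    using assms by (intro mult_le_mono1) simp
  finally show ?thesis
    using assms sd_index_less[of r "k * Suc n + i" n] by simp
qed

lemma sd_index_div_mod: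
  fixes n :: nat
  assumes "i \<le> n"
  shows "(k * (n + 1) + i) div (n + 1) = k" "(k * (n + 1) + i) mod (n + 1) = i"
proof -
  have "(i + k * (n + 1)) div (n + 1) = k + i div (n + 1)"
    by (rule div_mult_self1) simp
  then show "(k * (n + 1) + i) div (n + 1) = k"
    using assms by (simp add: add.commute)
  have "(i + k * (n + 1)) mod (n + 1) = i mod (n + 1)"
    by (rule mod_mult_self1)
  then show "(k * (n + 1) + i) mod (n + 1) = i"
    using assms by (simp add: add.commute)
qed

lemma sd_index_inj:
  fixes n :: nat
  assumes "i \<le> n" "j \<le> n" "k * (n + 1) + i = l * (n + 1) + j"
  shows "k = l \<and> i = j"
  using sd_index_div_mod[OF assms(1), of k] sd_index_div_mod[OF assms(2), of l] assms(3) by metis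

lemma sd_indexE:
  fixes r n t :: nat
  assumes "r > 0" "t \<le> r * (n + 1) - 1"
  obtains k i where "k < r" "i \<le> n" "t = k * (n + 1) + i"
proof
  show "t div Suc n < r"
    using assms sd_index_less[OF assms(1), of t n] by (simp add: less_mult_imp_div_less)
  show "t mod Suc n \<le> n"
    by (simp add: less_Suc_eq_le[symmetric])
  show "t = t div Suc n * (n + 1) + t mod Suc n"
    by (metis Suc_eq_plus1 div_mult_mod_eq)
qed

lemma sd_index_mono:
  assumes "k < l \<or> k = l \<and> i \<le> (j::nat)" "i \<le> n"
  shows "k * (n + 1) + i \<le> l * (n + 1) + j"
  using assms
proof (elim disjE)
  assume "k < l"
  then have "Suc k * (n + 1) \<le> l * (n + 1)"
    by (intro mult_le_mono1) simp
  then show ?thesis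
    using assms by simp
qed simp

lemma sd_map_index:
  assumes "k < r" "j \<le> m"
  shows "sd_map r m n \<theta> (k * (m + 1) + j) = k * (n + 1) + \<theta> j"
  using sd_index[OF assms] sd_index_div_mod[OF assms(2), of k]
  unfolding sd_map_def by (simp only: restrict_apply atMost_iff if_True)

lemma sd_map_mor:
  assumes r: "r > 0" and \<theta>: "\<theta> \<in> mor Delta m n"
  shows "sd_map r m n \<theta> \<in> mor Delta (r * (m + 1) - 1) (r * (n + 1) - 1)"
  unfolding Delta_def
proof (simp, intro conjI)
  have "sd_map r m n \<theta> t \<le> r * (n + 1) - 1" if "t \<le> r * (m + 1) - 1" for t
    using sd_indexE[OF r that] sd_map_index sd_index mor_DeltaD(1)[OF \<theta>] by (metis (no_types, lifting))
  moreover have "sd_map r m n \<theta> \<in> extensional {..r * (m + 1) - 1}"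
    by (simp add: sd_map_def)
  ultimately show "sd_map r m n \<theta> \<in> {..r + r * m - Suc 0} \<rightarrow>\<^sub>E {..r + r * n - Suc 0}"
    by (simp add: PiE_def)
  show "mono_on {..r + r * m - Suc 0} (sd_map r m n \<theta>)"
  proof (rule mono_onI)
    fix s t assume st: "s \<in> {..r + r * m - Suc 0}" "t \<in> {..r + r * m - Suc 0}" "s \<le> t"
    obtain k i where k: "k < r" "i \<le> m" "s = k * (m + 1) + i"
      using sd_indexE[OF r, of s m] st by auto
    obtain l j where l: "l < r" "j \<le> m" "t = l * (m + 1) + j"
      using sd_indexE[OF r, of t m] st by auto
    have "k < l \<or> k = l \<and> i \<le> j"
    proof (rule ccontr)
      assume *: "\<not> ?thesis"
      have "l * (m + 1) + j \<le> k * (m + 1) + i"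
        using * l by (intro sd_index_mono) auto
      then have "k * (m + 1) + i = l * (m + 1) + j"
        using st(3) k(3) l(3) by linarith
      then show False
        using * sd_index_inj[OF k(2) l(2)] by blast
    qed
    then have "k < l \<or> k = l \<and> \<theta> i \<le> \<theta> j"
      using mor_DeltaD(2)[OF \<theta>] l by auto
    then show "sd_map r m n \<theta> s \<le> sd_map r m n \<theta> t"
      unfolding k(3) l(3) sd_map_index[OF k(1,2)] sd_map_index[OF l(1,2)]
      by (rule sd_index_mono) (use mor_DeltaD(1)[OF \<theta>] k in auto)
  qed
qed

lemma mor_Delta_eqI:
  assumes "f \<in> mor Delta m n" "g \<in> mor Delta m n" "\<And>i. i \<le> m \<Longrightarrow> f i = g i"
  shows "f = g"
  using mor_DeltaD(3)[OF assms(1)] mor_DeltaD(3)[OF assms(2)] assms(3)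
  by (auto intro: extensionalityI)

lemma idm_Delta_mor: "idm Delta n \<in> mor Delta n n"
  by (auto simp: Delta_def mono_on_def)

lemma cmp_Delta_mor:
  assumes "f \<in> mor Delta l m" "g \<in> mor Delta m n"
  shows "cmp Delta l m n g f \<in> mor Delta l n"
  using mor_DeltaD[OF assms(1)] mor_DeltaD[OF assms(2)]
  by (auto simp: Delta_def compose_def mono_on_def)

lemma cmp_Delta_apply [simp]: "i \<le> l \<Longrightarrow> cmp Delta l m n g f i = g (f i)"
  by (simp add: Delta_def compose_def)

lemma idm_Delta_apply [simp]: "i \<le> n \<Longrightarrow> idm Delta n i = i"
  by (simp add: Delta_def)

lemma sd_presheaf:
  assumes r: "r > 0" and X: "presheaf Delta X"
  shows "presheaf Delta (sd r X)"
proof -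
  have sd_id: "sd_map r n n (idm Delta n) = idm Delta (r * (n + 1) - 1)" for n
  proof (rule mor_Delta_eqI[OF sd_map_mor[OF r idm_Delta_mor] idm_Delta_mor])
    fix t assume "t \<le> r * (n + 1) - 1"
    then show "sd_map r n n (idm Delta n) t = idm Delta (r * (n + 1) - 1) t"
      by (elim sd_indexE[OF r]) (use sd_map_index sd_index in auto)
  qed
  have sd_cmp: "sd_map r l n (cmp Delta l m n g f) =
      cmp Delta (r * (l + 1) - 1) (r * (m + 1) - 1) (r * (n + 1) - 1) (sd_map r m n g) (sd_map r l m f)"
    if f: "f \<in> mor Delta l m" and g: "g \<in> mor Delta m n" for l m n f g
  proof (rule mor_Delta_eqI)
    show "sd_map r l n (cmp Delta l m n g f) \<in> mor Delta (r * (l + 1) - 1) (r * (n + 1) - 1)"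
      by (intro sd_map_mor[OF r] cmp_Delta_mor f g)
    show "cmp Delta (r * (l + 1) - 1) (r * (m + 1) - 1) (r * (n + 1) - 1) (sd_map r m n g)
      (sd_map r l m f) \<in> mor Delta (r * (l + 1) - 1) (r * (n + 1) - 1)"
      by (intro cmp_Delta_mor[OF sd_map_mor[OF r f] sd_map_mor[OF r g]])
    fix t assume t: "t \<le> r * (l + 1) - 1"
    then obtain k i where k: "k < r" "i \<le> l" "t = k * (l + 1) + i"
      by (rule sd_indexE[OF r])
    show "sd_map r l n (cmp Delta l m n g f) t = cmp Delta (r * (l + 1) - 1) (r * (m + 1) - 1)
        (r * (n + 1) - 1) (sd_map r m n g) (sd_map r l m f) t"
      unfolding cmp_Delta_apply[OF t] unfolding k(3) sd_map_index[OF k(1,2)]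
        sd_map_index[OF k(1) mor_DeltaD(1)[OF f k(2)]] using k by simp
  qed
  have X': "\<And>m n f x. f \<in> mor Delta m n \<Longrightarrow> x \<in> pob X n \<Longrightarrow> pact X m n f x \<in> pob X m"
    "\<And>n x. x \<in> pob X n \<Longrightarrow> pact X n n (idm Delta n) x = x"
    "\<And>l m n f g x. f \<in> mor Delta l m \<Longrightarrow> g \<in> mor Delta m n \<Longrightarrow> x \<in> pob X n \<Longrightarrow>
      pact X l n (cmp Delta l m n g f) x = pact X l m f (pact X m n g x)"
    using presheaf_pact_mem[OF X] presheaf_pact_id[OF X] presheaf_pact_comp[OF X] by simp_all
  show ?thesis
    unfolding presheaf_def
    using X'(1)[OF sd_map_mor[OF r]] X'(2) X'(3)[OF sd_map_mor[OF r] sd_map_mor[OF r]] sd_id sd_cmp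
    by (simp add: sd_def del: One_nat_def)
qed

lemma realization_cong:
  assumes "\<And>n. pob X n = pob Y n"
    and "\<And>m n \<theta> x. \<theta> \<in> mor Delta m n \<Longrightarrow> x \<in> pob X n \<Longrightarrow> pact X m n \<theta> x = pact Y m n \<theta> x"
  shows "realization_point X = realization_point Y" "realization_top X = realization_top Y"
proof -
  have pre: "pre_realization X = pre_realization Y"
    using assms(1) by (simp add: pre_realization_def)
  have "realization_gen X = realization_gen Y"
    unfolding realization_gen_def using assms by (intro ext) (metis (no_types, lifting))
  then show pt: "realization_point X = realization_point Y"
    unfolding realization_point_def pre by (intro ext) simp
  show "realization_top X = realization_top Y"
    unfolding realization_top_def pre pt ..
qed

lemma sd_1:
  fixes X :: "(nat, nat \<Rightarrow> nat, 'a) psh"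
  shows "pob (sd 1 X) n = pob X n" "realization_point (sd 1 X) = realization_point X"
    "realization_top (sd 1 X) = realization_top X"
proof -
  have pob: "pob (sd 1 X) n = pob X n" for n
    by (simp add: sd_def)
  have map: "sd_map 1 m n \<theta> = \<theta>" if "\<theta> \<in> mor Delta m n" for m n \<theta>
    by (rule extensionalityI[OF _ mor_DeltaD(3)[OF that]]) (auto simp: sd_map_def)
  have "pact (sd 1 X) m n \<theta> x = pact X m n \<theta> x" if "\<theta> \<in> mor Delta m n" for m n \<theta> x
    using map[OF that] by (simp add: sd_def)
  then show "realization_point (sd 1 X) = realization_point X"
    "realization_top (sd 1 X) = realization_top X"
    using realization_cong[of "sd 1 X" X] pob by blast+
  show "pob (sd 1 X) n = pob X n"
    by (rule pob)
qed

section \<open>The rescaling is a homeomorphism\<close>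

text \<open>The point of the large simplex whose coordinates are \<open>r\<close> copies of those of \<open>z\<close>, rescaled.\<close>

definition spread :: "nat \<Rightarrow> nat \<Rightarrow> (nat \<Rightarrow> real) \<Rightarrow> nat \<Rightarrow> real" where
  "spread r n z = (\<lambda>t. if t < r * (n + 1) then z (t mod (n + 1)) / real r else 0)"

lemma spread_index:
  assumes "k < r" "i \<le> n"
  shows "spread r n z (k * (n + 1) + i) = z i / real r"
proof -
  have "k * (n + 1) + i < r * (n + 1)"
    using sd_index[OF assms] sd_index_less[of r "k * (n + 1) + i" n] assms by simp
  then show ?thesis
    using sd_index_div_mod(2)[OF assms(2), of k] unfolding spread_def by (simp only: if_True)
qed

lemma cut_spread:
  assumes z: "z \<in> standard_simplex n" and k: "k < r" and i: "i \<le> Suc n"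
  shows "cut (spread r n z) (k * (n + 1) + i) = (real k + cut z i) / real r"
proof -
  have step: "cut (spread r n z) (k * (n + 1) + i) = cut (spread r n z) (k * (n + 1)) + cut z i / real r"
    if "k < r" "i \<le> Suc n" for k i
    using that(2)
  proof (induction i)
    case (Suc i)
    then show ?case
      using spread_index[OF that(1), of i n z] by (simp add: cut_Suc add_divide_distrib)
  qed simp
  have "cut (spread r n z) (k * (n + 1)) = real k / real r" if "k \<le> r" for k
    using that
  proof (induction k)
    case (Suc k)
    then have "cut (spread r n z) (k * (n + 1) + Suc n) = real k / real r + 1 / real r"
      using step[of k "Suc n"] cut_last[OF z] by simp
    then show ?case
      by (simp add: algebra_simps add_divide_distrib)
  qed simp
  then show ?thesis
    using step[OF k i] k by (simp add: add_divide_distrib)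
qed

lemma spread_simplex:
  assumes r: "r > 0" and z: "z \<in> standard_simplex n"
  shows "spread r n z \<in> standard_simplex (r * (n + 1) - 1)"
proof -
  have "(\<Sum>t\<le>r * (n + 1) - 1. spread r n z t) = cut (spread r n z) (r * (n + 1))"
    using r by (simp add: cut_def lessThan_Suc_atMost[symmetric])
  also have "\<dots> = cut (spread r n z) ((r - 1) * (n + 1) + Suc n)"
    using r by (cases r) (auto simp: algebra_simps)
  also have "\<dots> = 1"
    using cut_spread[OF z, of "r - 1" r "Suc n"] cut_last[OF z] r by simp
  finally have sum: "(\<Sum>t\<le>r * (n + 1) - 1. spread r n z t) = 1" .
  have z01: "0 \<le> z i" "z i \<le> 1" for i
    using z by (auto simp: standard_simplex_def)
  have "z i / real r \<le> 1" for i
    using z01[of i] r by (simp add: divide_le_eq_1)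
  then have b: "0 \<le> spread r n z t" "spread r n z t \<le> 1" for t
    using z01 by (auto simp: spread_def)
  have zero: "spread r n z t = 0" if "t > r * (n + 1) - 1" for t
    using that sd_index_less[OF r, of t n] by (simp add: spread_def)
  show ?thesis
    unfolding standard_simplex_def using sum b zero by blast
qed

lemma spread_inner:
  assumes "r > 0" "inner_point n z"
  shows "inner_point (r * (n + 1) - 1) (spread r n z)"
  unfolding inner_point_def
proof (intro conjI allI impI)
  show "spread r n z \<in> standard_simplex (r * (n + 1) - 1)"
    by (intro spread_simplex inner_pointD assms)
  fix t assume "t \<le> r * (n + 1) - 1"
  then obtain k i where "k < r" "i \<le> n" "t = k * (n + 1) + i"
    by (rule sd_indexE[OF assms(1)])
  then show "0 < spread r n z t"
    using spread_index[of k r i n z] assms by (simp add: inner_point_def)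
qed

lemma cut_set_spread:
  assumes r: "r > 0" and z: "z \<in> standard_simplex n"
  shows "cut_set 1 (r * (n + 1) - 1) (spread r n z) = (\<lambda>x. x / real r) ` cut_set r n z"
    (is "?L = ?R")
proof (intro equalityI subsetI)
  fix x assume "x \<in> ?L"
  then obtain t where t: "t \<le> Suc (r * (n + 1) - 1)" "x = cut (spread r n z) t"
    by (auto elim!: cut_setE)
  have "\<exists>k i. k < r \<and> i \<le> Suc n \<and> t = k * (n + 1) + i"
  proof (cases "t = r * (n + 1)")
    case True
    then have "t = (r - 1) * (n + 1) + Suc n"
      using r by (cases r) auto
    then show ?thesis
      using r by (intro exI[of _ "r - 1"] exI[of _ "Suc n"]) auto
  next
    case False
    then have "t \<le> r * (n + 1) - 1"
      using t(1) r by (simp add: le_Suc_eq)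
    then obtain k i where "k < r" "i \<le> n" "t = k * (n + 1) + i"
      by (rule sd_indexE[OF r])
    then show ?thesis
      by (intro exI[of _ k] exI[of _ i]) simp
  qed
  then obtain k i where k: "k < r" "i \<le> Suc n" "t = k * (n + 1) + i"
    by blast
  show "x \<in> ?R"
    using cut_spread[OF z k(1,2)] cut_setI[OF k(1,2), of z] t(2) k(3) by auto
next
  fix x assume "x \<in> ?R"
  then obtain k i where k: "k < r" "i \<le> Suc n" "x = (real k + cut z i) / real r"
    by (auto elim!: cut_setE)
  have "k * (n + 1) + n \<le> r * (n + 1) - 1"
    using sd_index[OF k(1), of n n] by simp
  then have "k * (n + 1) + i \<le> Suc (r * (n + 1) - 1)"
    using k(2) by linarith
  then show "x \<in> ?L"
    using cut_setI[of 0 1 "k * (n + 1) + i" "r * (n + 1) - 1" "spread r n z"] cut_spread[OF z k(1,2)]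
      k(3) by simp
qed

lemma in_cell_spread:
  assumes "r > 0" and z: "z \<in> standard_simplex n" and k: "k < r" "i \<le> n" and "in_cell z k i x"
  shows "in_cell (spread r n z) 0 (k * (n + 1) + i) (x / real r)"
  using cut_spread[OF z k(1), of i] cut_spread[OF z k(1), of "Suc i"] assms
  by (simp add: in_cell_def divide_strict_right_mono)

subsection \<open>The topology of realizations\<close>

abbreviation simplex_top :: "nat \<Rightarrow> (nat \<Rightarrow> real) topology" where
  "simplex_top n \<equiv> subtopology (powertop_real UNIV) (standard_simplex n)"

lemma openin_discrete_prod:
  assumes "V \<subseteq> A \<times> topspace T"
  shows "openin (prod_topology (discrete_topology A) T) V \<longleftrightarrow> (\<forall>a\<in>A. openin T {z. (a, z) \<in> V})"
proof
  assume V: "openin (prod_topology (discrete_topology A) T) V"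
  show "\<forall>a\<in>A. openin T {z. (a, z) \<in> V}"
  proof
    fix a assume "a \<in> A"
    then have "continuous_map T (prod_topology (discrete_topology A) T) (\<lambda>z. (a, z))"
      by (intro continuous_map_pairedI) auto
    then have "openin T {z \<in> topspace T. (a, z) \<in> V}"
      using V by (rule openin_continuous_map_preimage)
    moreover have "{z \<in> topspace T. (a, z) \<in> V} = {z. (a, z) \<in> V}"
      using assms by auto
    ultimately show "openin T {z. (a, z) \<in> V}"
      by simp
  qed
next
  assume *: "\<forall>a\<in>A. openin T {z. (a, z) \<in> V}"
  have "V = (\<Union>a\<in>A. {a} \<times> {z. (a, z) \<in> V})"
    using assms by auto
  moreover have "openin (prod_topology (discrete_topology A) T) (\<Union>a\<in>A. {a} \<times> {z. (a, z) \<in> V})"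
    using * by (intro openin_Union) (auto simp: openin_prod_Times_iff)
  ultimately show "openin (prod_topology (discrete_topology A) T) V"
    by simp
qed

lemma openin_realization:
  "openin (realization_top X) U \<longleftrightarrow> U \<subseteq> realization X \<and>
    (\<forall>n. \<forall>x\<in>pob X n. openin (simplex_top n)
      {z \<in> standard_simplex n. realization_point X (n, x, z) \<in> U})"
proof -
  let ?V = "{p \<in> topspace (pre_realization X). realization_point X p \<in> U}"
  let ?P = "\<lambda>n. prod_topology (discrete_topology (pob X n)) (simplex_top n)"
  have "openin (pre_realization X) ?V \<longleftrightarrow> (\<forall>n. openin (?P n) {q. (n, q) \<in> ?V})"
    unfolding pre_realization_def openin_sum_topology by auto
  also have "\<dots> \<longleftrightarrow> (\<forall>n. \<forall>x\<in>pob X n. openin (simplex_top n) {z. (x, z) \<in> {q. (n, q) \<in> ?V}})"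
    by (intro all_cong1 openin_discrete_prod) (auto simp: topspace_pre_realization)
  also have "\<dots> \<longleftrightarrow> (\<forall>n. \<forall>x\<in>pob X n. openin (simplex_top n)
      {z \<in> standard_simplex n. realization_point X (n, x, z) \<in> U})"
    by (intro all_cong1 ball_cong refl arg_cong2[of _ _ _ _ openin])
      (auto simp: topspace_pre_realization)
  finally show ?thesis
    by (simp add: realization_top_def openin_quotient_topology)
qed

lemma closedin_realization:
  "closedin (realization_top X) C \<longleftrightarrow> C \<subseteq> realization X \<and>
    (\<forall>n. \<forall>x\<in>pob X n. closedin (simplex_top n)
      {z \<in> standard_simplex n. realization_point X (n, x, z) \<in> C})"
proof -
  have "{z \<in> standard_simplex n. realization_point X (n, x, z) \<in> realization X - C} =
      standard_simplex n - {z \<in> standard_simplex n. realization_point X (n, x, z) \<in> C}"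
    if "x \<in> pob X n" for n x
    using realization_pointI[OF that] by auto
  then show ?thesis
    unfolding closedin_def openin_realization by auto
qed

lemma finite_mor_Delta: "finite (mor Delta m n)"
  by (rule finite_subset[of _ "{..m} \<rightarrow>\<^sub>E {..n}"]) (auto simp: Delta_def intro: finite_PiE)

lemma continuous_map_spread: "continuous_map (powertop_real UNIV) (powertop_real UNIV) (spread r n)"
  unfolding continuous_map_componentwise_UNIV
proof
  fix k
  show "continuous_map (powertop_real UNIV) euclideanreal (\<lambda>z. spread r n z k)"
    unfolding spread_def divide_inverse
    by (cases "k < r * (n + 1)")
      (auto intro!: continuous_map_real_mult continuous_map_product_projection)
qed

lemma continuous_map_simplex_push:
  "continuous_map (powertop_real UNIV) (powertop_real UNIV) (simplex_push m \<theta>)"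
  unfolding continuous_map_componentwise_UNIV simplex_push_def
  by (intro allI continuous_map_sum continuous_map_product_projection) auto

text \<open>
  Every point \<open>w\<close> of a simplex is the image under some \<open>\<theta>\<close> of a rescaled diagonal point: refine the
  set of the \<open>r\<close>-fold multiples of its cut points to a set that is invariant under integer shifts.
\<close>

lemma simplex_point_from_spread:
  assumes r: "r > 0" and w: "w \<in> standard_simplex n"
  obtains m z \<theta> where "m \<le> r * (n + 2)" "inner_point m z" "\<theta> \<in> mor Delta (r * (m + 1) - 1) n"
    "w = simplex_push (r * (m + 1) - 1) \<theta> (spread r m z)"
proof -
  let ?F = "(\<lambda>i. real r * cut w i) ` {..Suc n}"
  have "?F \<in> fin_interval r"
    using cut_bounds[OF w] r by (auto simp: fin_interval_def mult_left_le)
  then obtain m z where z: "inner_point m z" "?F \<subseteq> cut_set r m z" "m \<le> r * card ?F"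
    by (rule cut_set_cofinal[OF _ r])
  have "card ?F \<le> n + 2"
    using card_image_le[of "{..Suc n}" "\<lambda>i. real r * cut w i"] by simp
  then have m: "m \<le> r * (n + 2)"
    using z(3) by (meson mult_le_mono2 order_trans)
  have "cut_set 1 n w \<subseteq> cut_set 1 (r * (m + 1) - 1) (spread r m z)"
  proof
    fix x assume "x \<in> cut_set 1 n w"
    then obtain i where i: "i \<le> Suc n" "x = cut w i"
      by (auto elim!: cut_setE)
    then have "real r * cut w i \<in> cut_set r m z"
      using z(2) by auto
    then have "real r * cut w i / real r \<in> (\<lambda>x. x / real r) ` cut_set r m z"
      by (rule imageI)
    then show "x \<in> cut_set 1 (r * (m + 1) - 1) (spread r m z)"
      unfolding cut_set_spread[OF r inner_pointD[OF z(1)]] using i r by simp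
  qed
  then obtain \<theta> where "\<theta> \<in> mor Delta (r * (m + 1) - 1) n"
    "w = simplex_push (r * (m + 1) - 1) \<theta> (spread r m z)"
    using cut_set_detect[OF w spread_inner[OF r z(1)], of 1] by auto
  then show ?thesis
    using that m z(1) by blast
qed

text \<open>
  For closedness, let \<open>C\<close> be closed and \<open>x\<close> an \<open>n\<close>-simplex of \<open>X\<close>. The set of those \<open>w\<close> for which
  \<open>(x, w)\<close> represents a point of \<open>D ` C\<close> is a finite union, over the operators \<open>\<theta>\<close> above, of
  images of compact sets: each \<open>w\<close> has the form \<open>\<theta>\<^sub>* (spread z)\<close>, and then \<open>(x, w)\<close> is equivalent to
  \<open>(\<theta>\<^sup>* x, spread z)\<close>, which represents \<open>D\<close> of the class of \<open>(\<theta>\<^sup>* x, z)\<close>.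
\<close>

lemma homeomorphic_map_spread:
  fixes X :: "(nat, nat \<Rightarrow> nat, 'a) psh"
  assumes r: "r > 0" and X: "presheaf Delta X"
    and bij: "bij_betw D (realization (sd r X)) (realization X)"
    and D: "\<And>n \<xi> z. \<xi> \<in> pob X (r * (n + 1) - 1) \<Longrightarrow> z \<in> standard_simplex n \<Longrightarrow>
      D (realization_point (sd r X) (n, \<xi>, z)) = realization_point X (r * (n + 1) - 1, \<xi>, spread r n z)"
  shows "homeomorphic_map (realization_top (sd r X)) (realization_top X) D"
proof (rule bijective_closed_imp_homeomorphic_map)
  show "D ` realization (sd r X) = realization X" "inj_on D (realization (sd r X))"
    using bij by (auto simp: bij_betw_def)
  have pob_sd: "pob (sd r X) n = pob X (r * (n + 1) - 1)" for n
    by (simp add: sd_def)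
  have spread_cont: "continuous_map (simplex_top n) (simplex_top (r * (n + 1) - 1)) (spread r n)" for n
    unfolding continuous_map_in_subtopology
    using spread_simplex[OF r] continuous_map_spread
    by (auto intro: continuous_map_from_subtopology)
  show "continuous_map (realization_top (sd r X)) (realization_top X) D"
    unfolding continuous_map
  proof (intro conjI allI impI)
    show "D ` realization (sd r X) \<subseteq> realization X"
      using bij by (simp add: bij_betw_def)
    fix U assume U: "openin (realization_top X) U"
    show "openin (realization_top (sd r X)) {p \<in> realization (sd r X). D p \<in> U}"
      unfolding openin_realization
    proof (intro conjI allI ballI)
      fix n \<xi> assume \<xi>: "\<xi> \<in> pob (sd r X) n"
      let ?V = "{w \<in> standard_simplex (r * (n + 1) - 1). realization_point X (r * (n + 1) - 1, \<xi>, w) \<in> U}"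
      have "openin (simplex_top (r * (n + 1) - 1)) ?V"
        using U \<xi> unfolding openin_realization pob_sd by blast
      then have "openin (simplex_top n) {z \<in> topspace (simplex_top n). spread r n z \<in> ?V}"
        by (rule openin_continuous_map_preimage[OF spread_cont])
      moreover have "{z \<in> topspace (simplex_top n). spread r n z \<in> ?V} =
        {z \<in> standard_simplex n. realization_point (sd r X) (n, \<xi>, z) \<in> {p \<in> realization (sd r X). D p \<in> U}}"
        using spread_simplex[OF r] D \<xi> realization_pointI[OF \<xi>] by (auto simp: pob_sd)
      ultimately show "openin (simplex_top n) {z \<in> standard_simplex n.
          realization_point (sd r X) (n, \<xi>, z) \<in> {p \<in> realization (sd r X). D p \<in> U}}"
        by simp
    qed auto
  qed
  show "closed_map (realization_top (sd r X)) (realization_top X) D"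
    unfolding closed_map_def
  proof (intro allI impI)
    fix C assume C: "closedin (realization_top (sd r X)) C"
    then have C_sub: "C \<subseteq> realization (sd r X)"
      by (rule closedin_subset)
    show "closedin (realization_top X) (D ` C)"
      unfolding closedin_realization
    proof (intro conjI allI ballI)
      show "D ` C \<subseteq> realization X"
        using C_sub bij by (auto simp: bij_betw_def)
      fix n x assume x: "x \<in> pob X n"
      define N where "N m = r * (m + 1) - 1" for m
      define E where "E m \<theta> = {z \<in> standard_simplex m.
        realization_point (sd r X) (m, pact X (N m) n \<theta> x, z) \<in> C}" for m \<theta>
      define W where "W = {w \<in> standard_simplex n. realization_point X (n, x, w) \<in> D ` C}"
      define push where "push m \<theta> z = simplex_push (N m) \<theta> (spread r m z)" for m \<theta> z
      have pt: "realization_point X (n, x, push m \<theta> z) =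
          D (realization_point (sd r X) (m, pact X (N m) n \<theta> x, z))"
        if "\<theta> \<in> mor Delta (N m) n" "z \<in> standard_simplex m" for m \<theta> z
        unfolding push_def
        using realization_point_push[OF X that(1) x, of "spread r m z"] spread_simplex[OF r that(2)]
          D[OF presheaf_pact_mem[OF X _ _ that(1)[unfolded N_def] x] that(2)]
        by (simp add: N_def)
      have pt_mem: "realization_point (sd r X) (m, pact X (N m) n \<theta> x, z) \<in> realization (sd r X)"
        if "\<theta> \<in> mor Delta (N m) n" "z \<in> standard_simplex m" for m \<theta> z
        using presheaf_pact_mem[OF X _ _ that(1) x] that(2)
        by (intro realization_pointI) (simp_all add: pob_sd N_def)
      have W_eq: "W = (\<Union>m\<in>{..r * (n + 2)}. \<Union>\<theta>\<in>mor Delta (N m) n. push m \<theta> ` E m \<theta>)"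
      proof (intro equalityI subsetI)
        fix w assume w: "w \<in> W"
        then have "w \<in> standard_simplex n"
          by (simp add: W_def)
        then obtain m z \<theta> where m: "m \<le> r * (n + 2)" "inner_point m z" "\<theta> \<in> mor Delta (N m) n"
          "w = push m \<theta> z"
          unfolding N_def push_def by (rule simplex_point_from_spread[OF r])
        note z = inner_pointD[OF m(2)]
        have "realization_point (sd r X) (m, pact X (N m) n \<theta> x, z) \<in> C"
        proof -
          have "realization_point X (n, x, push m \<theta> z) \<in> D ` C"
            using w m(4) by (simp add: W_def)
          then obtain c where c: "c \<in> C"
            "D c = D (realization_point (sd r X) (m, pact X (N m) n \<theta> x, z))"
            unfolding pt[OF m(3) z] by (metis imageE)
          have "inj_on D (realization (sd r X))"
            using bij by (simp add: bij_betw_def)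
          from inj_onD[OF this c(2) subsetD[OF C_sub c(1)] pt_mem[OF m(3) z]] c(1) show ?thesis
            by simp
        qed
        then show "w \<in> (\<Union>m\<in>{..r * (n + 2)}. \<Union>\<theta>\<in>mor Delta (N m) n. push m \<theta> ` E m \<theta>)"
          using m z by (auto simp: E_def)
      next
        fix w assume "w \<in> (\<Union>m\<in>{..r * (n + 2)}. \<Union>\<theta>\<in>mor Delta (N m) n. push m \<theta> ` E m \<theta>)"
        then obtain m \<theta> z where m: "\<theta> \<in> mor Delta (N m) n" "z \<in> E m \<theta>" "w = push m \<theta> z"
          by auto
        then have z: "z \<in> standard_simplex m"
          by (simp add: E_def)
        have "w \<in> standard_simplex n"
          using simplex_push_simplex[OF m(1), of "spread r m z"] spread_simplex[OF r z] m(3)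
          by (simp add: push_def N_def)
        then show "w \<in> W"
          using pt[OF m(1) z] m by (simp add: W_def E_def)
      qed
      have "compactin (powertop_real UNIV) (push m \<theta> ` E m \<theta>)" if \<theta>: "\<theta> \<in> mor Delta (N m) n" for m \<theta>
      proof (rule image_compactin)
        have "closedin (simplex_top m) (E m \<theta>)"
          using C presheaf_pact_mem[OF X _ _ \<theta> x]
          unfolding closedin_realization E_def pob_sd N_def by simp
        then have "closedin (powertop_real UNIV) (E m \<theta>)"
          using closedin_standard_simplex closedin_trans_full by blast
        moreover have "E m \<theta> \<subseteq> standard_simplex m"
          by (auto simp: E_def)
        ultimately show "compactin (powertop_real UNIV) (E m \<theta>)"
          using closed_compactin[OF compactin_standard_simplex[of m]] by blast
        show "continuous_map (powertop_real UNIV) (powertop_real UNIV) (push m \<theta>)"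
          unfolding push_def
          using continuous_map_compose[OF continuous_map_spread continuous_map_simplex_push]
          by (simp add: o_def)
      qed
      then have "closedin (powertop_real UNIV) W"
        unfolding W_eq
        by (intro closedin_Union finite_imageI finite_mor_Delta ballI)
          (auto intro!: compactin_imp_closedin closedin_Union finite_mor_Delta
            simp: Hausdorff_space_product_topology)
      then show "closedin (simplex_top n)
          {w \<in> standard_simplex n. realization_point X (n, x, w) \<in> D ` C}"
        unfolding W_def by (rule closedin_subset_topspace) auto
    qed
  qed
qed

section \<open>Homeomorphisms acting on filtered colimits\<close>

text \<open>
  The interval and the circle have in common: spaces \<open>S L\<close> for \<open>L > 0\<close>, sets \<open>H L L'\<close> of admissible
  homeomorphisms which form a groupoid, and a filtered diagram of sets over finite subsets of \<open>S L\<close>.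
  A homeomorphism \<open>h\<close> moves the index \<open>F\<close> to \<open>h ` F\<close>, and \<open>\<sigma> L L' h F\<close> identifies the values there.
  Functoriality of \<open>\<sigma>\<close> alone yields the actions and the equivariance of the rescaling: conjugation
  by \<open>s\<close> is defined so that \<open>conjugate s \<alpha> \<circ> s = s \<circ> \<alpha>\<close>.
\<close>

locale homeo_colimits =
  fixes S :: "real \<Rightarrow> 's set" and H :: "real \<Rightarrow> real \<Rightarrow> ('s \<Rightarrow> 's) set"
    and I :: "real \<Rightarrow> 's set set" and D :: "real \<Rightarrow> 's set \<Rightarrow> 'a set"
    and T :: "real \<Rightarrow> 's set \<Rightarrow> 's set \<Rightarrow> 'a \<Rightarrow> 'a"
    and \<sigma> :: "real \<Rightarrow> real \<Rightarrow> ('s \<Rightarrow> 's) \<Rightarrow> 's set \<Rightarrow> 'a \<Rightarrow> 'a"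
  assumes H_pos: "h \<in> H L L' \<Longrightarrow> 0 < L \<and> 0 < L'"
    and H_bij: "h \<in> H L L' \<Longrightarrow> bij_betw h (S L) (S L')"
    and H_ext: "h \<in> H L L' \<Longrightarrow> h \<in> extensional (S L)"
    and H_id: "0 < L \<Longrightarrow> (\<lambda>x\<in>S L. x) \<in> H L L"
    and H_comp: "h \<in> H L L' \<Longrightarrow> g \<in> H L' L'' \<Longrightarrow> compose (S L) g h \<in> H L L''"
    and H_inv: "h \<in> H L L' \<Longrightarrow> (\<lambda>y\<in>S L'. inv_into (S L) h y) \<in> H L' L"
    and fd: "0 < L \<Longrightarrow> filtered_diagram (I L) (D L) (T L)"
    and I_sub: "F \<in> I L \<Longrightarrow> F \<subseteq> S L"
    and I_img: "h \<in> H L L' \<Longrightarrow> F \<in> I L \<Longrightarrow> h ` F \<in> I L'"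
    and \<sigma>_in: "h \<in> H L L' \<Longrightarrow> F \<in> I L \<Longrightarrow> x \<in> D L F \<Longrightarrow> \<sigma> L L' h F x \<in> D L' (h ` F)"
    and \<sigma>_nat: "h \<in> H L L' \<Longrightarrow> F \<in> I L \<Longrightarrow> G \<in> I L \<Longrightarrow> F \<subseteq> G \<Longrightarrow> x \<in> D L F \<Longrightarrow>
      T L' (h ` F) (h ` G) (\<sigma> L L' h F x) = \<sigma> L L' h G (T L F G x)"
    and \<sigma>_id: "0 < L \<Longrightarrow> F \<in> I L \<Longrightarrow> x \<in> D L F \<Longrightarrow> \<sigma> L L (\<lambda>x\<in>S L. x) F x = x"
    and \<sigma>_comp: "h \<in> H L L' \<Longrightarrow> g \<in> H L' L'' \<Longrightarrow> F \<in> I L \<Longrightarrow> x \<in> D L F \<Longrightarrow>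
      \<sigma> L' L'' g (h ` F) (\<sigma> L L' h F x) = \<sigma> L L'' (compose (S L) g h) F x"
begin

abbreviation "Colim L \<equiv> colim (I L) (D L) (T L)"
abbreviation "inn L \<equiv> colim_in (I L) (D L) (T L)"

definition push :: "real \<Rightarrow> real \<Rightarrow> ('s \<Rightarrow> 's) \<Rightarrow> ('s set \<times> 'a) set \<Rightarrow> ('s set \<times> 'a) set" where
  "push L L' h c = (let (F, x) = SOME (F, x). F \<in> I L \<and> x \<in> D L F \<and> c = inn L F x
     in inn L' (h ` F) (\<sigma> L L' h F x))"

lemma push_in:
  assumes h: "h \<in> H L L'" and F: "F \<in> I L" "x \<in> D L F"
  shows "push L L' h (inn L F x) = inn L' (h ` F) (\<sigma> L L' h F x)"
proof -
  obtain G y where Gy: "(SOME (G, y). G \<in> I L \<and> y \<in> D L G \<and> inn L F x = inn L G y) = (G, y)"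
    by fastforce
  have "G \<in> I L \<and> y \<in> D L G \<and> inn L F x = inn L G y"
    using someI[of "\<lambda>(G, y). G \<in> I L \<and> y \<in> D L G \<and> inn L F x = inn L G y" "(F, x)"] F
    unfolding Gy by simp
  then have "inn L' (h ` F) (\<sigma> L L' h F x) = inn L' (h ` G) (\<sigma> L L' h G y)"
    using H_pos[OF h]
    by (intro colim_map_well_defined[OF fd fd, where a = "(`) h" and s = "\<sigma> L L' h"])
      (auto intro: I_img[OF h] \<sigma>_in[OF h] \<sigma>_nat[OF h] F)
  then show ?thesis
    unfolding push_def Gy by simp
qed

lemma push_mem:
  assumes h: "h \<in> H L L'" and c: "c \<in> Colim L"
  shows "push L L' h c \<in> Colim L'"
proof -
  obtain F x where F: "F \<in> I L" "x \<in> D L F" "c = inn L F x"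
    using c by (rule colimE)
  show ?thesis
    unfolding F(3) push_in[OF h F(1,2)] by (intro colim_in_mem I_img[OF h] \<sigma>_in[OF h] F)
qed

lemma push_comp:
  assumes h: "h \<in> H L L'" and g: "g \<in> H L' L''" and c: "c \<in> Colim L"
  shows "push L' L'' g (push L L' h c) = push L L'' (compose (S L) g h) c"
proof -
  obtain F x where F: "F \<in> I L" "x \<in> D L F" "c = inn L F x"
    using c by (rule colimE)
  have "compose (S L) g h ` F = g ` h ` F"
    using I_sub[OF F(1)] by (auto simp: compose_def image_iff)
  then show ?thesis
    unfolding F(3) push_in[OF h F(1,2)] push_in[OF H_comp[OF h g] F(1,2)]
      push_in[OF g I_img[OF h F(1)] \<sigma>_in[OF h F(1,2)]] \<sigma>_comp[OF h g F(1,2)] by simp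
qed

lemma push_id:
  assumes L: "0 < L" and c: "c \<in> Colim L"
  shows "push L L (\<lambda>x\<in>S L. x) c = c"
proof -
  obtain F x where F: "F \<in> I L" "x \<in> D L F" "c = inn L F x"
    using c by (rule colimE)
  have "(\<lambda>x\<in>S L. x) ` F = F"
    using I_sub[OF F(1)] by auto
  then show ?thesis
    unfolding F(3) push_in[OF H_id[OF L] F(1,2)] \<sigma>_id[OF L F(1,2)] by simp
qed

lemma H_apply: "h \<in> H L L' \<Longrightarrow> x \<in> S L \<Longrightarrow> h x \<in> S L'"
  using bij_betwE[OF H_bij] by blast

lemma H_inv_apply:
  assumes "h \<in> H L L'"
  shows "x \<in> S L \<Longrightarrow> inv_into (S L) h (h x) = x" "y \<in> S L' \<Longrightarrow> h (inv_into (S L) h y) = y"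
    "y \<in> S L' \<Longrightarrow> inv_into (S L) h y \<in> S L"
  using H_bij[OF assms] by (auto simp: bij_betw_def inv_into_into f_inv_into_f)

lemma H_eqI:
  assumes "h \<in> H L L'" "g \<in> H L L'" "\<And>x. x \<in> S L \<Longrightarrow> h x = g x"
  shows "h = g"
  using H_ext[OF assms(1)] H_ext[OF assms(2)] assms(3) by (rule extensionalityI)

lemma push_bij:
  assumes h: "h \<in> H L L'"
  shows "bij_betw (push L L' h) (Colim L) (Colim L')"
proof (rule bij_betw_byWitness[where f' = "push L' L (\<lambda>y\<in>S L'. inv_into (S L) h y)"])
  note pos = H_pos[OF h]
  have "compose (S L) (\<lambda>y\<in>S L'. inv_into (S L) h y) h = (\<lambda>x\<in>S L. x)"
    using H_inv_apply[OF h] H_apply[OF h] by (auto simp: compose_def)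
  then show "\<forall>c\<in>Colim L. push L' L (\<lambda>y\<in>S L'. inv_into (S L) h y) (push L L' h c) = c"
    using push_comp[OF h H_inv[OF h]] push_id pos by simp
  have "compose (S L') h (\<lambda>y\<in>S L'. inv_into (S L) h y) = (\<lambda>x\<in>S L'. x)"
    using H_inv_apply[OF h] by (auto simp: compose_def)
  then show "\<forall>c\<in>Colim L'. push L L' h (push L' L (\<lambda>y\<in>S L'. inv_into (S L) h y) c) = c"
    using push_comp[OF H_inv[OF h] h] push_id pos by simp
qed (use push_mem[OF h] push_mem[OF H_inv[OF h]] in auto)

definition Gr :: "real \<Rightarrow> ('s \<Rightarrow> 's) monoid" where
  "Gr L = \<lparr>carrier = H L L, monoid.mult = (\<lambda>\<alpha> \<beta>. compose (S L) \<alpha> \<beta>), one = (\<lambda>x\<in>S L. x)\<rparr>"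

lemma group_Gr:
  assumes "0 < L"
  shows "group (Gr L)"
proof (rule groupI; unfold Gr_def; simp)
  show "(\<lambda>x\<in>S L. x) \<in> H L L"
    by (rule H_id[OF assms])
  fix h assume h: "h \<in> H L L"
  show "compose (S L) (\<lambda>x\<in>S L. x) h = h"
    using H_apply[OF h] by (intro H_eqI[OF H_comp[OF h H_id[OF assms]] h]) (simp add: compose_def)
  show "\<exists>g\<in>H L L. compose (S L) g h = (\<lambda>x\<in>S L. x)"
    using H_inv_apply[OF h] H_apply[OF h] by (intro bexI[OF _ H_inv[OF h]]) (auto simp: compose_def)
  fix g assume g: "g \<in> H L L"
  show "compose (S L) h g \<in> H L L"
    by (rule H_comp[OF g h])
  fix k assume k: "k \<in> H L L"
  show "compose (S L) (compose (S L) h g) k = compose (S L) h (compose (S L) g k)"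
    using H_apply[OF k] by (auto simp: compose_def)
qed

lemma conjugate_mem:
  assumes s: "s \<in> H L L'" and \<alpha>: "\<alpha> \<in> H L L"
  shows "conjugate (S L) (S L') s \<alpha> \<in> H L' L'"
proof -
  have "conjugate (S L) (S L') s \<alpha> =
      compose (S L') (compose (S L) s \<alpha>) (\<lambda>y\<in>S L'. inv_into (S L) s y)"
    using H_inv_apply[OF s] by (auto simp: conjugate_def compose_def)
  then show ?thesis
    using H_comp[OF H_inv[OF s] H_comp[OF \<alpha> s]] by simp
qed

lemma conjugate_comp:
  assumes s: "s \<in> H L L'" and \<alpha>: "\<alpha> \<in> H L L"
  shows "compose (S L) (conjugate (S L) (S L') s \<alpha>) s = compose (S L) s \<alpha>"
  using H_inv_apply[OF s] H_apply[OF s] by (auto simp: conjugate_def compose_def)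

lemma conjugate_iso:
  assumes s: "s \<in> H L L'"
  shows "conjugate (S L) (S L') s \<in> iso (Gr L) (Gr L')"
proof (rule isoI)
  let ?c = "conjugate (S L) (S L') s"
  let ?i = "\<lambda>y\<in>S L'. inv_into (S L) s y"
  note si = H_inv[OF s]
  have inv_i: "inv_into (S L') ?i x = s x" if x: "x \<in> S L" for x
  proof -
    have "inv_into (S L') ?i (?i (s x)) = s x"
      using H_inv_apply(1)[OF si H_apply[OF s x]] .
    then show ?thesis
      using H_inv_apply(1)[OF s x] H_apply[OF s x] by simp
  qed
  show "?c \<in> hom (Gr L) (Gr L')"
  proof (rule homI)
    fix \<alpha> assume "\<alpha> \<in> carrier (Gr L)"
    then show "?c \<alpha> \<in> carrier (Gr L')"
      using conjugate_mem[OF s] by (simp add: Gr_def)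
  next
    fix \<alpha> \<beta> assume "\<alpha> \<in> carrier (Gr L)" "\<beta> \<in> carrier (Gr L)"
    then have ab: "\<alpha> \<in> H L L" "\<beta> \<in> H L L"
      by (simp_all add: Gr_def)
    have "?c (compose (S L) \<alpha> \<beta>) y = ?c \<alpha> (?c \<beta> y)" if "y \<in> S L'" for y
      using that H_inv_apply[OF s] H_apply[OF ab(2)] H_apply[OF s]
      by (simp add: conjugate_def compose_def)
    then show "?c (\<alpha> \<otimes>\<^bsub>Gr L\<^esub> \<beta>) = ?c \<alpha> \<otimes>\<^bsub>Gr L'\<^esub> ?c \<beta>"
      by (auto simp: Gr_def compose_def conjugate_def)
  qed
  show "bij_betw ?c (carrier (Gr L)) (carrier (Gr L'))"
  proof (rule bij_betw_byWitness[where f' = "conjugate (S L') (S L) ?i"])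
    show "\<forall>\<alpha>\<in>carrier (Gr L). conjugate (S L') (S L) ?i (?c \<alpha>) = \<alpha>"
    proof
      fix \<alpha> assume "\<alpha> \<in> carrier (Gr L)"
      then have \<alpha>: "\<alpha> \<in> H L L"
        by (simp add: Gr_def)
      show "conjugate (S L') (S L) ?i (?c \<alpha>) = \<alpha>"
      proof (rule H_eqI[OF conjugate_mem[OF si conjugate_mem[OF s \<alpha>]] \<alpha>])
        fix x assume x: "x \<in> S L"
        then show "conjugate (S L') (S L) ?i (?c \<alpha>) x = \<alpha> x"
          using inv_i[OF x] H_inv_apply(1)[OF s] H_apply[OF s] H_apply[OF \<alpha> x]
          by (simp add: conjugate_def)
      qed
    qed
    show "\<forall>\<beta>\<in>carrier (Gr L'). ?c (conjugate (S L') (S L) ?i \<beta>) = \<beta>"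
    proof
      fix \<beta> assume "\<beta> \<in> carrier (Gr L')"
      then have \<beta>: "\<beta> \<in> H L' L'"
        by (simp add: Gr_def)
      show "?c (conjugate (S L') (S L) ?i \<beta>) = \<beta>"
      proof (rule H_eqI[OF conjugate_mem[OF s conjugate_mem[OF si \<beta>]] \<beta>])
        fix y assume y: "y \<in> S L'"
        then show "?c (conjugate (S L') (S L) ?i \<beta>) y = \<beta> y"
          using inv_i H_inv_apply[OF s] H_apply[OF \<beta> y] by (simp add: conjugate_def)
      qed
    qed
  qed (use conjugate_mem[OF s] conjugate_mem[OF si] in \<open>auto simp: Gr_def\<close>)
qed

definition act :: "('p \<Rightarrow> ('s set \<times> 'a) set) \<Rightarrow> 'p set \<Rightarrow> real \<Rightarrow> ('s \<Rightarrow> 's) \<Rightarrow> 'p \<Rightarrow> 'p" where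
  "act \<kappa> R L \<alpha> = (\<lambda>p\<in>R. inv_into R \<kappa> (push L L \<alpha> (\<kappa> p)))"

lemma
  assumes \<kappa>: "bij_betw \<kappa> R (Colim L)" and \<alpha>: "\<alpha> \<in> H L L" and p: "p \<in> R"
  shows act_mem: "act \<kappa> R L \<alpha> p \<in> R" and \<kappa>_act: "\<kappa> (act \<kappa> R L \<alpha> p) = push L L \<alpha> (\<kappa> p)"
proof -
  have "push L L \<alpha> (\<kappa> p) \<in> \<kappa> ` R"
    using push_mem[OF \<alpha>] \<kappa> p by (auto simp: bij_betw_def)
  then show "act \<kappa> R L \<alpha> p \<in> R" "\<kappa> (act \<kappa> R L \<alpha> p) = push L L \<alpha> (\<kappa> p)"
    using p by (auto simp: act_def inv_into_into f_inv_into_f)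
qed

lemma group_action_act:
  assumes L: "0 < L" and \<kappa>: "bij_betw \<kappa> R (Colim L)"
  shows "group_action (Gr L) R (act \<kappa> R L)"
proof -
  have mem: "\<kappa> p \<in> Colim L" if "p \<in> R" for p
    using \<kappa> that by (auto simp: bij_betw_def)
  have inj: "p = q" if "\<kappa> p = \<kappa> q" "p \<in> R" "q \<in> R" for p q
    using \<kappa> that by (auto simp: bij_betw_def inj_on_def)
  have comp: "act \<kappa> R L (compose (S L) \<alpha> \<beta>) p = act \<kappa> R L \<alpha> (act \<kappa> R L \<beta> p)"
    if "\<alpha> \<in> H L L" "\<beta> \<in> H L L" "p \<in> R" for \<alpha> \<beta> p
    using that push_comp[OF that(2,1) mem[OF that(3)]]
    by (intro inj) (simp_all add: act_mem[OF \<kappa>] \<kappa>_act[OF \<kappa>] H_comp)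
  have id: "act \<kappa> R L (\<lambda>x\<in>S L. x) p = p" if "p \<in> R" for p
    using that push_id[OF L mem[OF that]]
    by (intro inj) (simp_all add: act_mem[OF \<kappa>] \<kappa>_act[OF \<kappa>] H_id[OF L])
  have bij: "act \<kappa> R L \<alpha> \<in> Bij R" if \<alpha>: "\<alpha> \<in> H L L" for \<alpha>
  proof -
    let ?i = "\<lambda>y\<in>S L. inv_into (S L) \<alpha> y"
    have "compose (S L) ?i \<alpha> = (\<lambda>x\<in>S L. x)" "compose (S L) \<alpha> ?i = (\<lambda>x\<in>S L. x)"
      using H_inv_apply[OF \<alpha>] H_apply[OF \<alpha>] by (auto simp: compose_def)
    then have "act \<kappa> R L ?i (act \<kappa> R L \<alpha> p) = p" "act \<kappa> R L \<alpha> (act \<kappa> R L ?i p) = p" if "p \<in> R" for p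
      using comp[OF H_inv[OF \<alpha>] \<alpha> that] comp[OF \<alpha> H_inv[OF \<alpha>] that] id[OF that] by simp_all
    then have "bij_betw (act \<kappa> R L \<alpha>) R R"
      using act_mem[OF \<kappa> \<alpha>] act_mem[OF \<kappa> H_inv[OF \<alpha>]]
      by (intro bij_betw_byWitness[where f' = "act \<kappa> R L ?i"]) auto
    then show ?thesis
      by (simp add: Bij_def act_def)
  qed
  have "act \<kappa> R L \<in> hom (Gr L) (BijGroup R)"
  proof (rule homI)
    fix \<alpha> assume "\<alpha> \<in> carrier (Gr L)"
    then show "act \<kappa> R L \<alpha> \<in> carrier (BijGroup R)"
      using bij by (simp add: Gr_def BijGroup_def)
  next
    fix \<alpha> \<beta> assume "\<alpha> \<in> carrier (Gr L)" "\<beta> \<in> carrier (Gr L)"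
    then have ab: "\<alpha> \<in> H L L" "\<beta> \<in> H L L"
      by (simp_all add: Gr_def)
    have "act \<kappa> R L (compose (S L) \<alpha> \<beta>) = compose R (act \<kappa> R L \<alpha>) (act \<kappa> R L \<beta>)"
    proof (rule extensionalityI)
      show "act \<kappa> R L (compose (S L) \<alpha> \<beta>) \<in> extensional R"
        by (simp add: act_def)
    qed (simp_all add: comp[OF ab] compose_eq)
    then show "act \<kappa> R L (\<alpha> \<otimes>\<^bsub>Gr L\<^esub> \<beta>) = act \<kappa> R L \<alpha> \<otimes>\<^bsub>BijGroup R\<^esub> act \<kappa> R L \<beta>"
      using bij ab by (simp add: Gr_def BijGroup_def)
  qed
  then show ?thesis
    unfolding group_action_def group_hom_def group_hom_axioms_def
    using group_Gr[OF L] group_BijGroup by blast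
qed

lemma actions_and_rescaling:
  assumes s: "s \<in> H L L'"
    and \<kappa>: "bij_betw \<kappa> R (Colim L)" and \<kappa>': "bij_betw \<kappa>' R' (Colim L')"
  shows "\<exists>\<rho> \<rho>' d.
    group_action (Gr L) R \<rho> \<and>
    (\<forall>\<alpha>\<in>H L L. \<forall>p\<in>R. \<forall>F\<in>I L. \<forall>x\<in>D L F.
       \<kappa> p = inn L F x \<longrightarrow> \<kappa> (\<rho> \<alpha> p) = inn L (\<alpha> ` F) (\<sigma> L L \<alpha> F x)) \<and>
    group_action (Gr L') R' \<rho>' \<and>
    (\<forall>\<alpha>\<in>H L' L'. \<forall>p\<in>R'. \<forall>F\<in>I L'. \<forall>x\<in>D L' F.
       \<kappa>' p = inn L' F x \<longrightarrow> \<kappa>' (\<rho>' \<alpha> p) = inn L' (\<alpha> ` F) (\<sigma> L' L' \<alpha> F x)) \<and>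
    bij_betw d R R' \<and>
    (\<forall>p\<in>R. \<forall>F\<in>I L. \<forall>x\<in>D L F.
       \<kappa> p = inn L F x \<longrightarrow> \<kappa>' (d p) = inn L' (s ` F) (\<sigma> L L' s F x)) \<and>
    (\<forall>\<alpha>\<in>H L L. \<forall>p\<in>R. d (\<rho> \<alpha> p) = \<rho>' (conjugate (S L) (S L') s \<alpha>) (d p))"
proof -
  have pos: "0 < L" "0 < L'"
    using H_pos[OF s] by auto
  define d where "d = inv_into R' \<kappa>' \<circ> (push L L' s \<circ> \<kappa>)"
  have mem: "\<kappa> p \<in> Colim L" if "p \<in> R" for p
    using \<kappa> that by (auto simp: bij_betw_def)
  have d_bij: "bij_betw d R R'"
    unfolding d_def
    by (rule bij_betw_trans[OF bij_betw_trans[OF \<kappa> push_bij[OF s]] bij_betw_inv_into[OF \<kappa>']])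
  have d_mem: "d p \<in> R'" if "p \<in> R" for p
    using d_bij that by (auto simp: bij_betw_def)
  have \<kappa>'_d: "\<kappa>' (d p) = push L L' s (\<kappa> p)" if "p \<in> R" for p
    using push_mem[OF s mem[OF that]] \<kappa>' by (simp add: d_def bij_betw_def f_inv_into_f)
  have equi: "d (act \<kappa> R L \<alpha> p) = act \<kappa>' R' L' (conjugate (S L) (S L') s \<alpha>) (d p)"
    if \<alpha>: "\<alpha> \<in> H L L" and p: "p \<in> R" for \<alpha> p
  proof -
    note c = conjugate_mem[OF s \<alpha>]
    have "\<kappa>' (d (act \<kappa> R L \<alpha> p)) = push L L' s (push L L \<alpha> (\<kappa> p))"
      by (simp add: \<kappa>'_d[OF act_mem[OF \<kappa> \<alpha> p]] \<kappa>_act[OF \<kappa> \<alpha> p])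
    also have "\<dots> = push L' L' (conjugate (S L) (S L') s \<alpha>) (push L L' s (\<kappa> p))"
      unfolding push_comp[OF \<alpha> s mem[OF p]] push_comp[OF s c mem[OF p]] conjugate_comp[OF s \<alpha>] ..
    also have "\<dots> = \<kappa>' (act \<kappa>' R' L' (conjugate (S L) (S L') s \<alpha>) (d p))"
      by (simp add: \<kappa>_act[OF \<kappa>' c d_mem[OF p]] \<kappa>'_d[OF p])
    finally show ?thesis
      using d_mem[OF act_mem[OF \<kappa> \<alpha> p]] act_mem[OF \<kappa>' c d_mem[OF p]] \<kappa>'
      by (auto simp: bij_betw_def inj_on_def)
  qed
  show ?thesis
    using group_action_act[OF pos(1) \<kappa>] group_action_act[OF pos(2) \<kappa>'] d_bij equi
    by (intro exI[of _ "act \<kappa> R L"] exI[of _ "act \<kappa>' R' L'"] exI[of _ d])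
      (simp add: \<kappa>_act[OF \<kappa>] \<kappa>_act[OF \<kappa>'] \<kappa>'_d push_in[OF s] push_in)
qed

end

text \<open>
  Such data arise from a presheaf by inserting objects \<open>ob L F\<close> of its category, with morphisms
  \<open>tr L F G : ob L G \<rightarrow> ob L F\<close> for \<open>F \<subseteq> G\<close> and \<open>iv L L' h F : ob L' (h ` F) \<rightarrow> ob L F\<close> that compose
  in the evident way.
\<close>

lemma homeo_colimits_presheaf:
  fixes S :: "real \<Rightarrow> 's set" and H :: "real \<Rightarrow> real \<Rightarrow> ('s \<Rightarrow> 's) set"
    and ob :: "real \<Rightarrow> 's set \<Rightarrow> 'o" and Xt :: "('o, 'm, 'a) psh"
    and tr :: "real \<Rightarrow> 's set \<Rightarrow> 's set \<Rightarrow> 'm"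
    and iv :: "real \<Rightarrow> real \<Rightarrow> ('s \<Rightarrow> 's) \<Rightarrow> 's set \<Rightarrow> 'm"
  defines "D L F \<equiv> pob Xt (ob L F)"
    and "T L F G \<equiv> pact Xt (ob L G) (ob L F) (tr L F G)"
    and "\<sigma> L L' h F \<equiv> pact Xt (ob L' (h ` F)) (ob L F) (iv L L' h F)"
  assumes Xt: "presheaf C Xt"
    and H_pos: "\<And>L L' h. h \<in> H L L' \<Longrightarrow> 0 < L \<and> 0 < L'"
    and H_bij: "\<And>L L' h. h \<in> H L L' \<Longrightarrow> bij_betw h (S L) (S L')"
    and H_ext: "\<And>L L' h. h \<in> H L L' \<Longrightarrow> h \<in> extensional (S L)"
    and H_id: "\<And>L. 0 < L \<Longrightarrow> (\<lambda>x\<in>S L. x) \<in> H L L"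
    and H_comp: "\<And>L L' L'' h g. h \<in> H L L' \<Longrightarrow> g \<in> H L' L'' \<Longrightarrow> compose (S L) g h \<in> H L L''"
    and H_inv: "\<And>L L' h. h \<in> H L L' \<Longrightarrow> (\<lambda>y\<in>S L'. inv_into (S L) h y) \<in> H L' L"
    and I_ne: "\<And>L. 0 < L \<Longrightarrow> I L \<noteq> {}" and I_un: "\<And>L F G. F \<in> I L \<Longrightarrow> G \<in> I L \<Longrightarrow> F \<union> G \<in> I L"
    and I_sub: "\<And>L F. F \<in> I L \<Longrightarrow> F \<subseteq> S L"
    and I_img: "\<And>L L' h F. h \<in> H L L' \<Longrightarrow> F \<in> I L \<Longrightarrow> h ` F \<in> I L'"
    and ob: "\<And>L F. 0 < L \<Longrightarrow> F \<in> I L \<Longrightarrow> ob L F \<in> obs C"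
    and tr: "\<And>L F G. 0 < L \<Longrightarrow> F \<in> I L \<Longrightarrow> G \<in> I L \<Longrightarrow> F \<subseteq> G \<Longrightarrow> tr L F G \<in> mor C (ob L G) (ob L F)"
    and tr_id: "\<And>L F. 0 < L \<Longrightarrow> F \<in> I L \<Longrightarrow> tr L F F = idm C (ob L F)"
    and tr_comp: "\<And>L F G K. 0 < L \<Longrightarrow> F \<in> I L \<Longrightarrow> G \<in> I L \<Longrightarrow> K \<in> I L \<Longrightarrow> F \<subseteq> G \<Longrightarrow> G \<subseteq> K \<Longrightarrow>
      cmp C (ob L K) (ob L G) (ob L F) (tr L F G) (tr L G K) = tr L F K"
    and iv: "\<And>L L' h F. h \<in> H L L' \<Longrightarrow> F \<in> I L \<Longrightarrow> iv L L' h F \<in> mor C (ob L' (h ` F)) (ob L F)"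
    and iv_id: "\<And>L F. 0 < L \<Longrightarrow> F \<in> I L \<Longrightarrow> iv L L (\<lambda>x\<in>S L. x) F = idm C (ob L F)"
    and iv_comp: "\<And>L L' L'' h g F. h \<in> H L L' \<Longrightarrow> g \<in> H L' L'' \<Longrightarrow> F \<in> I L \<Longrightarrow>
      cmp C (ob L'' (g ` h ` F)) (ob L' (h ` F)) (ob L F) (iv L L' h F) (iv L' L'' g (h ` F)) =
        iv L L'' (compose (S L) g h) F"
    and iv_tr: "\<And>L L' h F G. h \<in> H L L' \<Longrightarrow> F \<in> I L \<Longrightarrow> G \<in> I L \<Longrightarrow> F \<subseteq> G \<Longrightarrow>
      cmp C (ob L' (h ` G)) (ob L' (h ` F)) (ob L F) (iv L L' h F) (tr L' (h ` F) (h ` G)) =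
        cmp C (ob L' (h ` G)) (ob L G) (ob L F) (tr L F G) (iv L L' h G)"
  shows "homeo_colimits S H I D T \<sigma>"
proof
  note pc = presheaf_pact_comp[OF Xt] and pm = presheaf_pact_mem[OF Xt]
  fix L L' L'' :: real and F G :: "'s set" and h g :: "'s \<Rightarrow> 's" and x
  show "filtered_diagram (I L) (D L) (T L)" if L: "0 < L"
    unfolding filtered_diagram_def D_def T_def
  proof (intro conjI ballI impI funcsetI)
    fix F G K x assume F: "F \<in> I L" and x: "x \<in> pob Xt (ob L F)"
    show "pact Xt (ob L F) (ob L F) (tr L F F) x = x"
      using presheaf_pact_id[OF Xt ob[OF L F] x] tr_id[OF L F] by simp
    assume G: "G \<in> I L" and FG: "F \<subseteq> G"
    show "pact Xt (ob L G) (ob L F) (tr L F G) x \<in> pob Xt (ob L G)"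
      by (intro pm ob L F G tr FG x)
    assume K: "K \<in> I L" and GK: "G \<subseteq> K"
    show "pact Xt (ob L K) (ob L G) (tr L G K) (pact Xt (ob L G) (ob L F) (tr L F G) x) =
        pact Xt (ob L K) (ob L F) (tr L F K) x"
      using pc[OF ob[OF L K] ob[OF L G] ob[OF L F] tr[OF L G K GK] tr[OF L F G FG] x]
        tr_comp[OF L F G K FG GK] by simp
  qed (use I_ne[OF L] I_un in blast)+
  assume h: "h \<in> H L L'" and F: "F \<in> I L" and x: "x \<in> D L F"
  note pos = H_pos[OF h] and hF = I_img[OF h F] and x' = x[unfolded D_def]
  show "\<sigma> L L' h F x \<in> D L' (h ` F)"
    unfolding \<sigma>_def D_def by (intro pm ob iv h F hF x' pos[THEN conjunct1] pos[THEN conjunct2])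
  show "T L' (h ` F) (h ` G) (\<sigma> L L' h F x) = \<sigma> L L' h G (T L F G x)" if G: "G \<in> I L" and FG: "F \<subseteq> G"
    unfolding T_def \<sigma>_def
    using pc[OF ob[OF _ I_img[OF h G]] ob[OF _ hF] ob[OF _ F] tr[OF _ hF I_img[OF h G] image_mono[OF FG]]
        iv[OF h F] x'] pc[OF ob[OF _ I_img[OF h G]] ob[OF _ G] ob[OF _ F] iv[OF h G] tr[OF _ F G FG] x']
      iv_tr[OF h F G FG] pos by simp
  show "\<sigma> L' L'' g (h ` F) (\<sigma> L L' h F x) = \<sigma> L L'' (compose (S L) g h) F x" if g: "g \<in> H L' L''"
  proof -
    have "compose (S L) g h ` F = g ` h ` F"
      using I_sub[OF F] by (auto simp: compose_def image_iff)
    then show ?thesis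
      unfolding \<sigma>_def
      using pc[OF ob[OF _ I_img[OF g hF]] ob[OF _ hF] ob[OF _ F] iv[OF g hF] iv[OF h F] x']
        iv_comp[OF h g F] pos H_pos[OF g] by simp
  qed
next
  fix L F x assume L: "0 < L" and F: "F \<in> I L" and x: "x \<in> D L F"
  have "(\<lambda>x\<in>S L. x) ` F = F"
    using I_sub[OF F] by auto
  then show "\<sigma> L L (\<lambda>x\<in>S L. x) F x = x"
    using presheaf_pact_id[OF Xt ob[OF L F] x[unfolded D_def]] iv_id[OF L F] by (simp add: \<sigma>_def)
qed (rule H_pos H_bij H_ext H_id H_comp H_inv I_sub I_img; assumption)+

section \<open>Finite linear orders and presheaves on them\<close>

lemma Linear_orderI:
  assumes "\<And>a. a \<in> Field R \<Longrightarrow> (a, a) \<in> R"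
    and "\<And>a b c. (a, b) \<in> R \<Longrightarrow> (b, c) \<in> R \<Longrightarrow> (a, c) \<in> R"
    and "\<And>a b. (a, b) \<in> R \<Longrightarrow> (b, a) \<in> R \<Longrightarrow> a = b"
    and "\<And>a b. a \<in> Field R \<Longrightarrow> b \<in> Field R \<Longrightarrow> (a, b) \<in> R \<or> (b, a) \<in> R"
  shows "Linear_order R"
  unfolding order_on_defs refl_on_def trans_def antisym_def total_on_def
  using assms by (auto intro: FieldI1 FieldI2)

lemma Linear_orderD:
  assumes "Linear_order R"
  shows "\<And>a. a \<in> Field R \<Longrightarrow> (a, a) \<in> R"
    and "\<And>a b c. (a, b) \<in> R \<Longrightarrow> (b, c) \<in> R \<Longrightarrow> (a, c) \<in> R"
    and "\<And>a b. (a, b) \<in> R \<Longrightarrow> (b, a) \<in> R \<Longrightarrow> a = b"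
    and "\<And>a b. a \<in> Field R \<Longrightarrow> b \<in> Field R \<Longrightarrow> (a, b) \<in> R \<or> (b, a) \<in> R"
proof -
  have R: "refl_on (Field R) R" "trans R" "antisym R" "total_on (Field R) R"
    using assms by (simp_all add: order_on_defs)
  show refl: "\<And>a. a \<in> Field R \<Longrightarrow> (a, a) \<in> R"
    using R(1) by (simp add: refl_on_def)
  show "\<And>a b c. (a, b) \<in> R \<Longrightarrow> (b, c) \<in> R \<Longrightarrow> (a, c) \<in> R"
    using R(2) by (rule transD)
  show "\<And>a b. (a, b) \<in> R \<Longrightarrow> (b, a) \<in> R \<Longrightarrow> a = b"
    using R(3) by (rule antisymD)
  show "\<And>a b. a \<in> Field R \<Longrightarrow> b \<in> Field R \<Longrightarrow> (a, b) \<in> R \<or> (b, a) \<in> R"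
    using R(4) refl unfolding total_on_def by metis
qed

lemma Field_map_prod: "Field (map_prod i i ` R) = i ` Field R"
  by (force simp: Field_def)

lemma map_prod_rel_iff: "inj i \<Longrightarrow> (i a, i b) \<in> map_prod i i ` R \<longleftrightarrow> (a, b) \<in> R"
  by (auto simp: inj_def)

lemma Linear_order_map_prod:
  assumes i: "inj i" and R: "Linear_order R"
  shows "Linear_order (map_prod i i ` R)"
proof (rule Linear_orderI)
  fix a assume "a \<in> Field (map_prod i i ` R)"
  then show "(a, a) \<in> map_prod i i ` R"
    using Linear_orderD(1)[OF R] unfolding Field_map_prod by (auto simp: map_prod_rel_iff[OF i])
next
  fix a b c assume "(a, b) \<in> map_prod i i ` R" "(b, c) \<in> map_prod i i ` R"
  then obtain x y z where "a = i x" "b = i y" "c = i z" "(x, y) \<in> R" "(y, z) \<in> R"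
    by (auto simp: inj_eq[OF i])
  then show "(a, c) \<in> map_prod i i ` R"
    using Linear_orderD(2)[OF R, of x y z] by (simp add: map_prod_rel_iff[OF i])
next
  fix a b assume "(a, b) \<in> map_prod i i ` R" "(b, a) \<in> map_prod i i ` R"
  then obtain x y where "a = i x" "b = i y" "(x, y) \<in> R" "(y, x) \<in> R"
    by (auto simp: inj_eq[OF i])
  then show "a = b"
    using Linear_orderD(3)[OF R] by auto
next
  fix a b assume "a \<in> Field (map_prod i i ` R)" "b \<in> Field (map_prod i i ` R)"
  then show "(a, b) \<in> map_prod i i ` R \<or> (b, a) \<in> map_prod i i ` R"
    using Linear_orderD(4)[OF R] unfolding Field_map_prod by (auto simp: map_prod_rel_iff[OF i])
qed

lemma Field_ord [simp]: "Field (ord n) = {..n}"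
  by (auto simp: ord_def Field_def)

lemma Linear_order_ord: "Linear_order (ord n)"
proof (rule Linear_orderI)
  show "(a, b) \<in> ord n \<or> (b, a) \<in> ord n" if "a \<in> Field (ord n)" "b \<in> Field (ord n)" for a b
    using that unfolding Field_ord by (auto simp: ord_def)
  show "(a, a) \<in> ord n" if "a \<in> Field (ord n)" for a
    using that unfolding Field_ord by (auto simp: ord_def)
qed (auto simp: ord_def)

lemma finite_ord: "finite (ord n)"
  by (rule finite_subset[of _ "{..n} \<times> {..n}"]) (auto simp: ord_def)

lemma map_prod_obs_Delta_big:
  assumes "inj i" "Linear_order R" "finite R" "R \<noteq> {}"
  shows "map_prod i i ` R \<in> obs Delta_big"
  using assms Linear_order_map_prod[OF assms(1,2)] by (simp add: Delta_big_def)

lemma conj_map_apply: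
  assumes "inj i" "a \<in> A"
  shows "conj_map A i j f (i a) = j (f a)"
proof -
  have "inv_into A i (i a) = a"
    using assms by (meson inj_on_subset inv_into_f_f subset_UNIV)
  then show ?thesis
    using assms by (simp add: conj_map_def)
qed

lemma conj_map_mor_Delta_big:
  assumes i: "inj i" and j: "inj j" and f: "\<And>a. a \<in> Field R \<Longrightarrow> f a \<in> Field S"
    and mono: "\<And>a b. (a, b) \<in> R \<Longrightarrow> (f a, f b) \<in> S"
  shows "conj_map (Field R) i j f \<in> mor Delta_big (map_prod i i ` R) (map_prod j j ` S)"
proof -
  have "conj_map (Field R) i j f \<in> extensional (i ` Field R)"
    by (simp add: conj_map_def)
  then have "conj_map (Field R) i j f \<in> i ` Field R \<rightarrow>\<^sub>E j ` Field S"
    using f by (auto simp: PiE_def conj_map_apply[OF i])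
  moreover have "(conj_map (Field R) i j f x, conj_map (Field R) i j f y) \<in> map_prod j j ` S"
    if xy: "(x, y) \<in> map_prod i i ` R" for x y
  proof -
    obtain a b where ab: "x = i a" "y = i b" "(a, b) \<in> R"
      using xy by auto
    then have "a \<in> Field R" "b \<in> Field R"
      by (auto intro: FieldI1 FieldI2)
    then show ?thesis
      unfolding ab(1,2) using mono[OF ab(3)] by (simp only: conj_map_apply[OF i] map_prod_rel_iff[OF j])
  qed
  ultimately show ?thesis
    unfolding Delta_big_def by (simp only: Field_map_prod category.select_convs mem_Collect_eq) blast
qed

lemma mor_Delta_big_eqI:
  assumes "f \<in> mor Delta_big R S" "g \<in> mor Delta_big R S" "\<And>a. a \<in> Field R \<Longrightarrow> f a = g a"
  shows "f = g"
  using assms by (intro extensionalityI[of f "Field R"]) (auto simp: Delta_big_def PiE_def)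

lemma cmp_Delta_big_mor:
  assumes "f \<in> mor Delta_big Q R" "g \<in> mor Delta_big R S"
  shows "cmp Delta_big Q R S g f \<in> mor Delta_big Q S"
  using assms by (auto 4 4 simp: Delta_big_def compose_def intro: FieldI1 FieldI2)

lemma cmp_Delta_big_apply [simp]: "a \<in> Field Q \<Longrightarrow> cmp Delta_big Q R S g f a = g (f a)"
  by (simp add: Delta_big_def compose_def)

lemma idm_Delta_big_apply [simp]: "a \<in> Field R \<Longrightarrow> idm Delta_big R a = a"
  by (simp add: Delta_big_def)

lemma Delta_big_pact_comp:
  assumes X: "presheaf Delta_big Xt" and ob: "A \<in> obs Delta_big" "B \<in> obs Delta_big" "C \<in> obs Delta_big"
    and f: "f \<in> mor Delta_big A B" and g: "g \<in> mor Delta_big B C" and h: "h \<in> mor Delta_big A C"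
    and eq: "\<And>a. a \<in> Field A \<Longrightarrow> g (f a) = h a" and x: "x \<in> pob Xt C"
  shows "pact Xt A B f (pact Xt B C g x) = pact Xt A C h x"
proof -
  have "cmp Delta_big A B C g f = h"
    using eq
    by (intro mor_Delta_big_eqI[OF cmp_Delta_big_mor[OF f g] h]) simp
  then show ?thesis
    using presheaf_pact_comp[OF X ob f g x] by simp
qed

lemma idm_Delta_big_mor: "idm Delta_big A \<in> mor Delta_big A A"
  by (auto simp: Delta_big_def intro: FieldI1 FieldI2)

text \<open>A bijective monotone map between linear orders has a monotone inverse.\<close>

lemma Delta_big_pact_bij:
  assumes X: "presheaf Delta_big Xt" and ob: "A \<in> obs Delta_big" "B \<in> obs Delta_big"
    and f: "f \<in> mor Delta_big A B" and bij: "bij_betw f (Field A) (Field B)"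
  shows "bij_betw (pact Xt A B f) (pob Xt B) (pob Xt A)"
proof -
  define g where "g = (\<lambda>b\<in>Field B. inv_into (Field A) f b)"
  have fg: "f (g b) = b" "g b \<in> Field A" if "b \<in> Field B" for b
    using bij that by (auto simp: g_def bij_betw_def f_inv_into_f inv_into_into)
  have gf: "g (f a) = a" if "a \<in> Field A" for a
    using bij that by (auto simp: g_def bij_betw_def)
  have A: "Linear_order A" and B: "Linear_order B"
    using ob by (auto simp: Delta_big_def)
  have mono: "(f a, f a') \<in> B" if "(a, a') \<in> A" for a a'
    using f that by (auto simp: Delta_big_def)
  have g: "g \<in> mor Delta_big B A"
  proof -
    have "(g b, g b') \<in> A" if bb: "(b, b') \<in> B" for b b'
    proof (rule ccontr)
      assume "(g b, g b') \<notin> A"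
      have F: "b \<in> Field B" "b' \<in> Field B"
        using bb by (auto intro: FieldI1 FieldI2)
      then have "(g b', g b) \<in> A"
        using Linear_orderD(4)[OF A] fg \<open>(g b, g b') \<notin> A\<close> by blast
      then have "b = b'"
        using mono[of "g b'" "g b"] fg F bb Linear_orderD(3)[OF B] by auto
      then show False
        using \<open>(g b, g b') \<notin> A\<close> Linear_orderD(1)[OF A] fg F by auto
    qed
    moreover have "g \<in> Field B \<rightarrow>\<^sub>E Field A"
      using fg by (auto simp: g_def)
    ultimately show ?thesis
      by (auto simp: Delta_big_def)
  qed
  have "pact Xt B A g (pact Xt A B f x) = x" if "x \<in> pob Xt B" for x
    using Delta_big_pact_comp[OF X ob(2,1,2) g f idm_Delta_big_mor _ that] fg presheaf_pact_id[OF X ob(2) that]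
    by (simp add: Delta_big_def)
  moreover have "pact Xt A B f (pact Xt B A g x) = x" if "x \<in> pob Xt A" for x
    using Delta_big_pact_comp[OF X ob(1,2,1) f g idm_Delta_big_mor _ that] gf presheaf_pact_id[OF X ob(1) that]
    by (simp add: Delta_big_def)
  ultimately show ?thesis
    using presheaf_pact_mem[OF X ob f] presheaf_pact_mem[OF X ob(2,1) g]
    by (intro bij_betw_byWitness[where f' = "pact Xt B A g"]) auto
qed

section \<open>Components of complements in an interval\<close>

text \<open>Components of sets of reals are order-convex, so they can be recognized by separating points.\<close>

lemma real_component_iff:
  fixes A :: "real set"
  assumes x: "x \<in> A"
  shows "y \<in> connected_component_set A x \<longleftrightarrow> y \<in> A \<and> (\<forall>f. f \<notin> A \<longrightarrow> (f < x \<longleftrightarrow> f < y))"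
proof
  assume y: "y \<in> connected_component_set A x"
  then obtain U where U: "connected U" "U \<subseteq> A" "x \<in> U" "y \<in> U"
    by (auto simp: connected_component_def)
  have "f \<in> U" if "x \<le> f \<and> f \<le> y \<or> y \<le> f \<and> f \<le> x" for f
    using U that unfolding connected_iff_interval by blast
  then show "y \<in> A \<and> (\<forall>f. f \<notin> A \<longrightarrow> (f < x \<longleftrightarrow> f < y))"
    using U by (meson not_le less_imp_le subsetD)
next
  assume y: "y \<in> A \<and> (\<forall>f. f \<notin> A \<longrightarrow> (f < x \<longleftrightarrow> f < y))"
  have "f \<in> A" if "f \<in> {min x y..max x y}" for f
  proof (rule ccontr)
    assume "f \<notin> A"
    then have "f \<noteq> x" "f \<noteq> y" "f < x \<longleftrightarrow> f < y"
      using x y by auto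
    then show False
      using that by (auto simp: min_def max_def split: if_splits)
  qed
  then have "{min x y..max x y} \<subseteq> A"
    by blast
  then show "y \<in> connected_component_set A x"
    unfolding connected_component_def mem_Collect_eq
    by (intro exI[of _ "{min x y..max x y}"]) auto
qed

abbreviation icomp :: "real \<Rightarrow> real set \<Rightarrow> real \<Rightarrow> real set" where
  "icomp L F x \<equiv> connected_component_set ({0..L} - F) x"

lemma icomp_iff:
  assumes "x \<in> {0..L} - F"
  shows "y \<in> icomp L F x \<longleftrightarrow> y \<in> {0..L} - F \<and> (\<forall>f\<in>F. f < x \<longleftrightarrow> f < y)"
  unfolding real_component_iff[OF assms] using assms by auto

lemma icomp_self: "x \<in> {0..L} - F \<Longrightarrow> x \<in> icomp L F x"
  by (simp add: icomp_iff)

lemma icomps_iff: "C \<in> icomps L F \<longleftrightarrow> (\<exists>x. x \<in> {0..L} - F \<and> C = icomp L F x)"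
  by (rule components_iff)

lemma icomp_eq_iff:
  assumes x: "x \<in> {0..L} - F" and y: "y \<in> {0..L} - F"
  shows "icomp L F x = icomp L F y \<longleftrightarrow> (\<forall>f\<in>F. f < x \<longleftrightarrow> f < y)"
proof
  assume "icomp L F x = icomp L F y"
  then show "\<forall>f\<in>F. f < x \<longleftrightarrow> f < y"
    using icomp_self[OF y] icomp_iff[OF x] by blast
next
  assume "\<forall>f\<in>F. f < x \<longleftrightarrow> f < y"
  then show "icomp L F x = icomp L F y"
    using icomp_iff[OF x] icomp_iff[OF y] by blast
qed

lemma icomp_unique:
  assumes "C \<in> icomps L F" "x \<in> C"
  shows "x \<in> {0..L} - F" "C = icomp L F x"
proof -
  obtain z where z: "z \<in> {0..L} - F" "C = icomp L F z"
    using assms(1) icomps_iff by blast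
  show x: "x \<in> {0..L} - F"
    using assms(2) z icomp_iff[OF z(1)] by blast
  show "C = icomp L F x"
    unfolding z(2) icomp_eq_iff[OF z(1) x] using assms(2) z(2) icomp_iff[OF z(1)] by blast
qed

lemma pi0_iff:
  assumes x: "x \<in> {0..L} - F" and y: "y \<in> {0..L} - F"
  shows "(icomp L F x, icomp L F y) \<in> pi0 L F \<longleftrightarrow> (\<forall>f\<in>F. f < x \<longrightarrow> f < y)"
proof
  assume "(icomp L F x, icomp L F y) \<in> pi0 L F"
  then obtain u v where "u \<in> icomp L F x" "v \<in> icomp L F y" "u \<le> v"
    by (auto simp: pi0_def)
  then show "\<forall>f\<in>F. f < x \<longrightarrow> f < y"
    unfolding icomp_iff[OF x] icomp_iff[OF y] by (meson order_less_le_trans)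
next
  assume *: "\<forall>f\<in>F. f < x \<longrightarrow> f < y"
  have "\<exists>u\<in>icomp L F x. \<exists>v\<in>icomp L F y. u \<le> v"
  proof (cases "x \<le> y")
    case True
    then show ?thesis
      using icomp_self[OF x] icomp_self[OF y] by blast
  next
    case False
    then have "icomp L F x = icomp L F y"
      unfolding icomp_eq_iff[OF x y] using * by auto
    then show ?thesis
      using icomp_self[OF x] by blast
  qed
  then show "(icomp L F x, icomp L F y) \<in> pi0 L F"
    using x y icomps_iff unfolding pi0_def by blast
qed

lemma pi0E:
  assumes "(A, B) \<in> pi0 L F"
  obtains x y where "x \<in> {0..L} - F" "y \<in> {0..L} - F" "A = icomp L F x" "B = icomp L F y"
    "\<forall>f\<in>F. f < x \<longrightarrow> f < y"
proof -
  have "A \<in> icomps L F" "B \<in> icomps L F"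
    using assms by (auto simp: pi0_def)
  then obtain x y where "x \<in> {0..L} - F" "y \<in> {0..L} - F" "A = icomp L F x" "B = icomp L F y"
    unfolding icomps_iff by blast
  then show ?thesis
    using that assms pi0_iff by blast
qed

lemma Field_pi0: "Field (pi0 L F) = icomps L F"
proof
  show "Field (pi0 L F) \<subseteq> icomps L F"
    by (auto simp: Field_def pi0_def)
  show "icomps L F \<subseteq> Field (pi0 L F)"
  proof
    fix C assume "C \<in> icomps L F"
    then obtain x where "x \<in> {0..L} - F" "C = icomp L F x"
      unfolding icomps_iff by blast
    then have "(C, C) \<in> pi0 L F"
      using pi0_iff by blast
    then show "C \<in> Field (pi0 L F)"
      by (rule FieldI1)
  qed
qed

lemma Linear_order_pi0: "Linear_order (pi0 L F)"
proof (rule Linear_orderI)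
  fix A assume "A \<in> Field (pi0 L F)"
  then obtain x where "x \<in> {0..L} - F" "A = icomp L F x"
    unfolding Field_pi0 icomps_iff by blast
  then show "(A, A) \<in> pi0 L F"
    using pi0_iff by blast
next
  fix A B C assume "(A, B) \<in> pi0 L F" "(B, C) \<in> pi0 L F"
  then obtain x y y' z where x: "x \<in> {0..L} - F" "y \<in> {0..L} - F" "y' \<in> {0..L} - F" "z \<in> {0..L} - F"
    and "A = icomp L F x" "B = icomp L F y" "B = icomp L F y'" "C = icomp L F z"
    and "\<forall>f\<in>F. f < x \<longrightarrow> f < y" "\<forall>f\<in>F. f < y' \<longrightarrow> f < z"
    by (elim pi0E) blast
  then show "(A, C) \<in> pi0 L F"
    using pi0_iff[OF x(1,4)] icomp_eq_iff[OF x(2,3)] by metis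
next
  fix A B assume "(A, B) \<in> pi0 L F" "(B, A) \<in> pi0 L F"
  then obtain x y x' y' where x: "x \<in> {0..L} - F" "y \<in> {0..L} - F" "x' \<in> {0..L} - F" "y' \<in> {0..L} - F"
    and "A = icomp L F x" "B = icomp L F y" "A = icomp L F x'" "B = icomp L F y'"
    and "\<forall>f\<in>F. f < x \<longrightarrow> f < y" "\<forall>f\<in>F. f < y' \<longrightarrow> f < x'"
    by (elim pi0E) blast
  then show "A = B"
    using icomp_eq_iff[OF x(1,2)] icomp_eq_iff[OF x(1,3)] icomp_eq_iff[OF x(2,4)] by metis
next
  fix A B assume "A \<in> Field (pi0 L F)" "B \<in> Field (pi0 L F)"
  then obtain x y where x: "x \<in> {0..L} - F" "y \<in> {0..L} - F" and "A = icomp L F x" "B = icomp L F y"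
    unfolding Field_pi0 icomps_iff by blast
  moreover have "(\<forall>f\<in>F. f < x \<longrightarrow> f < y) \<or> (\<forall>f\<in>F. f < y \<longrightarrow> f < x)"
    by (cases "x \<le> y") auto
  ultimately show "(A, B) \<in> pi0 L F \<or> (B, A) \<in> pi0 L F"
    using pi0_iff[OF x] pi0_iff[OF x(2,1)] by blast
qed

lemma finite_icomps:
  assumes "finite F"
  shows "finite (icomps L F)"
proof (rule finite_subset)
  show "icomps L F \<subseteq> (\<lambda>A. {y \<in> {0..L} - F. {f \<in> F. f < y} = A}) ` Pow F"
  proof
    fix C assume "C \<in> icomps L F"
    then obtain x where x: "x \<in> {0..L} - F" "C = icomp L F x"
      unfolding icomps_iff by blast
    then have "C = {y \<in> {0..L} - F. {f \<in> F. f < y} = {f \<in> F. f < x}}"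
      using icomp_iff[OF x(1)] by auto
    then show "C \<in> (\<lambda>A. {y \<in> {0..L} - F. {f \<in> F. f < y} = A}) ` Pow F"
      by blast
  qed
  show "finite ((\<lambda>A. {y \<in> {0..L} - F. {f \<in> F. f < y} = A}) ` Pow F)"
    using assms by simp
qed

lemma interval_minus_finite_nonempty:
  fixes L :: real
  assumes "0 < L" "finite F"
  shows "\<exists>x. x \<in> {0..L} - F"
  using infinite_Icc[OF assms(1)] assms(2) by (metis Diff_infinite_finite finite.emptyI all_not_in_conv)

lemma finite_pi0: "finite F \<Longrightarrow> finite (pi0 L F)"
  by (rule finite_subset[of _ "icomps L F \<times> icomps L F"]) (auto simp: pi0_def finite_icomps)

lemma pi0_nonempty:
  assumes "0 < L" "finite F"
  shows "pi0 L F \<noteq> {}"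
proof -
  obtain x where "x \<in> {0..L} - F"
    using interval_minus_finite_nonempty[OF assms] by blast
  then show ?thesis
    using pi0_iff by blast
qed

lemma pi0_elem_obs: "0 < L \<Longrightarrow> finite F \<Longrightarrow> pi0_elem L F \<in> obs Delta_big"
  unfolding pi0_elem_def
  by (intro map_prod_obs_Delta_big Linear_order_pi0 finite_pi0 pi0_nonempty) auto

lemma std_ord_obs: "std_ord n \<in> obs Delta_big"
  unfolding std_ord_def
  by (intro map_prod_obs_Delta_big Linear_order_ord finite_ord) (auto simp: ord_def)

lemma Field_pi0_elem: "Field (pi0_elem L F) = Inr ` icomps L F"
  by (simp add: pi0_elem_def Field_map_prod Field_pi0)

lemma Field_pi0_elemE:
  assumes "a \<in> Field (pi0_elem L F)"
  obtains x where "x \<in> {0..L} - F" "a = Inr (icomp L F x)"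
  using assms icomps_iff[of _ L F] unfolding Field_pi0_elem by auto

lemma Field_std_ord: "Field (std_ord n) = Inl ` {..n}"
  by (simp add: std_ord_def Field_map_prod)

subsection \<open>Maps of components\<close>

text \<open>All maps out of sets of components are determined by their effect on points.\<close>

lemma icomp_refine:
  assumes "F \<subseteq> G" "x \<in> {0..L} - G"
  shows "pi0_refine L F G (icomp L G x) = icomp L F x"
proof -
  have x: "x \<in> {0..L} - F"
    using assms by auto
  have "(THE D. D \<in> icomps L F \<and> icomp L G x \<subseteq> D) = icomp L F x"
  proof (rule the_equality)
    show "icomp L F x \<in> icomps L F \<and> icomp L G x \<subseteq> icomp L F x"
      using x icomp_iff[OF x] icomp_iff[OF assms(2)] assms(1) unfolding icomps_iff by blast
    show "D = icomp L F x" if "D \<in> icomps L F \<and> icomp L G x \<subseteq> D" for D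
      using that icomp_self[OF assms(2)] icomp_unique(2)[of D L F x] by blast
  qed
  moreover have "icomp L G x \<in> icomps L G"
    using assms(2) unfolding icomps_iff by blast
  ultimately show ?thesis
    by (simp add: pi0_refine_def)
qed

lemma pi0_mor:
  assumes \<phi>: "\<And>x. x \<in> {0..L'} - G \<Longrightarrow> \<phi> (icomp L' G x) = icomp L F (e x)"
    and e: "\<And>x. x \<in> {0..L'} - G \<Longrightarrow> e x \<in> {0..L} - F"
    and mono: "\<And>x y. x \<in> {0..L'} - G \<Longrightarrow> y \<in> {0..L'} - G \<Longrightarrow> \<forall>g\<in>G. g < x \<longrightarrow> g < y \<Longrightarrow>
      \<forall>f\<in>F. f < e x \<longrightarrow> f < e y"
  shows "conj_map (icomps L' G) Inr Inr \<phi> \<in> mor Delta_big (pi0_elem L' G) (pi0_elem L F)"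
    and "\<And>x. x \<in> {0..L'} - G \<Longrightarrow>
      conj_map (icomps L' G) Inr Inr \<phi> (Inr (icomp L' G x)) = Inr (icomp L F (e x))"
proof -
  show "conj_map (icomps L' G) Inr Inr \<phi> \<in> mor Delta_big (pi0_elem L' G) (pi0_elem L F)"
    unfolding pi0_elem_def Field_pi0[symmetric]
  proof (rule conj_map_mor_Delta_big)
    fix A assume "A \<in> Field (pi0 L' G)"
    then obtain x where x: "x \<in> {0..L'} - G" "A = icomp L' G x"
      unfolding Field_pi0 icomps_iff by blast
    show "\<phi> A \<in> Field (pi0 L F)"
      unfolding x(2) \<phi>[OF x(1)] Field_pi0 icomps_iff using e[OF x(1)] by blast
  next
    fix A B assume "(A, B) \<in> pi0 L' G"
    then show "(\<phi> A, \<phi> B) \<in> pi0 L F"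
      by (rule pi0E) (use \<phi> e mono pi0_iff in simp)
  qed auto
  fix x assume x: "x \<in> {0..L'} - G"
  then have "icomp L' G x \<in> icomps L' G"
    unfolding icomps_iff by blast
  then show "conj_map (icomps L' G) Inr Inr \<phi> (Inr (icomp L' G x)) = Inr (icomp L F (e x))"
    using conj_map_apply[of Inr "icomp L' G x" "icomps L' G" Inr \<phi>] \<phi>[OF x] by simp
qed

lemma refine_mor:
  assumes "F \<subseteq> G"
  shows "conj_map (icomps L G) Inr Inr (pi0_refine L F G) \<in> mor Delta_big (pi0_elem L G) (pi0_elem L F)"
    and "\<And>x. x \<in> {0..L} - G \<Longrightarrow>
      conj_map (icomps L G) Inr Inr (pi0_refine L F G) (Inr (icomp L G x)) = Inr (icomp L F x)"
proof -
  have 1: "x \<in> {0..L} - F" if "x \<in> {0..L} - G" for x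
    using assms that by blast
  have 2: "\<forall>f\<in>F. f < x \<longrightarrow> f < y" if "\<forall>g\<in>G. g < x \<longrightarrow> g < y" for x y
    using assms that by blast
  note m = pi0_mor[of L G "pi0_refine L F G" L F "\<lambda>x. x", OF icomp_refine[OF assms] 1 2]
  show "conj_map (icomps L G) Inr Inr (pi0_refine L F G) \<in> mor Delta_big (pi0_elem L G) (pi0_elem L F)"
    by (rule m(1))
  show "conj_map (icomps L G) Inr Inr (pi0_refine L F G) (Inr (icomp L G x)) = Inr (icomp L F x)"
    if "x \<in> {0..L} - G" for x
    by (rule m(2); use that in blast)
qed

definition interval_homeos :: "real \<Rightarrow> real \<Rightarrow> (real \<Rightarrow> real) set" where
  "interval_homeos L L' = {h \<in> extensional {0..L}. 0 < L \<and> 0 < L' \<and>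
     homeomorphic_map (top_of_set {0..L}) (top_of_set {0..L'}) h \<and> mono_on {0..L} h}"

lemma interval_homeos_bij:
  assumes "h \<in> interval_homeos L L'"
  shows "bij_betw h {0..L} {0..L'}"
proof -
  have h: "homeomorphic_map (top_of_set {0..L}) (top_of_set {0..L'}) h"
    using assms by (simp add: interval_homeos_def)
  show ?thesis
    using homeomorphic_imp_surjective_map[OF h] homeomorphic_imp_injective_map[OF h]
    by (simp add: bij_betw_def)
qed

lemma interval_homeos_less_iff:
  assumes h: "h \<in> interval_homeos L L'" and x: "x \<in> {0..L}" and y: "y \<in> {0..L}"
  shows "h x < h y \<longleftrightarrow> x < y"
proof -
  have "inj_on h {0..L}" "mono_on {0..L} h"
    using interval_homeos_bij[OF h] h by (auto simp: bij_betw_def interval_homeos_def)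
  then show ?thesis
    using x y by (metis inj_on_eq_iff linorder_not_le mono_onD order_le_less)
qed

lemma interval_homeos_mem: "h \<in> interval_homeos L L' \<Longrightarrow> x \<in> {0..L} \<Longrightarrow> h x \<in> {0..L'}"
  using bij_betwE[OF interval_homeos_bij] by blast

lemma interval_homeos_image_mem:
  assumes h: "h \<in> interval_homeos L L'" and F: "F \<subseteq> {0..L}" and x: "x \<in> {0..L}"
  shows "h x \<in> h ` F \<longleftrightarrow> x \<in> F"
  using interval_homeos_bij[OF h] F x unfolding bij_betw_def inj_on_def by blast

lemma interval_homeos_complement:
  assumes h: "h \<in> interval_homeos L L'" and F: "F \<subseteq> {0..L}" and y: "y \<in> {0..L'} - h ` F"
  shows "\<exists>x. x \<in> {0..L} - F \<and> y = h x"
  using interval_homeos_bij[OF h] F y unfolding bij_betw_def by blast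

lemma icomp_image:
  assumes h: "h \<in> interval_homeos L L'" and F: "F \<subseteq> {0..L}" and x: "x \<in> {0..L} - F"
  shows "h ` icomp L F x = icomp L' (h ` F) (h x)"
proof -
  have hx: "h x \<in> {0..L'} - h ` F"
    using interval_homeos_mem[OF h] interval_homeos_image_mem[OF h F] x by auto
  have iff: "(\<forall>f\<in>F. f < x \<longleftrightarrow> f < y) \<longleftrightarrow> (\<forall>f\<in>h ` F. f < h x \<longleftrightarrow> f < h y)" if "y \<in> {0..L}" for y
    using interval_homeos_less_iff[OF h] F x that by (auto simp: subset_iff)
  show ?thesis
  proof (intro equalityI subsetI)
    fix z assume "z \<in> h ` icomp L F x"
    then obtain y where y: "y \<in> icomp L F x" "z = h y"
      by blast
    then have "y \<in> {0..L} - F" "\<forall>f\<in>F. f < x \<longleftrightarrow> f < y"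
      using icomp_iff[OF x] by auto
    then show "z \<in> icomp L' (h ` F) (h x)"
      unfolding icomp_iff[OF hx] y(2)
      using iff interval_homeos_mem[OF h] interval_homeos_image_mem[OF h F] by auto
  next
    fix z assume "z \<in> icomp L' (h ` F) (h x)"
    then have z: "z \<in> {0..L'} - h ` F" "\<forall>f\<in>h ` F. f < h x \<longleftrightarrow> f < z"
      unfolding icomp_iff[OF hx] by auto
    then obtain y where y: "y \<in> {0..L} - F" "z = h y"
      using interval_homeos_complement[OF h F] by blast
    then have "y \<in> icomp L F x"
      unfolding icomp_iff[OF x] using z iff by auto
    then show "z \<in> h ` icomp L F x"
      using y by blast
  qed
qed

lemma pi0_inv_icomp:
  assumes h: "h \<in> interval_homeos L L'" and F: "F \<subseteq> {0..L}" and x: "x \<in> {0..L} - F"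
  shows "pi0_inv L L' h F (icomp L' (h ` F) (h x)) = icomp L F x"
proof -
  have hx: "h x \<in> {0..L'} - h ` F"
    using interval_homeos_mem[OF h] interval_homeos_image_mem[OF h F] x by auto
  have "inj_on ((`) h) (icomps L F)"
  proof (rule inj_on_subset)
    show "inj_on ((`) h) (Pow {0..L})"
      using interval_homeos_bij[OF h] by (intro inj_on_image_Pow) (simp add: bij_betw_def)
    show "icomps L F \<subseteq> Pow {0..L}"
      using icomp_unique(1)[of _ L F] by blast
  qed
  moreover have "icomp L F x \<in> icomps L F"
    using x unfolding icomps_iff by blast
  ultimately have "inv_into (icomps L F) ((`) h) (h ` icomp L F x) = icomp L F x"
    by (rule inv_into_f_f)
  moreover have "icomp L' (h ` F) (h x) \<in> icomps L' (h ` F)"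
    using hx unfolding icomps_iff by blast
  ultimately show ?thesis
    by (simp add: pi0_inv_def icomp_image[OF h F x])
qed

lemma pi0_inv_mor:
  assumes h: "h \<in> interval_homeos L L'" and F: "F \<subseteq> {0..L}"
  shows "conj_map (icomps L' (h ` F)) Inr Inr (pi0_inv L L' h F)
      \<in> mor Delta_big (pi0_elem L' (h ` F)) (pi0_elem L F)"
    and "\<And>x. x \<in> {0..L} - F \<Longrightarrow>
      conj_map (icomps L' (h ` F)) Inr Inr (pi0_inv L L' h F) (Inr (icomp L' (h ` F) (h x))) =
        Inr (icomp L F x)"
proof -
  define e where "e = inv_into {0..L} h"
  have bij: "bij_betw h {0..L} {0..L'}"
    by (rule interval_homeos_bij[OF h])
  have eh: "e (h x) = x" if "x \<in> {0..L}" for x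
    using bij that by (simp add: e_def bij_betw_def)
  have 1: "pi0_inv L L' h F (icomp L' (h ` F) y) = icomp L F (e y)" if "y \<in> {0..L'} - h ` F" for y
    using interval_homeos_complement[OF h F that] pi0_inv_icomp[OF h F] eh by auto
  have 2: "e y \<in> {0..L} - F" if "y \<in> {0..L'} - h ` F" for y
    using interval_homeos_complement[OF h F that] eh by auto
  have 3: "\<forall>f\<in>F. f < e x \<longrightarrow> f < e y"
    if "x \<in> {0..L'} - h ` F" "y \<in> {0..L'} - h ` F" and le: "\<forall>g\<in>h ` F. g < x \<longrightarrow> g < y" for x y
  proof -
    obtain u v where uv: "u \<in> {0..L} - F" "x = h u" "v \<in> {0..L} - F" "y = h v"
      using interval_homeos_complement[OF h F] \<open>x \<in> _\<close> \<open>y \<in> _\<close> by blast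
    have "f < u \<longrightarrow> f < v" if "f \<in> F" for f
      using le uv interval_homeos_less_iff[OF h] F that by (auto simp: subset_iff)
    then show ?thesis
      using uv eh by auto
  qed
  show "conj_map (icomps L' (h ` F)) Inr Inr (pi0_inv L L' h F)
      \<in> mor Delta_big (pi0_elem L' (h ` F)) (pi0_elem L F)"
    by (rule pi0_mor(1)[of L' "h ` F" "pi0_inv L L' h F" L F e, OF 1 2 3])
  fix x assume x: "x \<in> {0..L} - F"
  then have "h x \<in> {0..L'} - h ` F"
    using interval_homeos_mem[OF h] interval_homeos_image_mem[OF h F] by auto
  then have "conj_map (icomps L' (h ` F)) Inr Inr (pi0_inv L L' h F) (Inr (icomp L' (h ` F) (h x))) =
      Inr (icomp L F (e (h x)))"
    by (intro pi0_mor(2)[of L' "h ` F" "pi0_inv L L' h F" L F e] 1 2 3)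
  then show "conj_map (icomps L' (h ` F)) Inr Inr (pi0_inv L L' h F) (Inr (icomp L' (h ` F) (h x))) =
      Inr (icomp L F x)"
    using eh x by simp
qed

lemma compose_image:
  assumes "F \<subseteq> A"
  shows "compose A g h ` F = g ` h ` F"
proof -
  have "compose A g h ` F = (\<lambda>x. g (h x)) ` F"
    using assms by (intro image_cong) (auto simp: compose_def)
  then show ?thesis
    by (simp add: image_image)
qed

lemma homeomorphic_map_inv_into:
  assumes "homeomorphic_map X Y h"
  shows "homeomorphic_map Y X (\<lambda>y\<in>topspace Y. inv_into (topspace X) h y)"
proof -
  obtain g where g: "homeomorphic_maps X Y h g"
    using assms homeomorphic_map_maps by blast
  have inj: "inj_on h (topspace X)"
    using homeomorphic_imp_injective_map[OF assms] .
  have "homeomorphic_map Y X g"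
    using g homeomorphic_maps_map by blast
  moreover have "g y = (\<lambda>y\<in>topspace Y. inv_into (topspace X) h y) y" if y: "y \<in> topspace Y" for y
  proof -
    have "g y \<in> topspace X" "h (g y) = y"
      using g y continuous_map_image_subset_topspace[of Y X g] by (auto simp: homeomorphic_maps_def)
    then have "inv_into (topspace X) h y = g y"
      using inv_into_f_f[OF inj] by metis
    then show ?thesis
      using y by simp
  qed
  ultimately show ?thesis
    by (rule homeomorphic_map_eq)
qed

lemma homeomorphic_map_compose_restrict:
  assumes "homeomorphic_map X Y h" "homeomorphic_map Y Z g"
  shows "homeomorphic_map X Z (compose (topspace X) g h)"
  using homeomorphic_map_compose[OF assms] by (rule homeomorphic_map_eq) (simp add: compose_def)

lemma interval_homeos_id: "0 < L \<Longrightarrow> (\<lambda>x\<in>{0..L}. x) \<in> interval_homeos L L"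
  unfolding interval_homeos_def
  by (auto simp: mono_on_def intro!: homeomorphic_map_eq[OF homeomorphic_map_id[THEN iffD2, OF refl]])

lemma interval_homeos_comp:
  assumes h: "h \<in> interval_homeos L L'" and g: "g \<in> interval_homeos L' L''"
  shows "compose {0..L} g h \<in> interval_homeos L L''"
proof -
  have "homeomorphic_map (top_of_set {0..L}) (top_of_set {0..L''}) (compose {0..L} g h)"
    using homeomorphic_map_compose_restrict[of "top_of_set {0..L}" "top_of_set {0..L'}" h
        "top_of_set {0..L''}" g] h g
    by (simp add: interval_homeos_def)
  moreover have "mono_on {0..L} (compose {0..L} g h)"
    using h g interval_homeos_mem[OF h] unfolding interval_homeos_def mono_on_def
    by (simp add: compose_def)
  ultimately show ?thesis
    using h g by (simp add: interval_homeos_def)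
qed

lemma interval_homeos_inv:
  assumes h: "h \<in> interval_homeos L L'"
  shows "(\<lambda>y\<in>{0..L'}. inv_into {0..L} h y) \<in> interval_homeos L' L"
proof -
  have "homeomorphic_map (top_of_set {0..L'}) (top_of_set {0..L}) (\<lambda>y\<in>{0..L'}. inv_into {0..L} h y)"
    using homeomorphic_map_inv_into[of "top_of_set {0..L}" "top_of_set {0..L'}" h] h
    by (simp add: interval_homeos_def)
  moreover have "mono_on {0..L'} (\<lambda>y\<in>{0..L'}. inv_into {0..L} h y)"
  proof (rule mono_onI)
    fix y z assume yz: "y \<in> {0..L'}" "z \<in> {0..L'}" "y \<le> z"
    obtain u v where uv: "u \<in> {0..L}" "y = h u" "v \<in> {0..L}" "z = h v"
      using yz(1,2) interval_homeos_bij[OF h] by (metis bij_betw_imp_surj_on imageE)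
    have "inv_into {0..L} h y = u" "inv_into {0..L} h z = v"
      using uv interval_homeos_bij[OF h] by (auto simp: bij_betw_def)
    then show "(\<lambda>y\<in>{0..L'}. inv_into {0..L} h y) y \<le> (\<lambda>y\<in>{0..L'}. inv_into {0..L} h y) z"
      using yz uv interval_homeos_less_iff[OF h uv(3,1)] by auto
  qed
  ultimately show ?thesis
    using h by (simp add: interval_homeos_def)
qed

lemma homeo_interval_eq:
  "0 < L \<Longrightarrow> homeo_interval L = \<lparr>carrier = interval_homeos L L,
     monoid.mult = (\<lambda>\<alpha> \<beta>. compose {0..L} \<alpha> \<beta>), one = (\<lambda>x\<in>{0..L}. x)\<rparr>"
  by (simp add: homeo_interval_def interval_homeos_def)

lemma scale_interval_homeo:
  assumes "r > 0"
  shows "scale_interval r \<in> interval_homeos (real r) 1"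
proof -
  have "homeomorphic_maps (top_of_set {0..real r}) (top_of_set {0..1}) (\<lambda>x. x / real r) (\<lambda>x. x * real r)"
    unfolding homeomorphic_maps_def continuous_map_in_subtopology
    using assms by (auto simp: divide_le_eq_1 mult_left_le_one_le intro!: continuous_intros)
  then have "homeomorphic_map (top_of_set {0..real r}) (top_of_set {0..1}) (\<lambda>x. x / real r)"
    using homeomorphic_map_maps by blast
  then have "homeomorphic_map (top_of_set {0..real r}) (top_of_set {0..1}) (scale_interval r)"
    by (rule homeomorphic_map_eq) (simp add: scale_interval_def)
  then show ?thesis
    using assms by (auto simp: interval_homeos_def scale_interval_def mono_on_def divide_right_mono)
qed

subsection \<open>Cells as components\<close>

lemma in_cell_mem:
  assumes "z \<in> standard_simplex n" "i \<le> n" "k < r" "in_cell z k i x"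
  shows "x \<in> {0..real r} - cut_set r n z"
proof -
  have "real k < x" "x < real k + 1"
    using in_cell_floor[OF assms(1,2,4)] by auto
  moreover have "real k + 1 \<le> real r"
    using assms(3) by linarith
  ultimately show ?thesis
    using in_cell_not_cut[OF assms(1,2,4)] by auto
qed

lemma icomp_cell:
  assumes z: "z \<in> standard_simplex n" and i: "i \<le> n" "k < r" and x: "in_cell z k i x"
  shows "y \<in> icomp (real r) (cut_set r n z) x \<longleftrightarrow> in_cell z k i y"
proof
  note x' = in_cell_mem[OF z i x]
  assume "y \<in> icomp (real r) (cut_set r n z) x"
  then have y: "y \<notin> cut_set r n z" "\<forall>f\<in>cut_set r n z. f < x \<longleftrightarrow> f < y"
    unfolding icomp_iff[OF x'] by auto
  have l: "real k + cut z i \<in> cut_set r n z" "real k + cut z (Suc i) \<in> cut_set r n z"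
    using i by (auto intro: cut_setI)
  show "in_cell z k i y"
    using x l y unfolding in_cell_def by (metis linorder_neqE_linordered_idom order_less_asym)
next
  note x' = in_cell_mem[OF z i x]
  assume y: "in_cell z k i y"
  have "f < x \<longleftrightarrow> f < y" if f: "f \<in> cut_set r n z" for f
  proof -
    have "\<not> in_cell z k i f"
      using in_cell_not_cut[OF z i(1)] f by blast
    then show ?thesis
      using x y unfolding in_cell_def by auto
  qed
  then show "y \<in> icomp (real r) (cut_set r n z) x"
    unfolding icomp_iff[OF x'] using in_cell_mem[OF z i y] by blast
qed

lemma cut_index_cell:
  assumes z: "z \<in> standard_simplex n" and i: "i \<le> n" "k < r" and x: "in_cell z k i x"
  shows "cut_index r n z (icomp (real r) (cut_set r n z) x) = k * (n + 1) + i"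
proof -
  let ?C = "icomp (real r) (cut_set r n z) x"
  have C: "?C = {real k + cut z i <..< real k + cut z (i + 1)}"
  proof (rule Set.set_eqI)
    fix y
    show "y \<in> ?C \<longleftrightarrow> y \<in> {real k + cut z i <..< real k + cut z (i + 1)}"
      unfolding icomp_cell[OF z i x] by (simp add: in_cell_def)
  qed
  have xC: "x \<in> ?C"
    using icomp_cell[OF z i x] x by blast
  have "(THE j. \<exists>k<r. \<exists>i\<le>n. ?C = {real k + cut z i <..< real k + cut z (i + 1)} \<and> j = k * (n + 1) + i) =
      k * (n + 1) + i"
  proof (rule the_equality)
    show "\<exists>k'<r. \<exists>i'\<le>n. ?C = {real k' + cut z i' <..< real k' + cut z (i' + 1)} \<and>
        k * (n + 1) + i = k' * (n + 1) + i'"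
      using C i by blast
    fix j assume "\<exists>k<r. \<exists>i\<le>n. ?C = {real k + cut z i <..< real k + cut z (i + 1)} \<and> j = k * (n + 1) + i"
    then obtain k' i' where k': "k' < r" "i' \<le> n" "j = k' * (n + 1) + i'"
      and C': "?C = {real k' + cut z i' <..< real k' + cut z (i' + 1)}"
      by blast
    have "in_cell z k' i' x"
      using xC unfolding C' by (simp add: in_cell_def)
    then show "j = k * (n + 1) + i"
      using in_cell_unique[OF z i(1) k'(2) x] k' by simp
  qed
  moreover have "?C \<in> icomps (real r) (cut_set r n z)"
    using in_cell_mem[OF z i x] unfolding icomps_iff by blast
  ultimately show ?thesis
    by (simp add: cut_index_def)
qed

lemma cut_index_mono:
  assumes r: "r > 0" and z: "z \<in> standard_simplex n"
    and AB: "(A, B) \<in> pi0 (real r) (cut_set r n z)"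
  shows "(cut_index r n z A, cut_index r n z B) \<in> ord (r * (n + 1) - 1)"
proof -
  obtain x y where x: "x \<in> {0..real r} - cut_set r n z" and y: "y \<in> {0..real r} - cut_set r n z"
    and A: "A = icomp r (cut_set r n z) x" and B: "B = icomp r (cut_set r n z) y"
    and le: "\<forall>f\<in>cut_set r n z. f < x \<longrightarrow> f < y"
    using AB by (rule pi0E)
  obtain k i where k: "k < r" "i \<le> n" "in_cell z k i x"
    using in_cell_exists[OF z r x] by blast
  obtain l j where l: "l < r" "j \<le> n" "in_cell z l j y"
    using in_cell_exists[OF z r y] by blast
  have "k < l \<or> k = l \<and> i \<le> j"
  proof (cases "x \<le> y")
    case True
    then show ?thesis
      using in_cell_mono[OF z k(2) l(2) k(3) l(3)] by blast
  next
    case False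
    then have "y \<in> icomp (real r) (cut_set r n z) x"
      unfolding icomp_iff[OF x] using le y by auto
    then have "in_cell z k i y"
      using icomp_cell[OF z k(2,1,3)] by blast
    then show ?thesis
      using in_cell_unique[OF z k(2) l(2) _ l(3)] by blast
  qed
  then have "k * (n + 1) + i \<le> l * (n + 1) + j"
    using k by (intro sd_index_mono) auto
  moreover have "l * (n + 1) + j \<le> r * (n + 1) - 1"
    using l by (intro sd_index)
  ultimately show ?thesis
    unfolding A B cut_index_cell[OF z k(2,1,3)] cut_index_cell[OF z l(2,1,3)] by (simp add: ord_def)
qed

lemma cut_index_le:
  assumes "r > 0" "z \<in> standard_simplex n" "A \<in> icomps (real r) (cut_set r n z)"
  shows "cut_index r n z A \<le> r * (n + 1) - 1"
proof -
  have "(A, A) \<in> pi0 (real r) (cut_set r n z)"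
    using Linear_orderD(1)[OF Linear_order_pi0] assms(3) unfolding Field_pi0 by blast
  then show ?thesis
    using cut_index_mono[OF assms(1,2)] by (simp add: ord_def)
qed

text \<open>
  For an inner point every cell is nonempty, so every label occurs exactly once.
\<close>

lemma cut_index_bij:
  assumes r: "r > 0" and z: "inner_point n z"
  shows "bij_betw (cut_index r n z) (icomps (real r) (cut_set r n z)) {..r * (n + 1) - 1}"
proof (rule bij_betw_imageI)
  note z' = inner_pointD[OF z]
  show "inj_on (cut_index r n z) (icomps (real r) (cut_set r n z))"
  proof (rule inj_onI)
    fix A B assume "A \<in> icomps (real r) (cut_set r n z)" "B \<in> icomps (real r) (cut_set r n z)"
      and eq: "cut_index r n z A = cut_index r n z B"
    then obtain x y where x: "x \<in> {0..real r} - cut_set r n z" and y: "y \<in> {0..real r} - cut_set r n z"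
      and A: "A = icomp r (cut_set r n z) x" and B: "B = icomp r (cut_set r n z) y"
      unfolding icomps_iff by blast
    obtain k i where k: "k < r" "i \<le> n" "in_cell z k i x"
      using in_cell_exists[OF z' r x] by blast
    obtain l j where l: "l < r" "j \<le> n" "in_cell z l j y"
      using in_cell_exists[OF z' r y] by blast
    have "k = l \<and> i = j"
      using eq sd_index_inj[OF k(2) l(2)]
      unfolding A B cut_index_cell[OF z' k(2,1,3)] cut_index_cell[OF z' l(2,1,3)] by blast
    then show "A = B"
      unfolding A B using icomp_cell[OF z' k(2,1,3)] icomp_cell[OF z' l(2,1,3)] by blast
  qed
  show "cut_index r n z ` icomps (real r) (cut_set r n z) = {..r * (n + 1) - 1}"
  proof (intro equalityI subsetI)
    fix t assume "t \<in> {..r * (n + 1) - 1}"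
    then have "t \<le> r * (n + 1) - 1"
      by simp
    then obtain k i where k: "k < r" "i \<le> n" "t = k * (n + 1) + i"
      by (rule sd_indexE[OF r])
    have "cut z i < cut z (Suc i)"
      using k by (intro cut_strict_mono[OF z]) auto
    then have c: "in_cell z k i (real k + (cut z i + cut z (Suc i)) / 2)" (is "in_cell z k i ?x")
      by (auto simp: in_cell_def)
    have "icomp (real r) (cut_set r n z) ?x \<in> icomps (real r) (cut_set r n z)"
      using in_cell_mem[OF z' k(2,1) c] unfolding icomps_iff by blast
    then show "t \<in> cut_index r n z ` icomps (real r) (cut_set r n z)"
      using cut_index_cell[OF z' k(2,1) c] k(3) by (metis imageI)
  qed (use cut_index_le[OF r z'] in auto)
qed

section \<open>The simplicial case\<close>

abbreviation canon_mor :: "nat \<Rightarrow> nat \<Rightarrow> (nat \<Rightarrow> real) \<Rightarrow> elem \<Rightarrow> elem" where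
  "canon_mor r n z \<equiv> conj_map (icomps r (cut_set r n z)) Inr Inl (cut_index r n z)"

lemma canon_mor_mor:
  assumes "r > 0" "z \<in> standard_simplex n"
  shows "canon_mor r n z \<in> mor Delta_big (pi0_elem r (cut_set r n z)) (std_ord (r * (n + 1) - 1))"
  unfolding pi0_elem_def std_ord_def Field_pi0[symmetric]
proof (rule conj_map_mor_Delta_big)
  fix A assume "A \<in> Field (pi0 r (cut_set r n z))"
  then show "cut_index r n z A \<in> Field (ord (r * (n + 1) - 1))"
    using cut_index_le[OF assms] unfolding Field_pi0 by simp
qed (use cut_index_mono[OF assms] in auto)

lemma canon_mor_cell:
  assumes z: "z \<in> standard_simplex n" and i: "i \<le> n" "k < r" and x: "in_cell z k i x"
  shows "canon_mor r n z (Inr (icomp (real r) (cut_set r n z) x)) = Inl (k * (n + 1) + i)"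
proof -
  have "icomp (real r) (cut_set r n z) x \<in> icomps (real r) (cut_set r n z)"
    using in_cell_mem[OF assms] unfolding icomps_iff by blast
  then show ?thesis
    by (simp only: conj_map_apply[OF inj_Inr] cut_index_cell[OF assms])
qed

lemma canon_mor_bij:
  assumes r: "r > 0" and z: "inner_point n z"
  shows "bij_betw (canon_mor r n z) (Field (pi0_elem r (cut_set r n z)))
    (Field (std_ord (r * (n + 1) - 1)))"
proof -
  have inl: "bij_betw Inl {..r * (n + 1) - 1} (Inl ` {..r * (n + 1) - 1})"
    by (simp add: bij_betw_def)
  have inr: "bij_betw Inr (icomps r (cut_set r n z)) (Inr ` icomps r (cut_set r n z))"
    by (simp add: bij_betw_def)
  have "canon_mor r n z u = (Inl \<circ> (cut_index r n z \<circ> inv_into (icomps r (cut_set r n z)) Inr)) u"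
    if "u \<in> Inr ` icomps r (cut_set r n z)" for u
    using that by (simp add: conj_map_def)
  then show ?thesis
    unfolding Field_pi0_elem Field_std_ord
    using bij_betw_trans[OF bij_betw_trans[OF bij_betw_inv_into[OF inr] cut_index_bij[OF assms]] inl]
    by (subst bij_betw_cong) auto
qed

context
  fixes X :: "(nat, nat \<Rightarrow> nat, 'a) psh" and Xt :: "(elem rel, elem \<Rightarrow> elem, 'a) psh"
  assumes X: "presheaf Delta X" and ext: "extends_simplicial Xt X"
begin

lemma Xt: "presheaf Delta_big Xt"
  using ext by (simp add: extends_simplicial_def)

lemma pob_std_ord: "pob Xt (std_ord n) = pob X n"
  using ext by (simp add: extends_simplicial_def restricts_to_def)

lemma pact_std_ord:
  "f \<in> mor Delta m n \<Longrightarrow> x \<in> pob X n \<Longrightarrow>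
    pact Xt (std_ord m) (std_ord n) (std_ord_map m n f) x = pact X m n f x"
  using ext by (simp add: extends_simplicial_def restricts_to_def)

lemma std_ord_map_mor:
  assumes f: "f \<in> mor Delta m n"
  shows "std_ord_map m n f \<in> mor Delta_big (std_ord m) (std_ord n)"
  unfolding std_ord_def std_ord_map_def Field_ord[symmetric]
proof (rule conj_map_mor_Delta_big)
  fix a assume "a \<in> Field (ord m)"
  then show "f a \<in> Field (ord n)"
    using mor_DeltaD(1)[OF f] unfolding Field_ord by simp
qed (use mor_DeltaD[OF f] in \<open>auto simp: ord_def\<close>)

lemma fin_intervalD: "F \<in> fin_interval L \<Longrightarrow> finite F \<and> F \<subseteq> {0..L}"
  by (simp add: fin_interval_def)

lemma interval_obs: "0 < L \<Longrightarrow> F \<in> fin_interval L \<Longrightarrow> pi0_elem L F \<in> obs Delta_big"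
  by (intro pi0_elem_obs) (auto simp: fin_interval_def)

abbreviation "tr_int L F G \<equiv> conj_map (icomps L G) Inr Inr (pi0_refine L F G)"
abbreviation "iv_int L L' h F \<equiv> conj_map (icomps L' (h ` F)) Inr Inr (pi0_inv L L' h F)"

definition interval_iso :: "real \<Rightarrow> real \<Rightarrow> (real \<Rightarrow> real) \<Rightarrow> real set \<Rightarrow> 'a \<Rightarrow> 'a" where
  "interval_iso L L' h F = pact Xt (pi0_elem L' (h ` F)) (pi0_elem L F) (iv_int L L' h F)"

lemma interval_push_eq: "interval_push Xt L L' h F x = interval_in Xt L' (h ` F) (interval_iso L L' h F x)"
  by (simp add: interval_push_def interval_iso_def)

lemma interval_homeos_image:
  "h \<in> interval_homeos L L' \<Longrightarrow> F \<in> fin_interval L \<Longrightarrow> h ` F \<in> fin_interval L'"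
  using interval_homeos_mem[of h L L'] by (auto simp: fin_interval_def)

lemma pi0_elem_imageE:
  assumes h: "h \<in> interval_homeos L L'" and F: "F \<subseteq> {0..L}" and a: "a \<in> Field (pi0_elem L' (h ` F))"
  obtains x where "x \<in> {0..L} - F" "h x \<in> {0..L'} - h ` F" "a = Inr (icomp L' (h ` F) (h x))"
  using a interval_homeos_complement[OF h F] by (elim Field_pi0_elemE) blast

lemma interval_homeo_colimits:
  "homeo_colimits (\<lambda>L. {0..L}) interval_homeos fin_interval (interval_val Xt) (interval_trans Xt)
     interval_iso"
proof -
  have eqs: "interval_val Xt = (\<lambda>L F. pob Xt (pi0_elem L F))"
    "interval_trans Xt = (\<lambda>L F G. pact Xt (pi0_elem L G) (pi0_elem L F) (tr_int L F G))"
    "interval_iso = (\<lambda>L L' h F. pact Xt (pi0_elem L' (h ` F)) (pi0_elem L F) (iv_int L L' h F))"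
    by (auto simp: fun_eq_iff interval_val_def interval_trans_def interval_iso_def)
  show ?thesis
    unfolding eqs
  proof (rule homeo_colimits_presheaf[OF Xt])
    fix L L' L'' :: real and h g :: "real \<Rightarrow> real" and F G K :: "real set"
    show "h \<in> interval_homeos L L' \<Longrightarrow> 0 < L \<and> 0 < L'"
      "h \<in> interval_homeos L L' \<Longrightarrow> h \<in> extensional {0..L}"
      by (simp_all add: interval_homeos_def)
    show "0 < L \<Longrightarrow> fin_interval L \<noteq> {}" "F \<in> fin_interval L \<Longrightarrow> F \<subseteq> {0..L}"
      "F \<in> fin_interval L \<Longrightarrow> G \<in> fin_interval L \<Longrightarrow> F \<union> G \<in> fin_interval L"
      by (auto simp: fin_interval_def)
    show "tr_int L F F = idm Delta_big (pi0_elem L F)"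
    proof (rule mor_Delta_big_eqI[OF refine_mor(1)[OF subset_refl] idm_Delta_big_mor])
      fix a assume a: "a \<in> Field (pi0_elem L F)"
      then obtain x where x: "x \<in> {0..L} - F" "a = Inr (icomp L F x)"
        by (rule Field_pi0_elemE)
      show "tr_int L F F a = idm Delta_big (pi0_elem L F) a"
        unfolding idm_Delta_big_apply[OF a] unfolding x(2) by (rule refine_mor(2)[OF subset_refl x(1)])
    qed
    show "cmp Delta_big (pi0_elem L K) (pi0_elem L G) (pi0_elem L F) (tr_int L F G) (tr_int L G K) =
        tr_int L F K" if FG: "F \<subseteq> G" and GK: "G \<subseteq> K"
    proof (rule mor_Delta_big_eqI[OF cmp_Delta_big_mor[OF refine_mor(1)[OF GK] refine_mor(1)[OF FG]]
          refine_mor(1)[OF order_trans[OF FG GK]]])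
      fix a assume a: "a \<in> Field (pi0_elem L K)"
      then obtain x where x: "x \<in> {0..L} - K" "a = Inr (icomp L K x)"
        by (rule Field_pi0_elemE)
      then have x': "x \<in> {0..L} - G"
        using GK by blast
      show "cmp Delta_big (pi0_elem L K) (pi0_elem L G) (pi0_elem L F) (tr_int L F G) (tr_int L G K) a =
          tr_int L F K a"
        unfolding cmp_Delta_big_apply[OF a]
        unfolding x(2) refine_mor(2)[OF GK x(1)] refine_mor(2)[OF FG x']
          refine_mor(2)[OF order_trans[OF FG GK] x(1)] ..
    qed
    show "iv_int L L (\<lambda>x\<in>{0..L}. x) F = idm Delta_big (pi0_elem L F)"
      if L: "0 < L" and F: "F \<in> fin_interval L"
    proof -
      have sub: "F \<subseteq> {0..L}" and im: "(\<lambda>x\<in>{0..L}. x) ` F = F"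
        using fin_intervalD[OF F] by auto
      note m = pi0_inv_mor[OF interval_homeos_id[OF L] sub, unfolded im]
      show ?thesis
        unfolding im
      proof (rule mor_Delta_big_eqI[OF m(1) idm_Delta_big_mor])
        fix a assume a: "a \<in> Field (pi0_elem L F)"
        then obtain y where y: "y \<in> {0..L} - F" "a = Inr (icomp L F y)"
          by (rule Field_pi0_elemE)
        then show "conj_map (icomps L F) Inr Inr (pi0_inv L L (\<lambda>x\<in>{0..L}. x) F) a =
            idm Delta_big (pi0_elem L F) a"
          unfolding idm_Delta_big_apply[OF a] using m(2)[OF y(1)] by simp
      qed
    qed
    assume h: "h \<in> interval_homeos L L'" and F: "F \<in> fin_interval L"
    have sub: "F \<subseteq> {0..L}" and sub': "h ` F \<subseteq> {0..L'}"
      using fin_intervalD[OF F] fin_intervalD[OF interval_homeos_image[OF h F]] by auto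
    note m1 = pi0_inv_mor[OF h sub]
    show "iv_int L L' h F \<in> mor Delta_big (pi0_elem L' (h ` F)) (pi0_elem L F)"
      by (rule m1(1))
    show "cmp Delta_big (pi0_elem L'' (g ` h ` F)) (pi0_elem L' (h ` F)) (pi0_elem L F) (iv_int L L' h F)
        (iv_int L' L'' g (h ` F)) = iv_int L L'' (compose {0..L} g h) F"
      if g: "g \<in> interval_homeos L' L''"
    proof -
      have im: "compose {0..L} g h ` F = g ` h ` F"
        using sub by (rule compose_image)
      note m2 = pi0_inv_mor[OF g sub'] and m3 = pi0_inv_mor[OF interval_homeos_comp[OF h g] sub, unfolded im]
      show ?thesis
        unfolding im
      proof (rule mor_Delta_big_eqI[OF cmp_Delta_big_mor[OF m2(1) m1(1)] m3(1)])
        fix a assume a: "a \<in> Field (pi0_elem L'' (g ` h ` F))"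
        obtain v where v: "v \<in> {0..L'} - h ` F" "g v \<in> {0..L''} - g ` h ` F"
          "a = Inr (icomp L'' (g ` h ` F) (g v))"
          by (rule pi0_elem_imageE[OF g sub' a])
        then obtain u where u: "u \<in> {0..L} - F" "v = h u"
          using interval_homeos_complement[OF h sub v(1)] by blast
        have comp: "compose {0..L} g h u = g (h u)"
          using u by (simp add: compose_def)
        show "cmp Delta_big (pi0_elem L'' (g ` h ` F)) (pi0_elem L' (h ` F)) (pi0_elem L F)
            (iv_int L L' h F) (iv_int L' L'' g (h ` F)) a =
          conj_map (icomps L'' (g ` h ` F)) Inr Inr (pi0_inv L L'' (compose {0..L} g h) F) a"
          unfolding cmp_Delta_big_apply[OF a]
          unfolding v(3) m2(2)[OF v(1)] unfolding u(2) m1(2)[OF u(1)] m3(2)[OF u(1), unfolded comp] ..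
      qed
    qed
    assume G: "G \<in> fin_interval L" and FG: "F \<subseteq> G"
    have sub2: "G \<subseteq> {0..L}"
      using fin_intervalD[OF G] by simp
    note m2 = pi0_inv_mor[OF h sub2] and t = refine_mor[OF FG, where L = L]
      and t' = refine_mor[OF image_mono[OF FG, of h], where L = L']
    show "cmp Delta_big (pi0_elem L' (h ` G)) (pi0_elem L' (h ` F)) (pi0_elem L F) (iv_int L L' h F)
        (tr_int L' (h ` F) (h ` G)) =
      cmp Delta_big (pi0_elem L' (h ` G)) (pi0_elem L G) (pi0_elem L F) (tr_int L F G) (iv_int L L' h G)"
    proof (rule mor_Delta_big_eqI[OF cmp_Delta_big_mor[OF t'(1) m1(1)] cmp_Delta_big_mor[OF m2(1) t(1)]])
      fix a assume a: "a \<in> Field (pi0_elem L' (h ` G))"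
      obtain u where u: "u \<in> {0..L} - G" "h u \<in> {0..L'} - h ` G" "a = Inr (icomp L' (h ` G) (h u))"
        by (rule pi0_elem_imageE[OF h sub2 a])
      then have u': "u \<in> {0..L} - F"
        using FG by auto
      show "cmp Delta_big (pi0_elem L' (h ` G)) (pi0_elem L' (h ` F)) (pi0_elem L F) (iv_int L L' h F)
          (tr_int L' (h ` F) (h ` G)) a =
        cmp Delta_big (pi0_elem L' (h ` G)) (pi0_elem L G) (pi0_elem L F) (tr_int L F G) (iv_int L L' h G) a"
        unfolding cmp_Delta_big_apply[OF a]
        unfolding u(3) t'(2)[OF u(2)] m1(2)[OF u'] m2(2)[OF u(1)] t(2)[OF u(1)] ..
    qed
  qed (fact interval_homeos_bij interval_homeos_id interval_homeos_comp interval_homeos_inv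
      interval_homeos_image interval_obs | rule refine_mor(1), assumption)+
qed

lemma interval_realization:
  assumes r: "r > 0"
  shows "\<exists>\<kappa>. bij_betw \<kappa> (realization (sd r X)) (interval_colim Xt (real r)) \<and>
    (\<forall>n. \<forall>\<xi>\<in>pob X (r * (n + 1) - 1). \<forall>z\<in>standard_simplex n.
       \<kappa> (realization_point (sd r X) (n, \<xi>, z)) = interval_canon Xt r n \<xi> z)"
proof -
  let ?L = "real r"
  have L: "0 < ?L"
    using r by simp
  define \<psi> where "\<psi> n z = pact Xt (pi0_elem ?L (cut_set r n z)) (std_ord (r * (n + 1) - 1)) (canon_mor r n z)"
    for n z
  have pob_sd: "pob (sd r X) n = pob Xt (std_ord (r * (n + 1) - 1))" for n
    by (simp add: sd_def pob_std_ord)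
  note cs = cut_set_fin_interval
  note oc = interval_obs[OF L cs]
  have "\<exists>\<kappa>. bij_betw \<kappa> (realization (sd r X)) (colim (fin_interval ?L) (interval_val Xt ?L) (interval_trans Xt ?L)) \<and>
    (\<forall>n. \<forall>\<xi>\<in>pob (sd r X) n. \<forall>z\<in>standard_simplex n. \<kappa> (realization_point (sd r X) (n, \<xi>, z)) =
       colim_in (fin_interval ?L) (interval_val Xt ?L) (interval_trans Xt ?L) (cut_set r n z) (\<psi> n z \<xi>))"
  proof (rule realization_as_colimit[OF sd_presheaf[OF r X] homeo_colimits.fd[OF interval_homeo_colimits L] cs])
    show "\<psi> n z x \<in> interval_val Xt ?L (cut_set r n z)"
      if "z \<in> standard_simplex n" "x \<in> pob (sd r X) n" for n z x
      using presheaf_pact_mem[OF Xt oc[OF that(1)] std_ord_obs canon_mor_mor[OF r that(1)]] that(2)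
      by (simp add: interval_val_def \<psi>_def pob_sd)
    show "cut_set r n (simplex_push m \<theta> z) \<subseteq> cut_set r m z" if "\<theta> \<in> mor Delta m n" for m n \<theta> z
      using that by (rule cut_set_push_subset)
    show "bij_betw (\<psi> n z) (pob (sd r X) n) (interval_val Xt ?L (cut_set r n z))"
      if "inner_point n z" for n z
      using Delta_big_pact_bij[OF Xt oc[OF inner_pointD[OF that]] std_ord_obs
          canon_mor_mor[OF r inner_pointD[OF that]] canon_mor_bij[OF r that]]
      by (simp add: interval_val_def \<psi>_def pob_sd)
    show "\<exists>n z. inner_point n z \<and> F \<subseteq> cut_set r n z" if "F \<in> fin_interval ?L" for F
      using cut_set_cofinal[OF that r] by blast
    show "\<exists>\<theta>\<in>mor Delta m n. z = simplex_push m \<theta> w"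
      if "z \<in> standard_simplex n" "inner_point m w" "cut_set r n z \<subseteq> cut_set r m w" for n z m w
      by (rule cut_set_detect[OF that(1,2) r that(3)])
    fix m n \<theta> z x assume \<theta>: "\<theta> \<in> mor Delta m n" and z: "z \<in> standard_simplex m" and x: "x \<in> pob (sd r X) n"
    let ?w = "simplex_push m \<theta> z" and ?N = "\<lambda>n. r * (n + 1) - 1"
    note w = simplex_push_simplex[OF \<theta> z] and sub = cut_set_push_subset[OF \<theta>, of r z]
      and s\<theta> = sd_map_mor[OF r \<theta>]
    have x': "x \<in> pob Xt (std_ord (?N n))" "x \<in> pob X (?N n)"
      using x by (simp_all add: pob_sd pob_std_ord del: One_nat_def)
    note m1 = refine_mor[OF sub, where L = ?L] and m2 = canon_mor_mor[OF r w] and m3 = canon_mor_mor[OF r z]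
      and m4 = std_ord_map_mor[OF s\<theta>]
    have "interval_trans Xt ?L (cut_set r n ?w) (cut_set r m z) (\<psi> n ?w x) =
      pact Xt (pi0_elem ?L (cut_set r m z)) (std_ord (?N n))
        (cmp Delta_big (pi0_elem ?L (cut_set r m z)) (std_ord (?N m)) (std_ord (?N n))
          (std_ord_map (?N m) (?N n) (sd_map r m n \<theta>)) (canon_mor r m z)) x"
      unfolding interval_trans_def \<psi>_def
    proof (rule Delta_big_pact_comp[OF Xt oc[OF z] oc[OF w] std_ord_obs m1(1) m2 cmp_Delta_big_mor[OF m3 m4] _ x'(1)])
      fix a assume a: "a \<in> Field (pi0_elem ?L (cut_set r m z))"
      then obtain y where y: "y \<in> {0..?L} - cut_set r m z" "a = Inr (icomp ?L (cut_set r m z) y)"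
        by (rule Field_pi0_elemE)
      obtain k j where k: "k < r" "j \<le> m" "in_cell z k j y"
        using in_cell_exists[OF z r y(1)] by blast
      have "std_ord_map (?N m) (?N n) (sd_map r m n \<theta>) (Inl (k * (m + 1) + j)) = Inl (k * (n + 1) + \<theta> j)"
      proof -
        have "k * (m + 1) + j \<in> {..?N m}"
          using sd_index[OF k(1,2)] by simp
        then show ?thesis
          unfolding std_ord_map_def by (simp only: conj_map_apply[OF inj_Inl] sd_map_index[OF k(1,2)])
      qed
      then show "canon_mor r n ?w (conj_map (icomps ?L (cut_set r m z)) Inr Inr
            (pi0_refine ?L (cut_set r n ?w) (cut_set r m z)) a) =
          cmp Delta_big (pi0_elem ?L (cut_set r m z)) (std_ord (?N m)) (std_ord (?N n))
            (std_ord_map (?N m) (?N n) (sd_map r m n \<theta>)) (canon_mor r m z) a"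
        unfolding cmp_Delta_big_apply[OF a]
        unfolding y(2) m1(2)[OF y(1)] canon_mor_cell[OF z k(2,1,3)]
          canon_mor_cell[OF w mor_DeltaD(1)[OF \<theta> k(2)] k(1) in_cell_push[OF \<theta> z k(2,3)]] by simp
    qed
    also have "\<dots> = \<psi> m z (pact (sd r X) m n \<theta> x)"
      unfolding \<psi>_def
      using presheaf_pact_comp[OF Xt oc[OF z] std_ord_obs std_ord_obs m3 m4 x'(1)] pact_std_ord[OF s\<theta> x'(2)]
      by (simp add: sd_def)
    finally show "interval_trans Xt ?L (cut_set r n ?w) (cut_set r m z) (\<psi> n ?w x) =
        \<psi> m z (pact (sd r X) m n \<theta> x)" .
  qed
  then show ?thesis
    unfolding interval_colim_def interval_canon_def interval_in_def \<psi>_def by (simp add: sd_def)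
qed

text \<open>
  The rescaling turns the \<open>k\<close>-th copy of the \<open>i\<close>-th cell of \<open>z\<close> into the cell of \<open>spread r n z\<close> with number
  \<open>k (n + 1) + i\<close>, so both sides carry the same labels. This computes \<open>D\<^sub>r\<close> on representatives.
\<close>

lemma interval_iso_canon:
  assumes r: "r > 0" and z: "z \<in> standard_simplex n" and \<xi>: "\<xi> \<in> pob X (r * (n + 1) - 1)"
  defines "F \<equiv> cut_set r n z" and "s \<equiv> scale_interval r"
  shows "interval_in Xt 1 (s ` F) (interval_iso r 1 s F
      (pact Xt (pi0_elem r F) (std_ord (r * (n + 1) - 1)) (canon_mor r n z) \<xi>)) =
    interval_canon Xt 1 (r * (n + 1) - 1) \<xi> (spread r n z)"
proof -
  let ?N = "r * (n + 1) - 1"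
  note s = scale_interval_homeo[OF r] and w = spread_simplex[OF r z]
  have F: "F \<in> fin_interval (real r)" "F \<subseteq> {0..real r}"
    using cut_set_fin_interval[OF z] fin_intervalD unfolding F_def by auto
  have L: "0 < real r" "(0::real) < 1"
    using r by auto
  have sF: "s ` F = cut_set 1 ?N (spread r n z)"
  proof -
    have "s ` F = (\<lambda>x. x / real r) ` F"
      using F(2) by (intro image_cong) (auto simp: s_def scale_interval_def)
    then show ?thesis
      unfolding cut_set_spread[OF r z] F_def .
  qed
  have N1: "1 * (?N + 1) - 1 = ?N"
    by simp
  note m2 = canon_mor_mor[OF zero_less_one w, unfolded N1 of_nat_1] and m1 = pi0_inv_mor[OF s F(2), folded s_def]
    and m3 = canon_mor_mor[OF r z, folded F_def]
  let ?c1 = "conj_map (icomps 1 (s ` F)) Inr Inl (cut_index 1 ?N (spread r n z)) :: elem \<Rightarrow> elem"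
  let ?cr = "conj_map (icomps r F) Inr Inl (cut_index r n z) :: elem \<Rightarrow> elem"
  have "interval_iso r 1 s F (pact Xt (pi0_elem r F) (std_ord ?N) ?cr \<xi>) =
      pact Xt (pi0_elem 1 (s ` F)) (std_ord ?N) ?c1 \<xi>"
    unfolding interval_iso_def
  proof (rule Delta_big_pact_comp[OF Xt _ _ std_ord_obs m1(1) m3 m2[folded sF]])
    show "pi0_elem 1 (s ` F) \<in> obs Delta_big" "pi0_elem r F \<in> obs Delta_big"
      using interval_obs[OF L(1) F(1)] interval_obs[OF L(2) interval_homeos_image[OF s F(1)]]
      by (simp_all add: s_def)
    fix a assume a: "a \<in> Field (pi0_elem 1 (s ` F))"
    obtain u where u: "u \<in> {0..real r} - F" "s u \<in> {0..1} - s ` F" "a = Inr (icomp 1 (s ` F) (s u))"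
      by (rule pi0_elem_imageE[OF s F(2) a[unfolded s_def], folded s_def])
    obtain k i where k: "k < r" "i \<le> n" "in_cell z k i u"
      using in_cell_exists[OF z r] u(1) unfolding F_def by blast
    have su: "s u = u / real r"
      using u(1) by (simp add: s_def scale_interval_def)
    have c: "in_cell (spread r n z) 0 (k * (n + 1) + i) (s u)"
      unfolding su by (rule in_cell_spread[OF r z k])
    show "?cr (conj_map (icomps 1 (s ` F)) Inr Inr (pi0_inv r 1 s F) a) = ?c1 a"
      unfolding u(3) m1(2)[OF u(1)]
      using canon_mor_cell[OF z k(2,1,3)] canon_mor_cell[OF w sd_index[OF k(1,2)] zero_less_one c]
      unfolding F_def[symmetric] sF[symmetric] by simp
  qed (use \<xi> in \<open>simp add: pob_std_ord\<close>)
  then show ?thesis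
    unfolding interval_canon_def N1 of_nat_1 sF[symmetric] F_def[symmetric] by simp
qed

lemma simplicial_case:
  assumes r: "r > 0"
  shows "filtered_diagram (fin_interval r) (interval_val Xt r) (interval_trans Xt r) \<and>
      (\<exists>\<kappa>\<^sub>r \<kappa>\<^sub>1 \<rho>\<^sub>r \<rho>\<^sub>1 D.
         bij_betw \<kappa>\<^sub>r (realization (sd r X)) (interval_colim Xt r) \<and>
         (\<forall>n. \<forall>\<xi>\<in>pob X (r * (n + 1) - 1). \<forall>z\<in>standard_simplex n.
            \<kappa>\<^sub>r (realization_point (sd r X) (n, \<xi>, z)) = interval_canon Xt r n \<xi> z) \<and>
         bij_betw \<kappa>\<^sub>1 (realization X) (interval_colim Xt 1) \<and>
         (\<forall>n. \<forall>\<xi>\<in>pob X n. \<forall>z\<in>standard_simplex n.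
            \<kappa>\<^sub>1 (realization_point X (n, \<xi>, z)) = interval_canon Xt 1 n \<xi> z) \<and>
         group_action (homeo_interval r) (realization (sd r X)) \<rho>\<^sub>r \<and>
         (\<forall>\<alpha>\<in>carrier (homeo_interval r). \<forall>p\<in>realization (sd r X).
            \<forall>F\<in>fin_interval r. \<forall>x\<in>interval_val Xt r F.
              \<kappa>\<^sub>r p = interval_in Xt r F x \<longrightarrow> \<kappa>\<^sub>r (\<rho>\<^sub>r \<alpha> p) = interval_push Xt r r \<alpha> F x) \<and>
         group_action (homeo_interval 1) (realization X) \<rho>\<^sub>1 \<and>
         (\<forall>\<alpha>\<in>carrier (homeo_interval 1). \<forall>p\<in>realization X.
            \<forall>F\<in>fin_interval 1. \<forall>x\<in>interval_val Xt 1 F.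
              \<kappa>\<^sub>1 p = interval_in Xt 1 F x \<longrightarrow> \<kappa>\<^sub>1 (\<rho>\<^sub>1 \<alpha> p) = interval_push Xt 1 1 \<alpha> F x) \<and>
         homeomorphic_map (realization_top (sd r X)) (realization_top X) D \<and>
         (\<forall>p\<in>realization (sd r X). \<forall>F\<in>fin_interval r. \<forall>x\<in>interval_val Xt r F.
            \<kappa>\<^sub>r p = interval_in Xt r F x \<longrightarrow>
            \<kappa>\<^sub>1 (D p) = interval_push Xt r 1 (scale_interval r) F x) \<and>
         conjugate {0..real r} {0..1} (scale_interval r) \<in> iso (homeo_interval r) (homeo_interval 1) \<and>
         (\<forall>\<alpha>\<in>carrier (homeo_interval r). \<forall>p\<in>realization (sd r X).
            D (\<rho>\<^sub>r \<alpha> p) = \<rho>\<^sub>1 (conjugate {0..real r} {0..1} (scale_interval r) \<alpha>) (D p)))"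
proof -
  interpret hc: homeo_colimits "\<lambda>L. {0..L}" interval_homeos fin_interval "interval_val Xt"
      "interval_trans Xt" interval_iso
    by (rule interval_homeo_colimits)
  have L: "0 < real r"
    using r by simp
  note s = scale_interval_homeo[OF r]
  obtain \<kappa>\<^sub>r where \<kappa>\<^sub>r: "bij_betw \<kappa>\<^sub>r (realization (sd r X)) (interval_colim Xt (real r))"
    and canon_r: "\<forall>n. \<forall>\<xi>\<in>pob X (r * (n + 1) - 1). \<forall>z\<in>standard_simplex n.
       \<kappa>\<^sub>r (realization_point (sd r X) (n, \<xi>, z)) = interval_canon Xt r n \<xi> z"
    using interval_realization[OF r] by blast
  obtain \<kappa>\<^sub>1 where \<kappa>\<^sub>1: "bij_betw \<kappa>\<^sub>1 (realization X) (interval_colim Xt 1)"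
    and canon_1: "\<forall>n. \<forall>\<xi>\<in>pob X n. \<forall>z\<in>standard_simplex n.
       \<kappa>\<^sub>1 (realization_point X (n, \<xi>, z)) = interval_canon Xt 1 n \<xi> z"
    using interval_realization[OF zero_less_one] unfolding sd_1 by auto
  have grp: "homeo_interval L = hc.Gr L" if "0 < L" for L
    using homeo_interval_eq[OF that] by (simp add: hc.Gr_def)
  obtain \<rho>\<^sub>r \<rho>\<^sub>1 D where
    *: "group_action (hc.Gr r) (realization (sd r X)) \<rho>\<^sub>r"
      "\<forall>\<alpha>\<in>interval_homeos r r. \<forall>p\<in>realization (sd r X). \<forall>F\<in>fin_interval r. \<forall>x\<in>interval_val Xt r F.
         \<kappa>\<^sub>r p = hc.inn r F x \<longrightarrow> \<kappa>\<^sub>r (\<rho>\<^sub>r \<alpha> p) = hc.inn r (\<alpha> ` F) (interval_iso r r \<alpha> F x)"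
      "group_action (hc.Gr 1) (realization X) \<rho>\<^sub>1"
      "\<forall>\<alpha>\<in>interval_homeos 1 1. \<forall>p\<in>realization X. \<forall>F\<in>fin_interval 1. \<forall>x\<in>interval_val Xt 1 F.
         \<kappa>\<^sub>1 p = hc.inn 1 F x \<longrightarrow> \<kappa>\<^sub>1 (\<rho>\<^sub>1 \<alpha> p) = hc.inn 1 (\<alpha> ` F) (interval_iso 1 1 \<alpha> F x)"
    and D_bij: "bij_betw D (realization (sd r X)) (realization X)"
    and D: "\<forall>p\<in>realization (sd r X). \<forall>F\<in>fin_interval r. \<forall>x\<in>interval_val Xt r F.
         \<kappa>\<^sub>r p = hc.inn r F x \<longrightarrow>
         \<kappa>\<^sub>1 (D p) = hc.inn 1 (scale_interval r ` F) (interval_iso r 1 (scale_interval r) F x)"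
    and equi: "\<forall>\<alpha>\<in>interval_homeos r r. \<forall>p\<in>realization (sd r X).
         D (\<rho>\<^sub>r \<alpha> p) = \<rho>\<^sub>1 (conjugate {0..real r} {0..1} (scale_interval r) \<alpha>) (D p)"
    using hc.actions_and_rescaling[OF s \<kappa>\<^sub>r[unfolded interval_colim_def] \<kappa>\<^sub>1[unfolded interval_colim_def]]
    by (elim exE conjE) (rule that; assumption)
  have D_spread: "D (realization_point (sd r X) (n, \<xi>, z)) =
      realization_point X (r * (n + 1) - 1, \<xi>, spread r n z)"
    if \<xi>: "\<xi> \<in> pob X (r * (n + 1) - 1)" and z: "z \<in> standard_simplex n" for n \<xi> z
  proof -
    let ?F = "cut_set r n z"
    let ?x = "pact Xt (pi0_elem r ?F) (std_ord (r * (n + 1) - 1)) (canon_mor r n z) \<xi>"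
    have p: "realization_point (sd r X) (n, \<xi>, z) \<in> realization (sd r X)"
      using \<xi> z by (intro realization_pointI) (simp_all add: sd_def)
    have x: "?x \<in> interval_val Xt r ?F"
      using presheaf_pact_mem[OF Xt interval_obs[OF L cut_set_fin_interval[OF z]] std_ord_obs
          canon_mor_mor[OF r z]] \<xi> by (simp add: interval_val_def pob_std_ord)
    have "\<kappa>\<^sub>r (realization_point (sd r X) (n, \<xi>, z)) = hc.inn r ?F ?x"
      unfolding canon_r[rule_format, OF \<xi> z] by (simp add: interval_canon_def interval_in_def)
    from D[rule_format, OF p cut_set_fin_interval[OF z] x this]
    have "\<kappa>\<^sub>1 (D (realization_point (sd r X) (n, \<xi>, z))) =
        \<kappa>\<^sub>1 (realization_point X (r * (n + 1) - 1, \<xi>, spread r n z))"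
      unfolding interval_iso_canon[OF r z \<xi>, unfolded interval_in_def]
        canon_1[rule_format, OF \<xi> spread_simplex[OF r z]] .
    then show ?thesis
      using \<kappa>\<^sub>1 bij_betwE[OF D_bij] p realization_pointI[OF \<xi> spread_simplex[OF r z]]
      by (auto simp: bij_betw_def inj_on_def)
  qed
  have homeo: "homeomorphic_map (realization_top (sd r X)) (realization_top X) D"
    using r X D_bij D_spread by (rule homeomorphic_map_spread)
  have conj: "conjugate {0..real r} {0..1} (scale_interval r) \<in> iso (homeo_interval r) (homeo_interval 1)"
    unfolding grp[OF L] grp[OF zero_less_one] by (rule hc.conjugate_iso[OF s])
  have carr: "carrier (homeo_interval r) = interval_homeos r r"
    "carrier (homeo_interval 1) = interval_homeos 1 1"
    using L by (simp_all add: homeo_interval_eq)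
  show ?thesis
    unfolding carr unfolding interval_push_eq interval_in_def
    by (intro conjI exI[of _ \<kappa>\<^sub>r] exI[of _ \<kappa>\<^sub>1] exI[of _ \<rho>\<^sub>r] exI[of _ \<rho>\<^sub>1] exI[of _ D])
      (fact hc.fd[OF L] \<kappa>\<^sub>r canon_r \<kappa>\<^sub>1 canon_1 *[folded grp[OF L] grp[OF zero_less_one]] homeo D conj equi)+
qed

end

section \<open>Paths on the circle\<close>

lemma circ_pt_iff:
  "circ_pt L x = circ_pt L y \<longleftrightarrow> (\<exists>k::int. y = x + L * of_int k)"
proof
  assume "circ_pt L x = circ_pt L y"
  moreover have "y \<in> circ_pt L y"
    by (auto simp: circ_pt_def intro: exI[of _ "0::int"])
  ultimately show "\<exists>k::int. y = x + L * of_int k"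
    by (auto simp: circ_pt_def)
next
  assume "\<exists>k::int. y = x + L * of_int k"
  then obtain k :: int where k: "y = x + L * of_int k" ..
  have 1: "y + L * of_int j = x + L * of_int (k + j)" "x + L * of_int j = y + L * of_int (j - k)" for j
    unfolding k by (simp_all add: algebra_simps)
  have "z \<in> circ_pt L x \<longleftrightarrow> z \<in> circ_pt L y" for z
    unfolding circ_pt_def mem_Collect_eq simp_thms using 1 by metis
  then show "circ_pt L x = circ_pt L y"
    by blast
qed

lemma circ_pt_shift [simp]: "circ_pt L (x + L * of_int k) = circ_pt L x"
  using circ_pt_iff[of L x "x + L * of_int k"] by auto

lemma circ_pt_shift1 [simp]: "circ_pt L (x + L) = circ_pt L x"
  using circ_pt_shift[of L x 1] by simp

lemma circ_eq: "circ L = range (circ_pt L)"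
  by (simp add: circ_top_def)

lemma circ_pt_mem [simp]: "circ_pt L x \<in> circ L"
  by (simp add: circ_eq)

lemma openin_circ:
  "openin (circ_top L) U \<longleftrightarrow> U \<subseteq> circ L \<and> open {x. circ_pt L x \<in> U}"
  by (simp add: circ_top_def openin_quotient_topology)

lemma continuous_map_circ_pt: "continuous_map euclideanreal (circ_top L) (circ_pt L)"
  by (auto simp: continuous_map openin_circ)

lemma continuous_map_from_circ:
  assumes "\<And>P. P \<in> circ L \<Longrightarrow> g P \<in> topspace Y"
    and "continuous_map euclideanreal Y (\<lambda>x. g (circ_pt L x))"
  shows "continuous_map (circ_top L) Y g"
  unfolding continuous_map
proof (intro conjI allI impI)
  fix U assume "openin Y U"
  then have "openin euclideanreal {x \<in> topspace euclideanreal. g (circ_pt L x) \<in> U}"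
    using assms(2) openin_continuous_map_preimage by blast
  then show "openin (circ_top L) {P \<in> circ L. g P \<in> U}"
    by (auto simp: openin_circ)
qed (use assms(1) in auto)

lemma openin_circ_pt_image:
  assumes "open V"
  shows "openin (circ_top L) (circ_pt L ` V)"
proof -
  have "{x. circ_pt L x \<in> circ_pt L ` V} = (\<Union>k::int. (+) (L * of_int k) ` V)"
  proof (intro equalityI subsetI)
    fix x assume "x \<in> {x. circ_pt L x \<in> circ_pt L ` V}"
    then obtain v where "v \<in> V" "circ_pt L v = circ_pt L x"
      by auto
    then show "x \<in> (\<Union>k::int. (+) (L * of_int k) ` V)"
      by (auto simp: circ_pt_iff add.commute)
  qed (auto simp: add.commute[of "L * _"])
  then show ?thesis
    using assms by (auto simp: openin_circ intro!: open_UN open_translation)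
qed

lemma circ_lift_in:
  assumes "0 < L" "P \<in> circ L"
  obtains x where "a \<le> x" "x < a + L" "P = circ_pt L x"
proof -
  obtain y where y: "P = circ_pt L y"
    using assms by (auto simp: circ_eq)
  define k where "k = \<lfloor>(y - a) / L\<rfloor>"
  have "of_int k \<le> (y - a) / L" "(y - a) / L < of_int k + 1"
    by (auto simp: k_def)
  then have "a \<le> y + L * of_int (- k)" "y + L * of_int (- k) < a + L"
    using assms(1) by (auto simp: field_simps)
  then show ?thesis
    using that y circ_pt_shift[of L y "- k"] by metis
qed

text \<open>The homotopy classes of monotone paths, described by the end points of their lifts.\<close>

definition hcls :: "real \<Rightarrow> real \<Rightarrow> real \<Rightarrow> hclass" where
  "hcls L x y = {q. \<exists>l. mono_lift L q l \<and> l 0 = x \<and> l 1 = y}"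

definition is_lift :: "real \<Rightarrow> (real \<Rightarrow> real set) \<Rightarrow> (real \<Rightarrow> real) \<Rightarrow> bool" where
  "is_lift L p l \<longleftrightarrow> continuous_on {0..1} l \<and> (\<forall>t\<in>{0..1}. p t = circ_pt L (l t))"

lemma mono_lift_is_lift: "mono_lift L p l \<Longrightarrow> is_lift L p l"
  by (simp add: mono_lift_def is_lift_def)

lemma mono_lift_shift: "mono_lift L p l \<Longrightarrow> mono_lift L p (\<lambda>t. l t + L * of_int k)"
  by (auto simp: mono_lift_def mono_on_def intro!: continuous_intros)

lemma hcls_shift: "hcls L (x + L * of_int k) (y + L * of_int k) = hcls L x y"
proof -
  have "hcls L x y \<subseteq> hcls L (x + L * of_int k) (y + L * of_int k)" for x y k
    using mono_lift_shift unfolding hcls_def by blast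
  from this[of x y k] this[of "x + L * of_int k" "y + L * of_int k" "- k"] show ?thesis
    by auto
qed

lemma hclsE:
  assumes "q \<in> hcls L x y"
  obtains l where "mono_lift L q l" "l 0 = x" "l 1 = y" "is_lift L q l"
  using assms mono_lift_is_lift by (auto simp: hcls_def)

lemma hcls_ends:
  assumes "q \<in> hcls L x y"
  shows "q 0 = circ_pt L x" "q 1 = circ_pt L y" "x \<le> y"
proof -
  obtain l where "mono_lift L q l" "l 0 = x" "l 1 = y"
    using assms by (rule hclsE)
  then show "q 0 = circ_pt L x" "q 1 = circ_pt L y" "x \<le> y"
    by (auto simp: mono_lift_def mono_on_def)
qed

lemma hcls_nonempty:
  assumes "x \<le> y"
  shows "(\<lambda>t. circ_pt L (x + t * (y - x))) \<in> hcls L x y"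
  unfolding hcls_def mem_Collect_eq mono_lift_def
  by (intro exI[of _ "\<lambda>t. x + t * (y - x)"])
    (use assms in \<open>auto simp: mono_on_def mult_right_mono intro!: continuous_intros\<close>)

text \<open>
  Wrapping the circle around the punctured plane turns the statement that homotopic paths have lifts
  with equal end points into monodromy for the exponential covering.
\<close>

lemma homotopic_lifts_finish:
  assumes L: "0 < L" and hom: "path_homotopic L p q"
    and l: "is_lift L p l" and m: "is_lift L q m" and start: "l 0 = m 0"
  shows "l 1 = m 1"
proof -
  define c :: "real \<Rightarrow> complex" where "c x = of_real x * (2 * of_real pi * \<i> / of_real L)" for x
  define e where "e P = exp (c (SOME x. x \<in> P))" for P
  have e: "e (circ_pt L x) = exp (c x)" for x
  proof -
    have "x \<in> circ_pt L x"
      by (auto simp: circ_pt_def intro: exI[of _ "0::int"])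
    then have "(SOME y. y \<in> circ_pt L x) \<in> circ_pt L x"
      by (rule someI)
    then obtain k :: int where k: "(SOME y. y \<in> circ_pt L x) = x + L * of_int k"
      by (auto simp: circ_pt_def)
    have "c (x + L * of_int k) = c x + of_real (of_int (2 * k) * pi) * \<i>"
      using L by (simp add: c_def field_simps)
    then show ?thesis
      unfolding e_def k exp_eq by blast
  qed
  have c_cont: "continuous_on A c" for A
    unfolding c_def by (intro continuous_intros) (use L in auto)
  have e_cont: "continuous_map (circ_top L) (top_of_set (- {0})) e"
  proof (rule continuous_map_from_circ)
    show "e P \<in> topspace (top_of_set (- {0}))" for P
      by (simp add: e_def)
    show "continuous_map euclideanreal (top_of_set (- {0})) (\<lambda>x. e (circ_pt L x))"
      unfolding e continuous_map_in_subtopology using c_cont[of UNIV]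
      by (auto intro!: continuous_intros)
  qed
  have hom': "homotopic_paths (- {0}) (e \<circ> p) (e \<circ> q)"
    unfolding homotopic_paths_def
    by (rule homotopic_with_compose_continuous_map_left[OF hom[unfolded path_homotopic_def] e_cont])
      (auto simp: pathstart_def pathfinish_def)
  have lift: "path (c \<circ> l)" "(c \<circ> l) 0 = c (l 0)" "exp ((c \<circ> l) t) = (e \<circ> p) t"
    if "is_lift L p l" "t \<in> {0..1}" for p l t
    using that continuous_on_compose[of "{0..1}" l c] c_cont
    by (auto simp: is_lift_def path_def e)
  have "pathfinish (c \<circ> l) = pathfinish (c \<circ> m)"
  proof (rule covering_space_monodromy[OF covering_space_exp_punctured_plane _ _ _ _ hom'])
    show "path (e \<circ> p)" "path (e \<circ> q)" "path_image (e \<circ> p) \<subseteq> - {0}" "path_image (e \<circ> q) \<subseteq> - {0}"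
      using homotopic_paths_imp_path[OF hom'] homotopic_paths_imp_subset[OF hom'] by auto
    show "path (c \<circ> l)" "path (c \<circ> m)"
      using lift(1)[OF l, of 0] lift(1)[OF m, of 0] by auto
    show "exp ((c \<circ> l) t) = (e \<circ> p) t" "exp ((c \<circ> m) t) = (e \<circ> q) t" if "t \<in> {0..1}" for t
      using lift(3)[OF l that] lift(3)[OF m that] .
    show "pathstart (c \<circ> l) = pathstart (c \<circ> m)"
      using start by (simp add: pathstart_def)
  qed auto
  then show ?thesis
    using L by (simp add: pathfinish_def c_def)
qed

text \<open>Two lifts with the same end points are joined by the straight-line homotopy.\<close>

lemma lifts_homotopic:
  assumes l: "is_lift L p l" and m: "is_lift L q m" and ends: "l 0 = m 0" "l 1 = m 1"
  shows "path_homotopic L p q"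
proof -
  have "homotopic_paths UNIV l m"
    using l m ends by (intro homotopic_paths_linear) (auto simp: is_lift_def path_def pathstart_def pathfinish_def)
  then have "homotopic_with (\<lambda>r. r 0 = l 0 \<and> r 1 = l 1) (top_of_set {0..1}) euclideanreal l m"
    by (simp add: homotopic_paths_def pathstart_def pathfinish_def)
  then have "homotopic_with (\<lambda>g. g 0 = circ_pt L (l 0) \<and> g 1 = circ_pt L (l 1)) (top_of_set {0..1}) (circ_top L)
      (circ_pt L \<circ> l) (circ_pt L \<circ> m)"
    using continuous_map_circ_pt by (rule homotopic_with_compose_continuous_map_left) auto
  then have "homotopic_with (\<lambda>g. g 0 = circ_pt L (l 0) \<and> g 1 = circ_pt L (l 1)) (top_of_set {0..1}) (circ_top L) p q"
    by (rule homotopic_with_eq) (use l m in \<open>auto simp: is_lift_def\<close>)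
  then show ?thesis
    using l by (simp add: path_homotopic_def is_lift_def)
qed

lemma path_class_eq:
  assumes L: "0 < L" and l: "is_lift L p l"
  shows "path_class L p = hcls L (l 0) (l 1)"
proof (intro equalityI subsetI)
  fix q assume "q \<in> path_class L p"
  then obtain m where m: "mono_lift L q m" and hom: "path_homotopic L p q"
    by (auto simp: path_class_def mono_path_def)
  have "q 0 = p 0"
    using homotopic_with_imp_property[OF hom[unfolded path_homotopic_def]] by blast
  then have "circ_pt L (m 0) = circ_pt L (l 0)"
    using l m by (simp add: is_lift_def mono_lift_def)
  then obtain k :: int where k: "l 0 = m 0 + L * of_int k"
    using circ_pt_iff by blast
  note m' = mono_lift_shift[OF m, of k]
  have "l 1 = m 1 + L * of_int k"
    using homotopic_lifts_finish[OF L hom l mono_lift_is_lift[OF m']] k by simp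
  then show "q \<in> hcls L (l 0) (l 1)"
    unfolding hcls_def using m' k by (auto intro!: exI[of _ "\<lambda>t. m t + L * of_int k"])
next
  fix q assume "q \<in> hcls L (l 0) (l 1)"
  then obtain m where m: "mono_lift L q m" "m 0 = l 0" "m 1 = l 1" "is_lift L q m"
    by (rule hclsE)
  then show "q \<in> path_class L p"
    using lifts_homotopic[OF l m(4)] by (auto simp: path_class_def mono_path_def)
qed

text \<open>
  The two lifts of one path differ by a translation by a multiple of \<open>L\<close>; hence a homotopy class
  remembers the end points of its lifts up to simultaneous translation, and nothing else.
\<close>

lemma hcls_eq_iff:
  assumes L: "0 < L" and "x \<le> y"
  shows "hcls L x y = hcls L x' y' \<longleftrightarrow> (\<exists>k::int. x' = x + L * of_int k \<and> y' = y + L * of_int k)"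
proof
  assume eq: "hcls L x y = hcls L x' y'"
  let ?q = "\<lambda>t. circ_pt L (x + t * (y - x))"
  have q: "?q \<in> hcls L x y"
    using \<open>x \<le> y\<close> by (rule hcls_nonempty)
  then have q': "?q \<in> hcls L x' y'"
    unfolding eq .
  have "circ_pt L x = circ_pt L x'"
    using hcls_ends(1)[OF q] hcls_ends(1)[OF q'] by simp
  then obtain k :: int where k: "x' = x + L * of_int k"
    using circ_pt_iff by blast
  have "hcls L x' y' = hcls L (x + L * of_int k) (y + L * of_int k)"
    unfolding hcls_shift using eq by simp
  then obtain l where l: "is_lift L ?q l" "l 0 = x'" "l 1 = y + L * of_int k"
    using q' by (metis hclsE k)
  obtain m where m: "is_lift L ?q m" "m 0 = x'" "m 1 = y'"
    using q' by (rule hclsE)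
  have "l 1 = m 1"
    using l m by (intro homotopic_lifts_finish[OF L lifts_homotopic[OF l(1) l(1)] l(1) m(1)]) auto
  then show "\<exists>k::int. x' = x + L * of_int k \<and> y' = y + L * of_int k"
    using k l m by auto
next
  assume "\<exists>k::int. x' = x + L * of_int k \<and> y' = y + L * of_int k"
  then show "hcls L x y = hcls L x' y'"
    using hcls_shift[of L x _ y] by metis
qed

lemma is_lift_join:
  assumes "is_lift L p l" "is_lift L q m" "l 1 = m 0"
  shows "is_lift L (path_join p q) (path_join l m)"
proof -
  have "path (l +++ m)"
    using assms by (intro path_join_imp) (auto simp: is_lift_def path_def pathstart_def pathfinish_def)
  moreover have "path_join l m = l +++ m"
    by (auto simp: path_join_def joinpaths_def)
  ultimately have "continuous_on {0..1} (path_join l m)"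
    by (simp add: path_def)
  then show ?thesis
    using assms by (auto simp: is_lift_def path_join_def)
qed

lemma path_join_ends: "path_join l m 0 = l 0" "path_join l m 1 = m 1"
  by (simp_all add: path_join_def)

lemma circ_cat_arrows:
  assumes "0 < L"
  shows "zar (circ_cat L) = {hcls L x y | x y. x \<le> y}"
proof (intro equalityI subsetI)
  fix f assume "f \<in> zar (circ_cat L)"
  then obtain p l where "f = path_class L p" "mono_lift L p l"
    by (auto simp: circ_cat_def mono_path_def)
  then have "f = hcls L (l 0) (l 1)" "l 0 \<le> l 1"
    using path_class_eq[OF assms mono_lift_is_lift[of L p l]] by (auto simp: mono_lift_def mono_on_def)
  then show "f \<in> {hcls L x y | x y. x \<le> y}"
    by blast
next
  fix f assume "f \<in> {hcls L x y | x y. x \<le> y}"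
  then obtain x y where f: "f = hcls L x y" "x \<le> y"
    by blast
  obtain l where l: "mono_lift L (\<lambda>t. circ_pt L (x + t * (y - x))) l" "l 0 = x" "l 1 = y"
    using hcls_nonempty[OF f(2)] by (rule hclsE)
  then show "f \<in> zar (circ_cat L)"
    using f(1) path_class_eq[OF assms mono_lift_is_lift[OF l(1)]]
    by (auto simp: circ_cat_def mono_path_def)
qed

lemma circ_cat_ends:
  assumes "x \<le> y"
  shows "zdom (circ_cat L) (hcls L x y) = circ_pt L x" "zcod (circ_cat L) (hcls L x y) = circ_pt L y"
proof -
  have "(SOME p. p \<in> hcls L x y) \<in> hcls L x y"
    using hcls_nonempty[OF assms, of L] some_in_eq by blast
  then show "zdom (circ_cat L) (hcls L x y) = circ_pt L x" "zcod (circ_cat L) (hcls L x y) = circ_pt L y"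
    using hcls_ends by (simp_all add: circ_cat_def)
qed

lemma UN_const_eq: "A \<noteq> {} \<Longrightarrow> (\<And>a. a \<in> A \<Longrightarrow> f a = c) \<Longrightarrow> (\<Union>a\<in>A. f a) = c"
  by auto

lemma circ_cat_comp:
  assumes L: "0 < L" and "x \<le> y" "y \<le> z"
  shows "zcomp (circ_cat L) (hcls L y z) (hcls L x y) = hcls L x z"
proof -
  have "path_class L (path_join p q) = hcls L x z" if pq: "p \<in> hcls L x y" "q \<in> hcls L y z" for p q
  proof -
    obtain l where l: "l 0 = x" "l 1 = y" "is_lift L p l"
      using pq(1) by (rule hclsE)
    obtain m where m: "m 0 = y" "m 1 = z" "is_lift L q m"
      using pq(2) by (rule hclsE)
    show ?thesis
      using path_class_eq[OF L is_lift_join[OF l(3) m(3)]] l m by (simp add: path_join_ends)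
  qed
  then show ?thesis
    using hcls_nonempty[OF assms(2), of L] hcls_nonempty[OF assms(3), of L]
    unfolding circ_cat_def by (auto intro!: UN_const_eq)
qed

lemma circ_cat_id:
  assumes "0 < L"
  shows "zid (circ_cat L) (circ_pt L x) = hcls L x x"
proof -
  have "is_lift L (\<lambda>t. circ_pt L x) (\<lambda>t. x)"
    by (simp add: is_lift_def)
  from path_class_eq[OF assms this] show ?thesis
    by (simp add: circ_cat_def)
qed

lemma circ_cat_one: "zone (circ_cat L) (circ_pt L x) = hcls L x (x + L)"
proof (intro equalityI subsetI)
  fix p assume "p \<in> zone (circ_cat L) (circ_pt L x)"
  then obtain l where l: "p 0 = circ_pt L x" "mono_lift L p l" "l 1 = l 0 + L"
    by (auto simp: circ_cat_def)
  then have "circ_pt L (l 0) = circ_pt L x"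
    by (simp add: mono_lift_def)
  then obtain k :: int where "x = l 0 + L * of_int k"
    using circ_pt_iff by blast
  then show "p \<in> hcls L x (x + L)"
    unfolding hcls_def using mono_lift_shift[OF l(2), of k] l(3)
    by (auto intro!: exI[of _ "\<lambda>t. l t + L * of_int k"])
next
  fix p assume "p \<in> hcls L x (x + L)"
  then show "p \<in> zone (circ_cat L) (circ_pt L x)"
    using hcls_ends(1)[of p L x "x + L"] unfolding hcls_def circ_cat_def by auto
qed

section \<open>Gaps between the lifts of a finite subset of the circle\<close>

abbreviation cov :: "real \<Rightarrow> real set set \<Rightarrow> real set" where
  "cov L F \<equiv> {x. circ_pt L x \<notin> F}"

abbreviation gap :: "real \<Rightarrow> real set set \<Rightarrow> real \<Rightarrow> real set" where
  "gap L F x \<equiv> connected_component_set (cov L F) x"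

text \<open>
  The component of the circle that contains the image of \<open>x\<close>, and the lift of its chosen point that
  lies in the same gap as \<open>x\<close>. Every morphism of the category of components is of the form \<open>arr x y\<close>;
  functors induced by maps of circles send \<open>arr x y\<close> to \<open>arr (l x) (l y)\<close> for a lift \<open>l\<close>, regardless
  of the choice of base points.
\<close>

definition cob :: "real \<Rightarrow> real set set \<Rightarrow> real \<Rightarrow> real set set" where
  "cob L F x = circ_pt L ` gap L F x"

definition rep :: "real \<Rightarrow> real set set \<Rightarrow> real \<Rightarrow> real" where
  "rep L F x = (THE y. y \<in> gap L F x \<and> circ_pt L y = chosen (cob L F x))"

definition arr :: "real \<Rightarrow> real set set \<Rightarrow> real \<Rightarrow> real \<Rightarrow> real set set \<times> real set set \<times> hclass" where
  "arr L F x y = (cob L F x, cob L F y, hcls L (rep L F x) (rep L F y))"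

text \<open>
  For the lifts of a finite set, too, two points lie in the same gap precisely if no lift of a point
  of \<open>F\<close> separates them. Nearly all facts about components below reduce to this order-theoretic form.
\<close>

lemma gap_iff:
  assumes "circ_pt L x \<notin> F"
  shows "y \<in> gap L F x \<longleftrightarrow> circ_pt L y \<notin> F \<and> (\<forall>f. circ_pt L f \<in> F \<longrightarrow> (f < x \<longleftrightarrow> f < y))"
  using real_component_iff[of x "cov L F" y] assms by simp

lemma gap_cov: "y \<in> gap L F x \<Longrightarrow> circ_pt L y \<notin> F"
  using connected_component_subset[of "cov L F" x] by auto

lemma gap_self: "circ_pt L x \<notin> F \<Longrightarrow> x \<in> gap L F x"
  by (simp add: gap_iff)

lemma gap_eq:
  assumes "circ_pt L x \<notin> F" "y \<in> gap L F x"
  shows "gap L F y = gap L F x"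
  using assms(2) by (rule connected_component_eq)

lemma gap_shift:
  assumes x: "circ_pt L x \<notin> F"
  shows "y + L * of_int k \<in> gap L F (x + L * of_int k) \<longleftrightarrow> y \<in> gap L F x"
proof -
  have "(\<forall>f. circ_pt L f \<in> F \<longrightarrow> (f < x + L * of_int k \<longleftrightarrow> f < y + L * of_int k)) \<longleftrightarrow>
      (\<forall>f. circ_pt L f \<in> F \<longrightarrow> (f < x \<longleftrightarrow> f < y))" (is "?l \<longleftrightarrow> ?r")
  proof
    assume ?l
    then show ?r
      using circ_pt_shift[of L _ k] by (metis add_less_cancel_right)
  next
    assume r: ?r
    show ?l
    proof (intro allI impI)
      fix f assume "circ_pt L f \<in> F"
      then have "f + L * of_int (- k) < x \<longleftrightarrow> f + L * of_int (- k) < y"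
        using r circ_pt_shift[of L f "- k"] by metis
      then show "f < x + L * of_int k \<longleftrightarrow> f < y + L * of_int k"
        by (simp add: algebra_simps)
    qed
  qed
  then show ?thesis
    using x gap_iff[of L x F y] gap_iff[of L "x + L * of_int k" F "y + L * of_int k"] by simp
qed

lemma gap_shift_image:
  assumes x: "circ_pt L x \<notin> F"
  shows "circ_pt L ` gap L F (x + L * of_int k) = circ_pt L ` gap L F x"
proof -
  have "circ_pt L ` gap L F x \<subseteq> circ_pt L ` gap L F (x + L * of_int k)"
    if "circ_pt L x \<notin> F" for x k
  proof
    fix P assume "P \<in> circ_pt L ` gap L F x"
    then obtain y where "y \<in> gap L F x" "P = circ_pt L y"
      by blast
    then show "P \<in> circ_pt L ` gap L F (x + L * of_int k)"
      using gap_shift[OF that, of y k] circ_pt_shift[of L y k] by (metis imageI)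
  qed
  from this[of x k] this[of "x + L * of_int k" "- k"] show ?thesis
    using x by auto
qed

lemma cob_shift: "circ_pt L x \<notin> F \<Longrightarrow> cob L F (x + L * of_int k) = cob L F x"
  by (simp add: cob_def gap_shift_image)

lemma fin_circleD: "F \<in> fin_circle L \<Longrightarrow> finite F \<and> F \<noteq> {} \<and> F \<subseteq> circ L"
  by (simp add: fin_circle_def)

lemma open_cov:
  assumes "F \<in> fin_circle L" "0 < L"
  shows "open (cov L F)"
proof -
  have "closed {x. circ_pt L x = P}" if P: "P \<in> F" for P
  proof -
    have "P \<in> range (circ_pt L)"
      using P fin_circleD[OF assms(1)] unfolding circ_eq by blast
    then obtain f where f: "P = circ_pt L f"
      by blast
    have "circ_pt L x = P \<longleftrightarrow> (x - f) / L \<in> \<int>" for x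
    proof -
      have "x = f + L * of_int k \<longleftrightarrow> (x - f) / L = of_int k" for k
        using assms(2) by (auto simp: field_simps)
      then show ?thesis
        unfolding f Ints_def using circ_pt_iff[of L f x] by auto
    qed
    then have "{x. circ_pt L x = P} = (\<lambda>x. (x - f) / L) -` \<int>"
      by auto
    moreover have "closed ((\<lambda>x. (x - f) / L) -` \<int>)"
      using assms(2) by (intro continuous_closed_vimage) auto
    ultimately show ?thesis
      by simp
  qed
  then have "closed (\<Union>P\<in>F. {x. circ_pt L x = P})"
    using fin_circleD[OF assms(1)] by (intro closed_UN) auto
  moreover have "cov L F = - (\<Union>P\<in>F. {x. circ_pt L x = P})"
    by auto
  ultimately show ?thesis
    using open_Compl by metis
qed

context
  fixes L :: real and F :: "real set set"
  assumes L: "0 < L" and F: "F \<in> fin_circle L"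
begin

lemma F_point_near: "\<exists>f. circ_pt L f \<in> F \<and> a \<le> f \<and> f < a + L"
proof -
  obtain P where "P \<in> F" "P \<in> circ L"
    using fin_circleD[OF F] by blast
  then show ?thesis
    using circ_lift_in[OF L, of P a] by metis
qed

lemma gap_bounded:
  assumes x: "circ_pt L x \<notin> F" and y: "y \<in> gap L F x"
  shows "\<bar>y - x\<bar> < L"
proof -
  obtain f where f: "circ_pt L f \<in> F" "x \<le> f" "f < x + L"
    using F_point_near by blast
  have f': "circ_pt L (f + L * of_int (- 1)) \<in> F"
    using f(1) by (simp only: circ_pt_shift)
  have ne: "f + L * of_int (- 1) \<noteq> x" "f \<noteq> y"
    using x f(1) f' gap_cov[OF y] by (metis, metis)
  then have "\<not> f < y" "f - L < y"
    using y f f' ne unfolding gap_iff[OF x] by auto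
  then show ?thesis
    using f ne by auto
qed

lemma gap_inj:
  assumes x: "circ_pt L x \<notin> F" and "y \<in> gap L F x" "y' \<in> gap L F x" "circ_pt L y = circ_pt L y'"
  shows "y = y'"
proof -
  have "y' \<in> gap L F y"
    using gap_eq[OF x assms(2)] assms(3) by simp
  then have "\<bar>y' - y\<bar> < L"
    by (rule gap_bounded[OF gap_cov[OF assms(2)]])
  moreover obtain k :: int where k: "y' = y + L * of_int k"
    using assms(4) circ_pt_iff by blast
  ultimately have "L * \<bar>of_int k\<bar> < L * 1"
    using L by (simp add: abs_mult)
  then have "\<bar>real_of_int k\<bar> < 1"
    using L by (simp only: mult_less_cancel_left_pos)
  then have "k = 0"
    by linarith
  then show ?thesis
    using k by simp
qed

lemma cob_eq_iff:
  assumes x: "circ_pt L x \<notin> F" and y: "circ_pt L y \<notin> F"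
  shows "cob L F x = cob L F y \<longleftrightarrow> (\<exists>k::int. y \<in> gap L F (x + L * of_int k))"
    and "circ_pt L y \<in> cob L F x \<longleftrightarrow> cob L F x = cob L F y"
proof -
  have 1: "\<exists>k::int. y \<in> gap L F (x + L * of_int k)" if mem: "circ_pt L y \<in> cob L F x"
  proof -
    obtain u where u: "u \<in> gap L F x" "circ_pt L u = circ_pt L y"
      using mem unfolding cob_def by (metis imageE)
    then obtain k :: int where "y = u + L * of_int k"
      using circ_pt_iff by blast
    then show ?thesis
      using gap_shift[OF x, of u k] u by auto
  qed
  have 2: "cob L F x = cob L F y" if "y \<in> gap L F (x + L * of_int k)" for k
  proof -
    have "gap L F y = gap L F (x + L * of_int k)"
      using x that by (intro gap_eq) simp_all
    then have "cob L F y = cob L F (x + L * of_int k)"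
      by (simp add: cob_def)
    then show ?thesis
      using cob_shift[OF x] by simp
  qed
  have 3: "circ_pt L y \<in> cob L F y"
    using gap_self[OF y] by (auto simp: cob_def)
  show "cob L F x = cob L F y \<longleftrightarrow> (\<exists>k::int. y \<in> gap L F (x + L * of_int k))"
    "circ_pt L y \<in> cob L F x \<longleftrightarrow> cob L F x = cob L F y"
    using 1 2 3 by blast+
qed

lemma rep:
  assumes x: "circ_pt L x \<notin> F"
  shows "rep L F x \<in> gap L F x" "circ_pt L (rep L F x) = chosen (cob L F x)"
    and "\<And>y. y \<in> gap L F x \<Longrightarrow> circ_pt L y = chosen (cob L F x) \<Longrightarrow> rep L F x = y"
proof -
  have "circ_pt L x \<in> cob L F x"
    using gap_self[OF x] by (auto simp: cob_def)
  then have "chosen (cob L F x) \<in> cob L F x"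
    unfolding chosen_def by (rule someI)
  then obtain y where "y \<in> gap L F x" "circ_pt L y = chosen (cob L F x)"
    by (auto simp: cob_def)
  then have "\<exists>!y. y \<in> gap L F x \<and> circ_pt L y = chosen (cob L F x)"
    using gap_inj[OF x] by metis
  from theI'[OF this] show 1: "rep L F x \<in> gap L F x" "circ_pt L (rep L F x) = chosen (cob L F x)"
    unfolding rep_def by auto
  show "rep L F x = y" if "y \<in> gap L F x" "circ_pt L y = chosen (cob L F x)" for y
    using gap_inj[OF x 1(1) that(1)] 1(2) that(2) by simp
qed

lemma rep_cov: "circ_pt L x \<notin> F \<Longrightarrow> circ_pt L (rep L F x) \<notin> F"
  using rep(1) gap_cov by blast

lemma gap_rep: "circ_pt L x \<notin> F \<Longrightarrow> gap L F (rep L F x) = gap L F x"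
  by (rule gap_eq[OF _ rep(1)])

lemma same_gap:
  assumes x: "circ_pt L x \<notin> F" and y: "y \<in> gap L F x"
  shows "cob L F y = cob L F x" "rep L F y = rep L F x"
  by (simp_all add: cob_def rep_def gap_eq[OF x y])

lemma rep_shift:
  assumes x: "circ_pt L x \<notin> F"
  shows "rep L F (x + L * of_int k) = rep L F x + L * of_int k"
proof (rule rep(3))
  show "circ_pt L (x + L * of_int k) \<notin> F" "rep L F x + L * of_int k \<in> gap L F (x + L * of_int k)"
    "circ_pt L (rep L F x + L * of_int k) = chosen (cob L F (x + L * of_int k))"
    using x rep(1,2)[OF x] gap_shift[OF x] cob_shift[OF x] by simp_all
qed

lemma rep_le_iff:
  assumes x: "circ_pt L x \<notin> F" and y: "circ_pt L y \<notin> F"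
  shows "rep L F x \<le> rep L F y \<longleftrightarrow> (\<forall>f. circ_pt L f \<in> F \<longrightarrow> f < x \<longrightarrow> f < y)"
proof
  note rx = rep(1)[OF x, unfolded gap_iff[OF x]] and ry = rep(1)[OF y, unfolded gap_iff[OF y]]
  show "\<forall>f. circ_pt L f \<in> F \<longrightarrow> f < x \<longrightarrow> f < y" if "rep L F x \<le> rep L F y"
    using rx ry that by (meson order_less_le_trans)
  assume le: "\<forall>f. circ_pt L f \<in> F \<longrightarrow> f < x \<longrightarrow> f < y"
  show "rep L F x \<le> rep L F y"
  proof (cases "y \<in> gap L F x")
    case True
    then show ?thesis
      using same_gap(2)[OF x] by simp
  next
    case False
    then obtain f where "circ_pt L f \<in> F" "\<not> f < x" "f < y"
      using le y unfolding gap_iff[OF x] by blast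
    then have "rep L F x \<le> f" "f < rep L F y"
      using rx ry by (meson not_le)+
    then show ?thesis
      by simp
  qed
qed

lemma rep_mono: "circ_pt L x \<notin> F \<Longrightarrow> circ_pt L y \<notin> F \<Longrightarrow> x \<le> y \<Longrightarrow> rep L F x \<le> rep L F y"
  by (subst rep_le_iff) auto

lemma rep_eq_iff:
  assumes x: "circ_pt L x \<notin> F" and y: "circ_pt L y \<notin> F"
  shows "rep L F x = rep L F y \<longleftrightarrow> y \<in> gap L F x"
  using gap_rep[OF x] gap_rep[OF y] gap_self[OF y] same_gap(2)[OF x] by metis

lemma arr_eq_iff:
  assumes x: "circ_pt L x \<notin> F" and y: "circ_pt L y \<notin> F" and le: "rep L F x \<le> rep L F y"
    and x': "circ_pt L x' \<notin> F" and y': "circ_pt L y' \<notin> F"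
  shows "arr L F x y = arr L F x' y' \<longleftrightarrow>
    (\<exists>k::int. x' \<in> gap L F (x + L * of_int k) \<and> y' \<in> gap L F (y + L * of_int k))"
proof
  assume "arr L F x y = arr L F x' y'"
  then have "hcls L (rep L F x) (rep L F y) = hcls L (rep L F x') (rep L F y')"
    by (simp add: arr_def)
  then obtain k :: int where "rep L F x' = rep L F x + L * of_int k" "rep L F y' = rep L F y + L * of_int k"
    unfolding hcls_eq_iff[OF L le] by blast
  then have "rep L F (x + L * of_int k) = rep L F x'" "rep L F (y + L * of_int k) = rep L F y'"
    using rep_shift x y by simp_all
  then show "\<exists>k::int. x' \<in> gap L F (x + L * of_int k) \<and> y' \<in> gap L F (y + L * of_int k)"
    using rep_eq_iff x y x' y' by auto
next
  assume "\<exists>k::int. x' \<in> gap L F (x + L * of_int k) \<and> y' \<in> gap L F (y + L * of_int k)"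
  then obtain k :: int where k: "x' \<in> gap L F (x + L * of_int k)" "y' \<in> gap L F (y + L * of_int k)"
    by blast
  have xk: "circ_pt L (x + L * of_int k) \<notin> F" "circ_pt L (y + L * of_int k) \<notin> F"
    using x y by simp_all
  show "arr L F x y = arr L F x' y'"
    unfolding arr_def same_gap[OF xk(1) k(1)] same_gap[OF xk(2) k(2)]
    using x y by (simp add: cob_shift rep_shift hcls_shift)
qed

lemma cob_image: "P \<in> cob L F x \<Longrightarrow> P \<in> circ L - F"
  using gap_cov by (auto simp: cob_def)

lemma openin_cob: "openin (circ_top L) (cob L F x)"
  unfolding cob_def by (intro openin_circ_pt_image open_connected_component open_cov F L)

text \<open>
  The images of gaps are connected, open and pairwise equal or disjoint, so they are the components.
\<close>

lemma ccomps_eq: "ccomps L F = cob L F ` cov L F"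
proof -
  let ?T = "subtopology (circ_top L) (circ L - F)"
  have top: "topspace ?T = circ_pt L ` cov L F"
    by (auto simp: circ_eq)
  have op: "openin ?T (cob L F x)" for x
    using openin_cob[of x] cob_image[of _ x]
    by (auto simp: openin_subtopology intro!: exI[of _ "cob L F x"])
  have "connected_component_of_set ?T (circ_pt L x) = cob L F x" if x: "circ_pt L x \<notin> F" for x
  proof
    have xc: "circ_pt L x \<in> cob L F x"
      using gap_self[OF x] by (auto simp: cob_def)
    have "topspace ?T - cob L F x = (\<Union>y\<in>{y. circ_pt L y \<notin> F \<and> cob L F y \<noteq> cob L F x}. cob L F y)"
    proof (intro equalityI subsetI)
      fix P assume "P \<in> topspace ?T - cob L F x"
      then obtain y where y: "circ_pt L y \<notin> F" "P = circ_pt L y" "circ_pt L y \<notin> cob L F x"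
        unfolding top by blast
      then show "P \<in> (\<Union>y\<in>{y. circ_pt L y \<notin> F \<and> cob L F y \<noteq> cob L F x}. cob L F y)"
        using cob_eq_iff(2)[OF y(1) y(1)] by auto
    next
      fix P assume "P \<in> (\<Union>y\<in>{y. circ_pt L y \<notin> F \<and> cob L F y \<noteq> cob L F x}. cob L F y)"
      then obtain y where y: "circ_pt L y \<notin> F" "cob L F y \<noteq> cob L F x" "P \<in> cob L F y"
        by blast
      then obtain u where u: "u \<in> gap L F y" "P = circ_pt L u"
        by (auto simp: cob_def)
      have u': "circ_pt L u \<notin> F"
        using gap_cov[OF u(1)] .
      show "P \<in> topspace ?T - cob L F x"
        using y same_gap(1)[OF y(1) u(1)] cob_eq_iff(2)[OF x u'] u' u(2) top by auto
    qed
    moreover have "openin ?T (\<Union>y\<in>{y. circ_pt L y \<notin> F \<and> cob L F y \<noteq> cob L F x}. cob L F y)"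
      using op by (intro openin_Union) auto
    ultimately have "closedin ?T (cob L F x)"
      using openin_subset[OF op] by (simp add: closedin_def)
    then show "connected_component_of_set ?T (circ_pt L x) \<subseteq> cob L F x"
      using connectedin_clopen_cases[OF connectedin_connected_component_of[of ?T "circ_pt L x"] _ op] xc x
        connected_component_of_refl[of ?T "circ_pt L x"]
      by (auto simp: disjnt_iff)
    have "connectedin (circ_top L) (cob L F x)"
      unfolding cob_def
      by (rule connectedin_continuous_map_image[OF continuous_map_circ_pt])
        (simp add: connectedin_iff_connected)
    then have "connectedin ?T (cob L F x)"
      using cob_image[of _ x] by (auto simp: connectedin_subtopology)
    then show "cob L F x \<subseteq> connected_component_of_set ?T (circ_pt L x)"
      using xc by (rule connected_component_of_maximal)
  qed
  then show ?thesis
    unfolding ccomps_def connected_components_of_def top by auto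
qed

lemma cpi0_obj: "zob (cpi0 L F) = cob L F ` cov L F"
  by (simp add: cpi0_def ccomps_eq)

lemma cpi0_objE:
  assumes "c \<in> ccomps L F"
  obtains x where "circ_pt L x \<notin> F" "c = cob L F x"
  using assms by (auto simp: ccomps_eq)

lemma cpi0_arrowE:
  assumes "f \<in> zar (cpi0 L F)"
  obtains x y where "circ_pt L x \<notin> F" "circ_pt L y \<notin> F" "x \<le> y" "f = arr L F x y"
proof -
  obtain c d g where f: "f = (c, d, g)" "c \<in> ccomps L F" "d \<in> ccomps L F" "g \<in> zar (circ_cat L)"
    "zdom (circ_cat L) g = chosen c" "zcod (circ_cat L) g = chosen d"
    using assms by (auto simp: cpi0_def)
  obtain u v where g: "g = hcls L u v" "u \<le> v"
    using f(4) circ_cat_arrows[OF L] by auto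
  obtain x where x: "circ_pt L x \<notin> F" "c = cob L F x"
    using f(2) by (rule cpi0_objE)
  obtain y where y: "circ_pt L y \<notin> F" "d = cob L F y"
    using f(3) by (rule cpi0_objE)
  have u: "circ_pt L u = chosen c" "circ_pt L v = chosen d"
    using f(5,6) circ_cat_ends[OF g(2)] g(1) by auto
  have r: "circ_pt L w \<notin> F \<and> cob L F w = c' \<and> rep L F w = w"
    if z: "circ_pt L z \<notin> F" "c' = cob L F z" and w: "circ_pt L w = chosen c'" for w z c'
  proof -
    have "circ_pt L w = circ_pt L (rep L F z)"
      using rep(2)[OF z(1)] w z(2) by simp
    then have w': "circ_pt L w \<notin> F" "circ_pt L w \<in> cob L F z"
      using rep_cov[OF z(1)] rep(1)[OF z(1)] by (auto simp: cob_def)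
    then have c: "cob L F w = c'"
      using cob_eq_iff(2)[OF z(1) w'(1)] z(2) by simp
    show ?thesis
      using w' c rep(3)[OF w'(1) gap_self[OF w'(1)]] w by simp
  qed
  show ?thesis
    using that[of u v] r[OF x u(1)] r[OF y u(2)] f(1) g by (simp add: arr_def)
qed

lemma arr_mem:
  assumes x: "circ_pt L x \<notin> F" and y: "circ_pt L y \<notin> F" and le: "rep L F x \<le> rep L F y"
  shows "arr L F x y \<in> zar (cpi0 L F)" "zdom (cpi0 L F) (arr L F x y) = cob L F x"
    "zcod (cpi0 L F) (arr L F x y) = cob L F y"
proof -
  have "hcls L (rep L F x) (rep L F y) \<in> zar (circ_cat L)"
    using circ_cat_arrows[OF L] le by blast
  then show "arr L F x y \<in> zar (cpi0 L F)"
    using x y circ_cat_ends[OF le] rep(2) by (auto simp: cpi0_def arr_def ccomps_eq)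
qed (simp_all add: cpi0_def arr_def)

lemma cpi0_id: "circ_pt L x \<notin> F \<Longrightarrow> zid (cpi0 L F) (cob L F x) = arr L F x x"
  using circ_cat_id[OF L] rep(2) by (simp add: cpi0_def arr_def flip: rep(2))

lemma cpi0_one: "circ_pt L x \<notin> F \<Longrightarrow> zone (cpi0 L F) (cob L F x) = arr L F x (x + L)"
  using circ_cat_one rep_shift[of x 1] cob_shift[of L x F 1] by (simp add: cpi0_def arr_def flip: rep(2))

lemma cpi0_comp:
  assumes "rep L F x \<le> rep L F y" "rep L F y \<le> rep L F z"
  shows "zcomp (cpi0 L F) (arr L F y z) (arr L F x y) = arr L F x z"
  using circ_cat_comp[OF L assms] by (simp add: cpi0_def arr_def)

text \<open>Composable arrows can be written over a common middle point.\<close>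

lemma cpi0_composableE:
  assumes f: "f \<in> zar (cpi0 L F)" and g: "g \<in> zar (cpi0 L F)" and fg: "zcod (cpi0 L F) f = zdom (cpi0 L F) g"
  obtains x y z where "circ_pt L x \<notin> F" "circ_pt L y \<notin> F" "circ_pt L z \<notin> F"
    "rep L F x \<le> rep L F y" "rep L F y \<le> rep L F z" "f = arr L F x y" "g = arr L F y z"
proof -
  obtain x y where x: "circ_pt L x \<notin> F" "circ_pt L y \<notin> F" "x \<le> y" "f = arr L F x y"
    using f by (rule cpi0_arrowE)
  obtain u v where u: "circ_pt L u \<notin> F" "circ_pt L v \<notin> F" "u \<le> v" "g = arr L F u v"
    using g by (rule cpi0_arrowE)
  note xy = rep_mono[OF x(1-3)] and uv = rep_mono[OF u(1-3)]
  have "cob L F u = cob L F y"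
    using fg arr_mem(3)[OF x(1,2) xy] arr_mem(2)[OF u(1,2) uv] x(4) u(4) by simp
  then obtain k :: int where k: "y \<in> gap L F (u + L * of_int k)"
    using cob_eq_iff(1)[OF u(1) x(2)] by blast
  define z where "z = v + L * of_int k"
  have z: "circ_pt L z \<notin> F"
    using u(2) by (simp add: z_def)
  have g': "g = arr L F y z"
    unfolding u(4) arr_eq_iff[OF u(1,2) uv x(2) z] using k gap_self[OF z] by (auto simp: z_def)
  have "rep L F y = rep L F u + L * of_int k"
    using same_gap(2)[OF _ k] rep_shift[OF u(1), of k] u(1) by simp
  then have "rep L F y \<le> rep L F z"
    using uv rep_shift[OF u(2), of k] by (simp add: z_def)
  then show ?thesis
    using that[OF x(1,2) z xy _ x(4) g'] by blast
qed

lemma zplus_category_cpi0: "zplus_category (cpi0 L F)"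
proof -
  have zob: "c \<in> zob (cpi0 L F) \<Longrightarrow> c \<in> ccomps L F" for c
    by (simp add: cpi0_def)
  have sh: "circ_pt L x \<notin> F \<Longrightarrow> rep L F (x + L) = rep L F x + L" for x
    using rep_shift[of x 1] by simp
  have le1: "circ_pt L x \<notin> F \<Longrightarrow> rep L F x \<le> rep L F (x + L)" for x
    using sh L by simp
  note am = arr_mem(1) and ad = arr_mem(2) and ac = arr_mem(3)
  show ?thesis
    unfolding zplus_category_def
  proof (intro conjI ballI impI)
    fix f assume f: "f \<in> zar (cpi0 L F)"
    then obtain x y where x: "circ_pt L x \<notin> F" "circ_pt L y \<notin> F" "x \<le> y" "f = arr L F x y"
      by (rule cpi0_arrowE)
    note le = rep_mono[OF x(1-3)]
    show "zdom (cpi0 L F) f \<in> zob (cpi0 L F)" "zcod (cpi0 L F) f \<in> zob (cpi0 L F)"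
      unfolding x(4) ad[OF x(1,2) le] ac[OF x(1,2) le] cpi0_obj using x by auto
    show "zcomp (cpi0 L F) f (zid (cpi0 L F) (zdom (cpi0 L F) f)) = f"
      "zcomp (cpi0 L F) (zid (cpi0 L F) (zcod (cpi0 L F) f)) f = f"
      unfolding x(4) ad[OF x(1,2) le] ac[OF x(1,2) le] cpi0_id[OF x(1)] cpi0_id[OF x(2)]
      by (simp_all add: cpi0_comp le)
    have "arr L F (x + L) (y + L) = f"
      unfolding x(4)
      by (subst arr_eq_iff)
        (use x sh le gap_self[of L x F] gap_self[of L y F] in \<open>auto intro!: exI[of _ "- 1::int"]\<close>)
    then show "zcomp (cpi0 L F) f (zone (cpi0 L F) (zdom (cpi0 L F) f)) =
        zcomp (cpi0 L F) (zone (cpi0 L F) (zcod (cpi0 L F) f)) f"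
      using cpi0_comp[of x "x + L" "y + L"] cpi0_comp[of x y "y + L"] sh x le le1
      unfolding x(4) ad[OF x(1,2) le] ac[OF x(1,2) le] cpi0_one[OF x(1)] cpi0_one[OF x(2)] by simp
    fix g assume g: "g \<in> zar (cpi0 L F)"
    show "zcomp (cpi0 L F) g f \<in> zar (cpi0 L F)"
      "zdom (cpi0 L F) (zcomp (cpi0 L F) g f) = zdom (cpi0 L F) f"
      "zcod (cpi0 L F) (zcomp (cpi0 L F) g f) = zcod (cpi0 L F) g"
      if "zcod (cpi0 L F) f = zdom (cpi0 L F) g"
      by (rule cpi0_composableE[OF f g that]; simp add: cpi0_comp arr_mem)+
    fix h assume h: "h \<in> zar (cpi0 L F)"
    assume fg: "zcod (cpi0 L F) f = zdom (cpi0 L F) g" and gh: "zcod (cpi0 L F) g = zdom (cpi0 L F) h"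
    obtain x y z where 1: "circ_pt L x \<notin> F" "circ_pt L y \<notin> F" "circ_pt L z \<notin> F"
      "rep L F x \<le> rep L F y" "rep L F y \<le> rep L F z" "f = arr L F x y" "g = arr L F y z"
      using f g fg by (rule cpi0_composableE)
    have xz: "rep L F x \<le> rep L F z"
      using 1 by simp
    obtain u v w where 2: "circ_pt L u \<notin> F" "circ_pt L v \<notin> F" "circ_pt L w \<notin> F"
      "rep L F u \<le> rep L F v" "rep L F v \<le> rep L F w" "arr L F x z = arr L F u v" "h = arr L F v w"
      by (rule cpi0_composableE[OF am[OF 1(1,3) xz] h]) (use gh 1 ac xz in auto)
    obtain k :: int where k: "u \<in> gap L F (x + L * of_int k)" "v \<in> gap L F (z + L * of_int k)"
      using 2(6) unfolding arr_eq_iff[OF 1(1,3) xz 2(1,2)] by blast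
    define t where "t = w + L * of_int (- k)"
    have t: "circ_pt L t \<notin> F"
      using 2(3) unfolding t_def circ_pt_shift .
    have zk: "circ_pt L (z + L * of_int k) \<notin> F"
      using 1(3) by simp
    have rv: "rep L F v = rep L F z + L * of_int k"
      using same_gap(2)[OF zk k(2)] rep_shift[OF 1(3)] by simp
    have zt: "rep L F z \<le> rep L F t"
      using 2(5) rv unfolding t_def rep_shift[OF 2(3)] by simp
    have tk: "t + L * of_int k = w"
      by (simp add: t_def)
    have "h = arr L F z t"
      unfolding 2(7) using arr_eq_iff[OF 1(3) t zt 2(2,3)] k(2) gap_self[OF 2(3)] tk by metis
    then show "zcomp (cpi0 L F) h (zcomp (cpi0 L F) g f) = zcomp (cpi0 L F) (zcomp (cpi0 L F) h g) f"
      using 1 zt by (simp add: cpi0_comp)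
  next
    fix c assume "c \<in> zob (cpi0 L F)"
    then obtain x where x: "circ_pt L x \<notin> F" "c = cob L F x"
      using cpi0_objE zob by metis
    have xL: "circ_pt L (x + L) \<notin> F"
      using x by simp
    show "zid (cpi0 L F) c \<in> zar (cpi0 L F)" "zdom (cpi0 L F) (zid (cpi0 L F) c) = c"
      "zcod (cpi0 L F) (zid (cpi0 L F) c) = c"
      unfolding x(2) cpi0_id[OF x(1)] using arr_mem x(1) by auto
    show "zone (cpi0 L F) c \<in> zar (cpi0 L F)" "zdom (cpi0 L F) (zone (cpi0 L F) c) = c"
      "zcod (cpi0 L F) (zone (cpi0 L F) c) = c"
      unfolding x(2) cpi0_one[OF x(1)] using arr_mem[OF x(1) xL le1[OF x(1)]] cob_shift[OF x(1), of 1] by auto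
    have "hcls L (rep L F x) (rep L F x) \<noteq> hcls L (rep L F x) (rep L F x + L)"
      unfolding hcls_eq_iff[OF L order_refl] using L by auto
    then show "zone (cpi0 L F) c \<noteq> zid (cpi0 L F) c"
      unfolding x(2) cpi0_one[OF x(1)] cpi0_id[OF x(1)] using sh[OF x(1)] by (simp add: arr_def)
  qed
qed

end

section \<open>Functors preserving the distinguished endomorphisms\<close>

lemma zplusD:
  assumes "zplus_category C"
  shows "\<And>f. f \<in> zar C \<Longrightarrow> zdom C f \<in> zob C" "\<And>f. f \<in> zar C \<Longrightarrow> zcod C f \<in> zob C"
    and "\<And>c. c \<in> zob C \<Longrightarrow> zid C c \<in> zar C" "\<And>c. c \<in> zob C \<Longrightarrow> zdom C (zid C c) = c"
      "\<And>c. c \<in> zob C \<Longrightarrow> zcod C (zid C c) = c"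
    and "\<And>f g. f \<in> zar C \<Longrightarrow> g \<in> zar C \<Longrightarrow> zcod C f = zdom C g \<Longrightarrow> zcomp C g f \<in> zar C"
      "\<And>f g. f \<in> zar C \<Longrightarrow> g \<in> zar C \<Longrightarrow> zcod C f = zdom C g \<Longrightarrow> zdom C (zcomp C g f) = zdom C f"
      "\<And>f g. f \<in> zar C \<Longrightarrow> g \<in> zar C \<Longrightarrow> zcod C f = zdom C g \<Longrightarrow> zcod C (zcomp C g f) = zcod C g"
    and "\<And>c. c \<in> zob C \<Longrightarrow> zone C c \<in> zar C" "\<And>c. c \<in> zob C \<Longrightarrow> zdom C (zone C c) = c"
      "\<And>c. c \<in> zob C \<Longrightarrow> zcod C (zone C c) = c"
  using assms unfolding zplus_category_def by auto

lemma zfunctors_iff: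
  "\<Phi> \<in> zfunctors C D \<longleftrightarrow> fst \<Phi> \<in> zob C \<rightarrow>\<^sub>E zob D \<and> snd \<Phi> \<in> zar C \<rightarrow>\<^sub>E zar D \<and>
     (\<forall>f\<in>zar C. zdom D (snd \<Phi> f) = fst \<Phi> (zdom C f) \<and> zcod D (snd \<Phi> f) = fst \<Phi> (zcod C f)) \<and>
     (\<forall>c\<in>zob C. snd \<Phi> (zid C c) = zid D (fst \<Phi> c)) \<and>
     (\<forall>f\<in>zar C. \<forall>g\<in>zar C. zcod C f = zdom C g \<longrightarrow> snd \<Phi> (zcomp C g f) = zcomp D (snd \<Phi> g) (snd \<Phi> f)) \<and>
     (\<forall>c\<in>zob C. snd \<Phi> (zone C c) = zone D (fst \<Phi> c))"
  by (cases \<Phi>) (simp add: zfunctors_def)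

lemma zfunctorsI:
  assumes "fst \<Phi> \<in> extensional (zob C)" "snd \<Phi> \<in> extensional (zar C)"
    and "\<And>c. c \<in> zob C \<Longrightarrow> fst \<Phi> c \<in> zob D" "\<And>f. f \<in> zar C \<Longrightarrow> snd \<Phi> f \<in> zar D"
    and "\<And>f. f \<in> zar C \<Longrightarrow> zdom D (snd \<Phi> f) = fst \<Phi> (zdom C f)"
    and "\<And>f. f \<in> zar C \<Longrightarrow> zcod D (snd \<Phi> f) = fst \<Phi> (zcod C f)"
    and "\<And>c. c \<in> zob C \<Longrightarrow> snd \<Phi> (zid C c) = zid D (fst \<Phi> c)"
    and "\<And>f g. f \<in> zar C \<Longrightarrow> g \<in> zar C \<Longrightarrow> zcod C f = zdom C g \<Longrightarrow>
      snd \<Phi> (zcomp C g f) = zcomp D (snd \<Phi> g) (snd \<Phi> f)"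
    and "\<And>c. c \<in> zob C \<Longrightarrow> snd \<Phi> (zone C c) = zone D (fst \<Phi> c)"
  shows "\<Phi> \<in> zfunctors C D"
  unfolding zfunctors_iff using assms by (auto simp: PiE_def)

lemma zfunctorsD:
  assumes "\<Phi> \<in> zfunctors C D"
  shows "fst \<Phi> \<in> extensional (zob C)" "snd \<Phi> \<in> extensional (zar C)"
    and "\<And>c. c \<in> zob C \<Longrightarrow> fst \<Phi> c \<in> zob D" "\<And>f. f \<in> zar C \<Longrightarrow> snd \<Phi> f \<in> zar D"
    and "\<And>f. f \<in> zar C \<Longrightarrow> zdom D (snd \<Phi> f) = fst \<Phi> (zdom C f)"
    and "\<And>f. f \<in> zar C \<Longrightarrow> zcod D (snd \<Phi> f) = fst \<Phi> (zcod C f)"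
    and "\<And>c. c \<in> zob C \<Longrightarrow> snd \<Phi> (zid C c) = zid D (fst \<Phi> c)"
    and "\<And>f g. f \<in> zar C \<Longrightarrow> g \<in> zar C \<Longrightarrow> zcod C f = zdom C g \<Longrightarrow>
      snd \<Phi> (zcomp C g f) = zcomp D (snd \<Phi> g) (snd \<Phi> f)"
    and "\<And>c. c \<in> zob C \<Longrightarrow> snd \<Phi> (zone C c) = zone D (fst \<Phi> c)"
  using assms unfolding zfunctors_iff by (simp_all add: PiE_def Pi_iff)

lemma zfunctors_eqI:
  assumes "\<Phi> \<in> zfunctors C D" "\<Psi> \<in> zfunctors C D"
    and "\<And>c. c \<in> zob C \<Longrightarrow> fst \<Phi> c = fst \<Psi> c" "\<And>f. f \<in> zar C \<Longrightarrow> snd \<Phi> f = snd \<Psi> f"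
  shows "\<Phi> = \<Psi>"
  using extensionalityI[OF zfunctorsD(1)[OF assms(1)] zfunctorsD(1)[OF assms(2)] assms(3)]
    extensionalityI[OF zfunctorsD(2)[OF assms(1)] zfunctorsD(2)[OF assms(2)] assms(4)]
  by (rule prod_eqI)

lemma zfun_comp_apply:
  "c \<in> zob C \<Longrightarrow> fst (zfun_comp C G F) c = fst G (fst F c)"
  "f \<in> zar C \<Longrightarrow> snd (zfun_comp C G F) f = snd G (snd F f)"
  by (simp_all add: zfun_comp_def compose_def)

lemma zfun_id_apply: "c \<in> zob C \<Longrightarrow> fst (zfun_id C) c = c" "f \<in> zar C \<Longrightarrow> snd (zfun_id C) f = f"
  by (simp_all add: zfun_id_def)

lemma zfun_comp_mem:
  assumes B: "zplus_category B" and F: "F \<in> zfunctors B C" and G: "G \<in> zfunctors C D"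
  shows "zfun_comp B G F \<in> zfunctors B D"
proof (rule zfunctorsI)
  show "fst (zfun_comp B G F) \<in> extensional (zob B)" "snd (zfun_comp B G F) \<in> extensional (zar B)"
    by (simp_all add: zfun_comp_def)
qed (simp_all add: zfun_comp_apply zplusD[OF B] zfunctorsD(3-)[OF F] zfunctorsD(3-)[OF G])

lemma zfun_id_mem: "zplus_category C \<Longrightarrow> zfun_id C \<in> zfunctors C C"
  by (rule zfunctorsI) (simp_all add: zfun_id_def zplusD)

lemma zfun_inv_eq:
  assumes F: "F \<in> zfunctors C D" and G: "G \<in> zfunctors D C"
    and GF: "zfun_comp C G F = zfun_id C" and FG: "zfun_comp D F G = zfun_id D"
  shows "zfun_inv C D F = G"
proof -
  have 1: "fst G (fst F c) = c" if "c \<in> zob C" for c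
    using zfun_comp_apply(1)[OF that, of G F] zfun_id_apply(1)[OF that] GF by simp
  have 2: "snd G (snd F f) = f" if "f \<in> zar C" for f
    using zfun_comp_apply(2)[OF that, of G F] zfun_id_apply(2)[OF that] GF by simp
  have 3: "fst F (fst G c) = c" if "c \<in> zob D" for c
    using zfun_comp_apply(1)[OF that, of F G] zfun_id_apply(1)[OF that] FG by simp
  have 4: "snd F (snd G f) = f" if "f \<in> zar D" for f
    using zfun_comp_apply(2)[OF that, of F G] zfun_id_apply(2)[OF that] FG by simp
  have "inv_into (zob C) (fst F) d = fst G d" if "d \<in> zob D" for d
    using inv_into_f_f[OF inj_on_inverseI[where A = "zob C" and f = "fst F" and g = "fst G", OF 1] zfunctorsD(3)[OF G that]] 3[OF that] by simp
  moreover have "inv_into (zar C) (snd F) g = snd G g" if "g \<in> zar D" for g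
    using inv_into_f_f[OF inj_on_inverseI[where A = "zar C" and f = "snd F" and g = "snd G", OF 2] zfunctorsD(4)[OF G that]] 4[OF that] by simp
  moreover have "fst (zfun_inv C D F) \<in> extensional (zob D)" "snd (zfun_inv C D F) \<in> extensional (zar D)"
    by (simp_all add: zfun_inv_def)
  moreover have "fst (zfun_inv C D F) d = inv_into (zob C) (fst F) d" if "d \<in> zob D" for d
    using that by (simp add: zfun_inv_def)
  moreover have "snd (zfun_inv C D F) g = inv_into (zar C) (snd F) g" if "g \<in> zar D" for g
    using that by (simp add: zfun_inv_def)
  ultimately have "fst (zfun_inv C D F) = fst G" "snd (zfun_inv C D F) = snd G"
    using extensionalityI[OF _ zfunctorsD(1)[OF G], of "fst (zfun_inv C D F)"]
      extensionalityI[OF _ zfunctorsD(2)[OF G], of "snd (zfun_inv C D F)"] by metis+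
  then show ?thesis
    by (rule prod_eqI)
qed

definition ziso :: "('o, 'm) zcat \<Rightarrow> ('p, 'n) zcat \<Rightarrow> ('o, 'm, 'p, 'n) zfun \<Rightarrow> bool" where
  "ziso C D F \<longleftrightarrow> F \<in> zfunctors C D \<and> bij_betw (fst F) (zob C) (zob D) \<and> bij_betw (snd F) (zar C) (zar D)"

lemma ziso_inverse:
  assumes C: "zplus_category C" and iso: "ziso C D F"
  shows "zfun_inv C D F \<in> zfunctors D C" "zfun_comp C (zfun_inv C D F) F = zfun_id C"
    "zfun_comp D F (zfun_inv C D F) = zfun_id D"
    and "\<And>c. c \<in> zob C \<Longrightarrow> fst (zfun_inv C D F) (fst F c) = c"
    and "\<And>f. f \<in> zar C \<Longrightarrow> snd (zfun_inv C D F) (snd F f) = f"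
proof -
  let ?G = "zfun_inv C D F"
  have F: "F \<in> zfunctors C D" and bo: "bij_betw (fst F) (zob C) (zob D)"
    and ba: "bij_betw (snd F) (zar C) (zar D)"
    using iso by (auto simp: ziso_def)
  note Cd = zplusD[OF C] and Fd = zfunctorsD[OF F]
  show 1: "fst ?G (fst F c) = c" if "c \<in> zob C" for c
    using that bo Fd(3) by (simp add: zfun_inv_def bij_betw_inv_into_left)
  show 2: "snd ?G (snd F f) = f" if "f \<in> zar C" for f
    using that ba Fd(4) by (simp add: zfun_inv_def bij_betw_inv_into_left)
  have ob: "\<exists>c\<in>zob C. d = fst F c" if "d \<in> zob D" for d
    using bo that by (metis bij_betw_imp_surj_on imageE)
  have ar: "\<exists>f\<in>zar C. g = snd F f" if "g \<in> zar D" for g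
    using ba that by (metis bij_betw_imp_surj_on imageE)
  show G: "?G \<in> zfunctors D C"
  proof (rule zfunctorsI)
    show "fst ?G \<in> extensional (zob D)" "snd ?G \<in> extensional (zar D)"
      by (simp_all add: zfun_inv_def)
  next
    fix d assume "d \<in> zob D"
    then obtain c where c: "c \<in> zob C" "d = fst F c"
      using ob by blast
    show "fst ?G d \<in> zob C" "snd ?G (zid D d) = zid C (fst ?G d)" "snd ?G (zone D d) = zone C (fst ?G d)"
      using c 1 2 Fd(7,9)[symmetric] Cd by simp_all
  next
    fix g assume "g \<in> zar D"
    then obtain f where f: "f \<in> zar C" "g = snd F f"
      using ar by blast
    show "snd ?G g \<in> zar C" "zdom C (snd ?G g) = fst ?G (zdom D g)" "zcod C (snd ?G g) = fst ?G (zcod D g)"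
      using f 1 2 Fd(5,6) Cd by simp_all
    fix g' assume "g' \<in> zar D"
    then obtain f' where f': "f' \<in> zar C" "g' = snd F f'"
      using ar by blast
    assume "zcod D g = zdom D g'"
    then have "fst F (zcod C f) = fst F (zdom C f')"
      using f f' Fd(5,6) by simp
    then have cc: "zcod C f = zdom C f'"
      using bo Cd f f' by (auto simp: bij_betw_def inj_on_def)
    then have "zcomp D g' g = snd F (zcomp C f' f)"
      using Fd(8) f f' by simp
    then show "snd ?G (zcomp D g' g) = zcomp C (snd ?G g') (snd ?G g)"
      using f f' cc 2 Cd by simp
  qed
  show "zfun_comp C ?G F = zfun_id C"
    using 1 2 by (auto simp: zfun_comp_def zfun_id_def compose_def)
  have "fst F (fst ?G d) = d" if "d \<in> zob D" for d
    using ob[OF that] 1 by auto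
  moreover have "snd F (snd ?G g) = g" if "g \<in> zar D" for g
    using ar[OF that] 2 by auto
  ultimately show "zfun_comp D F ?G = zfun_id D"
    by (auto simp: zfun_comp_def zfun_id_def compose_def)
qed

lemma ziso_comp:
  assumes "zplus_category B" "ziso B C F" "ziso C D G"
  shows "ziso B D (zfun_comp B G F)"
proof -
  have b: "bij_betw (fst G \<circ> fst F) (zob B) (zob D)" "bij_betw (snd G \<circ> snd F) (zar B) (zar D)"
    using assms(2,3) by (auto simp: ziso_def intro: bij_betw_trans)
  have "bij_betw (fst (zfun_comp B G F)) (zob B) (zob D)" "bij_betw (snd (zfun_comp B G F)) (zar B) (zar D)"
    using b by (simp_all add: zfun_comp_apply cong: bij_betw_cong)
  then show ?thesis
    using assms(2,3) zfun_comp_mem[OF assms(1), of F C G D] by (simp add: ziso_def)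
qed

subsection \<open>Renaming objects and arrows\<close>

context
  fixes i :: "'o \<Rightarrow> 'p" and j :: "'m \<Rightarrow> 'n"
  assumes i: "inj i" and j: "inj j"
begin

lemma inv_tag: "c \<in> A \<Longrightarrow> inv_into A i (i c) = c" "f \<in> B \<Longrightarrow> inv_into B j (j f) = f"
  using i j by (meson inj_on_subset inv_into_f_f subset_UNIV)+

lemma zrelabel_ops:
  "zob (zrelabel i j C) = i ` zob C" "zar (zrelabel i j C) = j ` zar C"
  "f \<in> zar C \<Longrightarrow> zdom (zrelabel i j C) (j f) = i (zdom C f)"
  "f \<in> zar C \<Longrightarrow> zcod (zrelabel i j C) (j f) = i (zcod C f)"
  "c \<in> zob C \<Longrightarrow> zid (zrelabel i j C) (i c) = j (zid C c)"
  "c \<in> zob C \<Longrightarrow> zone (zrelabel i j C) (i c) = j (zone C c)"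
  "f \<in> zar C \<Longrightarrow> g \<in> zar C \<Longrightarrow> zcomp (zrelabel i j C) (j g) (j f) = j (zcomp C g f)"
  by (simp_all add: zrelabel_def inv_tag)

lemma zplus_category_zrelabel:
  assumes C: "zplus_category C"
  shows "zplus_category (zrelabel i j C)"
proof -
  have ax: "\<And>f. f \<in> zar C \<Longrightarrow> zcomp C f (zid C (zdom C f)) = f"
    "\<And>f. f \<in> zar C \<Longrightarrow> zcomp C (zid C (zcod C f)) f = f"
    "\<And>f g h. f \<in> zar C \<Longrightarrow> g \<in> zar C \<Longrightarrow> h \<in> zar C \<Longrightarrow> zcod C f = zdom C g \<Longrightarrow> zcod C g = zdom C h \<Longrightarrow>
      zcomp C h (zcomp C g f) = zcomp C (zcomp C h g) f"
    "\<And>c. c \<in> zob C \<Longrightarrow> zone C c \<noteq> zid C c"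
    "\<And>f. f \<in> zar C \<Longrightarrow> zcomp C f (zone C (zdom C f)) = zcomp C (zone C (zcod C f)) f"
    using C unfolding zplus_category_def by auto
  show ?thesis
    unfolding zplus_category_def zrelabel_ops(1,2)
    by (auto simp: zrelabel_ops(3-) zplusD[OF C] ax inj_eq[OF i] inj_eq[OF j])
qed

lemma ziso_zrelabel:
  assumes C: "zplus_category C"
  shows "ziso C (zrelabel i j C) (restrict i (zob C), restrict j (zar C))"
  unfolding ziso_def
proof (intro conjI zfunctorsI)
  show "bij_betw (fst (restrict i (zob C), restrict j (zar C))) (zob C) (zob (zrelabel i j C))"
    "bij_betw (snd (restrict i (zob C), restrict j (zar C))) (zar C) (zar (zrelabel i j C))"
    using i j by (auto simp: zrelabel_ops(1,2) bij_betw_def inj_on_def inj_def)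
qed (simp_all add: zrelabel_ops zplusD[OF C])

end

lemma zrelabel_fun_apply:
  assumes "inj i" "inj j"
  shows "c \<in> zob C \<Longrightarrow> fst (zrelabel_fun C i j i' j' F) (i c) = i' (fst F c)"
    "f \<in> zar C \<Longrightarrow> snd (zrelabel_fun C i j i' j' F) (j f) = j' (snd F f)"
  using assms by (simp_all add: zrelabel_fun_def conj_map_apply)

lemma zrelabel_fun_mem:
  assumes inj: "inj i" "inj j" "inj i'" "inj j'" and C: "zplus_category C" and F: "F \<in> zfunctors C D"
  shows "zrelabel_fun C i j i' j' F \<in> zfunctors (zrelabel i j C) (zrelabel i' j' D)"
proof (rule zfunctorsI)
  show "fst (zrelabel_fun C i j i' j' F) \<in> extensional (zob (zrelabel i j C))"
    "snd (zrelabel_fun C i j i' j' F) \<in> extensional (zar (zrelabel i j C))"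
    by (simp_all add: zrelabel_fun_def conj_map_def zrelabel_def)
qed (auto simp: zrelabel_ops[OF inj(1,2)] zrelabel_ops[OF inj(3,4)] zrelabel_fun_apply[OF inj(1,2)]
    zplusD[OF C] zfunctorsD(3-)[OF F] inj_eq[OF inj(1)])

lemma zrelabel_fun_id:
  assumes "inj i" "inj j"
  shows "zrelabel_fun C i j i j (zfun_id C) = zfun_id (zrelabel i j C)"
  by (auto simp: zrelabel_fun_def conj_map_def zfun_id_def zrelabel_ops[OF assms] inv_tag[OF assms] fun_eq_iff)

lemma zrelabel_fun_comp:
  assumes "inj i" "inj j" "inj i'" "inj j'" and F: "F \<in> zfunctors B C"
  shows "zfun_comp (zrelabel i j B) (zrelabel_fun C i' j' i'' j'' G) (zrelabel_fun B i j i' j' F) =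
    zrelabel_fun B i j i'' j'' (zfun_comp B G F)"
  using zfunctorsD(3,4)[OF F]
  by (auto simp: zrelabel_fun_def conj_map_def zfun_comp_def compose_def zrelabel_ops[OF assms(1,2)]
      inv_tag[OF assms(1,2)] inv_tag[OF assms(3,4)] fun_eq_iff)

subsection \<open>Cyclic categories of linear orders\<close>

lemma cyc_ops [simp]:
  "zob (cyc R) = Field R" "zdom (cyc R) (a, b, k) = a" "zcod (cyc R) (a, b, k) = b"
  "zid (cyc R) a = (a, a, 0)" "zone (cyc R) a = (a, a, 1)"
  "zcomp (cyc R) (b', c, l) (a, b, k) = (a, c, k + l)"
  "(a, b, k) \<in> zar (cyc R) \<longleftrightarrow> a \<in> Field R \<and> b \<in> Field R \<and> (k = 0 \<longrightarrow> (a, b) \<in> R)"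
  by (simp_all add: cyc_def)

lemma zplus_category_cyc:
  assumes R: "Linear_order R"
  shows "zplus_category (cyc R)"
  unfolding zplus_category_def using Linear_orderD(1,2)[OF R] by (auto simp: split_paired_all)

lemma cyc_map_mem:
  assumes R: "Linear_order R" and f: "\<And>a. a \<in> Field R \<Longrightarrow> f a \<in> Field S"
    and mono: "\<And>a b. (a, b) \<in> R \<Longrightarrow> (f a, f b) \<in> S"
  shows "cyc_map R f \<in> zfunctors (cyc R) (cyc S)"
  by (rule zfunctorsI)
    (use f mono Linear_orderD(1,2)[OF R] in \<open>auto simp: cyc_map_def split_paired_all\<close>)

lemma cyc_map_apply:
  "a \<in> Field R \<Longrightarrow> fst (cyc_map R f) a = f a"
  "(a, b, k) \<in> zar (cyc R) \<Longrightarrow> snd (cyc_map R f) (a, b, k) = (f a, f b, k)"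
  by (simp_all add: cyc_map_def del: cyc_ops(7))

lemma cyc_map_ord_mem: "f \<in> mor Delta m n \<Longrightarrow> cyc_map (ord m) f \<in> mor DeltaC m n"
proof -
  assume f: "f \<in> mor Delta m n"
  have "cyc_map (ord m) f \<in> zfunctors (cyc (ord m)) (cyc (ord n))"
  proof (rule cyc_map_mem[OF Linear_order_ord])
    show "f a \<in> Field (ord n)" if "a \<in> Field (ord m)" for a
      using mor_DeltaD(1)[OF f] that unfolding Field_ord by simp
  qed (use mor_DeltaD[OF f] in \<open>auto simp: ord_def\<close>)
  then show ?thesis
    by (simp add: DeltaC_def)
qed

lemma obs_DeltaC [simp]: "n \<in> obs DeltaC"
  by (simp add: DeltaC_def)

lemma simplicial_of_presheaf:
  assumes X: "presheaf DeltaC X"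
  shows "presheaf Delta (simplicial_of X)"
proof -
  have cid: "cyc_map (ord n) (idm Delta n) = idm DeltaC n" for n
    by (auto simp: cyc_map_def DeltaC_def zfun_id_def Delta_def split_paired_all fun_eq_iff
        simp del: Field_ord simp: Field_ord[symmetric])
  have ccomp: "cyc_map (ord l) (cmp Delta l m n g f) =
      cmp DeltaC l m n (cyc_map (ord m) g) (cyc_map (ord l) f)"
    if f: "f \<in> mor Delta l m" and g: "g \<in> mor Delta m n" for l m n f g
  proof -
    have z: "zplus_category (cyc (ord l))"
      by (rule zplus_category_cyc[OF Linear_order_ord])
    have F: "cyc_map (ord l) f \<in> zfunctors (cyc (ord l)) (cyc (ord m))"
      and G: "cyc_map (ord m) g \<in> zfunctors (cyc (ord m)) (cyc (ord n))"
      and H: "cyc_map (ord l) (cmp Delta l m n g f) \<in> zfunctors (cyc (ord l)) (cyc (ord n))"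
      using cyc_map_ord_mem[OF f] cyc_map_ord_mem[OF g] cyc_map_ord_mem[OF cmp_Delta_mor[OF f g]]
      by (simp_all add: DeltaC_def)
    have "cyc_map (ord l) (cmp Delta l m n g f) = zfun_comp (cyc (ord l)) (cyc_map (ord m) g) (cyc_map (ord l) f)"
    proof (rule zfunctors_eqI[OF H zfun_comp_mem[OF z F G]])
      fix c assume c: "c \<in> zob (cyc (ord l))"
      then have "c \<le> l"
        by simp
      then show "fst (cyc_map (ord l) (cmp Delta l m n g f)) c =
          fst (zfun_comp (cyc (ord l)) (cyc_map (ord m) g) (cyc_map (ord l) f)) c"
        using zfunctorsD(3)[OF F c] unfolding zfun_comp_apply(1)[OF c] by (simp add: cyc_map_apply)
    next
      fix u assume u: "u \<in> zar (cyc (ord l))"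
      obtain a b k where abk: "u = (a, b, k)"
        by (cases u)
      then have "a \<le> l" "b \<le> l"
        using u by simp_all
      then show "snd (cyc_map (ord l) (cmp Delta l m n g f)) u =
          snd (zfun_comp (cyc (ord l)) (cyc_map (ord m) g) (cyc_map (ord l) f)) u"
        using zfunctorsD(4)[OF F u] u unfolding zfun_comp_apply(2)[OF u] unfolding abk
        by (simp add: cyc_map_apply del: cyc_ops(7))
    qed
    then show ?thesis
      by (simp add: DeltaC_def)
  qed
  show ?thesis
    unfolding presheaf_def
    using presheaf_pact_mem[OF X _ _ cyc_map_ord_mem] presheaf_pact_id[OF X]
      presheaf_pact_comp[OF X _ _ _ cyc_map_ord_mem cyc_map_ord_mem] cid ccomp
    by (simp add: simplicial_of_def)
qed

subsection \<open>Presheaves on cyclic categories\<close>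

lemma DeltaC_big_ops [simp]: "mor DeltaC_big = zfunctors" "idm DeltaC_big = zfun_id"
  "cmp DeltaC_big B C D G F = zfun_comp B G F"
  by (simp_all add: DeltaC_big_def)

lemma zrelabel_obs:
  assumes "inj i" "inj j" and C: "zplus_category C" and iso: "ziso (cyc (ord n)) C F"
  shows "zrelabel i j C \<in> obs DeltaC_big"
proof -
  note z = zplus_category_cyc[OF Linear_order_ord, of n]
  note iso' = ziso_comp[OF z iso ziso_zrelabel[OF assms(1,2) C]]
  have "zisomorphic (cyc (ord n)) (zrelabel i j C)"
    unfolding zisomorphic_def using ziso_inverse[OF z iso'] iso' by (auto simp: ziso_def)
  then show ?thesis
    using zplus_category_zrelabel[OF assms(1-3)] by (auto simp: DeltaC_big_def)
qed

lemma ziso_id: "zplus_category C \<Longrightarrow> ziso C C (zfun_id C)"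
  by (simp add: ziso_def zfun_id_mem) (simp add: zfun_id_def bij_betw_def inj_on_def)

lemma std_cyc_obs: "std_cyc n \<in> obs DeltaC_big"
  unfolding std_cyc_def
  using zrelabel_obs[OF inj_Inl inj_Inl zplus_category_cyc ziso_id[OF zplus_category_cyc]] Linear_order_ord
  by blast

lemma DeltaC_big_pact_bij:
  assumes X: "presheaf DeltaC_big Xt" and obs: "zrelabel i j C \<in> obs DeltaC_big" "zrelabel i' j' D \<in> obs DeltaC_big"
    and inj: "inj i" "inj j" "inj i'" "inj j'" and C: "zplus_category C" and D: "zplus_category D"
    and iso: "ziso C D F"
  shows "bij_betw (pact Xt (zrelabel i j C) (zrelabel i' j' D) (zrelabel_fun C i j i' j' F))
    (pob Xt (zrelabel i' j' D)) (pob Xt (zrelabel i j C))"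
proof -
  note inv = ziso_inverse[OF C iso]
  have F: "F \<in> zfunctors C D"
    using iso by (simp add: ziso_def)
  let ?F = "zrelabel_fun C i j i' j' F" and ?G = "zrelabel_fun D i' j' i j (zfun_inv C D F)"
  have m: "?F \<in> mor DeltaC_big (zrelabel i j C) (zrelabel i' j' D)"
    "?G \<in> mor DeltaC_big (zrelabel i' j' D) (zrelabel i j C)"
    using zrelabel_fun_mem[OF inj C F] zrelabel_fun_mem[OF inj(3,4,1,2) D inv(1)] by simp_all
  have c: "zfun_comp (zrelabel i j C) ?G ?F = zfun_id (zrelabel i j C)"
    "zfun_comp (zrelabel i' j' D) ?F ?G = zfun_id (zrelabel i' j' D)"
    using zrelabel_fun_comp[OF inj F, of i j "zfun_inv C D F"] inv(2) zrelabel_fun_id[OF inj(1,2)]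
      zrelabel_fun_comp[OF inj(3,4,1,2) inv(1), of i' j' F] inv(3) zrelabel_fun_id[OF inj(3,4)] by simp_all
  show ?thesis
  proof (rule bij_betw_byWitness[where f' = "pact Xt (zrelabel i' j' D) (zrelabel i j C) ?G"])
    show "\<forall>x\<in>pob Xt (zrelabel i' j' D). pact Xt (zrelabel i' j' D) (zrelabel i j C) ?G
        (pact Xt (zrelabel i j C) (zrelabel i' j' D) ?F x) = x"
      using presheaf_pact_comp[OF X obs(2,1,2) m(2,1)] presheaf_pact_id[OF X obs(2)] c(2) by simp
    show "\<forall>x\<in>pob Xt (zrelabel i j C). pact Xt (zrelabel i j C) (zrelabel i' j' D) ?F
        (pact Xt (zrelabel i' j' D) (zrelabel i j C) ?G x) = x"
      using presheaf_pact_comp[OF X obs(1,2,1) m(1,2)] presheaf_pact_id[OF X obs(1)] c(1) by simp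
  qed (use presheaf_pact_mem[OF X obs m(1)] presheaf_pact_mem[OF X obs(2,1) m(2)] in auto)
qed

section \<open>Functors induced by maps of circles\<close>

text \<open>
  The lifts of those maps that carry components of the complement of \<open>G\<close> into components of the
  complement of \<open>F\<close>: a separating point of the target must be the image of a separating point of the source.
\<close>

definition lift_map :: "real \<Rightarrow> real set set \<Rightarrow> real \<Rightarrow> real set set \<Rightarrow> (real \<Rightarrow> real) \<Rightarrow> bool" where
  "lift_map L G L' F l \<longleftrightarrow> continuous_on UNIV l \<and> strict_mono l \<and> (\<forall>x. l (x + L) = l x + L') \<and>
     (\<forall>f'. circ_pt L' f' \<in> F \<longrightarrow> (\<exists>f. f' = l f \<and> circ_pt L f \<in> G))"

text \<open>
  The functor \<open>\<Phi>\<close> is given on gaps by applying \<open>e\<close> to arbitrary points in them. The inequality between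
  representatives says that \<open>arr\<close> of the images is again a morphism.
\<close>

definition acts ::
  "real \<Rightarrow> real set set \<Rightarrow> real \<Rightarrow> real set set \<Rightarrow>
    (real set set, real set set \<times> real set set \<times> hclass, real set set, real set set \<times> real set set \<times> hclass) zfun \<Rightarrow>
    (real \<Rightarrow> real) \<Rightarrow> bool" where
  "acts L G L' F \<Phi> e \<longleftrightarrow> \<Phi> \<in> zfunctors (cpi0 L G) (cpi0 L' F) \<and>
     (\<forall>x. circ_pt L x \<notin> G \<longrightarrow> circ_pt L' (e x) \<notin> F \<and> fst \<Phi> (cob L G x) = cob L' F (e x)) \<and>
     (\<forall>x y. circ_pt L x \<notin> G \<longrightarrow> circ_pt L y \<notin> G \<longrightarrow> rep L G x \<le> rep L G y \<longrightarrow>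
        rep L' F (e x) \<le> rep L' F (e y) \<and> snd \<Phi> (arr L G x y) = arr L' F (e x) (e y))"

lemma actsD:
  assumes "acts L G L' F \<Phi> e"
  shows "\<Phi> \<in> zfunctors (cpi0 L G) (cpi0 L' F)"
    and "\<And>x. circ_pt L x \<notin> G \<Longrightarrow> circ_pt L' (e x) \<notin> F"
    and "\<And>x. circ_pt L x \<notin> G \<Longrightarrow> fst \<Phi> (cob L G x) = cob L' F (e x)"
    and "\<And>x y. circ_pt L x \<notin> G \<Longrightarrow> circ_pt L y \<notin> G \<Longrightarrow> rep L G x \<le> rep L G y \<Longrightarrow>
      rep L' F (e x) \<le> rep L' F (e y)"
    and "\<And>x y. circ_pt L x \<notin> G \<Longrightarrow> circ_pt L y \<notin> G \<Longrightarrow> rep L G x \<le> rep L G y \<Longrightarrow>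
      snd \<Phi> (arr L G x y) = arr L' F (e x) (e y)"
  using assms unfolding acts_def by blast+

lemma cpi0_functor_eqI:
  assumes L: "0 < L" and G: "G \<in> fin_circle L"
    and \<Phi>: "\<Phi> \<in> zfunctors (cpi0 L G) C" and \<Psi>: "\<Psi> \<in> zfunctors (cpi0 L G) C"
    and ob: "\<And>x. circ_pt L x \<notin> G \<Longrightarrow> fst \<Phi> (cob L G x) = fst \<Psi> (cob L G x)"
    and ar: "\<And>x y. circ_pt L x \<notin> G \<Longrightarrow> circ_pt L y \<notin> G \<Longrightarrow> rep L G x \<le> rep L G y \<Longrightarrow>
      snd \<Phi> (arr L G x y) = snd \<Psi> (arr L G x y)"
  shows "\<Phi> = \<Psi>"
proof (rule zfunctors_eqI[OF \<Phi> \<Psi>])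
  show "fst \<Phi> c = fst \<Psi> c" if "c \<in> zob (cpi0 L G)" for c
    using that ob unfolding cpi0_obj[OF L G] by blast
  show "snd \<Phi> f = snd \<Psi> f" if "f \<in> zar (cpi0 L G)" for f
    using that by (rule cpi0_arrowE[OF L G]) (use ar rep_mono[OF L G] in blast)
qed

lemma acts_eq:
  assumes L: "0 < L" and G: "G \<in> fin_circle L" and \<Phi>: "acts L G L' F \<Phi> e" and \<Psi>: "acts L G L' F \<Psi> e'"
    and eq: "\<And>x. circ_pt L x \<notin> G \<Longrightarrow> e x = e' x"
  shows "\<Phi> = \<Psi>"
  by (rule cpi0_functor_eqI[OF L G actsD(1)[OF \<Phi>] actsD(1)[OF \<Psi>]])
    (simp_all add: actsD(3,5)[OF \<Phi>] actsD(3,5)[OF \<Psi>] eq)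

lemma acts_id: "0 < L \<Longrightarrow> G \<in> fin_circle L \<Longrightarrow> acts L G L G (zfun_id (cpi0 L G)) (\<lambda>x. x)"
  unfolding acts_def
  by (auto simp: zfun_id_mem zplus_category_cpi0 zfun_id_apply cpi0_obj arr_mem(1))

lemma acts_comp:
  assumes L: "0 < L" and G: "G \<in> fin_circle L"
    and \<Phi>: "acts L G L' F \<Phi> e" and \<Psi>: "acts L' F L'' E \<Psi> e'"
  shows "acts L G L'' E (zfun_comp (cpi0 L G) \<Psi> \<Phi>) (\<lambda>x. e' (e x))"
  unfolding acts_def
  using zfun_comp_mem[OF zplus_category_cpi0[OF L G] actsD(1)[OF \<Phi>] actsD(1)[OF \<Psi>]]
  by (auto simp: zfun_comp_apply cpi0_obj[OF L G] arr_mem(1)[OF L G] actsD(2-)[OF \<Phi>] actsD(2-)[OF \<Psi>])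

text \<open>Over an arc, paths lift, because the projection from a gap to the arc is a homeomorphism.\<close>

lemma path_lift_gap:
  assumes L: "0 < L" and F: "F \<in> fin_circle L" and x: "circ_pt L x \<notin> F"
    and u: "u \<in> paths_in L (cob L F x) (circ_pt L a) (circ_pt L b)"
    and a: "a \<in> gap L F x" and b: "b \<in> gap L F x"
  obtains l where "is_lift L u l" "l 0 = a" "l 1 = b"
proof -
  let ?T = "subtopology (circ_top L) (cob L F x)"
  have top: "topspace ?T = circ_pt L ` gap L F x"
    unfolding cob_def[symmetric] using cob_image[OF L F, of _ x] by auto
  have "homeomorphic_map (top_of_set (gap L F x)) ?T (circ_pt L)"
  proof (rule bijective_open_imp_homeomorphic_map)
    show "continuous_map (top_of_set (gap L F x)) ?T (circ_pt L)"
      by (simp add: continuous_map_in_subtopology continuous_map_from_subtopology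
          continuous_map_circ_pt cob_def)
    show "open_map (top_of_set (gap L F x)) ?T (circ_pt L)"
      unfolding open_map_def
    proof (intro allI impI)
      fix V assume "openin (top_of_set (gap L F x)) V"
      then have V: "open V" "V \<subseteq> gap L F x"
        using openin_open_eq[OF open_connected_component[OF open_cov[OF F L]]] by auto
      then show "openin ?T (circ_pt L ` V)"
        unfolding openin_subtopology
        by (intro exI[of _ "circ_pt L ` V"] conjI openin_circ_pt_image) (auto simp: cob_def)
    qed
    show "circ_pt L ` topspace (top_of_set (gap L F x)) = topspace ?T"
      unfolding top by simp
    show "inj_on (circ_pt L) (topspace (top_of_set (gap L F x)))"
      using gap_inj[OF L F x] by (auto intro: inj_onI)
  qed
  then obtain g where g: "homeomorphic_maps (top_of_set (gap L F x)) ?T (circ_pt L) g"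
    using homeomorphic_map_maps by blast
  have u': "continuous_map (top_of_set {0..1}) ?T u" "u 0 = circ_pt L a" "u 1 = circ_pt L b"
    using u by (auto simp: paths_in_def pathin_def)
  have "continuous_map (top_of_set {0..1}) (top_of_set (gap L F x)) (g \<circ> u)"
    using u'(1) g continuous_map_compose unfolding homeomorphic_maps_def by blast
  then have c: "continuous_on {0..1} (g \<circ> u)"
    by (simp add: continuous_map_in_subtopology)
  have "circ_pt L (g (u t)) = u t" if "t \<in> {0..1}" for t
  proof -
    have "t \<in> topspace (top_of_set {0..1})"
      using that by simp
    then have "u t \<in> topspace ?T"
      using continuous_map_image_subset_topspace[OF u'(1)] by blast
    then show ?thesis
      using g unfolding homeomorphic_maps_def by blast
  qed
  then have "is_lift L u (g \<circ> u)"
    using c by (simp add: is_lift_def)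
  moreover have "(g \<circ> u) 0 = a" "(g \<circ> u) 1 = b"
    using g a b u'(2,3) unfolding homeomorphic_maps_def by simp_all
  ultimately show ?thesis
    by (rule that)
qed

lemma paths_in_nonempty:
  assumes x: "circ_pt L x \<notin> F" and a: "a \<in> gap L F x" and b: "b \<in> gap L F x"
  shows "paths_in L (cob L F x) (circ_pt L a) (circ_pt L b) \<noteq> {}"
proof -
  let ?l = "\<lambda>t. (1 - t) * a + t * b"
  have conv: "?l t \<in> gap L F x" if "t \<in> {0..1}" for t
  proof -
    have "convex (gap L F x)"
      using is_interval_convex_1 is_interval_connected_1 connected_connected_component by blast
    then show ?thesis
      using a b that by (simp add: convex_alt)
  qed
  have "continuous_map (top_of_set {0..1}) (circ_top L) (circ_pt L \<circ> ?l)"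
    by (intro continuous_map_compose[OF _ continuous_map_circ_pt]) (auto intro!: continuous_intros)
  then have "(circ_pt L \<circ> ?l) \<in> paths_in L (cob L F x) (circ_pt L a) (circ_pt L b)"
    using conv by (auto simp: paths_in_def pathin_def continuous_map_in_subtopology cob_def)
  then show ?thesis
    by blast
qed

lemma lift_map_shift:
  fixes L L' :: real
  assumes l: "\<And>x. l (x + L) = l x + L'"
  shows "l (x + L * of_int k) = l x + L' * of_int k"
proof -
  have nat: "l (x + L * real n) = l x + L' * real n" for n x
  proof (induction n)
    case (Suc n)
    have eq: "x + L * real (Suc n) = (x + L * real n) + L"
      by (simp add: algebra_simps)
    show ?case
      unfolding eq l Suc.IH by (simp add: algebra_simps)
  qed simp
  show ?thesis
  proof (cases "0 \<le> k")
    case True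
    then show ?thesis
      using nat[of x "nat k"] by simp
  next
    case False
    then show ?thesis
      using nat[of "x + L * of_int k" "nat (- k)"] by simp
  qed
qed

text \<open>
  The auxiliary paths in \<open>cpi0_map\<close> from and to the chosen points lie in single arcs, so they lift to
  paths inside single gaps. The lift of the whole concatenation therefore runs from the representative
  of the gap of \<open>l x\<close> to that of the gap of \<open>l y\<close>, which is what \<open>arr (l x) (l y)\<close> prescribes.
\<close>

lemma cpi0_map_acts:
  assumes L: "0 < L" and G: "G \<in> fin_circle L" and L': "0 < L'" and F: "F \<in> fin_circle L'"
    and l: "lift_map L G L' F l" and h: "\<And>x. h (circ_pt L x) = circ_pt L' (l x)"
  shows "acts L G L' F (cpi0_map L G L' F h) l"
proof -
  let ?\<Phi> = "cpi0_map L G L' F h"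
  have mono: "l x < l y \<longleftrightarrow> x < y" for x y
    using l by (simp add: lift_map_def strict_mono_less)
  have cont: "continuous_on A l" for A
    using l continuous_on_subset by (auto simp: lift_map_def)
  have over: "\<exists>f. f' = l f \<and> circ_pt L f \<in> G" if "circ_pt L' f' \<in> F" for f'
    using l that by (simp add: lift_map_def)
  have sh: "l (x + L) = l x + L'" for x
    using l by (simp add: lift_map_def)
  have cov: "circ_pt L' (l x) \<notin> F" if "circ_pt L x \<notin> G" for x
  proof
    assume "circ_pt L' (l x) \<in> F"
    then obtain f where "l x = l f" "circ_pt L f \<in> G"
      using over by blast
    then show False
      using that mono[of x f] mono[of f x] by (metis linorder_neqE_linordered_idom order.irrefl)
  qed
  have gap: "l y \<in> gap L' F (l x)" if x: "circ_pt L x \<notin> G" and y: "y \<in> gap L G x" for x y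
    unfolding gap_iff[OF cov[OF x]]
    using over y cov mono unfolding gap_iff[OF x] by metis
  have le: "rep L' F (l x) \<le> rep L' F (l y)"
    if x: "circ_pt L x \<notin> G" and y: "circ_pt L y \<notin> G" and "rep L G x \<le> rep L G y" for x y
    using that(3) over mono unfolding rep_le_iff[OF L G x y] rep_le_iff[OF L' F cov[OF x] cov[OF y]] by metis
  have comp: "ccomp_map L' F h (cob L G x) = cob L' F (l x)" if x: "circ_pt L x \<notin> G" for x
    unfolding ccomp_map_def
  proof (rule the_equality)
    show "cob L' F (l x) \<in> ccomps L' F \<and> h ` cob L G x \<subseteq> cob L' F (l x)"
      using cov[OF x] gap[OF x] h by (auto simp: ccomps_eq[OF L' F] cob_def)
    fix c assume c: "c \<in> ccomps L' F \<and> h ` cob L G x \<subseteq> c"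
    then obtain y where y: "circ_pt L' y \<notin> F" "c = cob L' F y"
      using cpi0_objE[OF L' F] by metis
    have "h (circ_pt L x) \<in> h ` cob L G x"
      unfolding cob_def by (intro imageI gap_self[OF x])
    then have "circ_pt L' (l x) \<in> c"
      using c h[of x] by auto
    then show "c = cob L' F (l x)"
      using cob_eq_iff(2)[OF L' F y(1) cov[OF x]] y(2) by simp
  qed
  have ob: "fst ?\<Phi> (cob L G x) = cob L' F (l x)" if x: "circ_pt L x \<notin> G" for x
    using comp[OF x] x by (auto simp: cpi0_map_def ccomps_eq[OF L G])
  have ar: "snd ?\<Phi> (arr L G x y) = arr L' F (l x) (l y)"
    if x: "circ_pt L x \<notin> G" and y: "circ_pt L y \<notin> G" and xy: "rep L G x \<le> rep L G y" for x y
  proof -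
    let ?a = "rep L G x" and ?b = "rep L G y" and ?a' = "rep L' F (l x)" and ?b' = "rep L' F (l y)"
    let ?U = "paths_in L' (cob L' F (l x)) (chosen (cob L' F (l x))) (h (chosen (cob L G x)))"
    let ?V = "paths_in L' (cob L' F (l y)) (h (chosen (cob L G y))) (chosen (cob L' F (l y)))"
    note x' = cov[OF x] and y' = cov[OF y]
    have ch: "chosen (cob L' F (l x)) = circ_pt L' ?a'" "h (chosen (cob L G x)) = circ_pt L' (l ?a)"
      "chosen (cob L' F (l y)) = circ_pt L' ?b'" "h (chosen (cob L G y)) = circ_pt L' (l ?b)"
      using rep(2)[OF L G x] rep(2)[OF L G y] rep(2)[OF L' F x'] rep(2)[OF L' F y'] h by metis+
    note g = rep(1)[OF L' F x'] gap[OF x rep(1)[OF L G x]] rep(1)[OF L' F y'] gap[OF y rep(1)[OF L G y]]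
    have "path_class L' (path_join u (path_join (h \<circ> p) v)) = hcls L' ?a' ?b'"
      if p: "p \<in> hcls L ?a ?b" and u: "u \<in> ?U" and v: "v \<in> ?V" for p u v
    proof -
      obtain m where m: "m 0 = ?a" "m 1 = ?b" "is_lift L p m"
        using p by (rule hclsE)
      obtain mu where mu: "is_lift L' u mu" "mu 0 = ?a'" "mu 1 = l ?a"
        using path_lift_gap[OF L' F x' u[unfolded ch] g(1,2)] .
      obtain mv where mv: "is_lift L' v mv" "mv 0 = l ?b" "mv 1 = ?b'"
        using path_lift_gap[OF L' F y' v[unfolded ch] g(4,3)] .
      have "is_lift L' (h \<circ> p) (l \<circ> m)"
        using m(3) h cont continuous_on_compose[of "{0..1}" m l] by (simp add: is_lift_def)
      then have "is_lift L' (path_join u (path_join (h \<circ> p) v)) (path_join mu (path_join (l \<circ> m) mv))"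
        using mu mv m by (intro is_lift_join) (simp_all add: path_join_ends)
      from path_class_eq[OF L' this] show ?thesis
        using mu mv by (simp add: path_join_ends)
    qed
    then have "(\<Union>p\<in>hcls L ?a ?b. \<Union>u\<in>?U. \<Union>v\<in>?V. path_class L' (path_join u (path_join (h \<circ> p) v))) =
        hcls L' ?a' ?b'"
      using hcls_nonempty[OF xy, of L] paths_in_nonempty[OF x' g(1,2), folded ch]
        paths_in_nonempty[OF y' g(4,3), folded ch]
      by (intro UN_const_eq) blast+
    then show ?thesis
      using arr_mem(1)[OF L G x y xy] comp[OF x] comp[OF y] by (simp add: cpi0_map_def arr_def Let_def)
  qed
  have "?\<Phi> \<in> zfunctors (cpi0 L G) (cpi0 L' F)"
  proof (rule zfunctorsI)
    show "fst ?\<Phi> \<in> extensional (zob (cpi0 L G))" "snd ?\<Phi> \<in> extensional (zar (cpi0 L G))"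
      by (simp_all add: cpi0_map_def) (simp add: cpi0_def)
  next
    fix c assume "c \<in> zob (cpi0 L G)"
    then obtain x where x: "circ_pt L x \<notin> G" "c = cob L G x"
      unfolding cpi0_obj[OF L G] by blast
    note x' = cov[OF x(1)]
    have le1: "rep L G x \<le> rep L G (x + L)"
      using x L by (intro rep_mono[OF L G]) auto
    show "fst ?\<Phi> c \<in> zob (cpi0 L' F)" "snd ?\<Phi> (zid (cpi0 L G) c) = zid (cpi0 L' F) (fst ?\<Phi> c)"
      "snd ?\<Phi> (zone (cpi0 L G) c) = zone (cpi0 L' F) (fst ?\<Phi> c)"
      using x(1) x' ob[OF x(1)] ar[of x x] ar[of x "x + L"] le1 sh unfolding x(2)
      by (auto simp: cpi0_obj[OF L' F] cpi0_id[OF L G] cpi0_id[OF L' F] cpi0_one[OF L G] cpi0_one[OF L' F])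
  next
    fix f assume "f \<in> zar (cpi0 L G)"
    then obtain x y where x: "circ_pt L x \<notin> G" "circ_pt L y \<notin> G" "x \<le> y" "f = arr L G x y"
      by (rule cpi0_arrowE[OF L G])
    note xy = rep_mono[OF L G x(1-3)]
    show "snd ?\<Phi> f \<in> zar (cpi0 L' F)" "zdom (cpi0 L' F) (snd ?\<Phi> f) = fst ?\<Phi> (zdom (cpi0 L G) f)"
      "zcod (cpi0 L' F) (snd ?\<Phi> f) = fst ?\<Phi> (zcod (cpi0 L G) f)"
      unfolding x(4) ar[OF x(1,2) xy]
      using arr_mem[OF L' F cov[OF x(1)] cov[OF x(2)] le[OF x(1,2) xy]] arr_mem[OF L G x(1,2) xy] ob x
      by simp_all
  next
    fix f g assume "f \<in> zar (cpi0 L G)" "g \<in> zar (cpi0 L G)" "zcod (cpi0 L G) f = zdom (cpi0 L G) g"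
    then obtain x y z where x: "circ_pt L x \<notin> G" "circ_pt L y \<notin> G" "circ_pt L z \<notin> G"
      "rep L G x \<le> rep L G y" "rep L G y \<le> rep L G z" "f = arr L G x y" "g = arr L G y z"
      by (rule cpi0_composableE[OF L G])
    have xz: "rep L G x \<le> rep L G z"
      using x by simp
    show "snd ?\<Phi> (zcomp (cpi0 L G) g f) = zcomp (cpi0 L' F) (snd ?\<Phi> g) (snd ?\<Phi> f)"
      unfolding x(6,7) cpi0_comp[OF L G x(4,5)] ar[OF x(1,3) xz] ar[OF x(1,2,4)] ar[OF x(2,3,5)]
      using cpi0_comp[OF L' F le[OF x(1,2,4)] le[OF x(2,3,5)]] by simp
  qed
  then show ?thesis
    unfolding acts_def using cov ob ar le by blast
qed

lemma lift_map_refine: "F \<subseteq> G \<Longrightarrow> lift_map L G L F (\<lambda>x. x)"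
  by (auto simp: lift_map_def strict_mono_def)

lemma refine_acts:
  assumes "0 < L" "F \<in> fin_circle L" "G \<in> fin_circle L" "F \<subseteq> G"
  shows "acts L G L F (cpi0_map L G L F (\<lambda>x. x)) (\<lambda>x. x)"
  by (rule cpi0_map_acts[OF assms(1,3,1,2) lift_map_refine[OF assms(4)]]) simp

subsection \<open>Homeomorphisms of circles\<close>

definition circle_homeos :: "real \<Rightarrow> real \<Rightarrow> (real set \<Rightarrow> real set) set" where
  "circle_homeos L L' = {h \<in> extensional (circ L). 0 < L \<and> 0 < L' \<and>
     homeomorphic_map (circ_top L) (circ_top L') h \<and>
     (\<exists>l. continuous_on UNIV l \<and> strict_mono l \<and> (\<forall>x. h (circ_pt L x) = circ_pt L' (l x)))}"

lemma circle_homeosD: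
  assumes "h \<in> circle_homeos L L'"
  shows "0 < L" "0 < L'" "h \<in> extensional (circ L)" "homeomorphic_map (circ_top L) (circ_top L') h"
    "bij_betw h (circ L) (circ L')"
proof -
  show "0 < L" "0 < L'" "h \<in> extensional (circ L)" and h: "homeomorphic_map (circ_top L) (circ_top L') h"
    using assms by (auto simp: circle_homeos_def)
  show "bij_betw h (circ L) (circ L')"
    using homeomorphic_imp_surjective_map[OF h] homeomorphic_imp_injective_map[OF h] unfolding bij_betw_def by blast
qed

text \<open>An injective map of circles has a lift of degree one: going once around the source, the lift
  cannot pass a second lift of its initial value.\<close>

lemma circle_homeo_lift:
  assumes h: "h \<in> circle_homeos L L'"
  obtains l where "continuous_on UNIV l" "strict_mono l" "\<forall>x. l (x + L) = l x + L'" "surj l"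
    "\<forall>x. h (circ_pt L x) = circ_pt L' (l x)"
proof -
  note L = circle_homeosD(1,2)[OF h]
  obtain l where l: "continuous_on UNIV l" "strict_mono l" and hl: "\<And>x. h (circ_pt L x) = circ_pt L' (l x)"
    using h by (auto simp: circle_homeos_def)
  have cont: "continuous_on A l" for A
    using l(1) continuous_on_subset by blast
  have sh: "l (x + L) = l x + L'" for x
  proof -
    have "circ_pt L' (l x) = circ_pt L' (l (x + L))"
      using hl[of x] hl[of "x + L"] by simp
    then obtain k :: int where k: "l (x + L) = l x + L' * of_int k"
      using circ_pt_iff by blast
    have "l x < l (x + L)"
      using l(2) L by (simp add: strict_mono_less)
    then have k1: "1 \<le> k"
      using k L by (simp add: zero_less_mult_iff)
    have "k < 2"
    proof (rule ccontr)
      assume "\<not> k < 2"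
      then have "L' * 2 \<le> L' * of_int k"
        using L by simp
      then have lt: "l x < l x + L'" "l x + L' < l (x + L)"
        using L unfolding k by linarith+
      then obtain y where y: "x \<le> y" "y \<le> x + L" "l y = l x + L'"
        using IVT'[of l x "l x + L'" "x + L"] cont L by auto
      then have "h (circ_pt L y) = h (circ_pt L x)"
        using hl by simp
      then have "circ_pt L x = circ_pt L y"
        using circle_homeosD(5)[OF h] by (auto simp: bij_betw_def inj_on_def)
      then obtain j :: int where j: "y = x + L * of_int j"
        using circ_pt_iff by blast
      have "y \<noteq> x" "y \<noteq> x + L"
        using y lt by auto
      then have "L * 0 < L * of_int j" "L * of_int j < L * 1"
        using y(1,2) j unfolding mult_1_right mult_zero_right by linarith+
      then have "0 < real_of_int j" "real_of_int j < 1"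
        using L by (simp_all only: mult_less_cancel_left_pos)
      then have "0 < j" "j < 1"
        by simp_all
      then show False
        by simp
    qed
    then show ?thesis
      using k k1 by auto
  qed
  have "\<exists>x. l x = y" for y
  proof -
    define n where "n = \<lceil>\<bar>y - l 0\<bar> / L'\<rceil>"
    have "\<bar>y - l 0\<bar> / L' \<le> of_int n" "0 \<le> \<bar>y - l 0\<bar> / L'"
      using L by (auto simp: n_def)
    then have "0 \<le> real_of_int n"
      by linarith
    then have n: "\<bar>y - l 0\<bar> \<le> L' * of_int n" "0 \<le> n"
      using \<open>\<bar>y - l 0\<bar> / L' \<le> of_int n\<close> L by (simp_all add: field_simps)
    have e: "l (L * of_int k) = l 0 + L' * of_int k" for k
      using lift_map_shift[of l L L' 0 k] sh by simp
    have "l (L * of_int (- n)) \<le> y" "y \<le> l (L * of_int n)"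
      using n(1) unfolding e by auto
    moreover have "L * of_int (- n) \<le> L * of_int n"
      using n(2) L by simp
    ultimately show ?thesis
      using IVT'[of l "L * of_int (- n)" y "L * of_int n"] cont by blast
  qed
  then have "surj l"
    by (metis surjI)
  then show ?thesis
    using that l sh hl by blast
qed

lemma inverse_lift:
  assumes "strict_mono l" "surj l" "\<And>x. l (x + L) = l x + (L'::real)"
  shows "continuous_on UNIV (inv_into UNIV l)" "strict_mono (inv_into UNIV l)" "\<And>y. inv_into UNIV l (y + L') = inv_into UNIV l y + (L::real)"
    "\<And>x. inv_into UNIV l (l x) = x" "\<And>y. l (inv_into UNIV l y) = y"
proof -
  have inj: "inj l"
    using assms(1) strict_mono_imp_inj_on by blast
  show 1: "inv_into UNIV l (l x) = x" for x
    using inj by (simp add: inv_f_f)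
  show 2: "l (inv_into UNIV l y) = y" for y
    using assms(2) by (rule surj_f_inv_f)
  show m: "strict_mono (inv_into UNIV l)"
  proof (rule strict_monoI)
    fix x y :: real assume "x < y"
    then show "inv_into UNIV l x < inv_into UNIV l y"
      using strict_mono_less[OF assms(1), of "inv_into UNIV l x" "inv_into UNIV l y"] 2 by simp
  qed
  have "range (inv_into UNIV l) = UNIV"
    using 1 by (metis surjI)
  then show "continuous_on UNIV (inv_into UNIV l)"
    using m by (intro continuous_onI_mono) (auto simp: strict_mono_less_eq)
  show "inv_into UNIV l (y + L') = inv_into UNIV l y + L" for y
    using assms(3)[of "inv_into UNIV l y"] 1[of "inv_into UNIV l y + L"] 2[of y] by simp
qed

lemma circle_homeo_inv_lift:
  assumes h: "h \<in> circle_homeos L L'" and l: "strict_mono l" "surj l" "\<And>x. l (x + L) = l x + L'"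
    and hl: "\<And>x. h (circ_pt L x) = circ_pt L' (l x)"
  shows "(\<lambda>P\<in>circ L'. inv_into (circ L) h P) (circ_pt L' y) = circ_pt L (inv_into UNIV l y)"
proof -
  have "h (circ_pt L (inv_into UNIV l y)) = circ_pt L' y"
    unfolding hl using inverse_lift(5)[OF l] by simp
  then have "inv_into (circ L) h (circ_pt L' y) = circ_pt L (inv_into UNIV l y)"
    using circle_homeosD(5)[OF h] by (intro inv_into_f_eq) (auto simp: bij_betw_def)
  then show ?thesis
    by simp
qed

lemma circle_homeos_id: "0 < L \<Longrightarrow> (\<lambda>P\<in>circ L. P) \<in> circle_homeos L L"
  unfolding circle_homeos_def
  by (auto intro!: homeomorphic_map_eq[OF homeomorphic_map_id[THEN iffD2, OF refl]] exI[of _ "\<lambda>x. x"]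
      simp: strict_mono_def)

lemma circle_homeos_comp:
  assumes h: "h \<in> circle_homeos L L'" and g: "g \<in> circle_homeos L' L''"
  shows "compose (circ L) g h \<in> circle_homeos L L''"
proof -
  obtain l where l: "continuous_on UNIV l" "strict_mono l" "\<forall>x. l (x + L) = l x + L'" "surj l"
    "\<forall>x. h (circ_pt L x) = circ_pt L' (l x)"
    using circle_homeo_lift[OF h] .
  obtain m where m: "continuous_on UNIV m" "strict_mono m" "\<forall>x. m (x + L') = m x + L''" "surj m"
    "\<forall>x. g (circ_pt L' x) = circ_pt L'' (m x)"
    using circle_homeo_lift[OF g] .
  have "continuous_on UNIV (\<lambda>x. m (l x))"
    using continuous_on_compose2[OF m(1) l(1)] by simp
  moreover have "strict_mono (\<lambda>x. m (l x))"
    using l(2) m(2) by (simp add: strict_mono_def)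
  moreover have "compose (circ L) g h (circ_pt L x) = circ_pt L'' (m (l x))" for x
    using l(5) m(5) by (simp add: compose_def)
  ultimately have "\<exists>l. continuous_on UNIV l \<and> strict_mono l \<and>
      (\<forall>x. compose (circ L) g h (circ_pt L x) = circ_pt L'' (l x))"
    by blast
  then show ?thesis
    using circle_homeosD(1)[OF h] circle_homeosD(2)[OF g] compose_extensional[of "circ L" g h]
      homeomorphic_map_compose_restrict[OF circle_homeosD(4)[OF h] circle_homeosD(4)[OF g]]
    unfolding circle_homeos_def mem_Collect_eq by (intro conjI)
qed

lemma circle_homeos_inv:
  assumes h: "h \<in> circle_homeos L L'"
  shows "(\<lambda>P\<in>circ L'. inv_into (circ L) h P) \<in> circle_homeos L' L"
proof -
  obtain l where "continuous_on UNIV l" and l1: "strict_mono l" and l3: "\<forall>x. l (x + L) = l x + L'"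
    and l2: "surj l" and hl: "\<forall>x. h (circ_pt L x) = circ_pt L' (l x)"
    using circle_homeo_lift[OF h] .
  note l = l1 l2 l3[rule_format]
  have "\<exists>l. continuous_on UNIV l \<and> strict_mono l \<and>
      (\<forall>x. (\<lambda>P\<in>circ L'. inv_into (circ L) h P) (circ_pt L' x) = circ_pt L (l x))"
    using inverse_lift(1,2)[OF l] circle_homeo_inv_lift[OF h l hl[rule_format]] by blast
  then show ?thesis
    using circle_homeosD(1,2)[OF h] homeomorphic_map_inv_into[OF circle_homeosD(4)[OF h]]
    unfolding circle_homeos_def mem_Collect_eq by (intro conjI restrict_extensional) simp_all
qed

lemma circle_homeos_image: "h \<in> circle_homeos L L' \<Longrightarrow> F \<in> fin_circle L \<Longrightarrow> h ` F \<in> fin_circle L'"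
  using bij_betwE[OF circle_homeosD(5)[of h L L']] by (auto simp: fin_circle_def subset_iff)

lemma homeo_map_acts:
  assumes h: "h \<in> circle_homeos L L'" and F: "F \<in> fin_circle L"
    and l: "continuous_on UNIV l" "strict_mono l" "surj l" "\<And>x. l (x + L) = l x + L'"
    and hl: "\<And>x. h (circ_pt L x) = circ_pt L' (l x)"
  shows "acts L F L' (h ` F) (cpi0_map L F L' (h ` F) h) l"
    and "acts L' (h ` F) L F (zfun_inv (cpi0 L F) (cpi0 L' (h ` F)) (cpi0_map L F L' (h ` F) h)) (inv_into UNIV l)"
proof -
  note L = circle_homeosD(1,2)[OF h] and hF = circle_homeos_image[OF h F] and il = inverse_lift[OF l(2-4)]
  let ?h' = "\<lambda>P\<in>circ L'. inv_into (circ L) h P"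
  have "lift_map L F L' (h ` F) l"
    unfolding lift_map_def
  proof (intro conjI allI impI l)
    fix f' assume "circ_pt L' f' \<in> h ` F"
    then obtain Q where Q: "Q \<in> F" "circ_pt L' f' = h Q"
      by blast
    then obtain q where q: "Q = circ_pt L q"
      using fin_circleD[OF F] by (auto simp: circ_eq)
    then obtain k :: int where k: "f' = l q + L' * of_int k"
      using Q(2) hl circ_pt_iff by metis
    then have "f' = l (q + L * of_int k)"
      using lift_map_shift[of l L L' q k] l(4) by simp
    then show "\<exists>f. f' = l f \<and> circ_pt L f \<in> F"
      using Q(1) q circ_pt_shift by metis
  qed
  then show 1: "acts L F L' (h ` F) (cpi0_map L F L' (h ` F) h) l"
    using hl by (rule cpi0_map_acts[OF L(1) F L(2) hF])
  have "lift_map L' (h ` F) L F (inv_into UNIV l)"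
    unfolding lift_map_def
  proof (intro conjI allI impI il(1-3))
    fix f assume "circ_pt L f \<in> F"
    then have "circ_pt L' (l f) \<in> h ` F"
      unfolding hl[symmetric] by (rule imageI)
    then show "\<exists>f'. f = inv_into UNIV l f' \<and> circ_pt L' f' \<in> h ` F"
      using il(4)[of f] by metis
  qed
  then have 2: "acts L' (h ` F) L F (cpi0_map L' (h ` F) L F ?h') (inv_into UNIV l)"
    using circle_homeo_inv_lift[OF h l(2-4) hl] by (rule cpi0_map_acts[OF L(2) hF L(1) F])
  have "zfun_inv (cpi0 L F) (cpi0 L' (h ` F)) (cpi0_map L F L' (h ` F) h) = cpi0_map L' (h ` F) L F ?h'"
  proof (rule zfun_inv_eq[OF actsD(1)[OF 1] actsD(1)[OF 2]])
    show "zfun_comp (cpi0 L F) (cpi0_map L' (h ` F) L F ?h') (cpi0_map L F L' (h ` F) h) = zfun_id (cpi0 L F)"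
      by (rule acts_eq[OF L(1) F acts_comp[OF L(1) F 1 2] acts_id[OF L(1) F]]) (rule il(4))
    show "zfun_comp (cpi0 L' (h ` F)) (cpi0_map L F L' (h ` F) h) (cpi0_map L' (h ` F) L F ?h') =
        zfun_id (cpi0 L' (h ` F))"
      by (rule acts_eq[OF L(2) hF acts_comp[OF L(2) hF 2 1] acts_id[OF L(2) hF]]) (rule il(5))
  qed
  then show "acts L' (h ` F) L F (zfun_inv (cpi0 L F) (cpi0 L' (h ` F)) (cpi0_map L F L' (h ` F) h)) (inv_into UNIV l)"
    using 2 by simp
qed

section \<open>Categories of components as cyclic categories\<close>

lemma arr_shift:
  assumes "0 < L" "F \<in> fin_circle L" "circ_pt L x \<notin> F" "circ_pt L y \<notin> F"
  shows "arr L F (x + L * of_int k) (y + L * of_int k) = arr L F x y"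
  using assms by (simp add: arr_def cob_shift rep_shift hcls_shift)

text \<open>
  Cutting the circle at a point \<open>x\<^sub>0\<close> of \<open>F\<close> identifies its category of components with \<open>cyc R\<close>, where
  \<open>R\<close> is the order of the gaps in one period.
\<close>

lemma cpi0_ziso:
  fixes p :: "'e \<Rightarrow> real"
  assumes L: "0 < L" and F: "F \<in> fin_circle L" and R: "Linear_order R" and x0: "circ_pt L x\<^sub>0 \<in> F"
    and p: "\<And>a. a \<in> Field R \<Longrightarrow> circ_pt L (p a) \<notin> F" "\<And>a. a \<in> Field R \<Longrightarrow> x\<^sub>0 < p a"
      "\<And>a. a \<in> Field R \<Longrightarrow> p a < x\<^sub>0 + L"
    and ord: "\<And>a b. a \<in> Field R \<Longrightarrow> b \<in> Field R \<Longrightarrow> (a, b) \<in> R \<longleftrightarrow> rep L F (p a) \<le> rep L F (p b)"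
    and cover: "\<And>y. circ_pt L y \<notin> F \<Longrightarrow> x\<^sub>0 < y \<Longrightarrow> y < x\<^sub>0 + L \<Longrightarrow> \<exists>a\<in>Field R. y \<in> gap L F (p a)"
    and ext: "fst \<Phi> \<in> extensional (Field R)" "snd \<Phi> \<in> extensional (zar (cyc R))"
    and ob: "\<And>a. a \<in> Field R \<Longrightarrow> fst \<Phi> a = cob L F (p a)"
    and ar: "\<And>a b k. (a, b, k) \<in> zar (cyc R) \<Longrightarrow> snd \<Phi> (a, b, k) = arr L F (p a) (p b + L * real k)"
  shows "ziso (cyc R) (cpi0 L F) \<Phi>"
proof -
  have shn: "circ_pt L (y + L * real k) = circ_pt L y" for y k
    using circ_pt_shift[of L y "int k"] by simp
  have repn: "rep L F (y + L * real k) = rep L F y + L * real k" if "circ_pt L y \<notin> F" for y k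
    using rep_shift[OF L F that, of "int k"] by simp
  have le: "rep L F (p a) \<le> rep L F (p b + L * real k)" if abk: "(a, b, k) \<in> zar (cyc R)" for a b k
  proof (cases "k = 0")
    case True
    then show ?thesis
      using abk ord[of a b] by simp
  next
    case False
    then have "L * 1 \<le> L * real k"
      using L by (intro mult_left_mono) auto
    then have "p a \<le> p b + L * real k"
      using p(2)[of b] p(3)[of a] abk by simp
    then show ?thesis
      using p(1)[of a] p(1)[of b] abk shn by (intro rep_mono[OF L F]) auto
  qed
  \<comment> \<open>Lifts of \<open>x\<^sub>0\<close> separate the periods, so gaps inside one period are not translates of each other.\<close>
  have gap0: "k = 0" if "v \<in> gap L F (u + L * of_int k)" "circ_pt L u \<notin> F" "x\<^sub>0 < u" "u < x\<^sub>0 + L" "x\<^sub>0 < v" "v < x\<^sub>0 + L"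
    for u v and k :: int
  proof -
    have "circ_pt L (x\<^sub>0 + L * of_int k) \<in> F" "circ_pt L (x\<^sub>0 + L * of_int (k + 1)) \<in> F"
      using x0 by (simp_all only: circ_pt_shift)
    moreover have "\<forall>f. circ_pt L f \<in> F \<longrightarrow> (f < u + L * of_int k \<longleftrightarrow> f < v)"
      using that(1,2) gap_iff[of L "u + L * of_int k" F v] by simp
    moreover have "x\<^sub>0 + L * of_int k < u + L * of_int k" "\<not> x\<^sub>0 + L * of_int (k + 1) < u + L * of_int k"
      using that(3,4) by (simp_all add: algebra_simps)
    ultimately have "x\<^sub>0 + L * of_int k < v" "\<not> x\<^sub>0 + L * of_int (k + 1) < v"
      by blast+
    then have "L * of_int k < L * 1" "L * 0 < L * of_int (k + 1)"
      using that(5,6) unfolding mult_1_right mult_zero_right by linarith+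
    then have "real_of_int k < 1" "0 < real_of_int (k + 1)"
      using L by (simp_all only: mult_less_cancel_left_pos)
    then show ?thesis
      by linarith
  qed
  have inj_p: "a = b" if "a \<in> Field R" "b \<in> Field R" "p b \<in> gap L F (p a)" for a b
    using that same_gap(2)[OF L F p(1)[OF that(1)] that(3)] ord Linear_orderD(3)[OF R, of a b] by auto
  \<comment> \<open>Conversely, every gap is a translate of a gap in the chosen period.\<close>
  have norm: "\<exists>a\<in>Field R. \<exists>k::int. y \<in> gap L F (p a + L * of_int k)" if y: "circ_pt L y \<notin> F" for y
  proof -
    obtain u where u: "x\<^sub>0 \<le> u" "u < x\<^sub>0 + L" "circ_pt L y = circ_pt L u"
      using circ_lift_in[OF L circ_pt_mem[of L y]] by blast
    then have u': "circ_pt L u \<notin> F"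
      using y by simp
    then have "x\<^sub>0 < u"
      using u(1) x0 by (cases "u = x\<^sub>0") auto
    then obtain a where a: "a \<in> Field R" "u \<in> gap L F (p a)"
      using cover[OF u' _ u(2)] by blast
    obtain k :: int where "y = u + L * of_int k"
      using u(3)[symmetric] circ_pt_iff by blast
    then show ?thesis
      using gap_shift[OF p(1)[OF a(1)], of u k] a by auto
  qed
  have am: "arr L F (p a) (p b + L * real k) \<in> zar (cpi0 L F)"
    "zdom (cpi0 L F) (arr L F (p a) (p b + L * real k)) = cob L F (p a)"
    "zcod (cpi0 L F) (arr L F (p a) (p b + L * real k)) = cob L F (p b)"
    if abk: "(a, b, k) \<in> zar (cyc R)" for a b k
    using arr_mem[OF L F p(1)[of a] _ le[OF abk]] p(1)[of b] abk shn cob_shift[of L "p b" F "int k"] by auto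
  have fct: "\<Phi> \<in> zfunctors (cyc R) (cpi0 L F)"
  proof (rule zfunctorsI)
    fix c assume "c \<in> zob (cyc R)"
    then have c: "c \<in> Field R" "(c, c, 0) \<in> zar (cyc R)" "(c, c, 1) \<in> zar (cyc R)"
      using Linear_orderD(1)[OF R] by auto
    show "fst \<Phi> c \<in> zob (cpi0 L F)" "snd \<Phi> (zid (cyc R) c) = zid (cpi0 L F) (fst \<Phi> c)"
      "snd \<Phi> (zone (cyc R) c) = zone (cpi0 L F) (fst \<Phi> c)"
      using ar[OF c(2)] ar[OF c(3)] p(1)[OF c(1)] ob[OF c(1)]
      by (auto simp: cpi0_obj[OF L F] cpi0_id[OF L F] cpi0_one[OF L F])
  next
    fix f assume f: "f \<in> zar (cyc R)"
    obtain a b k where abk: "f = (a, b, k)"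
      by (cases f)
    show "snd \<Phi> f \<in> zar (cpi0 L F)" "zdom (cpi0 L F) (snd \<Phi> f) = fst \<Phi> (zdom (cyc R) f)"
      "zcod (cpi0 L F) (snd \<Phi> f) = fst \<Phi> (zcod (cyc R) f)"
      using am[OF f[unfolded abk]] ar[OF f[unfolded abk]] ob f unfolding abk by auto
    fix g assume g: "g \<in> zar (cyc R)" and fg: "zcod (cyc R) f = zdom (cyc R) g"
    obtain b' c m where bcm: "g = (b', c, m)"
      by (cases g)
    have b': "b' = b"
      using fg unfolding abk bcm by simp
    note f' = f[unfolded abk] and g' = g[unfolded bcm b']
    have F': "a \<in> Field R" "b \<in> Field R" "c \<in> Field R"
      using f' g' by auto
    have gf: "(a, c, k + m) \<in> zar (cyc R)"
      using f' g' Linear_orderD(2)[OF R] by auto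
    have q: "p b + L * real k = p b + L * of_int (int k)"
      "p c + L * real (k + m) = (p c + L * real m) + L * of_int (int k)"
      by (simp_all add: algebra_simps)
    have e: "arr L F (p b) (p c + L * real m) = arr L F (p b + L * real k) (p c + L * real (k + m))"
      unfolding q by (rule arr_shift[OF L F p(1)[OF F'(2)], symmetric]) (use p(1)[OF F'(3)] shn in simp)
    have le2: "rep L F (p b + L * real k) \<le> rep L F (p c + L * real (k + m))"
      using le[OF g'] unfolding repn[OF p(1)[OF F'(2)]] repn[OF p(1)[OF F'(3)]] by (simp add: algebra_simps)
    show "snd \<Phi> (zcomp (cyc R) g f) = zcomp (cpi0 L F) (snd \<Phi> g) (snd \<Phi> f)"
      unfolding abk bcm b' cyc_ops ar[OF f'] ar[OF g'] ar[OF gf] e cpi0_comp[OF L F le[OF f'] le2] ..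
  qed (use ext in simp_all)
  have bo: "bij_betw (fst \<Phi>) (zob (cyc R)) (zob (cpi0 L F))"
  proof (rule bij_betw_imageI)
    show "inj_on (fst \<Phi>) (zob (cyc R))"
    proof (rule inj_onI)
      fix a b assume "a \<in> zob (cyc R)" "b \<in> zob (cyc R)" and eq: "fst \<Phi> a = fst \<Phi> b"
      then have ab: "a \<in> Field R" "b \<in> Field R"
        by auto
      then have "cob L F (p a) = cob L F (p b)"
        using eq ob by simp
      then obtain k :: int where k: "p b \<in> gap L F (p a + L * of_int k)"
        using cob_eq_iff(1)[OF L F p(1)[OF ab(1)] p(1)[OF ab(2)]] by blast
      then have "k = 0"
        using p ab by (intro gap0) auto
      then show "a = b"
        using k inj_p ab by simp
    qed
    show "fst \<Phi> ` zob (cyc R) = zob (cpi0 L F)"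
    proof
      show "fst \<Phi> ` zob (cyc R) \<subseteq> zob (cpi0 L F)"
        using zfunctorsD(3)[OF fct] by blast
      show "zob (cpi0 L F) \<subseteq> fst \<Phi> ` zob (cyc R)"
      proof
        fix c assume "c \<in> zob (cpi0 L F)"
        then obtain y where y: "circ_pt L y \<notin> F" "c = cob L F y"
          unfolding cpi0_obj[OF L F] by blast
        obtain a k where a: "a \<in> Field R" "y \<in> gap L F (p a + L * of_int k)"
          using norm[OF y(1)] by blast
        then have "c = fst \<Phi> a"
          using cob_eq_iff(1)[OF L F p(1)[OF a(1)] y(1)] ob y(2) by auto
        then show "c \<in> fst \<Phi> ` zob (cyc R)"
          using a by simp
      qed
    qed
  qed
  have ba: "bij_betw (snd \<Phi>) (zar (cyc R)) (zar (cpi0 L F))"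
  proof (rule bij_betw_imageI)
    show "inj_on (snd \<Phi>) (zar (cyc R))"
    proof (rule inj_onI)
      fix f g assume f: "f \<in> zar (cyc R)" and g: "g \<in> zar (cyc R)" and eq: "snd \<Phi> f = snd \<Phi> g"
      obtain a b k where abk: "f = (a, b, k)"
        by (cases f)
      obtain a' b' m where abm: "g = (a', b', m)"
        by (cases g)
      note f' = f[unfolded abk] and g' = g[unfolded abm]
      have F': "a \<in> Field R" "b \<in> Field R" "a' \<in> Field R" "b' \<in> Field R"
        using f' g' by auto
      have "arr L F (p a) (p b + L * real k) = arr L F (p a') (p b' + L * real m)"
        using eq ar[OF f'] ar[OF g'] unfolding abk abm by simp
      then obtain j :: int where j: "p a' \<in> gap L F (p a + L * of_int j)"
        "p b' + L * real m \<in> gap L F ((p b + L * real k) + L * of_int j)"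
        using arr_eq_iff[OF L F p(1)[OF F'(1)] _ le[OF f'] p(1)[OF F'(3)]] shn p(1)[OF F'(2)] p(1)[OF F'(4)] by auto
      have j0: "j = 0"
        using j(1) p F' by (intro gap0[of "p a'" "p a"]) auto
      have c: "circ_pt L (p b + L * of_int (int k - int m)) \<notin> F"
        using p(1)[OF F'(2)] by (simp only: circ_pt_shift not_False_eq_True)
      have eq1: "(p b + L * of_int (int k - int m)) + L * of_int (int m) = (p b + L * real k) + L * of_int j"
        using j0 by (simp add: algebra_simps)
      have eq2: "p b' + L * of_int (int m) = p b' + L * real m"
        by simp
      have "p b' \<in> gap L F (p b + L * of_int (int k - int m))"
        using j(2) gap_shift[OF c, of "p b'" "int m"] unfolding eq1 eq2 by blast
      moreover from this have "int k - int m = 0"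
        using p F' by (intro gap0[of "p b'" "p b"]) auto
      ultimately show "f = g"
        using inj_p[OF F'(1,3)] inj_p[OF F'(2,4)] j(1) j0 unfolding abk abm by simp
    qed
    show "snd \<Phi> ` zar (cyc R) = zar (cpi0 L F)"
    proof
      show "snd \<Phi> ` zar (cyc R) \<subseteq> zar (cpi0 L F)"
        using zfunctorsD(4)[OF fct] by blast
      show "zar (cpi0 L F) \<subseteq> snd \<Phi> ` zar (cyc R)"
      proof
        fix f assume "f \<in> zar (cpi0 L F)"
        then obtain x y where x: "circ_pt L x \<notin> F" "circ_pt L y \<notin> F" "x \<le> y" "f = arr L F x y"
          by (rule cpi0_arrowE[OF L F])
        obtain a j where a: "a \<in> Field R" "x \<in> gap L F (p a + L * of_int j)"
          using norm[OF x(1)] by blast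
        obtain b i where b: "b \<in> Field R" "y \<in> gap L F (p b + L * of_int i)"
          using norm[OF x(2)] by blast
        have c: "circ_pt L (p a + L * of_int j) \<notin> F" "circ_pt L (p b + L * of_int i) \<notin> F"
          "circ_pt L (p b + L * of_int (i - j)) \<notin> F"
          using p(1) a(1) b(1) by (simp_all only: circ_pt_shift not_False_eq_True)
        have "rep L F (p a + L * of_int j) \<le> rep L F (p b + L * of_int i)"
          using same_gap(2)[OF L F c(1) a(2)] same_gap(2)[OF L F c(2) b(2)] rep_mono[OF L F x(1-3)] by simp
        then have "rep L F (p a) + L * of_int j \<le> rep L F (p b) + L * of_int i"
          unfolding rep_shift[OF L F p(1)[OF a(1)]] rep_shift[OF L F p(1)[OF b(1)]] .
        then have "rep L F (p a) \<le> rep L F (p b) + L * of_int (i - j)"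
          by (simp add: algebra_simps)
        then have r: "rep L F (p a) \<le> rep L F (p b + L * of_int (i - j))"
          unfolding rep_shift[OF L F p(1)[OF b(1)]] .
        have eq: "p b + L * of_int (i - j) + L * of_int j = p b + L * of_int i"
          by (simp add: algebra_simps)
        have "f = arr L F (p a + L * of_int j) (p b + L * of_int i)"
          unfolding x(4) arr_def same_gap[OF L F c(1) a(2)] same_gap[OF L F c(2) b(2)] ..
        also have "\<dots> = arr L F (p a) (p b + L * of_int (i - j))"
          using arr_shift[OF L F p(1)[OF a(1)] c(3), of j] unfolding eq .
        finally have f: "f = arr L F (p a) (p b + L * of_int (i - j))" .
        have ij: "0 \<le> i - j"
        proof (rule ccontr)
          assume "\<not> 0 \<le> i - j"
          then have "L * of_int (i - j) \<le> L * of_int (- 1)"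
            using L by (intro mult_left_mono) (simp_all only: of_int_le_iff)
          then have s: "p b + L * of_int (i - j) < x\<^sub>0"
            using p(3)[OF b(1)] by simp
          have "\<forall>f. circ_pt L f \<in> F \<longrightarrow> f < p a \<longrightarrow> f < p b + L * of_int (i - j)"
            using r rep_le_iff[OF L F p(1)[OF a(1)] c(3)] by blast
          then have "x\<^sub>0 < p b + L * of_int (i - j)"
            using x0 p(2)[OF a(1)] by blast
          then show False
            using s by simp
        qed
        have "(a, b, nat (i - j)) \<in> zar (cyc R)"
          using a(1) b(1) ij r ord by auto
        then show "f \<in> snd \<Phi> ` zar (cyc R)"
          using ar f ij by (metis imageI of_nat_nat of_int_of_nat_eq)
      qed
    qed
  qed
  show ?thesis
    unfolding ziso_def using fct bo ba by blast
qed

lemma finite_lifts: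
  assumes L: "0 < L" and F: "F \<in> fin_circle L"
  shows "finite {f. circ_pt L f \<in> F \<and> a \<le> f \<and> f \<le> b}"
proof -
  have "finite {f. circ_pt L f = Q \<and> a \<le> f \<and> f \<le> b}" if Q: "Q \<in> F" for Q
  proof -
    obtain q where q: "Q = circ_pt L q"
      using Q fin_circleD[OF F] by (auto simp: circ_eq)
    have "{f. circ_pt L f = Q \<and> a \<le> f \<and> f \<le> b} \<subseteq> (\<lambda>k. q + L * of_int k) ` {\<lceil>(a - q) / L\<rceil>..\<lfloor>(b - q) / L\<rfloor>}"
    proof
      fix f assume f: "f \<in> {f. circ_pt L f = Q \<and> a \<le> f \<and> f \<le> b}"
      then obtain k :: int where k: "f = q + L * of_int k"
        using q circ_pt_iff by (metis (mono_tags, lifting) mem_Collect_eq)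
      have "(a - q) / L \<le> of_int k" "of_int k \<le> (b - q) / L"
        using f k L by (auto simp: field_simps)
      then show "f \<in> (\<lambda>k. q + L * of_int k) ` {\<lceil>(a - q) / L\<rceil>..\<lfloor>(b - q) / L\<rfloor>}"
        using k by (auto simp: ceiling_le_iff le_floor_iff)
    qed
    then show ?thesis
      using finite_subset by blast
  qed
  moreover have "{f. circ_pt L f \<in> F \<and> a \<le> f \<and> f \<le> b} = (\<Union>Q\<in>F. {f. circ_pt L f = Q \<and> a \<le> f \<and> f \<le> b})"
    by auto
  ultimately show ?thesis
    using fin_circleD[OF F] by simp
qed

text \<open>
  The representatives of the gaps in one period, listed in increasing order, are the objects
  \<open>0, \<dots>, n\<close> of the standard cyclic category.
\<close>

lemma cpi0_ziso_ord:
  assumes L: "0 < L" and F: "F \<in> fin_circle L"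
  shows "\<exists>n \<Phi>. ziso (cyc (ord n)) (cpi0 L F) \<Phi>"
proof -
  obtain x\<^sub>0 where x0: "circ_pt L x\<^sub>0 \<in> F"
    using F_point_near[OF L F] by blast
  then have x1: "circ_pt L (x\<^sub>0 + L) \<in> F"
    by simp
  define V where "V = {x. circ_pt L x \<notin> F \<and> x\<^sub>0 < x \<and> x < x\<^sub>0 + L}"
  define P where "P = rep L F ` V"
  have P: "circ_pt L u \<notin> F" "rep L F u = u" "x\<^sub>0 < u" "u < x\<^sub>0 + L" if "u \<in> P" for u
  proof -
    obtain x where x: "circ_pt L x \<notin> F" "x\<^sub>0 < x" "x < x\<^sub>0 + L" "u = rep L F x"
      using \<open>u \<in> P\<close> by (auto simp: P_def V_def)
    note g = rep(1)[OF L F x(1), folded x(4)]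
    show u: "circ_pt L u \<notin> F" "rep L F u = u"
      using gap_cov[OF g] same_gap(2)[OF L F x(1) g] x(4) by auto
    show "x\<^sub>0 < u" "u < x\<^sub>0 + L"
      using g x0 x1 x(2,3) u(1) unfolding gap_iff[OF x(1)] by (blast, metis linorder_neqE_linordered_idom order_less_asym)
  qed
  have finP: "finite P"
  proof (rule inj_on_finite)
    show "inj_on (\<lambda>u. {f \<in> {f. circ_pt L f \<in> F \<and> x\<^sub>0 \<le> f \<and> f \<le> x\<^sub>0 + L}. f < u}) P"
    proof (rule inj_onI)
      fix u v assume u: "u \<in> P" and v: "v \<in> P"
        and eq: "{f \<in> {f. circ_pt L f \<in> F \<and> x\<^sub>0 \<le> f \<and> f \<le> x\<^sub>0 + L}. f < u} =
          {f \<in> {f. circ_pt L f \<in> F \<and> x\<^sub>0 \<le> f \<and> f \<le> x\<^sub>0 + L}. f < v}"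
      have "f < u \<longleftrightarrow> f < v" if "circ_pt L f \<in> F" for f
      proof (cases "x\<^sub>0 \<le> f \<and> f \<le> x\<^sub>0 + L")
        case True
        then show ?thesis
          using eq that by blast
      next
        case False
        then show ?thesis
          using P(3,4)[OF u] P(3,4)[OF v] by auto
      qed
      then have "v \<in> gap L F u"
        using gap_iff[OF P(1)[OF u]] P(1)[OF v] by blast
      then show "u = v"
        using same_gap(2)[OF L F P(1)[OF u]] P(2)[OF u] P(2)[OF v] by simp
    qed
    show "(\<lambda>u. {f \<in> {f. circ_pt L f \<in> F \<and> x\<^sub>0 \<le> f \<and> f \<le> x\<^sub>0 + L}. f < u}) ` P
        \<subseteq> Pow {f. circ_pt L f \<in> F \<and> x\<^sub>0 \<le> f \<and> f \<le> x\<^sub>0 + L}"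
      by auto
    show "finite (Pow {f. circ_pt L f \<in> F \<and> x\<^sub>0 \<le> f \<and> f \<le> x\<^sub>0 + L})"
      using finite_lifts[OF L F] by simp
  qed
  have "P \<noteq> {}"
  proof -
    have "{x\<^sub>0<..<x\<^sub>0 + L} - {f. circ_pt L f \<in> F \<and> x\<^sub>0 \<le> f \<and> f \<le> x\<^sub>0 + L} \<noteq> {}"
      using Diff_infinite_finite[OF finite_lifts[OF L F, of "x\<^sub>0" "x\<^sub>0 + L"] infinite_Ioo[of "x\<^sub>0" "x\<^sub>0 + L"]] L
      by force
    then show ?thesis
      by (auto simp: P_def V_def)
  qed
  then obtain n where n: "card P = Suc n"
    using finP by (metis card_eq_0_iff not0_implies_Suc)
  define p where "p = (!) (sorted_list_of_set P)"
  have p: "bij_betw p {..n} P" "\<And>i j. i < j \<Longrightarrow> j \<le> n \<Longrightarrow> p i < p j"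
    unfolding p_def using finP n sorted_wrt_nth_less[OF strict_sorted_list_of_set, of _ _ P]
    by (auto intro!: bij_betw_nth)
  have pP: "p i \<in> P" if "i \<in> Field (ord n)" for i
    using p(1) that unfolding Field_ord by (auto simp: bij_betw_def)
  define \<Phi> where "\<Phi> = (\<lambda>a\<in>Field (ord n). cob L F (p a), \<lambda>(a, b, k)\<in>zar (cyc (ord n)). arr L F (p a) (p b + L * real k))"
  have "ziso (cyc (ord n)) (cpi0 L F) \<Phi>"
  proof (rule cpi0_ziso[OF L F Linear_order_ord x0])
    show "(a, b) \<in> ord n \<longleftrightarrow> rep L F (p a) \<le> rep L F (p b)" if "a \<in> Field (ord n)" "b \<in> Field (ord n)" for a b
    proof -
      have "a \<le> b \<longleftrightarrow> p a \<le> p b"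
        using p(2)[of a b] p(2)[of b a] that unfolding Field_ord by (metis atMost_iff linorder_not_le order_le_less)
      then show ?thesis
        using P(2)[OF pP[OF that(1)]] P(2)[OF pP[OF that(2)]] that unfolding Field_ord by (auto simp: ord_def)
    qed
    show "\<exists>a\<in>Field (ord n). y \<in> gap L F (p a)" if y: "circ_pt L y \<notin> F" "x\<^sub>0 < y" "y < x\<^sub>0 + L" for y
    proof -
      have "rep L F y \<in> p ` {..n}"
        using y p(1) by (auto simp: P_def V_def bij_betw_def)
      then obtain a where "a \<in> Field (ord n)" "rep L F y = p a"
        unfolding Field_ord by blast
      then show ?thesis
        using gap_rep[OF L F y(1)] gap_self[OF y(1)] by auto
    qed
    show "fst \<Phi> \<in> extensional (Field (ord n))" "snd \<Phi> \<in> extensional (zar (cyc (ord n)))"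
      by (simp_all add: \<Phi>_def)
    show "fst \<Phi> a = cob L F (p a)" if "a \<in> Field (ord n)" for a
      using that by (simp add: \<Phi>_def)
    show "snd \<Phi> (a, b, k) = arr L F (p a) (p b + L * real k)" if "(a, b, k) \<in> zar (cyc (ord n))" for a b k
      using that by (simp add: \<Phi>_def del: cyc_ops(7))
    show "circ_pt L (p a) \<notin> F" "x\<^sub>0 < p a" "p a < x\<^sub>0 + L" if "a \<in> Field (ord n)" for a
      using P(1,3,4)[OF pP[OF that]] by simp_all
  qed
  then show ?thesis
    by blast
qed

lemma cpi0_big_obs: "0 < L \<Longrightarrow> F \<in> fin_circle L \<Longrightarrow> cpi0_big L F \<in> obs DeltaC_big"
  unfolding cpi0_big_def using zrelabel_obs[OF inj_Inr inj_Inr zplus_category_cpi0] cpi0_ziso_ord by blast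

section \<open>The diagram of finite subsets of the circle\<close>

abbreviation label_fun ::
  "real \<Rightarrow> real set set \<Rightarrow> (real set set, real set set \<times> real set set \<times> hclass, real set set,
     real set set \<times> real set set \<times> hclass) zfun \<Rightarrow> (cobj, carr, cobj, carr) zfun" where
  "label_fun L F \<Phi> \<equiv> zrelabel_fun (cpi0 L F) Inr Inr Inr Inr \<Phi>"

lemma label_fun_mem:
  assumes "0 < L" "G \<in> fin_circle L" "\<Phi> \<in> zfunctors (cpi0 L G) (cpi0 L' F)"
  shows "label_fun L G \<Phi> \<in> zfunctors (cpi0_big L G) (cpi0_big L' F)"
  unfolding cpi0_big_def
  by (rule zrelabel_fun_mem[OF inj_Inr inj_Inr inj_Inr inj_Inr zplus_category_cpi0[OF assms(1,2)] assms(3)])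

lemma label_fun_comp:
  assumes "\<Phi> \<in> zfunctors (cpi0 L G) (cpi0 L' F)"
  shows "zfun_comp (cpi0_big L G) (label_fun L' F \<Psi>) (label_fun L G \<Phi>) = label_fun L G (zfun_comp (cpi0 L G) \<Psi> \<Phi>)"
  unfolding cpi0_big_def by (rule zrelabel_fun_comp[OF inj_Inr inj_Inr inj_Inr inj_Inr assms])

lemma label_fun_id: "label_fun L F (zfun_id (cpi0 L F)) = zfun_id (cpi0_big L F)"
  unfolding cpi0_big_def by (rule zrelabel_fun_id[OF inj_Inr inj_Inr])

abbreviation "tr_circ L F G \<equiv> label_fun L G (cpi0_map L G L F (\<lambda>x. x))"
abbreviation "iv_circ L L' h F \<equiv>
  label_fun L' (h ` F) (zfun_inv (cpi0 L F) (cpi0 L' (h ` F)) (cpi0_map L F L' (h ` F) h))"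

definition circle_iso ::
  "'a cyc_big \<Rightarrow> real \<Rightarrow> real \<Rightarrow> (real set \<Rightarrow> real set) \<Rightarrow> real set set \<Rightarrow> 'a \<Rightarrow> 'a" where
  "circle_iso Xt L L' h F = pact Xt (cpi0_big L' (h ` F)) (cpi0_big L F) (iv_circ L L' h F)"

lemma circle_push_eq: "circle_push Xt L L' h F x = circle_in Xt L' (h ` F) (circle_iso Xt L L' h F x)"
  by (simp add: circle_push_def circle_iso_def)

text \<open>
  All functors involved act on gaps by lifts of degree one, and a functor is determined by the lift
  through which it acts. Hence every equation between them reduces to one between lifts.
\<close>

lemma circle_homeo_colimits:
  assumes Xt: "presheaf DeltaC_big Xt"
  shows "homeo_colimits circ circle_homeos fin_circle (circle_val Xt) (circle_trans Xt) (circle_iso Xt)"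
proof -
  have eqs: "circle_val Xt = (\<lambda>L F. pob Xt (cpi0_big L F))"
    "circle_trans Xt = (\<lambda>L F G. pact Xt (cpi0_big L G) (cpi0_big L F) (tr_circ L F G))"
    "circle_iso Xt = (\<lambda>L L' h F. pact Xt (cpi0_big L' (h ` F)) (cpi0_big L F) (iv_circ L L' h F))"
    by (auto simp: fun_eq_iff circle_val_def circle_trans_def circle_iso_def)
  show ?thesis
    unfolding eqs
  proof (rule homeo_colimits_presheaf[OF Xt], unfold DeltaC_big_ops)
    fix L L' L'' :: real and h g :: "real set \<Rightarrow> real set" and F G K :: "real set set"
    show "h \<in> circle_homeos L L' \<Longrightarrow> 0 < L \<and> 0 < L'"
      by (intro conjI circle_homeosD(1,2))
    show "0 < L \<Longrightarrow> fin_circle L \<noteq> {}"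
      using circ_pt_mem[of L 0] by (auto simp: fin_circle_def intro!: exI[of _ "{circ_pt L 0}"])
    show "F \<in> fin_circle L \<Longrightarrow> F \<subseteq> circ L" "F \<in> fin_circle L \<Longrightarrow> G \<in> fin_circle L \<Longrightarrow> F \<union> G \<in> fin_circle L"
      by (auto simp: fin_circle_def)
    show "tr_circ L F G \<in> zfunctors (cpi0_big L G) (cpi0_big L F)"
      if "0 < L" "F \<in> fin_circle L" "G \<in> fin_circle L" "F \<subseteq> G"
      by (rule label_fun_mem[OF that(1,3) actsD(1)[OF refine_acts[OF that]]])
    show "tr_circ L F F = zfun_id (cpi0_big L F)" if L: "0 < L" and F: "F \<in> fin_circle L"
      unfolding acts_eq[OF L F refine_acts[OF L F F subset_refl] acts_id[OF L F] refl]
      by (rule label_fun_id)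
    show "zfun_comp (cpi0_big L K) (tr_circ L F G) (tr_circ L G K) = tr_circ L F K"
      if L: "0 < L" and F: "F \<in> fin_circle L" and G: "G \<in> fin_circle L" and K: "K \<in> fin_circle L"
        and FG: "F \<subseteq> G" and GK: "G \<subseteq> K"
    proof -
      note a = refine_acts[OF L G K GK] and b = refine_acts[OF L F G FG]
        and c = refine_acts[OF L F K order_trans[OF FG GK]]
      show ?thesis
        unfolding label_fun_comp[OF actsD(1)[OF a]] acts_eq[OF L K acts_comp[OF L K a b] c refl] ..
    qed
    show "iv_circ L L (\<lambda>P\<in>circ L. P) F = zfun_id (cpi0_big L F)" if L: "0 < L" and F: "F \<in> fin_circle L"
    proof -
      have im: "(\<lambda>P\<in>circ L. P) ` F = F"
        using fin_circleD[OF F] by auto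
      have "acts L ((\<lambda>P\<in>circ L. P) ` F) L F
          (zfun_inv (cpi0 L F) (cpi0 L ((\<lambda>P\<in>circ L. P) ` F)) (cpi0_map L F L ((\<lambda>P\<in>circ L. P) ` F) (\<lambda>P\<in>circ L. P)))
          (inv_into UNIV (\<lambda>x. x))"
        by (rule homeo_map_acts(2)[OF circle_homeos_id[OF L] F]) (auto simp: strict_mono_def)
      note a = this[unfolded im]
      have "inv_into UNIV (\<lambda>x. x) x = x" for x :: real
        by (rule inv_into_f_eq) auto
      note e = acts_eq[OF L F a acts_id[OF L F] this]
      show ?thesis
        unfolding im e by (rule label_fun_id)
    qed
    assume h: "h \<in> circle_homeos L L'" and F: "F \<in> fin_circle L"
    obtain l where l1: "continuous_on UNIV l" and l2: "strict_mono l" and l4: "\<forall>x. l (x + L) = l x + L'"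
      and l3: "surj l" and hl: "\<forall>x. h (circ_pt L x) = circ_pt L' (l x)"
      using circle_homeo_lift[OF h] .
    note l = l1 l2 l3 l4[rule_format] hl[rule_format]
    note L = circle_homeosD(1,2)[OF h] and hF = circle_homeos_image[OF h F]
      and hFa = homeo_map_acts(2)[OF h F l]
    show "iv_circ L L' h F \<in> zfunctors (cpi0_big L' (h ` F)) (cpi0_big L F)"
      by (rule label_fun_mem[OF L(2) hF actsD(1)[OF hFa]])
    show "zfun_comp (cpi0_big L'' (g ` h ` F)) (iv_circ L L' h F) (iv_circ L' L'' g (h ` F)) =
        iv_circ L L'' (compose (circ L) g h) F" if g: "g \<in> circle_homeos L' L''"
    proof -
      have im: "compose (circ L) g h ` F = g ` h ` F"
        using fin_circleD[OF F] by (intro compose_image) simp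
      obtain m where m1: "continuous_on UNIV m" and m2: "strict_mono m" and m4: "\<forall>x. m (x + L') = m x + L''"
        and m3: "surj m" and gm: "\<forall>x. g (circ_pt L' x) = circ_pt L'' (m x)"
        using circle_homeo_lift[OF g] .
      note m = m1 m2 m3 m4[rule_format] gm[rule_format]
      note L'' = circle_homeosD(2)[OF g] and ghF = circle_homeos_image[OF g hF]
        and gFa = homeo_map_acts(2)[OF g hF m]
      have "acts L'' (compose (circ L) g h ` F) L F
          (zfun_inv (cpi0 L F) (cpi0 L'' (compose (circ L) g h ` F))
            (cpi0_map L F L'' (compose (circ L) g h ` F) (compose (circ L) g h)))
          (inv_into UNIV (\<lambda>x. m (l x)))"
      proof (rule homeo_map_acts(2)[OF circle_homeos_comp[OF h g] F])
        show "continuous_on UNIV (\<lambda>x. m (l x))"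
          using continuous_on_compose2[OF m1 l1] by simp
        show "strict_mono (\<lambda>x. m (l x))"
          using l2 m2 by (simp add: strict_mono_def)
        show "surj (\<lambda>x. m (l x))"
          using comp_surj[OF l3 m3] by (simp add: comp_def)
        show "m (l (x + L)) = m (l x) + L''" for x
          by (simp only: l(4) m(4))
        show "compose (circ L) g h (circ_pt L x) = circ_pt L'' (m (l x))" for x
          using l(5) m(5) by (simp add: compose_def)
      qed
      note c = this[unfolded im]
      have i: "inv_into UNIV l (inv_into UNIV m x) = inv_into UNIV (\<lambda>x. m (l x)) x" for x
      proof (rule inv_into_f_eq[symmetric])
        show "inj (\<lambda>x. m (l x))"
          using l2 m2 by (intro strict_mono_imp_inj_on) (simp add: strict_mono_def)
        show "m (l (inv_into UNIV l (inv_into UNIV m x))) = x"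
          by (simp only: inverse_lift(5)[OF l(2-4)] inverse_lift(5)[OF m(2-4)])
      qed simp
      note e = acts_eq[OF L'' ghF acts_comp[OF L'' ghF gFa hFa] c i]
      show ?thesis
        unfolding im label_fun_comp[OF actsD(1)[OF gFa]] e ..
    qed
    assume G: "G \<in> fin_circle L" and FG: "F \<subseteq> G"
    note hG = circle_homeos_image[OF h G] and hGa = homeo_map_acts(2)[OF h G l]
    note t = refine_acts[OF L(1) F G FG] and t' = refine_acts[OF L(2) hF hG image_mono[OF FG]]
    note e = acts_eq[OF L(2) hG acts_comp[OF L(2) hG t' hFa] acts_comp[OF L(2) hG hGa t] refl]
    show "zfun_comp (cpi0_big L' (h ` G)) (iv_circ L L' h F) (tr_circ L' (h ` F) (h ` G)) =
        zfun_comp (cpi0_big L' (h ` G)) (tr_circ L F G) (iv_circ L L' h G)"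
      unfolding label_fun_comp[OF actsD(1)[OF t']] label_fun_comp[OF actsD(1)[OF hGa]] e ..
  qed (fact circle_homeosD(3,5) circle_homeos_id circle_homeos_comp circle_homeos_inv
      circle_homeos_image cpi0_big_obs)+
qed

section \<open>Cutting the circle open\<close>

context
  fixes L :: real and F :: "real set"
  assumes L: "0 < L" and F: "F \<in> fin_interval L" and ends: "0 \<in> F" "L \<in> F"
begin

lemma cut_fin_circle: "circ_pt L ` F \<in> fin_circle L"
  using F ends by (auto simp: fin_circle_def fin_interval_def)

text \<open>
  The projection to the circle identifies only the two end points of \<open>[0,L]\<close>, and both belong to \<open>F\<close>.
\<close>

lemma cut_mem:
  assumes x: "x \<in> {0..L}"
  shows "circ_pt L x \<in> circ_pt L ` F \<longleftrightarrow> x \<in> F"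
proof
  assume "circ_pt L x \<in> circ_pt L ` F"
  then obtain f where f: "f \<in> F" "circ_pt L f = circ_pt L x"
    by auto
  then obtain k :: int where k: "x = f + L * of_int k"
    using circ_pt_iff by blast
  have f': "0 \<le> f" "f \<le> L"
    using f(1) F by (auto simp: fin_interval_def)
  have "L * of_int k \<le> L * 1" "L * (- 1) \<le> L * of_int k"
    using x f' k by auto
  then have "real_of_int k \<le> 1" "- 1 \<le> real_of_int k"
    using L by (simp_all only: mult_le_cancel_left_pos)
  then have "k = 0 \<or> k = 1 \<or> k = - 1"
    by linarith
  then show "x \<in> F"
  proof (elim disjE)
    assume "k = 1"
    then have "x = L"
      using k x f' by auto
    then show ?thesis
      using ends by simp
  next
    assume "k = - 1"
    then have "x = 0"
      using k x f' by auto
    then show ?thesis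
      using ends by simp
  qed (use k f in simp)
qed simp

lemma cut_complement: "x \<in> {0..L} - F \<Longrightarrow> circ_pt L x \<notin> circ_pt L ` F"
  using cut_mem by blast

lemma cut_complement_bounds:
  assumes x: "x \<in> {0..L} - F"
  shows "0 < x" "x < L"
  using x ends by (auto simp: order_less_le)

lemma gap_cut:
  assumes x: "x \<in> {0..L} - F"
  shows "gap L (circ_pt L ` F) x = icomp L F x"
proof (rule Set.set_eqI)
  fix y
  have e: "circ_pt L 0 \<in> circ_pt L ` F" "circ_pt L L \<in> circ_pt L ` F"
    using ends by auto
  show "y \<in> gap L (circ_pt L ` F) x \<longleftrightarrow> y \<in> icomp L F x"
  proof
    assume "y \<in> gap L (circ_pt L ` F) x"
    then have y: "circ_pt L y \<notin> circ_pt L ` F"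
      "\<forall>f. circ_pt L f \<in> circ_pt L ` F \<longrightarrow> (f < x \<longleftrightarrow> f < y)"
      unfolding gap_iff[OF cut_complement[OF x]] by auto
    then have "0 < y" "\<not> L < y"
      using e cut_complement_bounds[OF x] by (blast, meson order_less_asym)
    then show "y \<in> icomp L F x"
      unfolding icomp_iff[OF x] using y by auto
  next
    assume "y \<in> icomp L F x"
    then have y: "y \<in> {0..L} - F" "\<forall>f\<in>F. f < x \<longleftrightarrow> f < y"
      unfolding icomp_iff[OF x] by auto
    have "f < x \<longleftrightarrow> f < y" if "circ_pt L f \<in> circ_pt L ` F" for f
    proof (cases "f \<in> {0..L}")
      case True
      then show ?thesis
        using cut_mem that y(2) by blast
    next
      case False
      then show ?thesis
        using cut_complement_bounds[OF x] cut_complement_bounds[OF y(1)] by auto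
    qed
    then show "y \<in> gap L (circ_pt L ` F) x"
      unfolding gap_iff[OF cut_complement[OF x]] using cut_complement[OF y(1)] by blast
  qed
qed

lemma cut_rep_le_iff:
  assumes x: "x \<in> {0..L} - F" and y: "y \<in> {0..L} - F"
  shows "rep L (circ_pt L ` F) x \<le> rep L (circ_pt L ` F) y \<longleftrightarrow> (icomp L F x, icomp L F y) \<in> pi0 L F"
proof -
  have "(\<forall>f. circ_pt L f \<in> circ_pt L ` F \<longrightarrow> f < x \<longrightarrow> f < y) \<longleftrightarrow> (\<forall>f\<in>F. f < x \<longrightarrow> f < y)"
  proof (intro iffI allI impI ballI)
    fix f assume all: "\<forall>f\<in>F. f < x \<longrightarrow> f < y" and f: "circ_pt L f \<in> circ_pt L ` F" "f < x"
    show "f < y"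
    proof (cases "0 \<le> f")
      case True
      then have "f \<in> F"
        using f cut_mem[of f] cut_complement_bounds[OF x] by auto
      then show ?thesis
        using all f(2) by blast
    qed (use cut_complement_bounds[OF y] in simp)
  qed auto
  then show ?thesis
    unfolding rep_le_iff[OF L cut_fin_circle cut_complement[OF x] cut_complement[OF y]] pi0_iff[OF x y] .
qed

lemma glue_object:
  assumes x: "x \<in> {0..L} - F"
  shows "fst (glue L F) (icomp L F x) = cob L (circ_pt L ` F) x"
proof -
  have "icomp L F x \<in> icomps L F"
    using x unfolding icomps_iff by blast
  then show ?thesis
    by (simp add: glue_def cob_def gap_cut[OF x])
qed

text \<open>The paths occurring in \<open>glue\<close> are those which lift to paths between the lifts of the chosen
  points that lie in the prescribed gaps; such lifts have the same end points.\<close>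

lemma glue_arrow:
  assumes x: "x \<in> {0..L} - F" and y: "y \<in> {0..L} - F"
    and arr: "(icomp L F x, icomp L F y, k) \<in> zar (cyc (pi0 L F))"
  shows "snd (glue L F) (icomp L F x, icomp L F y, k) = arr L (circ_pt L ` F) x (y + L * real k)"
proof -
  let ?F = "circ_pt L ` F"
  note Fc = cut_fin_circle and cx = cut_complement[OF x] and cy = cut_complement[OF y]
  have yk: "cob L ?F (y + L * real k) = cob L ?F y" "rep L ?F (y + L * real k) = rep L ?F y + L * real k"
    using cob_shift[OF cy, of "int k"] rep_shift[OF L Fc cy, of "int k"] by simp_all
  have sh: "circ_pt L (t - L * real k) = circ_pt L t" for t
    using circ_pt_shift[of L t "- int k"] by simp
  have cobs: "circ_pt L ` icomp L F x = cob L ?F x" "circ_pt L ` icomp L F y = cob L ?F y"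
    by (simp_all add: cob_def gap_cut[OF x] gap_cut[OF y])
  have "{p. p 0 = chosen (cob L ?F x) \<and> p 1 = chosen (cob L ?F y) \<and>
      (\<exists>l. mono_lift L p l \<and> l 0 \<in> gap L ?F x \<and> l 1 - L * real k \<in> gap L ?F y)} =
    hcls L (rep L ?F x) (rep L ?F y + L * real k)" (is "?A = ?B")
  proof (intro equalityI subsetI)
    fix p assume "p \<in> ?A"
    then obtain l where p: "p 0 = chosen (cob L ?F x)" "p 1 = chosen (cob L ?F y)"
      and l: "mono_lift L p l" "l 0 \<in> gap L ?F x" "l 1 - L * real k \<in> gap L ?F y"
      by blast
    have pl: "p 0 = circ_pt L (l 0)" "p 1 = circ_pt L (l 1)"
      using l(1) by (simp_all add: mono_lift_def)
    have "rep L ?F x = l 0"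
      using rep(3)[OF L Fc cx l(2)] p(1) pl(1) by simp
    moreover have "rep L ?F y = l 1 - L * real k"
      using rep(3)[OF L Fc cy l(3)] p(2) pl(2) sh by simp
    ultimately show "p \<in> ?B"
      unfolding hcls_def using l(1) by auto
  next
    fix p assume "p \<in> ?B"
    then obtain l where l: "mono_lift L p l" "l 0 = rep L ?F x" "l 1 = rep L ?F y + L * real k" "is_lift L p l"
      by (rule hclsE)
    have "p 0 = circ_pt L (l 0)" "p 1 = circ_pt L (l 1)"
      using l(1) by (simp_all add: mono_lift_def)
    then have "p 0 = chosen (cob L ?F x)" "p 1 = chosen (cob L ?F y)"
      using rep(2)[OF L Fc cx] rep(2)[OF L Fc cy] sh[of "l 1"] l(2,3) by simp_all
    then show "p \<in> ?A"
      using l rep(1)[OF L Fc cx] rep(1)[OF L Fc cy] by auto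
  qed
  then show ?thesis
    using arr unfolding arr_def yk by (simp add: glue_def cobs gap_cut[OF x] gap_cut[OF y] del: cyc_ops(7))
qed

lemma glue_ziso: "ziso (cyc (pi0 L F)) (cpi0 L (circ_pt L ` F)) (glue L F)"
proof -
  let ?F = "circ_pt L ` F"
  define p :: "real set \<Rightarrow> real" where "p A = (SOME x. x \<in> A)" for A
  have p: "p A \<in> {0..L} - F" "A = icomp L F (p A)" if "A \<in> Field (pi0 L F)" for A
  proof -
    obtain x where x: "x \<in> {0..L} - F" "A = icomp L F x"
      using \<open>A \<in> Field (pi0 L F)\<close> unfolding Field_pi0 icomps_iff by blast
    then have "x \<in> A"
      by (simp only: icomp_self)
    then have "p A \<in> A"
      unfolding p_def by (rule someI)
    then show "p A \<in> {0..L} - F" "A = icomp L F (p A)"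
      using icomp_unique[of A L F "p A"] \<open>A \<in> Field (pi0 L F)\<close> unfolding Field_pi0 by auto
  qed
  show ?thesis
  proof (rule cpi0_ziso[OF L cut_fin_circle Linear_order_pi0, where p = p and x\<^sub>0 = 0])
    show "circ_pt L 0 \<in> ?F"
      using ends by blast
    fix A assume A: "A \<in> Field (pi0 L F)"
    note pA = p[OF A]
    show "circ_pt L (p A) \<notin> ?F" "0 < p A" "p A < 0 + L"
      using cut_complement[OF pA(1)] cut_complement_bounds[OF pA(1)] by simp_all
    show "fst (glue L F) A = cob L ?F (p A)"
      using glue_object[OF pA(1)] pA(2) by simp
    fix B assume B: "B \<in> Field (pi0 L F)"
    show "(A, B) \<in> pi0 L F \<longleftrightarrow> rep L ?F (p A) \<le> rep L ?F (p B)"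
      using cut_rep_le_iff[OF pA(1) p(1)[OF B]] pA(2) p(2)[OF B] by simp
  next
    fix y assume y: "circ_pt L y \<notin> ?F" "0 < y" "y < 0 + L"
    then have y': "y \<in> {0..L} - F"
      by auto
    then have A: "icomp L F y \<in> Field (pi0 L F)"
      unfolding Field_pi0 icomps_iff by blast
    have "y \<in> gap L ?F (p (icomp L F y))"
      unfolding gap_cut[OF p(1)[OF A]] p(2)[OF A, symmetric] by (rule icomp_self[OF y'])
    then show "\<exists>A\<in>Field (pi0 L F). y \<in> gap L ?F (p A)"
      using A by blast
  next
    fix A B k assume m: "(A, B, k) \<in> zar (cyc (pi0 L F))"
    then have AB: "A \<in> Field (pi0 L F)" "B \<in> Field (pi0 L F)"
      by simp_all
    show "snd (glue L F) (A, B, k) = arr L ?F (p A) (p B + L * real k)"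
      using glue_arrow[OF p(1)[OF AB(1)] p(1)[OF AB(2)], of k] m
      unfolding p(2)[OF AB(1), symmetric] p(2)[OF AB(2), symmetric] by blast
  qed (simp_all add: glue_def Field_pi0)
qed

end

subsection \<open>Functors to cyclic categories\<close>

text \<open>The functor called \<open>f\<^sub>c\<^sub>y\<^sub>c\<close> in the canonical bijection, for an arbitrary labelling \<open>c\<close> of the
  components of the cut circle.\<close>

definition cut_functor ::
  "real \<Rightarrow> real set \<Rightarrow> (real set \<Rightarrow> 'e) \<Rightarrow>
    (real set set, real set set \<times> real set set \<times> hclass, 'e, 'e \<times> 'e \<times> nat) zfun" where
  "cut_functor L F c = zfun_comp (cpi0 L (circ_pt L ` F)) (cyc_map (pi0 L F) c)
     (zfun_inv (cyc (pi0 L F)) (cpi0 L (circ_pt L ` F)) (glue L F))"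

lemma ziso_inv:
  assumes C: "zplus_category C" and iso: "ziso C D F"
  shows "ziso D C (zfun_inv C D F)"
proof -
  have "bij_betw (fst F) (zob C) (zob D)" "bij_betw (snd F) (zar C) (zar D)"
    using iso by (simp_all add: ziso_def)
  note b = bij_betw_inv_into[OF this(1)] bij_betw_inv_into[OF this(2)]
  have "bij_betw (fst (zfun_inv C D F)) (zob D) (zob C)" "bij_betw (snd (zfun_inv C D F)) (zar D) (zar C)"
    using b by (simp_all add: zfun_inv_def cong: bij_betw_cong)
  then show ?thesis
    using ziso_inverse(1)[OF assms] by (simp add: ziso_def)
qed

lemma cyc_map_ziso:
  assumes R: "Linear_order R" and S: "Linear_order S" and c: "bij_betw c (Field R) (Field S)"
    and mono: "\<And>a b. (a, b) \<in> R \<Longrightarrow> (c a, c b) \<in> S"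
  shows "ziso (cyc R) (cyc S) (cyc_map R c)"
proof -
  have cF: "c a \<in> Field S" if "a \<in> Field R" for a
    using bij_betwE[OF c] that by blast
  have mem: "cyc_map R c \<in> zfunctors (cyc R) (cyc S)"
    by (rule cyc_map_mem[OF R cF mono])
  have inj: "a = b" if "a \<in> Field R" "b \<in> Field R" "c a = c b" for a b
    using c that by (auto simp: bij_betw_def inj_on_def)
  have refl: "(a, b) \<in> R" if ab: "a \<in> Field R" "b \<in> Field R" "(c a, c b) \<in> S" for a b
  proof (rule ccontr)
    assume "(a, b) \<notin> R"
    then have "(b, a) \<in> R"
      using Linear_orderD(4)[OF R ab(1,2)] by blast
    then have "c a = c b"
      using Linear_orderD(3)[OF S ab(3)] mono by blast
    then have "a = b"
      using inj ab(1,2) by blast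
    then show False
      using \<open>(a, b) \<notin> R\<close> Linear_orderD(1)[OF R] ab(1) by blast
  qed
  have "bij_betw (fst (cyc_map R c)) (Field R) (Field S) \<longleftrightarrow> bij_betw c (Field R) (Field S)"
    by (rule bij_betw_cong) (rule cyc_map_apply(1))
  then have "bij_betw (fst (cyc_map R c)) (zob (cyc R)) (zob (cyc S))"
    using c by simp
  moreover have "bij_betw (snd (cyc_map R c)) (zar (cyc R)) (zar (cyc S))"
  proof (rule bij_betw_imageI)
    show "inj_on (snd (cyc_map R c)) (zar (cyc R))"
    proof (rule inj_onI)
      fix f g assume fg: "f \<in> zar (cyc R)" "g \<in> zar (cyc R)" "snd (cyc_map R c) f = snd (cyc_map R c) g"
      obtain a b k where eq1: "f = (a, b, k)"
        by (rule prod_cases3)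
      obtain a' b' m where eq2: "g = (a', b', m)"
        by (rule prod_cases3)
      note eq = eq1 eq2
      have "c a = c a'" "c b = c b'" "k = m"
        using fg(3) cyc_map_apply(2)[OF fg(1)[unfolded eq], of c] cyc_map_apply(2)[OF fg(2)[unfolded eq], of c]
        unfolding eq by simp_all
      then show "f = g"
        using inj[of a a'] inj[of b b'] fg(1,2) unfolding eq by simp
    qed
    show "snd (cyc_map R c) ` zar (cyc R) = zar (cyc S)"
    proof (intro equalityI subsetI)
      fix g assume g: "g \<in> zar (cyc S)"
      obtain a' b' k where eq: "g = (a', b', k)"
        by (rule prod_cases3)
      then have "a' \<in> c ` Field R" "b' \<in> c ` Field R"
        using g bij_betw_imp_surj_on[OF c] by simp_all
      then obtain a b where ab: "a \<in> Field R" "a' = c a" "b \<in> Field R" "b' = c b"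
        by blast
      have m: "(a, b, k) \<in> zar (cyc R)"
        using g ab refl unfolding eq by simp
      have "snd (cyc_map R c) (a, b, k) = g"
        unfolding eq ab(2,4) by (rule cyc_map_apply(2)[OF m])
      then show "g \<in> snd (cyc_map R c) ` zar (cyc R)"
        using m by blast
    qed (use zfunctorsD(4)[OF mem] in blast)
  qed
  ultimately show ?thesis
    using mem unfolding ziso_def by blast
qed

context
  fixes L :: real and F :: "real set"
  assumes L: "0 < L" and F: "F \<in> fin_interval L" and ends: "0 \<in> F" "L \<in> F"
begin

lemma zplus_category_cut: "zplus_category (cpi0 L (circ_pt L ` F))"
  by (rule zplus_category_cpi0[OF L cut_fin_circle[OF L F ends]])

text \<open>
  Functors on the cut circle can be compared on points and paths that start in the fundamental
  interval, because the gluing functor is surjective on objects and on arrows.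
\<close>

lemma cut_functor_eqI:
  assumes \<Phi>: "\<Phi> \<in> zfunctors (cpi0 L (circ_pt L ` F)) C" and \<Psi>: "\<Psi> \<in> zfunctors (cpi0 L (circ_pt L ` F)) C"
    and ob: "\<And>x. x \<in> {0..L} - F \<Longrightarrow> fst \<Phi> (cob L (circ_pt L ` F) x) = fst \<Psi> (cob L (circ_pt L ` F) x)"
    and ar: "\<And>x y k. x \<in> {0..L} - F \<Longrightarrow> y \<in> {0..L} - F \<Longrightarrow>
      rep L (circ_pt L ` F) x \<le> rep L (circ_pt L ` F) (y + L * real k) \<Longrightarrow>
      snd \<Phi> (arr L (circ_pt L ` F) x (y + L * real k)) = snd \<Psi> (arr L (circ_pt L ` F) x (y + L * real k))"
  shows "\<Phi> = \<Psi>"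
proof (rule zfunctors_eqI[OF \<Phi> \<Psi>])
  let ?F = "circ_pt L ` F"
  note iso = glue_ziso[OF L F ends]
  fix c assume "c \<in> zob (cpi0 L ?F)"
  then have "c \<in> fst (glue L F) ` zob (cyc (pi0 L F))"
    using iso by (simp add: ziso_def bij_betw_def)
  then obtain A where A: "A \<in> icomps L F" "c = fst (glue L F) A"
    unfolding cyc_ops Field_pi0 by blast
  then obtain x where "x \<in> {0..L} - F" "A = icomp L F x"
    unfolding icomps_iff by blast
  note x = this A(2)
  then show "fst \<Phi> c = fst \<Psi> c"
    using ob[OF x(1)] unfolding x(3,2) glue_object[OF L F ends x(1)] by simp
next
  let ?F = "circ_pt L ` F"
  note iso = glue_ziso[OF L F ends] and Fc = cut_fin_circle[OF L F ends] and cc = cut_complement[OF L F ends]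
  fix f assume "f \<in> zar (cpi0 L ?F)"
  then have "f \<in> snd (glue L F) ` zar (cyc (pi0 L F))"
    using iso by (simp only: ziso_def bij_betw_def)
  then obtain g where g: "g \<in> zar (cyc (pi0 L F))" "f = snd (glue L F) g"
    by blast
  obtain A B k where "g = (A, B, k)"
    by (rule prod_cases3)
  then have m: "(A, B, k) \<in> zar (cyc (pi0 L F))" and f: "f = snd (glue L F) (A, B, k)"
    using g by simp_all
  then have "A \<in> icomps L F" "B \<in> icomps L F"
    unfolding cyc_ops Field_pi0 by simp_all
  then obtain x y where x: "x \<in> {0..L} - F" "A = icomp L F x" and y: "y \<in> {0..L} - F" "B = icomp L F y"
    unfolding icomps_iff by blast
  have fa: "f = arr L ?F x (y + L * real k)"
    unfolding f x(2) y(2) by (rule glue_arrow[OF L F ends x(1) y(1) m[unfolded x(2) y(2)]])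
  have "rep L ?F x \<le> rep L ?F (y + L * real k)"
  proof (cases "k = 0")
    case True
    then show ?thesis
      using m cut_rep_le_iff[OF L F ends x(1) y(1)] unfolding x(2) y(2) by simp
  next
    case False
    then have "L * 1 \<le> L * real k"
      using L by (intro mult_left_mono) auto
    then have "x \<le> y + L * real k"
      using cut_complement_bounds[OF L F ends x(1)] cut_complement_bounds[OF L F ends y(1)]
      unfolding mult_1_right by linarith
    moreover have "circ_pt L (y + L * real k) \<notin> ?F"
      using cc[OF y(1)] circ_pt_shift[of L y "int k"] by simp
    ultimately show ?thesis
      using rep_mono[OF L Fc cc[OF x(1)]] by blast
  qed
  then show "snd \<Phi> f = snd \<Psi> f"
    unfolding fa by (rule ar[OF x(1) y(1)])
qed

context
  fixes S :: "'e rel" and c :: "real set \<Rightarrow> 'e"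
  assumes mono: "\<And>A B. (A, B) \<in> pi0 L F \<Longrightarrow> (c A, c B) \<in> S"
begin

lemma label_Field: "A \<in> Field (pi0 L F) \<Longrightarrow> c A \<in> Field S"
  using mono[OF Linear_orderD(1)[OF Linear_order_pi0]] by (auto simp: Field_def)

lemma cut_functor_mem: "cut_functor L F c \<in> zfunctors (cpi0 L (circ_pt L ` F)) (cyc S)"
  unfolding cut_functor_def
  by (rule zfun_comp_mem[OF zplus_category_cut
        ziso_inverse(1)[OF zplus_category_cyc[OF Linear_order_pi0] glue_ziso[OF L F ends]]
        cyc_map_mem[OF Linear_order_pi0 label_Field mono]])

lemma cut_functor_object:
  assumes x: "x \<in> {0..L} - F"
  shows "fst (cut_functor L F c) (cob L (circ_pt L ` F) x) = c (icomp L F x)"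
proof -
  note z = zplus_category_cyc[OF Linear_order_pi0] and iso = glue_ziso[OF L F ends]
  have i: "icomp L F x \<in> Field (pi0 L F)"
    unfolding Field_pi0 icomps_iff using x by blast
  have "cob L (circ_pt L ` F) x \<in> zob (cpi0 L (circ_pt L ` F))"
    unfolding cpi0_obj[OF L cut_fin_circle[OF L F ends]] using cut_complement[OF L F ends x] by blast
  moreover have "fst (zfun_inv (cyc (pi0 L F)) (cpi0 L (circ_pt L ` F)) (glue L F)) (cob L (circ_pt L ` F) x) = icomp L F x"
    using ziso_inverse(4)[OF z iso, of "icomp L F x"] i unfolding glue_object[OF L F ends x] by simp
  ultimately show ?thesis
    by (simp add: cut_functor_def zfun_comp_apply cyc_map_apply(1)[OF i])
qed

lemma cut_functor_arrow:
  assumes x: "x \<in> {0..L} - F" and y: "y \<in> {0..L} - F"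
    and le: "rep L (circ_pt L ` F) x \<le> rep L (circ_pt L ` F) (y + L * real k)"
  shows "snd (cut_functor L F c) (arr L (circ_pt L ` F) x (y + L * real k)) = (c (icomp L F x), c (icomp L F y), k)"
proof -
  let ?F = "circ_pt L ` F"
  note z = zplus_category_cyc[OF Linear_order_pi0] and iso = glue_ziso[OF L F ends]
    and Fc = cut_fin_circle[OF L F ends] and cc = cut_complement[OF L F ends]
  have m: "(icomp L F x, icomp L F y, k) \<in> zar (cyc (pi0 L F))"
    unfolding cyc_ops Field_pi0 icomps_iff using x y le cut_rep_le_iff[OF L F ends x y] by auto
  have "circ_pt L (y + L * real k) \<notin> ?F"
    using cc[OF y] circ_pt_shift[of L y "int k"] by simp
  then have a: "arr L ?F x (y + L * real k) \<in> zar (cpi0 L ?F)"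
    using arr_mem(1)[OF L Fc cc[OF x] _ le] by blast
  have "snd (zfun_inv (cyc (pi0 L F)) (cpi0 L ?F) (glue L F)) (arr L ?F x (y + L * real k)) =
      (icomp L F x, icomp L F y, k)"
    using ziso_inverse(5)[OF z iso m] unfolding glue_arrow[OF L F ends x y m] .
  then show ?thesis
    unfolding cut_functor_def zfun_comp_apply(2)[OF a] by (simp only: cyc_map_apply(2)[OF m])
qed

lemma cut_functor_ziso:
  assumes S: "Linear_order S" and bij: "bij_betw c (Field (pi0 L F)) (Field S)"
  shows "ziso (cpi0 L (circ_pt L ` F)) (cyc S) (cut_functor L F c)"
  unfolding cut_functor_def
  by (rule ziso_comp[OF zplus_category_cut ziso_inv[OF zplus_category_cyc[OF Linear_order_pi0] glue_ziso[OF L F ends]]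
        cyc_map_ziso[OF Linear_order_pi0 S bij mono]])

lemma cut_functor_relabel:
  assumes S: "Linear_order S" and u: "\<And>a. a \<in> Field S \<Longrightarrow> u a \<in> Field T" "\<And>a b. (a, b) \<in> S \<Longrightarrow> (u a, u b) \<in> T"
  shows "zfun_comp (cpi0 L (circ_pt L ` F)) (cyc_map S u) (cut_functor L F c) \<in> zfunctors (cpi0 L (circ_pt L ` F)) (cyc T)"
    and "x \<in> {0..L} - F \<Longrightarrow> fst (zfun_comp (cpi0 L (circ_pt L ` F)) (cyc_map S u) (cut_functor L F c))
      (cob L (circ_pt L ` F) x) = u (c (icomp L F x))"
    and "x \<in> {0..L} - F \<Longrightarrow> y \<in> {0..L} - F \<Longrightarrow> rep L (circ_pt L ` F) x \<le> rep L (circ_pt L ` F) (y + L * real k) \<Longrightarrow>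
      snd (zfun_comp (cpi0 L (circ_pt L ` F)) (cyc_map S u) (cut_functor L F c))
      (arr L (circ_pt L ` F) x (y + L * real k)) = (u (c (icomp L F x)), u (c (icomp L F y)), k)"
proof -
  let ?F = "circ_pt L ` F"
  note Fc = cut_fin_circle[OF L F ends] and cc = cut_complement[OF L F ends]
  show "zfun_comp (cpi0 L ?F) (cyc_map S u) (cut_functor L F c) \<in> zfunctors (cpi0 L ?F) (cyc T)"
    by (rule zfun_comp_mem[OF zplus_category_cut cut_functor_mem cyc_map_mem[OF S u]])
  show "fst (zfun_comp (cpi0 L ?F) (cyc_map S u) (cut_functor L F c)) (cob L ?F x) = u (c (icomp L F x))"
    if x: "x \<in> {0..L} - F"
  proof -
    have i: "cob L ?F x \<in> zob (cpi0 L ?F)"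
      unfolding cpi0_obj[OF L Fc] using cc[OF x] by blast
    have "c (icomp L F x) \<in> Field S"
      by (rule label_Field) (use x in \<open>unfold Field_pi0 icomps_iff, blast\<close>)
    then show ?thesis
      unfolding zfun_comp_apply(1)[OF i] cut_functor_object[OF x] by (rule cyc_map_apply(1))
  qed
  show "snd (zfun_comp (cpi0 L ?F) (cyc_map S u) (cut_functor L F c)) (arr L ?F x (y + L * real k)) =
      (u (c (icomp L F x)), u (c (icomp L F y)), k)"
    if x: "x \<in> {0..L} - F" and y: "y \<in> {0..L} - F" and le: "rep L ?F x \<le> rep L ?F (y + L * real k)"
  proof -
    have "circ_pt L (y + L * real k) \<notin> ?F"
      using cc[OF y] circ_pt_shift[of L y "int k"] by simp
    then have a: "arr L ?F x (y + L * real k) \<in> zar (cpi0 L ?F)"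
      using arr_mem(1)[OF L Fc cc[OF x] _ le] by blast
    have "(c (icomp L F x), c (icomp L F y), k) \<in> zar (cyc S)"
      using zfunctorsD(4)[OF cut_functor_mem a] unfolding cut_functor_arrow[OF x y le] .
    then show ?thesis
      unfolding zfun_comp_apply(2)[OF a] cut_functor_arrow[OF x y le] by (rule cyc_map_apply(2))
  qed
qed

end

end

text \<open>A functor between categories of components that moves points by \<open>e\<close> corresponds to moving the
  labels by \<open>e\<close>, provided that \<open>e\<close> does not cross the points at which the circles are cut.\<close>

lemma cut_functor_natural:
  assumes L: "0 < L" and G: "G \<in> fin_interval L" and endsG: "0 \<in> G" "L \<in> G"
    and L': "0 < L'" and F: "F \<in> fin_interval L'" and endsF: "0 \<in> F" "L' \<in> F"
    and mono: "\<And>A B. (A, B) \<in> pi0 L' F \<Longrightarrow> (c A, c B) \<in> S"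
    and \<Phi>: "acts L (circ_pt L ` G) L' (circ_pt L' ` F) \<Phi> e"
    and e: "\<And>x. x \<in> {0..L} - G \<Longrightarrow> e x \<in> {0..L'} - F" "\<And>x k. e (x + L * real k) = e x + L' * real k"
    and \<Psi>: "\<Psi> \<in> zfunctors (cpi0 L (circ_pt L ` G)) (cyc S)"
    and ob: "\<And>x. x \<in> {0..L} - G \<Longrightarrow> fst \<Psi> (cob L (circ_pt L ` G) x) = c (icomp L' F (e x))"
    and ar: "\<And>x y k. x \<in> {0..L} - G \<Longrightarrow> y \<in> {0..L} - G \<Longrightarrow>
      rep L (circ_pt L ` G) x \<le> rep L (circ_pt L ` G) (y + L * real k) \<Longrightarrow>
      snd \<Psi> (arr L (circ_pt L ` G) x (y + L * real k)) = (c (icomp L' F (e x)), c (icomp L' F (e y)), k)"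
  shows "zfun_comp (cpi0 L (circ_pt L ` G)) (cut_functor L' F c) \<Phi> = \<Psi>"
proof (rule cut_functor_eqI[OF L G endsG _ \<Psi>])
  let ?G = "circ_pt L ` G" and ?F = "circ_pt L' ` F"
  note Gc = cut_fin_circle[OF L G endsG] and cc = cut_complement[OF L G endsG]
    and zG = zplus_category_cut[OF L G endsG]
  show "zfun_comp (cpi0 L ?G) (cut_functor L' F c) \<Phi> \<in> zfunctors (cpi0 L ?G) (cyc S)"
    by (rule zfun_comp_mem[OF zG actsD(1)[OF \<Phi>] cut_functor_mem[OF L' F endsF mono]])
  fix x assume x: "x \<in> {0..L} - G"
  have "cob L ?G x \<in> zob (cpi0 L ?G)"
    unfolding cpi0_obj[OF L Gc] using cc[OF x] by blast
  then show "fst (zfun_comp (cpi0 L ?G) (cut_functor L' F c) \<Phi>) (cob L ?G x) = fst \<Psi> (cob L ?G x)"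
    by (simp only: zfun_comp_apply(1) actsD(3)[OF \<Phi> cc[OF x]] ob[OF x]
        cut_functor_object[OF L' F endsF mono e(1)[OF x]])
  fix y k assume y: "y \<in> {0..L} - G" and le: "rep L ?G x \<le> rep L ?G (y + L * real k)"
  have yk: "circ_pt L (y + L * real k) \<notin> ?G"
    using cc[OF y] circ_pt_shift[of L y "int k"] by simp
  have a: "arr L ?G x (y + L * real k) \<in> zar (cpi0 L ?G)"
    by (rule arr_mem(1)[OF L Gc cc[OF x] yk le])
  have "rep L' ?F (e x) \<le> rep L' ?F (e y + L' * real k)"
    using actsD(4)[OF \<Phi> cc[OF x] yk le] unfolding e(2) .
  then show "snd (zfun_comp (cpi0 L ?G) (cut_functor L' F c) \<Phi>) (arr L ?G x (y + L * real k)) =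
      snd \<Psi> (arr L ?G x (y + L * real k))"
    unfolding zfun_comp_apply(2)[OF a] actsD(5)[OF \<Phi> cc[OF x] yk le] e(2) ar[OF x y le]
    using mono by (intro cut_functor_arrow[OF L' F endsF _ e(1)[OF x] e(1)[OF y]])
qed

section \<open>The cyclic case\<close>

lemma cut_set_cut:
  assumes "r > 0" "z \<in> standard_simplex n"
  shows "0 < real r" "cut_set r n z \<in> fin_interval (real r)" "0 \<in> cut_set r n z" "real r \<in> cut_set r n z"
  using assms cut_set_fin_interval cut_set_ends by simp_all

lemma cut_set_fin_circle:
  "r > 0 \<Longrightarrow> z \<in> standard_simplex n \<Longrightarrow> circ_pt r ` cut_set r n z \<in> fin_circle (real r)"
  by (intro cut_fin_circle cut_set_cut)

abbreviation canon_functor ::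
  "nat \<Rightarrow> nat \<Rightarrow> (nat \<Rightarrow> real) \<Rightarrow> (real set set, real set set \<times> real set set \<times> hclass, nat, nat \<times> nat \<times> nat) zfun" where
  "canon_functor r n z \<equiv> cut_functor (real r) (cut_set r n z) (cut_index r n z)"

abbreviation canon_label ::
  "nat \<Rightarrow> nat \<Rightarrow> (nat \<Rightarrow> real) \<Rightarrow> (cobj, carr, cobj, carr) zfun" where
  "canon_label r n z \<equiv>
     zrelabel_fun (cpi0 r (circ_pt r ` cut_set r n z)) Inr Inr Inl Inl (canon_functor r n z)"

lemma circle_canon_eq:
  "circle_canon Xt r n \<xi> z = circle_in Xt r (circ_pt r ` cut_set r n z)
     (pact Xt (cpi0_big r (circ_pt r ` cut_set r n z)) (std_cyc (r * (n + 1) - 1)) (canon_label r n z) \<xi>)"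
  by (simp add: circle_canon_def cut_functor_def Let_def)

lemma canon_functor_mem:
  assumes "r > 0" "z \<in> standard_simplex n"
  shows "canon_functor r n z \<in> zfunctors (cpi0 r (circ_pt r ` cut_set r n z)) (cyc (ord (r * (n + 1) - 1)))"
  by (rule cut_functor_mem[OF cut_set_cut[OF assms] cut_index_mono[OF assms]])

lemma canon_label_mem:
  assumes "r > 0" "z \<in> standard_simplex n"
  shows "canon_label r n z \<in> zfunctors (cpi0_big r (circ_pt r ` cut_set r n z)) (std_cyc (r * (n + 1) - 1))"
  unfolding cpi0_big_def std_cyc_def
  by (rule zrelabel_fun_mem[OF inj_Inr inj_Inr inj_Inl inj_Inl
        zplus_category_cpi0[OF cut_set_cut(1)[OF assms] cut_set_fin_circle[OF assms]] canon_functor_mem[OF assms]])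

lemma zfun_comp_canon_label:
  assumes "\<Phi> \<in> zfunctors (cpi0 L G) (cpi0 (real r) (circ_pt r ` cut_set r n z))"
  shows "zfun_comp (cpi0_big L G) (canon_label r n z) (label_fun L G \<Phi>) =
    zrelabel_fun (cpi0 L G) Inr Inr Inl Inl (zfun_comp (cpi0 L G) (canon_functor r n z) \<Phi>)"
  unfolding cpi0_big_def by (rule zrelabel_fun_comp[OF inj_Inr inj_Inr inj_Inr inj_Inr assms])

text \<open>Naturality of the canonical functors under simplicial operators: both composites label the
  component \<open>(k + x\<^sub>j, k + x\<^sub>j\<^sub>+\<^sub>1)\<close> of the finer subdivision by \<open>k (n + 1) + \<theta> j\<close>.\<close>

lemma canon_functor_push:
  assumes r: "r > 0" and \<theta>: "\<theta> \<in> mor Delta m n" and z: "z \<in> standard_simplex m"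
  defines "G \<equiv> circ_pt r ` cut_set r m z" and "F \<equiv> circ_pt r ` cut_set r n (simplex_push m \<theta> z)"
  shows "zfun_comp (cpi0 r G) (canon_functor r n (simplex_push m \<theta> z)) (cpi0_map r G r F (\<lambda>x. x)) =
    zfun_comp (cpi0 r G) (cyc_map (ord (r * (m + 1) - 1)) (sd_map r m n \<theta>)) (canon_functor r m z)"
proof -
  let ?w = "simplex_push m \<theta> z" and ?Nm = "r * (m + 1) - 1" and ?Nn = "r * (n + 1) - 1"
  note w = simplex_push_simplex[OF \<theta> z] and sub = cut_set_push_subset[OF \<theta>, of r z]
    and s\<theta> = sd_map_mor[OF r \<theta>]
  have ref: "acts r G r F (cpi0_map r G r F (\<lambda>x. x)) (\<lambda>x. x)"
    unfolding G_def F_def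
    by (rule refine_acts[OF cut_set_cut(1)[OF r z] cut_set_fin_circle[OF r w] cut_set_fin_circle[OF r z]
          image_mono[OF sub]])
  have u: "sd_map r m n \<theta> a \<in> Field (ord ?Nn)" if "a \<in> Field (ord ?Nm)" for a
    using mor_DeltaD(1)[OF s\<theta>, of a] that unfolding Field_ord by simp
  have mono: "(sd_map r m n \<theta> a, sd_map r m n \<theta> b) \<in> ord ?Nn" if "(a, b) \<in> ord ?Nm" for a b
    using mor_DeltaD[OF s\<theta>] that by (auto simp: ord_def)
  have label: "cut_index r n ?w (icomp r (cut_set r n ?w) y) = sd_map r m n \<theta> (cut_index r m z (icomp r (cut_set r m z) y))"
    if y: "y \<in> {0..real r} - cut_set r m z" for y
  proof -
    obtain k j where k: "k < r" "j \<le> m" "in_cell z k j y"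
      using in_cell_exists[OF z r y] by blast
    show ?thesis
      unfolding cut_index_cell[OF z k(2,1,3)] sd_map_index[OF k(1,2)]
      by (rule cut_index_cell[OF w mor_DeltaD(1)[OF \<theta> k(2)] k(1) in_cell_push[OF \<theta> z k(2,3)]])
  qed
  let ?K = "zfun_comp (cpi0 r G) (cyc_map (ord ?Nm) (sd_map r m n \<theta>)) (canon_functor r m z)"
  note rel = cut_functor_relabel[where T = "ord ?Nn", OF cut_set_cut[OF r z], folded G_def]
  show ?thesis
    unfolding F_def G_def
  proof (rule cut_functor_natural[OF cut_set_cut[OF r z] cut_set_cut[OF r w] cut_index_mono[OF r w]
        ref[unfolded G_def F_def] _ refl], unfold G_def[symmetric])
    show "?K \<in> zfunctors (cpi0 r G) (cyc (ord ?Nn))"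
      by (intro rel(1) cut_index_mono[OF r z] Linear_order_ord u mono)
    fix x assume x: "x \<in> {0..real r} - cut_set r m z"
    show "x \<in> {0..real r} - cut_set r n ?w"
      using sub x by blast
    show "fst ?K (cob r G x) = cut_index r n ?w (icomp r (cut_set r n ?w) x)"
      unfolding label[OF x] using x by (intro rel(2) cut_index_mono[OF r z] Linear_order_ord u mono)
    fix y k assume y: "y \<in> {0..real r} - cut_set r m z" and le: "rep r G x \<le> rep r G (y + real r * real k)"
    show "snd ?K (arr r G x (y + real r * real k)) =
        (cut_index r n ?w (icomp r (cut_set r n ?w) x), cut_index r n ?w (icomp r (cut_set r n ?w) y), k)"
      unfolding label[OF x] label[OF y] using x y le
      by (intro rel(3) cut_index_mono[OF r z] Linear_order_ord u mono)
  qed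
qed

text \<open>After rescaling by \<open>1/r\<close> the canonical functor of \<open>z\<close> becomes that of \<open>spread r n z\<close>.\<close>

lemma canon_functor_spread:
  assumes r: "r > 0" and z: "z \<in> standard_simplex n"
  defines "N \<equiv> r * (n + 1) - 1"
  defines "G \<equiv> circ_pt 1 ` cut_set 1 N (spread r n z)" and "F \<equiv> circ_pt r ` cut_set r n z"
  assumes \<Phi>: "acts 1 G r F \<Phi> (\<lambda>y. y * real r)"
  shows "zfun_comp (cpi0 1 G) (canon_functor r n z) \<Phi> = canon_functor 1 N (spread r n z)"
proof -
  let ?G = "cut_set 1 N (spread r n z)" and ?F = "cut_set r n z"
  note w = spread_simplex[OF r z, folded N_def]
  note cG = cut_set_cut[OF zero_less_one w, unfolded of_nat_1]
  have N1: "1 * (N + 1) - 1 = N"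
    by simp
  have G: "?G = (\<lambda>x. x / real r) ` ?F"
    unfolding N_def by (rule cut_set_spread[OF r z])
  have e: "y * real r \<in> {0..real r} - ?F" if y: "y \<in> {0..1} - ?G" for y
  proof -
    have "y * real r \<notin> ?F"
    proof
      assume "y * real r \<in> ?F"
      then have "y * real r / real r \<in> ?G"
        unfolding G by (rule imageI)
      then show False
        using y r by simp
    qed
    moreover have "y * real r \<le> 1 * real r"
      using y by (intro mult_right_mono) simp_all
    moreover have "0 \<le> y * real r"
      using y by simp
    ultimately show ?thesis
      by simp
  qed
  note mono1 = cut_index_mono[OF zero_less_one w, unfolded N1 of_nat_1]
  have label: "cut_index 1 N (spread r n z) (icomp 1 ?G y) = cut_index r n z (icomp r ?F (y * real r))"
    if y: "y \<in> {0..1} - ?G" for y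
  proof -
    obtain k i where k: "k < r" "i \<le> n" "in_cell z k i (y * real r)"
      using in_cell_exists[OF z r e[OF y]] by blast
    have "in_cell (spread r n z) 0 (k * (n + 1) + i) (y * real r / real r)"
      by (rule in_cell_spread[OF r z k])
    then have "in_cell (spread r n z) 0 (k * (n + 1) + i) y"
      using r by simp
    from cut_index_cell[OF w sd_index[OF k(1,2), folded N_def] zero_less_one this]
    show ?thesis
      unfolding cut_index_cell[OF z k(2,1,3)] of_nat_1 by simp
  qed
  show ?thesis
    unfolding G_def of_nat_1
  proof (rule cut_functor_natural[OF cG cut_set_cut[OF r z] cut_index_mono[OF r z] \<Phi>[unfolded G_def F_def] e])
    show "(x + 1 * real k) * real r = x * real r + real r * real k" for x k
      by (simp add: algebra_simps)
    show "cut_functor 1 ?G (cut_index 1 N (spread r n z)) \<in> zfunctors (cpi0 1 (circ_pt 1 ` ?G)) (cyc (ord (r * (n + 1) - 1)))"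
      unfolding N_def[symmetric] by (rule cut_functor_mem[OF cG mono1])
    fix x assume x: "x \<in> {0..1} - ?G"
    show "fst (cut_functor 1 ?G (cut_index 1 N (spread r n z))) (cob 1 (circ_pt 1 ` ?G) x) =
        cut_index r n z (icomp r ?F (x * real r))"
      unfolding label[OF x, symmetric] by (rule cut_functor_object[OF cG mono1 x])
    fix y k assume y: "y \<in> {0..1} - ?G"
      and le: "rep 1 (circ_pt 1 ` ?G) x \<le> rep 1 (circ_pt 1 ` ?G) (y + 1 * real k)"
    show "snd (cut_functor 1 ?G (cut_index 1 N (spread r n z))) (arr 1 (circ_pt 1 ` ?G) x (y + 1 * real k)) =
        (cut_index r n z (icomp r ?F (x * real r)), cut_index r n z (icomp r ?F (y * real r)), k)"
      unfolding label[OF x, symmetric] label[OF y, symmetric] by (rule cut_functor_arrow[OF cG mono1 x y le])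
  qed
qed

lemma homeo_circle_eq:
  "0 < L \<Longrightarrow> homeo_circle L = \<lparr>carrier = circle_homeos L L,
     monoid.mult = (\<lambda>\<alpha> \<beta>. compose (circ L) \<alpha> \<beta>), one = (\<lambda>x\<in>circ L. x)\<rparr>"
  by (simp add: homeo_circle_def circle_homeos_def)

lemma circ_pt_scale: "(\<lambda>x. x * c) ` circ_pt L x = circ_pt (L * c) (x * c)"
proof -
  have "circ_pt L x = range (\<lambda>k::int. x + L * of_int k)" for L x
    by (auto simp: circ_pt_def)
  then show ?thesis
    by (simp add: image_image algebra_simps)
qed

lemma scale_circle_pt:
  assumes "r > 0"
  shows "scale_circle r (circ_pt r x) = circ_pt 1 (x / real r)"
  using circ_pt_scale[of "1 / real r" "real r" x] assms by (simp add: scale_circle_def)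

lemma scale_circle_homeo:
  assumes r: "r > 0"
  shows "scale_circle r \<in> circle_homeos (real r) 1"
proof -
  note s = scale_circle_pt[OF r]
  define g :: "real set \<Rightarrow> real set" where "g P = (\<lambda>x. x * real r) ` P" for P
  have g: "g (circ_pt 1 x) = circ_pt r (x * real r)" for x
    using circ_pt_scale[of "real r" 1 x] r by (simp add: g_def)
  have c1: "continuous_map (circ_top r) (circ_top 1) (scale_circle r)"
  proof (rule continuous_map_from_circ)
    show "scale_circle r P \<in> circ 1" if "P \<in> circ (real r)" for P
      using that s by (auto simp: circ_eq)
    have "continuous_map euclideanreal (circ_top 1) (circ_pt 1 \<circ> (\<lambda>x. x / real r))"
      by (rule continuous_map_compose[OF _ continuous_map_circ_pt]) (use r in \<open>auto intro!: continuous_intros\<close>)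
    then show "continuous_map euclideanreal (circ_top 1) (\<lambda>x. scale_circle r (circ_pt r x))"
      unfolding s by (simp add: comp_def)
  qed
  have c2: "continuous_map (circ_top 1) (circ_top r) g"
  proof (rule continuous_map_from_circ)
    show "g P \<in> circ (real r)" if "P \<in> circ 1" for P
      using that g by (auto simp: circ_eq)
    have "continuous_map euclideanreal (circ_top r) (circ_pt r \<circ> (\<lambda>x. x * real r))"
      by (rule continuous_map_compose[OF _ continuous_map_circ_pt]) (auto intro!: continuous_intros)
    then show "continuous_map euclideanreal (circ_top r) (\<lambda>x. g (circ_pt 1 x))"
      unfolding g by (simp add: comp_def)
  qed
  have "homeomorphic_maps (circ_top r) (circ_top 1) (scale_circle r) g"
    unfolding homeomorphic_maps_def using c1 c2 s g r by (auto simp: circ_eq)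
  then have "homeomorphic_map (circ_top r) (circ_top 1) (scale_circle r)"
    using homeomorphic_map_maps by blast
  moreover have "continuous_on UNIV (\<lambda>x. x / real r)" "strict_mono (\<lambda>x. x / real r)"
    using r by (auto intro!: continuous_intros simp: strict_mono_def divide_strict_right_mono)
  moreover have "scale_circle r \<in> extensional (circ (real r))"
    by (simp add: scale_circle_def)
  ultimately show ?thesis
    unfolding circle_homeos_def mem_Collect_eq using r s
    by (intro conjI exI[of _ "\<lambda>x. x / real r"]) simp_all
qed

lemma scale_circle_cut_set:
  assumes r: "r > 0" and z: "z \<in> standard_simplex n"
  shows "scale_circle r ` circ_pt r ` cut_set r n z = circ_pt 1 ` cut_set 1 (r * (n + 1) - 1) (spread r n z)"
  unfolding cut_set_spread[OF r z] by (simp add: image_image scale_circle_pt[OF r])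

context
  fixes X :: "(nat, czfun, 'a) psh" and Xt :: "'a cyc_big"
  assumes X: "presheaf DeltaC X" and ext: "extends_cyclic Xt X"
begin

lemma Xt_cyc: "presheaf DeltaC_big Xt"
  using ext by (simp add: extends_cyclic_def)

lemma pob_std_cyc: "pob Xt (std_cyc n) = pob X n"
  using ext by (simp add: extends_cyclic_def restricts_to_def)

lemma pact_std_cyc:
  "f \<in> mor DeltaC m n \<Longrightarrow> x \<in> pob X n \<Longrightarrow>
    pact Xt (std_cyc m) (std_cyc n) (std_cyc_map m n f) x = pact X m n f x"
  using ext by (simp add: extends_cyclic_def restricts_to_def)

lemma circle_realization:
  assumes r: "r > 0"
  shows "\<exists>\<kappa>. bij_betw \<kappa> (realization (sd r (simplicial_of X))) (circle_colim Xt (real r)) \<and>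
    (\<forall>n. \<forall>\<xi>\<in>pob X (r * (n + 1) - 1). \<forall>z\<in>standard_simplex n.
       \<kappa> (realization_point (sd r (simplicial_of X)) (n, \<xi>, z)) = circle_canon Xt r n \<xi> z)"
proof -
  let ?L = "real r" and ?Y = "sd r (simplicial_of X)" and ?N = "\<lambda>n. r * (n + 1) - 1"
  have L: "0 < ?L"
    using r by simp
  define C where "C n z = circ_pt ?L ` cut_set r n z" for n z
  define \<psi> where "\<psi> n z = pact Xt (cpi0_big ?L (C n z)) (std_cyc (?N n)) (canon_label r n z)" for n z
  have pob_sd: "pob ?Y n = pob Xt (std_cyc (?N n))" for n
    by (simp add: sd_def simplicial_of_def pob_std_cyc)
  have cs: "C n z \<in> fin_circle ?L" if "z \<in> standard_simplex n" for n z
    unfolding C_def by (rule cut_set_fin_circle[OF r that])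
  note oc = cpi0_big_obs[OF L cs]
  have lab: "canon_label r n z \<in> mor DeltaC_big (cpi0_big ?L (C n z)) (std_cyc (?N n))"
    if "z \<in> standard_simplex n" for n z
    unfolding DeltaC_big_ops C_def by (rule canon_label_mem[OF r that])
  have "\<exists>\<kappa>. bij_betw \<kappa> (realization ?Y) (colim (fin_circle ?L) (circle_val Xt ?L) (circle_trans Xt ?L)) \<and>
    (\<forall>n. \<forall>\<xi>\<in>pob ?Y n. \<forall>z\<in>standard_simplex n. \<kappa> (realization_point ?Y (n, \<xi>, z)) =
       colim_in (fin_circle ?L) (circle_val Xt ?L) (circle_trans Xt ?L) (C n z) (\<psi> n z \<xi>))"
  proof (rule realization_as_colimit[OF sd_presheaf[OF r simplicial_of_presheaf[OF X]]
        homeo_colimits.fd[OF circle_homeo_colimits[OF Xt_cyc] L] cs])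
    show "\<psi> n z x \<in> circle_val Xt ?L (C n z)" if "z \<in> standard_simplex n" "x \<in> pob ?Y n" for n z x
      using presheaf_pact_mem[OF Xt_cyc oc[OF that(1)] std_cyc_obs lab[OF that(1)]] that(2)
      by (simp add: circle_val_def \<psi>_def pob_sd)
    show "C n (simplex_push m \<theta> z) \<subseteq> C m z" if "\<theta> \<in> mor Delta m n" for m n \<theta> z
      unfolding C_def by (rule image_mono[OF cut_set_push_subset[OF that]])
    show "bij_betw (\<psi> n z) (pob ?Y n) (circle_val Xt ?L (C n z))" if z: "inner_point n z" for n z
    proof -
      note z' = inner_pointD[OF z]
      have "ziso (cpi0 ?L (C n z)) (cyc (ord (?N n))) (canon_functor r n z)"
        unfolding C_def
      proof (rule cut_functor_ziso[OF cut_set_cut[OF r z'] cut_index_mono[OF r z'] Linear_order_ord])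
        show "bij_betw (cut_index r n z) (Field (pi0 ?L (cut_set r n z))) (Field (ord (?N n)))"
          unfolding Field_pi0 Field_ord by (rule cut_index_bij[OF r z])
      qed
      then show ?thesis
        unfolding pob_sd circle_val_def \<psi>_def unfolding cpi0_big_def std_cyc_def C_def
        using oc[OF z', unfolded cpi0_big_def C_def] std_cyc_obs[of "?N n", unfolded std_cyc_def]
          zplus_category_cpi0[OF L cs[OF z', unfolded C_def]] zplus_category_cyc[OF Linear_order_ord]
        by (intro DeltaC_big_pact_bij[OF Xt_cyc _ _ inj_Inr inj_Inr inj_Inl inj_Inl])
    qed
    show "\<exists>n z. inner_point n z \<and> F \<subseteq> C n z" if F: "F \<in> fin_circle ?L" for F
    proof -
      let ?F = "{f. circ_pt ?L f \<in> F \<and> 0 \<le> f \<and> f \<le> ?L}"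
      have "?F \<in> fin_interval ?L"
        using finite_lifts[OF L F, of 0 ?L] by (auto simp: fin_interval_def)
      then obtain n z where z: "inner_point n z" "?F \<subseteq> cut_set r n z"
        using cut_set_cofinal[OF _ r] by blast
      have "F \<subseteq> circ_pt ?L ` ?F"
      proof
        fix P assume P: "P \<in> F"
        then have "P \<in> circ ?L"
          using fin_circleD[OF F] by blast
        then obtain x where "0 \<le> x" "x < 0 + ?L" "P = circ_pt ?L x"
          by (rule circ_lift_in[OF L])
        then show "P \<in> circ_pt ?L ` ?F"
          using P by auto
      qed
      then have "F \<subseteq> C n z"
        unfolding C_def using z(2) by blast
      then show ?thesis
        using z(1) by blast
    qed
    show "\<exists>\<theta>\<in>mor Delta m n. z = simplex_push m \<theta> w"
      if z: "z \<in> standard_simplex n" and w: "inner_point m w" and sub: "C n z \<subseteq> C m w" for n z m w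
    proof (rule cut_set_detect[OF z w r])
      show "cut_set r n z \<subseteq> cut_set r m w"
      proof
        fix x assume x: "x \<in> cut_set r n z"
        then have "x \<in> {0..?L}" "circ_pt ?L x \<in> circ_pt ?L ` cut_set r m w"
          using cut_set_subset[OF z] sub unfolding C_def by blast+
        then show "x \<in> cut_set r m w"
          using cut_mem[OF cut_set_cut[OF r inner_pointD[OF w]]] by blast
      qed
    qed
    fix m n \<theta> z x assume \<theta>: "\<theta> \<in> mor Delta m n" and z: "z \<in> standard_simplex m" and x: "x \<in> pob ?Y n"
    let ?w = "simplex_push m \<theta> z" and ?u = "cyc_map (ord (?N m)) (sd_map r m n \<theta>)"
    note w = simplex_push_simplex[OF \<theta> z] and sub = image_mono[OF cut_set_push_subset[OF \<theta>, of r z], of "circ_pt ?L", folded C_def]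
      and u = cyc_map_ord_mem[OF sd_map_mor[OF r \<theta>]]
    have u': "?u \<in> zfunctors (cyc (ord (?N m))) (cyc (ord (?N n)))"
      using u by (simp add: DeltaC_def)
    have x1: "x \<in> pob Xt (std_cyc (?N n))"
      using x unfolding pob_sd .
    note x' = x1 x1[unfolded pob_std_cyc]
    note ref = actsD(1)[OF refine_acts[OF L cs[OF w] cs[OF z] sub]]
    have t: "tr_circ ?L (C n ?w) (C m z) \<in> mor DeltaC_big (cpi0_big ?L (C m z)) (cpi0_big ?L (C n ?w))"
      unfolding DeltaC_big_ops by (rule label_fun_mem[OF L cs[OF z] ref])
    have su: "std_cyc_map (?N m) (?N n) ?u \<in> mor DeltaC_big (std_cyc (?N m)) (std_cyc (?N n))"
      unfolding DeltaC_big_ops std_cyc_map_def std_cyc_def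
      by (rule zrelabel_fun_mem[OF inj_Inl inj_Inl inj_Inl inj_Inl zplus_category_cyc[OF Linear_order_ord] u'])
    have "zfun_comp (cpi0_big ?L (C m z)) (canon_label r n ?w) (tr_circ ?L (C n ?w) (C m z)) =
        zrelabel_fun (cpi0 ?L (C m z)) Inr Inr Inl Inl (zfun_comp (cpi0 ?L (C m z)) ?u (canon_functor r m z))"
      unfolding C_def zfun_comp_canon_label[OF ref[unfolded C_def]] canon_functor_push[OF r \<theta> z] ..
    also have "\<dots> = zfun_comp (cpi0_big ?L (C m z)) (std_cyc_map (?N m) (?N n) ?u) (canon_label r m z)"
      unfolding cpi0_big_def std_cyc_map_def C_def
      by (rule zrelabel_fun_comp[OF inj_Inr inj_Inr inj_Inl inj_Inl canon_functor_mem[OF r z], symmetric])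
    finally have e: "zfun_comp (cpi0_big ?L (C m z)) (canon_label r n ?w) (tr_circ ?L (C n ?w) (C m z)) =
        zfun_comp (cpi0_big ?L (C m z)) (std_cyc_map (?N m) (?N n) ?u) (canon_label r m z)" .
    note p1 = presheaf_pact_comp[OF Xt_cyc oc[OF z] oc[OF w] std_cyc_obs t lab[OF w] x'(1), unfolded DeltaC_big_ops]
      and p2 = presheaf_pact_comp[OF Xt_cyc oc[OF z] std_cyc_obs std_cyc_obs lab[OF z] su x'(1), unfolded DeltaC_big_ops]
    have "circle_trans Xt ?L (C n ?w) (C m z) (\<psi> n ?w x) =
        pact Xt (cpi0_big ?L (C m z)) (std_cyc (?N m)) (canon_label r m z)
          (pact Xt (std_cyc (?N m)) (std_cyc (?N n)) (std_cyc_map (?N m) (?N n) ?u) x)"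
      unfolding circle_trans_def \<psi>_def p1 p2 e ..
    also have "\<dots> = \<psi> m z (pact ?Y m n \<theta> x)"
      unfolding \<psi>_def pact_std_cyc[OF u x'(2)] by (simp add: sd_def simplicial_of_def)
    finally show "circle_trans Xt ?L (C n ?w) (C m z) (\<psi> n ?w x) = \<psi> m z (pact ?Y m n \<theta> x)" .
  qed
  then show ?thesis
    unfolding circle_colim_def circle_canon_eq circle_in_def \<psi>_def C_def pob_sd pob_std_cyc .
qed

lemma circle_iso_canon:
  assumes r: "r > 0" and z: "z \<in> standard_simplex n" and \<xi>: "\<xi> \<in> pob X (r * (n + 1) - 1)"
  defines "F \<equiv> circ_pt r ` cut_set r n z" and "s \<equiv> scale_circle r"
  shows "circle_in Xt 1 (s ` F) (circle_iso Xt r 1 s F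
      (pact Xt (cpi0_big r F) (std_cyc (r * (n + 1) - 1)) (canon_label r n z) \<xi>)) =
    circle_canon Xt 1 (r * (n + 1) - 1) \<xi> (spread r n z)"
proof -
  let ?N = "r * (n + 1) - 1"
  note s = scale_circle_homeo[OF r, folded s_def] and w = spread_simplex[OF r z]
  note F = cut_set_fin_circle[OF r z, folded F_def] and L = cut_set_cut(1)[OF r z]
  note sF = circle_homeos_image[OF s F]
  have sF_eq: "s ` F = circ_pt 1 ` cut_set 1 ?N (spread r n z)"
    unfolding s_def F_def by (rule scale_circle_cut_set[OF r z])
  have N1: "1 * (?N + 1) - 1 = ?N"
    by simp
  let ?\<Phi> = "zfun_inv (cpi0 r F) (cpi0 1 (s ` F)) (cpi0_map r F 1 (s ` F) s)"
  have "acts 1 (s ` F) r F ?\<Phi> (inv_into UNIV (\<lambda>x. x / real r))"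
  proof (rule homeo_map_acts(2)[OF s F])
    show "continuous_on UNIV (\<lambda>x. x / real r)" "strict_mono (\<lambda>x. x / real r)"
      using r by (auto intro!: continuous_intros simp: strict_mono_def divide_strict_right_mono)
    show "surj (\<lambda>x. x / real r)"
      using r by (intro surjI[where f = "\<lambda>x. x * real r"]) simp
    show "(x + real r) / real r = x / real r + 1" for x
      using r by (simp add: add_divide_distrib)
    show "s (circ_pt (real r) x) = circ_pt 1 (x / real r)" for x
      unfolding s_def by (rule scale_circle_pt[OF r])
  qed
  moreover have "inv_into UNIV (\<lambda>x. x / real r) = (\<lambda>y. y * real r)"
    using r by (intro HOL.ext inv_into_f_eq) (auto simp: inj_on_def)
  ultimately have \<Phi>: "acts 1 (s ` F) r F ?\<Phi> (\<lambda>y. y * real r)"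
    by simp
  note cs = canon_functor_spread[OF r z, folded F_def sF_eq, OF \<Phi>]
  have "zfun_comp (cpi0_big 1 (s ` F)) (canon_label r n z) (iv_circ r 1 s F) =
      zrelabel_fun (cpi0 1 (s ` F)) Inr Inr Inl Inl (canon_functor 1 ?N (spread r n z))"
    unfolding F_def zfun_comp_canon_label[OF actsD(1)[OF \<Phi>, unfolded F_def]] cs[unfolded F_def] ..
  moreover have "iv_circ r 1 s F \<in> mor DeltaC_big (cpi0_big 1 (s ` F)) (cpi0_big r F)"
    unfolding DeltaC_big_ops by (rule label_fun_mem[OF zero_less_one sF actsD(1)[OF \<Phi>]])
  moreover have "canon_label r n z \<in> mor DeltaC_big (cpi0_big r F) (std_cyc ?N)"
    unfolding DeltaC_big_ops F_def by (rule canon_label_mem[OF r z])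
  moreover have "\<xi> \<in> pob Xt (std_cyc ?N)"
    using \<xi> unfolding pob_std_cyc .
  ultimately have "circle_iso Xt r 1 s F (pact Xt (cpi0_big r F) (std_cyc ?N) (canon_label r n z) \<xi>) =
      pact Xt (cpi0_big 1 (s ` F)) (std_cyc ?N)
        (zrelabel_fun (cpi0 1 (s ` F)) Inr Inr Inl Inl (canon_functor 1 ?N (spread r n z))) \<xi>"
    using presheaf_pact_comp[OF Xt_cyc cpi0_big_obs[OF zero_less_one sF] cpi0_big_obs[OF L F] std_cyc_obs]
    unfolding circle_iso_def DeltaC_big_ops by metis
  then show ?thesis
    unfolding circle_canon_eq N1 of_nat_1 sF_eq by simp
qed

lemma cyclic_case:
  assumes r: "r > 0"
  shows "filtered_diagram (fin_circle r) (circle_val Xt r) (circle_trans Xt r) \<and>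
      (\<exists>\<kappa>\<^sub>r \<kappa>\<^sub>1 \<rho>\<^sub>r \<rho>\<^sub>1 D.
         bij_betw \<kappa>\<^sub>r (realization (sd r (simplicial_of X))) (circle_colim Xt r) \<and>
         (\<forall>n. \<forall>\<xi>\<in>pob X (r * (n + 1) - 1). \<forall>z\<in>standard_simplex n.
            \<kappa>\<^sub>r (realization_point (sd r (simplicial_of X)) (n, \<xi>, z)) = circle_canon Xt r n \<xi> z) \<and>
         bij_betw \<kappa>\<^sub>1 (realization (simplicial_of X)) (circle_colim Xt 1) \<and>
         (\<forall>n. \<forall>\<xi>\<in>pob X n. \<forall>z\<in>standard_simplex n.
            \<kappa>\<^sub>1 (realization_point (simplicial_of X) (n, \<xi>, z)) = circle_canon Xt 1 n \<xi> z) \<and>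
         group_action (homeo_circle r) (realization (sd r (simplicial_of X))) \<rho>\<^sub>r \<and>
         (\<forall>\<alpha>\<in>carrier (homeo_circle r). \<forall>p\<in>realization (sd r (simplicial_of X)).
            \<forall>F\<in>fin_circle r. \<forall>x\<in>circle_val Xt r F.
              \<kappa>\<^sub>r p = circle_in Xt r F x \<longrightarrow> \<kappa>\<^sub>r (\<rho>\<^sub>r \<alpha> p) = circle_push Xt r r \<alpha> F x) \<and>
         group_action (homeo_circle 1) (realization (simplicial_of X)) \<rho>\<^sub>1 \<and>
         (\<forall>\<alpha>\<in>carrier (homeo_circle 1). \<forall>p\<in>realization (simplicial_of X).
            \<forall>F\<in>fin_circle 1. \<forall>x\<in>circle_val Xt 1 F.
              \<kappa>\<^sub>1 p = circle_in Xt 1 F x \<longrightarrow> \<kappa>\<^sub>1 (\<rho>\<^sub>1 \<alpha> p) = circle_push Xt 1 1 \<alpha> F x) \<and>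
         homeomorphic_map (realization_top (sd r (simplicial_of X)))
           (realization_top (simplicial_of X)) D \<and>
         (\<forall>p\<in>realization (sd r (simplicial_of X)). \<forall>F\<in>fin_circle r. \<forall>x\<in>circle_val Xt r F.
            \<kappa>\<^sub>r p = circle_in Xt r F x \<longrightarrow>
            \<kappa>\<^sub>1 (D p) = circle_push Xt r 1 (scale_circle r) F x) \<and>
         conjugate (circ r) (circ 1) (scale_circle r) \<in> iso (homeo_circle r) (homeo_circle 1) \<and>
         (\<forall>\<alpha>\<in>carrier (homeo_circle r). \<forall>p\<in>realization (sd r (simplicial_of X)).
            D (\<rho>\<^sub>r \<alpha> p) = \<rho>\<^sub>1 (conjugate (circ r) (circ 1) (scale_circle r) \<alpha>) (D p)))"
proof -
  interpret hc: homeo_colimits circ circle_homeos fin_circle "circle_val Xt" "circle_trans Xt" "circle_iso Xt"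
    by (rule circle_homeo_colimits[OF Xt_cyc])
  have L: "0 < real r"
    using r by simp
  note s = scale_circle_homeo[OF r]
  obtain \<kappa>\<^sub>r where \<kappa>\<^sub>r: "bij_betw \<kappa>\<^sub>r (realization (sd r (simplicial_of X))) (circle_colim Xt (real r))"
    and canon_r: "\<forall>n. \<forall>\<xi>\<in>pob X (r * (n + 1) - 1). \<forall>z\<in>standard_simplex n.
       \<kappa>\<^sub>r (realization_point (sd r (simplicial_of X)) (n, \<xi>, z)) = circle_canon Xt r n \<xi> z"
    using circle_realization[OF r] by blast
  obtain \<kappa>\<^sub>1 where \<kappa>\<^sub>1: "bij_betw \<kappa>\<^sub>1 (realization (simplicial_of X)) (circle_colim Xt 1)"
    and canon_1: "\<forall>n. \<forall>\<xi>\<in>pob X n. \<forall>z\<in>standard_simplex n.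
       \<kappa>\<^sub>1 (realization_point (simplicial_of X) (n, \<xi>, z)) = circle_canon Xt 1 n \<xi> z"
    using circle_realization[OF zero_less_one] unfolding sd_1 by auto
  have grp: "homeo_circle L = hc.Gr L" if "0 < L" for L
    using homeo_circle_eq[OF that] by (simp add: hc.Gr_def)
  obtain \<rho>\<^sub>r \<rho>\<^sub>1 D where
    *: "group_action (hc.Gr r) (realization (sd r (simplicial_of X))) \<rho>\<^sub>r"
      "\<forall>\<alpha>\<in>circle_homeos r r. \<forall>p\<in>realization (sd r (simplicial_of X)). \<forall>F\<in>fin_circle r. \<forall>x\<in>circle_val Xt r F.
         \<kappa>\<^sub>r p = hc.inn r F x \<longrightarrow> \<kappa>\<^sub>r (\<rho>\<^sub>r \<alpha> p) = hc.inn r (\<alpha> ` F) (circle_iso Xt r r \<alpha> F x)"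
      "group_action (hc.Gr 1) (realization (simplicial_of X)) \<rho>\<^sub>1"
      "\<forall>\<alpha>\<in>circle_homeos 1 1. \<forall>p\<in>realization (simplicial_of X). \<forall>F\<in>fin_circle 1. \<forall>x\<in>circle_val Xt 1 F.
         \<kappa>\<^sub>1 p = hc.inn 1 F x \<longrightarrow> \<kappa>\<^sub>1 (\<rho>\<^sub>1 \<alpha> p) = hc.inn 1 (\<alpha> ` F) (circle_iso Xt 1 1 \<alpha> F x)"
    and D_bij: "bij_betw D (realization (sd r (simplicial_of X))) (realization (simplicial_of X))"
    and D: "\<forall>p\<in>realization (sd r (simplicial_of X)). \<forall>F\<in>fin_circle r. \<forall>x\<in>circle_val Xt r F.
         \<kappa>\<^sub>r p = hc.inn r F x \<longrightarrow>
         \<kappa>\<^sub>1 (D p) = hc.inn 1 (scale_circle r ` F) (circle_iso Xt r 1 (scale_circle r) F x)"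
    and equi: "\<forall>\<alpha>\<in>circle_homeos r r. \<forall>p\<in>realization (sd r (simplicial_of X)).
         D (\<rho>\<^sub>r \<alpha> p) = \<rho>\<^sub>1 (conjugate (circ r) (circ 1) (scale_circle r) \<alpha>) (D p)"
    using hc.actions_and_rescaling[OF s \<kappa>\<^sub>r[unfolded circle_colim_def] \<kappa>\<^sub>1[unfolded circle_colim_def]]
    by (elim exE conjE) (rule that; assumption)
  have D_spread: "D (realization_point (sd r (simplicial_of X)) (n, \<xi>, z)) =
      realization_point (simplicial_of X) (r * (n + 1) - 1, \<xi>, spread r n z)"
    if \<xi>: "\<xi> \<in> pob (simplicial_of X) (r * (n + 1) - 1)" and z: "z \<in> standard_simplex n" for n \<xi> z
  proof -
    have \<xi>': "\<xi> \<in> pob X (r * (n + 1) - 1)"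
      using \<xi> by (simp add: simplicial_of_def)
    let ?F = "circ_pt r ` cut_set r n z"
    let ?x = "pact Xt (cpi0_big r ?F) (std_cyc (r * (n + 1) - 1)) (canon_label r n z) \<xi>"
    note F = cut_set_fin_circle[OF r z]
    have p: "realization_point (sd r (simplicial_of X)) (n, \<xi>, z) \<in> realization (sd r (simplicial_of X))"
      using \<xi> z by (intro realization_pointI) (simp_all add: sd_def)
    have x: "?x \<in> circle_val Xt r ?F"
      unfolding circle_val_def
      by (rule presheaf_pact_mem[OF Xt_cyc cpi0_big_obs[OF L F] std_cyc_obs])
        (use canon_label_mem[OF r z] \<xi>' in \<open>simp_all only: DeltaC_big_ops pob_std_cyc\<close>)
    have "\<kappa>\<^sub>r (realization_point (sd r (simplicial_of X)) (n, \<xi>, z)) = hc.inn r ?F ?x"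
      unfolding canon_r[rule_format, OF \<xi>' z] circle_canon_eq circle_in_def ..
    from D[rule_format, OF p F x this]
    have "\<kappa>\<^sub>1 (D (realization_point (sd r (simplicial_of X)) (n, \<xi>, z))) =
        \<kappa>\<^sub>1 (realization_point (simplicial_of X) (r * (n + 1) - 1, \<xi>, spread r n z))"
      unfolding circle_iso_canon[OF r z \<xi>', unfolded circle_in_def]
        canon_1[rule_format, OF \<xi>' spread_simplex[OF r z]] .
    then show ?thesis
      using \<kappa>\<^sub>1 bij_betwE[OF D_bij] p realization_pointI[OF \<xi> spread_simplex[OF r z]]
      by (auto simp: bij_betw_def inj_on_def)
  qed
  have homeo: "homeomorphic_map (realization_top (sd r (simplicial_of X))) (realization_top (simplicial_of X)) D"
    using r simplicial_of_presheaf[OF X] D_bij D_spread by (rule homeomorphic_map_spread)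
  have conj: "conjugate (circ r) (circ 1) (scale_circle r) \<in> iso (homeo_circle r) (homeo_circle 1)"
    unfolding grp[OF L] grp[OF zero_less_one] by (rule hc.conjugate_iso[OF s])
  have carr: "carrier (homeo_circle r) = circle_homeos r r" "carrier (homeo_circle 1) = circle_homeos 1 1"
    using L by (simp_all add: homeo_circle_eq)
  show ?thesis
    unfolding carr unfolding circle_push_eq circle_in_def
    by (intro conjI exI[of _ \<kappa>\<^sub>r] exI[of _ \<kappa>\<^sub>1] exI[of _ \<rho>\<^sub>r] exI[of _ \<rho>\<^sub>1] exI[of _ D])
      (fact hc.fd[OF L] \<kappa>\<^sub>r canon_r[unfolded circle_in_def] \<kappa>\<^sub>1 canon_1 *[folded grp[OF L] grp[OF zero_less_one]] homeo D conj equi)+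
qed

end

section \<open>Subdivision and homeomorphism groups\<close>

theorem theorem1p5:
  fixes r :: nat
  assumes "r > 0"
  shows
  "(\<forall>(X :: (nat, nat \<Rightarrow> nat, 'a) psh) Xt.
      presheaf Delta X \<longrightarrow> extends_simplicial Xt X \<longrightarrow>
      filtered_diagram (fin_interval r) (interval_val Xt r) (interval_trans Xt r) \<and>
      (\<exists>\<kappa>\<^sub>r \<kappa>\<^sub>1 \<rho>\<^sub>r \<rho>\<^sub>1 D.
         bij_betw \<kappa>\<^sub>r (realization (sd r X)) (interval_colim Xt r) \<and>
         (\<forall>n. \<forall>\<xi>\<in>pob X (r * (n + 1) - 1). \<forall>z\<in>standard_simplex n.
            \<kappa>\<^sub>r (realization_point (sd r X) (n, \<xi>, z)) = interval_canon Xt r n \<xi> z) \<and>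
         bij_betw \<kappa>\<^sub>1 (realization X) (interval_colim Xt 1) \<and>
         (\<forall>n. \<forall>\<xi>\<in>pob X n. \<forall>z\<in>standard_simplex n.
            \<kappa>\<^sub>1 (realization_point X (n, \<xi>, z)) = interval_canon Xt 1 n \<xi> z) \<and>
         group_action (homeo_interval r) (realization (sd r X)) \<rho>\<^sub>r \<and>
         (\<forall>\<alpha>\<in>carrier (homeo_interval r). \<forall>p\<in>realization (sd r X).
            \<forall>F\<in>fin_interval r. \<forall>x\<in>interval_val Xt r F.
              \<kappa>\<^sub>r p = interval_in Xt r F x \<longrightarrow> \<kappa>\<^sub>r (\<rho>\<^sub>r \<alpha> p) = interval_push Xt r r \<alpha> F x) \<and>
         group_action (homeo_interval 1) (realization X) \<rho>\<^sub>1 \<and>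
         (\<forall>\<alpha>\<in>carrier (homeo_interval 1). \<forall>p\<in>realization X.
            \<forall>F\<in>fin_interval 1. \<forall>x\<in>interval_val Xt 1 F.
              \<kappa>\<^sub>1 p = interval_in Xt 1 F x \<longrightarrow> \<kappa>\<^sub>1 (\<rho>\<^sub>1 \<alpha> p) = interval_push Xt 1 1 \<alpha> F x) \<and>
         homeomorphic_map (realization_top (sd r X)) (realization_top X) D \<and>
         (\<forall>p\<in>realization (sd r X). \<forall>F\<in>fin_interval r. \<forall>x\<in>interval_val Xt r F.
            \<kappa>\<^sub>r p = interval_in Xt r F x \<longrightarrow>
            \<kappa>\<^sub>1 (D p) = interval_push Xt r 1 (scale_interval r) F x) \<and>
         conjugate {0..real r} {0..1} (scale_interval r) \<in> iso (homeo_interval r) (homeo_interval 1) \<and>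
         (\<forall>\<alpha>\<in>carrier (homeo_interval r). \<forall>p\<in>realization (sd r X).
            D (\<rho>\<^sub>r \<alpha> p) = \<rho>\<^sub>1 (conjugate {0..real r} {0..1} (scale_interval r) \<alpha>) (D p)))) \<and>
   (\<forall>(X :: (nat, czfun, 'b) psh) Xt.
      presheaf DeltaC X \<longrightarrow> extends_cyclic Xt X \<longrightarrow>
      filtered_diagram (fin_circle r) (circle_val Xt r) (circle_trans Xt r) \<and>
      (\<exists>\<kappa>\<^sub>r \<kappa>\<^sub>1 \<rho>\<^sub>r \<rho>\<^sub>1 D.
         bij_betw \<kappa>\<^sub>r (realization (sd r (simplicial_of X))) (circle_colim Xt r) \<and>
         (\<forall>n. \<forall>\<xi>\<in>pob X (r * (n + 1) - 1). \<forall>z\<in>standard_simplex n.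
            \<kappa>\<^sub>r (realization_point (sd r (simplicial_of X)) (n, \<xi>, z)) = circle_canon Xt r n \<xi> z) \<and>
         bij_betw \<kappa>\<^sub>1 (realization (simplicial_of X)) (circle_colim Xt 1) \<and>
         (\<forall>n. \<forall>\<xi>\<in>pob X n. \<forall>z\<in>standard_simplex n.
            \<kappa>\<^sub>1 (realization_point (simplicial_of X) (n, \<xi>, z)) = circle_canon Xt 1 n \<xi> z) \<and>
         group_action (homeo_circle r) (realization (sd r (simplicial_of X))) \<rho>\<^sub>r \<and>
         (\<forall>\<alpha>\<in>carrier (homeo_circle r). \<forall>p\<in>realization (sd r (simplicial_of X)).
            \<forall>F\<in>fin_circle r. \<forall>x\<in>circle_val Xt r F.
              \<kappa>\<^sub>r p = circle_in Xt r F x \<longrightarrow> \<kappa>\<^sub>r (\<rho>\<^sub>r \<alpha> p) = circle_push Xt r r \<alpha> F x) \<and>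
         group_action (homeo_circle 1) (realization (simplicial_of X)) \<rho>\<^sub>1 \<and>
         (\<forall>\<alpha>\<in>carrier (homeo_circle 1). \<forall>p\<in>realization (simplicial_of X).
            \<forall>F\<in>fin_circle 1. \<forall>x\<in>circle_val Xt 1 F.
              \<kappa>\<^sub>1 p = circle_in Xt 1 F x \<longrightarrow> \<kappa>\<^sub>1 (\<rho>\<^sub>1 \<alpha> p) = circle_push Xt 1 1 \<alpha> F x) \<and>
         homeomorphic_map (realization_top (sd r (simplicial_of X)))
           (realization_top (simplicial_of X)) D \<and>
         (\<forall>p\<in>realization (sd r (simplicial_of X)). \<forall>F\<in>fin_circle r. \<forall>x\<in>circle_val Xt r F.
            \<kappa>\<^sub>r p = circle_in Xt r F x \<longrightarrow>
            \<kappa>\<^sub>1 (D p) = circle_push Xt r 1 (scale_circle r) F x) \<and>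
         conjugate (circ r) (circ 1) (scale_circle r) \<in> iso (homeo_circle r) (homeo_circle 1) \<and>
         (\<forall>\<alpha>\<in>carrier (homeo_circle r). \<forall>p\<in>realization (sd r (simplicial_of X)).
            D (\<rho>\<^sub>r \<alpha> p) = \<rho>\<^sub>1 (conjugate (circ r) (circ 1) (scale_circle r) \<alpha>) (D p))))"
  by (rule conjI; intro allI impI; (rule simplicial_case | rule cyclic_case); (assumption | rule assms))

end
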